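(* Let $r,s,\alpha>0$, $K\in\mathbb N$, $K\ge2$, $D\subseteq\mathbb R^n$, and let $\Lambda$ be a lattice of $\mathbb Z^n$ (a sublattice). Let $H(y,x)=h(y)+f(y,x)$ be real-analytic on $D_r\times\mathbb T^n_s$ with $|\!|\!|f|\!|\!|_{r,s}<\infty$. Assume that $D_r$ is $(\alpha,K)$ non-resonant modulo $\Lambda$ (with respect to $h$) and that $$\vartheta_*:=\frac{2^{11}K^2}{\alpha rs}|\!|\!|f|\!|\!|_{r,s}<1 .$$ Then there exists a real-analytic symplectic change of variables $$\Psi:(y',x')\in D_{r_*}\times\mathbb T^n_{s_*}\mapsto(y,x)\in D_r\times\mathbb T^n_s,\qquad r_*:=r/2,\quad s_*:=s(1-1/K),$$ satisfying $$|y-y'|_1\le\frac{\vartheta_*}{2^7K}\,r,\qquad\max_{1\le i\le n}|x_i-x_i'|\le\frac{\vartheta_*}{16K^2}\,s,$$ and such that $$H\circ\Psi=h+f^\flat+f_*,\qquad f^\flat:=\mathtt p_\Lambda f+T_K^\perp\mathtt p_\Lambda^\perp f,$$ with $$|\!|\!|f_*|\!|\!|_{r_*,s_*}\le\frac1K\vartheta_*|\!|\!|f|\!|\!|_{r,s},\qquad|\!|\!|T_K\mathtt p_\Lambda^\perp f_*|\!|\!|_{r_*,s_*}\le\Big(\frac{\vartheta_*}8\Big)^K\frac8{eK}|\!|\!|f|\!|\!|_{r,s}.$$ Moreover, re-writing $H\circ\Psi=h+g+f_{**}$ with $\mathtt p_\Lambda g=g$ and $\mathtt p_\Lambda f_{**}=0$,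 one has $$|\!|\!|g-\mathtt p_\Lambda f|\!|\!|_{r_*,s_*}\le\frac1K\vartheta_*|\!|\!|f|\!|\!|_{r,s},\qquad|\!|\!|f_{**}|\!|\!|_{r_*,s/2}\le2e^{-(K-2)\bar s}|\!|\!|f|\!|\!|_{r,s},$$ where $\bar s:=\min\{\frac s2,\ \log\frac8{\vartheta_*}\}$.
   Context: $|\cdot|$ is the Euclidean norm, $|k|_1=\sum_i|k_i|$ (also for vectors in $\mathbb C^n$). $\mathbb T^n_s=\{x\in\mathbb C^n:|\mathrm{Im}\,x_j|<s\}/(2\pi\mathbb Z^n)$; $D_r=\{z\in\mathbb C^n:|z-y|<r\text{ for some }y\in D\}$. Symplectic form $dy\wedge dx$. For $f(y,x)=\sum_{k\in\mathbb Z^n}f_k(y)e^{ik\cdot x}$: $|\!|\!|f|\!|\!|_{r,s}=\sup_{y\in D_r}\sum_k|f_k(y)|e^{|k|_1s}$; $\mathtt p_\Lambda f=\sum_{k\in\Lambda}f_k(y)e^{ik\cdot x}$, $\mathtt p_\Lambda^\perp f=\sum_{k\notin\Lambda}f_k(y)e^{ik\cdot x}$; $T_Kf=\sum_{|k|_1\le K}f_k(y)e^{ik\cdot x}$, $T_K^\perp f=\sum_{|k|_1>K}f_k(y)e^{ik\cdot x}$. A set $U$ is $(\alpha,K)$ non-resonant modulo $\Lambda$ (with respect to $h$) if $|h'(y)\cdot k|\ge\alpha$ for all $y\in U$ and all $k\in\mathbb Z^n\setminus\Lambda$ with $|k|_1\le K$, where $h'=\partial_yh$. *)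

theory Defs
  imports "HOL-Analysis.Analysis"
begin

text \<open>Points are pairs (action, angle).\<close>

type_synonym 'n phase = "(complex^'n) \<times> (complex^'n)"

definition l1norm :: "complex^'n \<Rightarrow> real" where
  "l1norm z = (\<Sum>i\<in>UNIV. norm (z $ i))"

definition int_l1norm :: "int^'n \<Rightarrow> int" where
  "int_l1norm k = (\<Sum>i\<in>UNIV. \<bar>k $ i\<bar>)"

definition cvec :: "real^'n \<Rightarrow> complex^'n" where
  "cvec x = (\<chi> i. complex_of_real (x $ i))"

definition kdot :: "int^'n \<Rightarrow> complex^'n \<Rightarrow> complex" where
  "kdot k z = (\<Sum>i\<in>UNIV. of_int (k $ i) * z $ i)"

definition cnbhd :: "(real^'n) set \<Rightarrow> real \<Rightarrow> (complex^'n) set" where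
  "cnbhd D r = {z. \<exists>y\<in>D. norm (z - cvec y) < r}"

definition strip :: "real \<Rightarrow> (complex^'n) set" where
  "strip s = {x. \<forall>j. \<bar>Im (x $ j)\<bar> < s}"

text \<open>
  The complex torus is the quotient of \<open>strip s\<close> by the lattice of real periods \<open>2\<pi>\<close>.
  Objects on it are represented by lifts to the strip: functions by \<open>2\<pi>\<close>-periodic functions,
  and maps between tori by maps between strips whose angle displacement is periodic.
\<close>

definition phase_dom :: "(real^'n) set \<Rightarrow> real \<Rightarrow> real \<Rightarrow> 'n phase set" where
  "phase_dom D r s = cnbhd D r \<times> strip s"

definition period :: "int^'n \<Rightarrow> complex^'n" where
  "period m = (\<chi> i. 2 * complex_of_real pi * of_int (m $ i))"

definition real_vec :: "complex^'n \<Rightarrow> bool" where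
  "real_vec z \<longleftrightarrow> (\<forall>i. z $ i \<in> \<real>)"

text \<open>
  As usual for functions on complex domains, \<open>real-analytic\<close> means holomorphic and real at the
  real points of the domain. Holomorphy in several variables is Frechet differentiability with
  a complex-linear derivative.
\<close>

definition real_analytic_act :: "(complex^'n) set \<Rightarrow> (complex^'n \<Rightarrow> complex) \<Rightarrow> bool" where
  "real_analytic_act U h \<longleftrightarrow>
     (\<forall>y\<in>U. \<exists>L. (h has_derivative L) (at y) \<and> (\<forall>c v. L (c *s v) = c * L v)) \<and>
     (\<forall>y\<in>U. real_vec y \<longrightarrow> h y \<in> \<real>)"

definition real_analytic_torus ::
  "(real^'n) set \<Rightarrow> real \<Rightarrow> real \<Rightarrow> ('n phase \<Rightarrow> complex) \<Rightarrow> bool" where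
  "real_analytic_torus D r s f \<longleftrightarrow>
     (\<forall>p\<in>phase_dom D r s. \<exists>L. (f has_derivative L) (at p) \<and>
        (\<forall>c u v. L (c *s u, c *s v) = c * L (u, v))) \<and>
     (\<forall>(y, x)\<in>phase_dom D r s. \<forall>m. f (y, x + period m) = f (y, x)) \<and>
     (\<forall>(y, x)\<in>phase_dom D r s. real_vec y \<and> real_vec x \<longrightarrow> f (y, x) \<in> \<real>)"

definition fcoeff ::
  "('n phase \<Rightarrow> complex) \<Rightarrow> int^'n \<Rightarrow> complex^'n \<Rightarrow> complex" where
  "fcoeff f k y =
     integral (cbox 0 (\<chi> i. 2 * pi)) (\<lambda>x::real^'n. f (y, cvec x) * exp (- (\<i> * kdot k (cvec x))))
       / complex_of_real ((2 * pi) ^ CARD('n))"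

definition fnorm ::
  "(real^'n) set \<Rightarrow> real \<Rightarrow> real \<Rightarrow> ('n phase \<Rightarrow> complex) \<Rightarrow> ennreal" where
  "fnorm D r s f =
     (SUP y\<in>cnbhd D r. \<Sum>\<^sub>\<infinity>k\<in>UNIV. ennreal (norm (fcoeff f k y) * exp (of_int (int_l1norm k) * s)))"

definition fproj ::
  "(int^'n) set \<Rightarrow> ('n phase \<Rightarrow> complex) \<Rightarrow> 'n phase \<Rightarrow> complex" where
  "fproj S f = (\<lambda>(y, x). \<Sum>\<^sub>\<infinity>k\<in>S. fcoeff f k y * exp (\<i> * kdot k x))"

abbreviation proj_perp ::
  "(int^'n) set \<Rightarrow> ('n phase \<Rightarrow> complex) \<Rightarrow> 'n phase \<Rightarrow> complex" where
  "proj_perp S f \<equiv> fproj (- S) f"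

definition trunc ::
  "nat \<Rightarrow> ('n::finite phase \<Rightarrow> complex) \<Rightarrow> 'n phase \<Rightarrow> complex" where
  "trunc K = fproj {k. int_l1norm k \<le> int K}"

definition trunc_perp ::
  "nat \<Rightarrow> ('n::finite phase \<Rightarrow> complex) \<Rightarrow> 'n phase \<Rightarrow> complex" where
  "trunc_perp K = fproj {k. int_l1norm k > int K}"

definition sublattice :: "(int^'n) set \<Rightarrow> bool" where
  "sublattice \<Lambda> \<longleftrightarrow> 0 \<in> \<Lambda> \<and> (\<forall>k\<in>\<Lambda>. \<forall>l\<in>\<Lambda>. k - l \<in> \<Lambda>)"

definition cgrad :: "(complex^'n \<Rightarrow> complex) \<Rightarrow> complex^'n \<Rightarrow> complex^'n" where
  "cgrad h y = (\<chi> i. deriv (\<lambda>t. h (y + t *s axis i 1)) 0)"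

definition nonresonant ::
  "(complex^'n \<Rightarrow> complex) \<Rightarrow> real \<Rightarrow> nat \<Rightarrow> (int^'n) set \<Rightarrow> (complex^'n) set \<Rightarrow> bool" where
  "nonresonant h \<alpha> K \<Lambda> U \<longleftrightarrow>
     (\<forall>y\<in>U. \<forall>k. k \<notin> \<Lambda> \<and> int_l1norm k \<le> int K \<longrightarrow> norm (kdot k (cgrad h y)) \<ge> \<alpha>)"

text \<open>The form \<open>dy \<and> dx\<close> evaluated on tangent vectors written as (action, angle).\<close>

definition symp_form :: "'n::finite phase \<Rightarrow> 'n phase \<Rightarrow> complex" where
  "symp_form u v = (\<Sum>i\<in>UNIV. fst u $ i * snd v $ i - fst v $ i * snd u $ i)"

text \<open>
  Periodicity of the angle displacement makes the lift \<open>\<Psi>\<close> descend to the torus, and makes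
  injectivity of the lift equivalent to injectivity on the torus. Together with preservation of
  the symplectic form, injectivity makes \<open>\<Psi>\<close> a biholomorphism onto its image.
\<close>

definition symplectic_change ::
  "(real^'n) set \<Rightarrow> real \<Rightarrow> real \<Rightarrow>
    ('n phase \<Rightarrow> 'n phase) \<Rightarrow> bool" where
  "symplectic_change D r s \<Psi> \<longleftrightarrow>
     (\<forall>i. real_analytic_torus D r s (\<lambda>p. fst (\<Psi> p) $ i)) \<and>
     (\<forall>i. real_analytic_torus D r s (\<lambda>p. snd (\<Psi> p) $ i - snd p $ i)) \<and>
     inj_on \<Psi> (phase_dom D r s) \<and>
     (\<forall>p\<in>phase_dom D r s. \<exists>L. (\<Psi> has_derivative L) (at p) \<and>
        (\<forall>u v. symp_form (L u) (L v) = symp_form u v))"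

text \<open>
  The exponent \<open>min (s/2) (log (8/\<theta>))\<close>, where the logarithm is \<open>+\<infinity>\<close> if \<open>\<theta> = 0\<close>
  (in HOL, \<open>ln (8/0) = 0\<close>).
\<close>

definition sbar :: "real \<Rightarrow> real \<Rightarrow> real" where
  "sbar s \<theta> = (if \<theta> = 0 then s / 2 else min (s / 2) (ln (8 / \<theta>)))"

end

theory Submission
  imports Defs "HOL-Complex_Analysis.Conformal_Mappings"
begin

text \<open>
  The transformation \<open>\<Psi>\<close> is a composition of \<open>K\<close> time-one maps of Hamiltonian fields, each of which
  removes the non-resonant harmonics \<open>0 < \<bar>l\<bar>\<^sub>1 \<le> K\<close>, \<open>l \<notin> \<Lambda>\<close>, of the current perturbation to first
  order. Write \<open>S\<close> for this finite set of modes. For a perturbation \<open>f = \<Sum>\<^sub>l\<^sub>\<in>\<^sub>S f\<^sub>l e\<^sup>i\<^sup>l\<^sup>x\<close> the trigonometric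
  polynomial \<open>\<phi>\<close> with coefficients \<open>\<i> f\<^sub>l / (h'(y) \<cdot> l)\<close> solves the homological equation
  \<open>{h, \<phi>} = - f\<close>, and \<open>\<bar>h' \<cdot> l\<bar> \<ge> \<alpha>\<close> bounds it by \<open>\<bar>f\<bar> / \<alpha>\<close> in the weighted Fourier norm. After the time-one
  map of \<open>\<phi>\<close> the linear term cancels and only brackets with \<open>\<phi>\<close> remain
  (\<open>generator\<close>, \<open>flow_expansion\<close>, \<open>normal_form_step\<close>).

  The time-one map is defined by the Lie series of the coordinates, with no differential equation.
  Three facts make this work. Cauchy's estimate on shrinking domains gives geometric convergence
  (\<open>Lie_pow_bound\<close>, \<open>fnorm_le_Lie_pow\<close>). The Leibniz formula makes \<open>G \<mapsto> \<Sum>\<^sub>m L\<^sup>m G / m!\<close> multiplicative, so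
  that Hadamard's lemma forces it to be composition with the map (\<open>lie_series_eq_flow\<close>). The Jacobi
  identity makes it preserve Poisson brackets, so that the map is symplectic (\<open>flow_symplectic\<close>).

  All estimates are in the norm \<open>sup\<^sub>y \<Sum>\<^sub>k \<bar>f\<^sub>k(y)\<bar> e\<^bsup>\<bar>k\<bar>\<^sub>1 s\<^esup>\<close>, in which a product is bounded by the product of
  the norms and derivatives cost \<open>1 / \<rho>\<close> in the actions and \<open>1 / (e \<sigma>)\<close> in the angles (\<open>fnorm_le_Lie_ham\<close>).
  Functions are recovered from their coefficients by Fourier inversion on the torus, here a
  consequence of the Stone-Weierstrass theorem (\<open>Fourier_inversion\<close>).

  For the constants it matters how the domain is spent. The first step has room \<open>r/4\<close> and \<open>s/(2K)\<close>, and
  leaves a perturbation of size \<open>\<theta>/(8K)\<close> times the norm of \<open>f\<close>. The other \<open>K - 1\<close> steps have room of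
  order \<open>r/K\<close> and \<open>s/K\<^sup>2\<close>, which would be too little for the part \<open>b\<close> of \<open>f\<close> that is never removed, since
  it stays of the size of \<open>f\<close>. But \<open>b\<close> is still defined on the original domain, so that the first
  bracket with it only pays for the distance \<open>r/4\<close>, \<open>s/(2K)\<close> to the boundary. Every later step then gains
  the factor \<open>\<theta>/8\<close>, which makes the non-resonant low modes of order \<open>(\<theta>/8)\<^sup>K / K\<close> (\<open>iterate\<close>). Harmonics of
  order above \<open>K\<close> are made small by giving up analyticity width (\<open>fnorm_le_fproj_tail\<close>).
\<close>

section \<open>Holomorphic functions of actions and angles\<close>

definition cscale :: "complex \<Rightarrow> 'n::finite phase \<Rightarrow> 'n phase" where
  "cscale c p = (c *s fst p, c *s snd p)"

definition holo :: "'n::finite phase set \<Rightarrow> ('n phase \<Rightarrow> complex) \<Rightarrow> bool" where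
  "holo W F \<longleftrightarrow> (\<forall>p\<in>W. \<exists>L. (F has_derivative L) (at p) \<and> (\<forall>c v. L (cscale c v) = c * L v))"

text \<open>
  The derivative along a complex line, as a derivative in one complex variable. It is defined without
  choosing a Frechet derivative; for holomorphic functions both agree (\<open>holo_has_dd\<close>), and the
  one-variable form makes Cauchy's estimates applicable.
\<close>

definition dd :: "('n::finite phase \<Rightarrow> complex) \<Rightarrow> 'n phase \<Rightarrow> 'n phase \<Rightarrow> complex" where
  "dd F p v = deriv (\<lambda>t. F (p + cscale t v)) 0"

lemma cscale_simps [simp]:
  "cscale 0 p = 0" "cscale 1 p = p" "cscale c 0 = 0" "cscale (of_real x) p = x *\<^sub>R p" "cscale a (cscale b p) = cscale (a * b) p"
  "fst (cscale c p) = c *s fst p" "snd (cscale c p) = c *s snd p"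
  by (auto simp: cscale_def prod_eq_iff vec_eq_iff scaleR_conv_of_real[where 'a=complex])

lemma cscale_add_left: "cscale (a + b) p = cscale a p + cscale b p"
  by (auto simp: cscale_def prod_eq_iff vec_eq_iff algebra_simps)

lemma norm_vec_cmult: "norm (c *s v) = norm c * norm (v :: complex^'n)"
  by (simp add: norm_vec_def norm_mult L2_set_right_distrib)

lemma norm_cscale: "norm (cscale c p) = norm c * norm p"
  by (simp add: cscale_def norm_prod_def norm_vec_cmult power_mult_distrib real_sqrt_mult
      flip: distrib_left)

lemma bounded_linear_cscale_left: "bounded_linear (\<lambda>t. cscale t v)"
  by (rule bounded_linear_intro[where K="norm v"])
     (auto simp: cscale_add_left norm_cscale, auto simp: cscale_def prod_eq_iff vec_eq_iff scaleR_conv_of_real[where 'a=complex])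

lemma continuous_on_cscale [continuous_intros]:
  "continuous_on A f \<Longrightarrow> continuous_on A (\<lambda>x. cscale (f x) v)"
  by (rule bounded_linear.continuous_on[OF bounded_linear_cscale_left])

lemma holo_has_dd:
  assumes "holo W F" "p \<in> W"
  shows "(F has_derivative dd F p) (at p)" "dd F p (cscale c v) = c * dd F p v"
proof -
  obtain L where L: "(F has_derivative L) (at p)" "\<And>c v. L (cscale c v) = c * L v"
    using assms unfolding holo_def by blast
  have "dd F p v = L v" for v
  proof -
    have g: "((\<lambda>t. p + cscale t v) has_derivative (\<lambda>t. cscale t v)) (at 0)"
      by (auto intro!: derivative_eq_intros bounded_linear_imp_has_derivative bounded_linear_cscale_left)
    have "((\<lambda>t. F (p + cscale t v)) has_derivative (\<lambda>t. L (cscale t v))) (at 0)"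
      by (rule has_derivative_compose[OF g]) (use L in simp)
    then have "((\<lambda>t. F (p + cscale t v)) has_field_derivative L v) (at 0)"
      by (simp add: has_field_derivative_def L(2) mult.commute[of _ "L v"])
    then show ?thesis by (simp add: dd_def DERIV_imp_deriv)
  qed
  then have "dd F p = L" by auto
  then show "(F has_derivative dd F p) (at p)" "dd F p (cscale c v) = c * dd F p v"
    using L by auto
qed

lemma holo_line:
  assumes "holo W F" "p + cscale t v \<in> W"
  shows "((\<lambda>t. F (p + cscale t v)) has_field_derivative dd F (p + cscale t v) v) (at t)"
proof -
  have g: "((\<lambda>t. p + cscale t v) has_derivative (\<lambda>t. cscale t v)) (at t)"
    by (auto intro!: derivative_eq_intros bounded_linear_imp_has_derivative bounded_linear_cscale_left)
  have "((\<lambda>t. F (p + cscale t v)) has_derivative (\<lambda>s. dd F (p + cscale t v) (cscale s v))) (at t)"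
    by (rule has_derivative_compose[OF g]) (use holo_has_dd[OF assms] in simp)
  then show ?thesis
    by (simp add: has_field_derivative_def holo_has_dd(2)[OF assms] mult.commute[of _ "dd F (p + cscale t v) v"])
qed

lemma bounded_linear_dd: "holo W F \<Longrightarrow> p \<in> W \<Longrightarrow> bounded_linear (dd F p)"
  using holo_has_dd(1) has_derivative_bounded_linear by blast

lemma dd_lin:
  assumes "holo W F" "p \<in> W"
  shows "dd F p (u + v) = dd F p u + dd F p v" "dd F p (- v) = - dd F p v"
    "dd F p (u - v) = dd F p u - dd F p v" "dd F p 0 = 0"
    "dd F p (sum f A) = (\<Sum>i\<in>A. dd F p (f i))"
  using bounded_linear.linear[OF bounded_linear_dd[OF assms]]
  by (auto simp: linear_add linear_neg linear_diff linear_0 linear_sum)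

lemma holoI:
  assumes "\<And>p. p \<in> W \<Longrightarrow> (F has_derivative L p) (at p)" "\<And>p c v. p \<in> W \<Longrightarrow> L p (cscale c v) = c * L p v"
  shows "holo W F" "p \<in> W \<Longrightarrow> dd F p v = L p v"
proof -
  show *: "holo W F" unfolding holo_def using assms by blast
  show "dd F p v = L p v" if "p \<in> W"
    using has_derivative_unique[OF holo_has_dd(1)[OF * that] assms(1)[OF that]] by simp
qed

lemma holo_subset: "holo W F \<Longrightarrow> V \<subseteq> W \<Longrightarrow> holo V F"
  unfolding holo_def by blast

lemma holo_continuous_on: "holo W F \<Longrightarrow> continuous_on W F"
  by (meson continuous_at_imp_continuous_on has_derivative_continuous holo_has_dd(1))

lemma holo_cong:
  assumes "open W" "\<And>p. p \<in> W \<Longrightarrow> F p = G p" "holo W F"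
  shows "holo W G"
proof -
  have "(G has_derivative dd F p) (at p)" if "p \<in> W" for p
    using has_derivative_transform_within_open[OF holo_has_dd(1)[OF assms(3) that] assms(1) that assms(2)] .
  then show ?thesis
    using holo_has_dd(2)[OF assms(3)] unfolding holo_def by blast
qed

lemma dd_cong:
  assumes "open W" "\<And>p. p \<in> W \<Longrightarrow> F p = G p" "p \<in> W"
  shows "dd F p v = dd G p v"
  unfolding dd_def
proof (rule deriv_cong_ev)
  have "open ((\<lambda>t. p + cscale t v) -` W)"
    by (rule open_vimage[OF assms(1)]) (intro continuous_intros)
  then have "\<forall>\<^sub>F t in nhds 0. p + cscale t v \<in> W"
    using assms(3) eventually_nhds_in_open[of "(\<lambda>t. p + cscale t v) -` W" 0] by simp
  then show "\<forall>\<^sub>F t in nhds 0. F (p + cscale t v) = G (p + cscale t v)"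
    by eventually_elim (use assms in auto)
qed auto

lemma holo_const: "holo W (\<lambda>p. c)" and dd_const: "dd (\<lambda>p. c) p v = 0"
  by (auto intro!: holoI(1)[where L="\<lambda>_ _. 0"] simp: dd_def)

lemma holo_add:
  assumes "holo W F" "holo W G"
  shows "holo W (\<lambda>p. F p + G p)" "p \<in> W \<Longrightarrow> dd (\<lambda>p. F p + G p) p v = dd F p v + dd G p v"
  by (rule holoI[where W=W and L="\<lambda>p v. dd F p v + dd G p v"];
      simp add: assms holo_has_dd[OF assms(1)] holo_has_dd[OF assms(2)] has_derivative_add algebra_simps)+

lemma holo_mult:
  assumes "holo W F" "holo W G"
  shows "holo W (\<lambda>p. F p * G p)" "p \<in> W \<Longrightarrow> dd (\<lambda>p. F p * G p) p v = F p * dd G p v + dd F p v * G p"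
proof -
  let ?L = "\<lambda>p v. F p * dd G p v + dd F p v * G p"
  have "((\<lambda>p. F p * G p) has_derivative ?L p) (at p)" if "p \<in> W" for p
    by (rule has_derivative_mult[OF holo_has_dd(1)[OF assms(1) that] holo_has_dd(1)[OF assms(2) that]])
  moreover have "?L p (cscale c v) = c * ?L p v" if "p \<in> W" for p c v
    by (simp add: holo_has_dd(2)[OF assms(1) that] holo_has_dd(2)[OF assms(2) that] algebra_simps)
  ultimately show "holo W (\<lambda>p. F p * G p)"
    "p \<in> W \<Longrightarrow> dd (\<lambda>p. F p * G p) p v = F p * dd G p v + dd F p v * G p"
    by (rule_tac holoI[where W=W and L="?L"]; simp)+
qed

lemma holo_cmult:
  assumes "holo W F"
  shows "holo W (\<lambda>p. c * F p)" "p \<in> W \<Longrightarrow> dd (\<lambda>p. c * F p) p v = c * dd F p v"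
  using holo_mult[OF holo_const[of W c] assms] by (auto simp: dd_const)

lemma holo_minus:
  assumes "holo W F"
  shows "holo W (\<lambda>p. - F p)" "p \<in> W \<Longrightarrow> dd (\<lambda>p. - F p) p v = - dd F p v"
  using holo_cmult[OF assms, where c="-1"] by auto

lemma holo_diff:
  assumes "holo W F" "holo W G"
  shows "holo W (\<lambda>p. F p - G p)" "p \<in> W \<Longrightarrow> dd (\<lambda>p. F p - G p) p v = dd F p v - dd G p v"
  using holo_add[OF assms(1) holo_minus(1)[OF assms(2)]] holo_minus(2)[OF assms(2)] by auto

lemma holo_sum:
  assumes "\<And>i. i \<in> A \<Longrightarrow> holo W (F i)"
  shows "holo W (\<lambda>p. \<Sum>i\<in>A. F i p)" "p \<in> W \<Longrightarrow> dd (\<lambda>p. \<Sum>i\<in>A. F i p) p v = (\<Sum>i\<in>A. dd (F i) p v)"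
proof -
  have "holo W (\<lambda>p. \<Sum>i\<in>A. F i p) \<and> (p \<in> W \<longrightarrow> dd (\<lambda>p. \<Sum>i\<in>A. F i p) p v = (\<Sum>i\<in>A. dd (F i) p v))"
    using assms
    by (induction A rule: infinite_finite_induct) (simp_all add: holo_const dd_const holo_add[of W])
  then show "holo W (\<lambda>p. \<Sum>i\<in>A. F i p)" "p \<in> W \<Longrightarrow> dd (\<lambda>p. \<Sum>i\<in>A. F i p) p v = (\<Sum>i\<in>A. dd (F i) p v)"
    by blast+
qed

lemma holo_compose_field:
  assumes "holo W F" "\<And>p. p \<in> W \<Longrightarrow> (g has_field_derivative g' (F p)) (at (F p))"
  shows "holo W (\<lambda>p. g (F p))" "p \<in> W \<Longrightarrow> dd (\<lambda>p. g (F p)) p v = g' (F p) * dd F p v"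
proof -
  have "((\<lambda>p. g (F p)) has_derivative (\<lambda>v. g' (F p) * dd F p v)) (at p)" if "p \<in> W" for p
    by (rule has_derivative_compose[OF holo_has_dd(1)[OF assms(1) that]])
       (use assms(2)[OF that] in \<open>simp add: has_field_derivative_def\<close>)
  then show "holo W (\<lambda>p. g (F p))" "p \<in> W \<Longrightarrow> dd (\<lambda>p. g (F p)) p v = g' (F p) * dd F p v"
    using holo_has_dd(2)[OF assms(1)]
    by (rule_tac holoI[where L="\<lambda>p v. g' (F p) * dd F p v"]; simp)+
qed

lemma holo_exp:
  assumes "holo W F"
  shows "holo W (\<lambda>p. exp (F p))" "p \<in> W \<Longrightarrow> dd (\<lambda>p. exp (F p)) p v = exp (F p) * dd F p v"
  using holo_compose_field[OF assms, of exp exp] DERIV_exp by auto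

lemma holo_inverse:
  assumes "holo W F" "\<And>p. p \<in> W \<Longrightarrow> F p \<noteq> 0"
  shows "holo W (\<lambda>p. inverse (F p))"
  using holo_compose_field(1)[OF assms(1), of inverse "\<lambda>z. - (inverse z ^ Suc (Suc 0))"] assms(2) DERIV_inverse
  by auto

lemma holo_linear:
  assumes "bounded_linear L" "\<And>c v. L (cscale c v) = c * L v"
  shows "holo W L" "dd L p v = L v"
proof -
  show "holo W L"
    by (rule holoI(1)[where L="\<lambda>_. L"]) (use assms bounded_linear_imp_has_derivative in auto)
  show "dd L p v = L v"
    by (rule holoI(2)[where W=UNIV and L="\<lambda>_. L"]) (use assms bounded_linear_imp_has_derivative in auto)
qed

lemma holo_compose_linear:
  assumes "holo W F" "bounded_linear A" "\<And>c v. A (cscale c v) = cscale c (A v)" "\<And>p. p \<in> V \<Longrightarrow> A p + b \<in> W"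
  shows "holo V (\<lambda>p. F (A p + b))" "p \<in> V \<Longrightarrow> dd (\<lambda>p. F (A p + b)) p v = dd F (A p + b) (A v)"
proof -
  have d: "((\<lambda>p. F (A p + b)) has_derivative (\<lambda>v. dd F (A p + b) (A v))) (at p)" if "p \<in> V" for p
  proof -
    have "((\<lambda>p. A p + b) has_derivative A) (at p)"
      by (auto intro!: derivative_eq_intros bounded_linear_imp_has_derivative assms)
    from has_derivative_compose[OF this, of F] show ?thesis
      using holo_has_dd(1)[OF assms(1) assms(4)[OF that]] by simp
  qed
  show "holo V (\<lambda>p. F (A p + b))" "p \<in> V \<Longrightarrow> dd (\<lambda>p. F (A p + b)) p v = dd F (A p + b) (A v)"
    using d assms(3) holo_has_dd(2)[OF assms(1) assms(4)]
    by (rule_tac holoI[where L="\<lambda>p v. dd F (A p + b) (A v)"]; simp)+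
qed

subsection \<open>Cauchy formula\<close>

lemma line_holomorphic:
  assumes "holo W F" "\<And>t. t \<in> T \<Longrightarrow> p + cscale t v \<in> W"
  shows "(\<lambda>t. F (p + cscale t v)) holomorphic_on T"
  unfolding holomorphic_on_def field_differentiable_def
  by (rule ballI, rule exI, rule has_field_derivative_at_within, rule holo_line[OF assms(1) assms(2)])

lemma cauchy_bound:
  assumes "holo W F" "R > 0" "\<And>t. norm t \<le> R \<Longrightarrow> p + cscale t v \<in> W"
    and "\<And>t. norm t = R \<Longrightarrow> norm (F (p + cscale t v)) \<le> M"
  shows "norm (dd F p v) \<le> M / R"
proof -
  have "(\<lambda>t. F (p + cscale t v)) holomorphic_on cball 0 R"
    by (rule line_holomorphic[OF assms(1)]) (use assms(3) in auto)
  then have "norm ((deriv ^^ 1) (\<lambda>t. F (p + cscale t v)) 0) \<le> fact 1 * M / R ^ 1"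
    by (intro Cauchy_inequality)
       (use assms in \<open>auto intro: holomorphic_on_subset holomorphic_on_imp_continuous_on\<close>)
  then show ?thesis by (simp add: dd_def)
qed

text \<open>
  The integrand is written with the factor \<open>1 *\<^sub>R p\<close> because it is then an instance of the parameter
  integrals treated below, with constant dilation \<open>1\<close>.
\<close>

lemma cauchy_formula:
  assumes "holo W F" "R > 0" "\<And>t. norm t \<le> R \<Longrightarrow> p + cscale t v \<in> W"
  shows "dd F p v = integral (cbox 0 1) (\<lambda>t::real. exp (- (2 * of_real pi * \<i> * t)) / R *
            F (1 *\<^sub>R p + cscale (of_real R * exp (2 * of_real pi * \<i> * t)) v))"
proof -
  let ?f = "\<lambda>t. F (p + cscale t v)"
  have h: "?f holomorphic_on cball 0 R"
    by (rule line_holomorphic[OF assms(1)]) (use assms(3) in auto)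
  have hc: "continuous_on (cball 0 R) ?f"
    by (rule holomorphic_on_imp_continuous_on[OF h])
  have hb: "?f holomorphic_on ball 0 R"
    by (rule holomorphic_on_subset[OF h ball_subset_cball])
  have eq: "dd F p v = 1 / (2 * of_real pi * \<i>) * contour_integral (circlepath 0 R) (\<lambda>u. ?f u / (u - 0)^2)"
    unfolding dd_def
    by (rule DERIV_imp_deriv[OF Cauchy_derivative_integral_circlepath(2)[OF hc hb]]) (simp add: assms(2))
  have alg: "z / (R' * E - 0)\<^sup>2 * (2 * pi * \<i> * R' * E) = (2 * of_real pi * \<i>) * (inverse E / R' * z)"
    if "E \<noteq> 0" "R' \<noteq> 0" for z E R' :: complex
    using that by (simp add: field_simps power2_eq_square)
  note eq
  also have "contour_integral (circlepath 0 R) (\<lambda>u. ?f u / (u - 0)^2) =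
     integral {0..1} (\<lambda>t::real. (2 * of_real pi * \<i>) * (exp (- (2 * of_real pi * \<i> * t)) / R * ?f (R * exp (2 * of_real pi * \<i> * t))))"
    unfolding contour_integral_integral
  proof (rule Henstock_Kurzweil_Integration.integral_cong)
    fix t :: real
    let ?E = "exp (2 * of_real pi * \<i> * t)"
    have cp: "circlepath 0 R t = R * ?E"
      by (simp add: circlepath)
    have vd: "vector_derivative (circlepath 0 R) (at t) = 2 * pi * \<i> * R * ?E"
      by (simp add: vector_derivative_circlepath)
    show "?f (circlepath 0 R t) / (circlepath 0 R t - 0)\<^sup>2 * vector_derivative (circlepath 0 R) (at t)
        = (2 * of_real pi * \<i>) * (exp (- (2 * of_real pi * \<i> * t)) / R * ?f (R * ?E))"
      unfolding cp vd exp_minus by (rule alg) (use assms(2) in simp_all)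
  qed
  finally show ?thesis
    unfolding integral_mult_right cbox_interval scaleR_one by simp
qed

lemma continuous_on_dd_direction:
  assumes W: "open W" and F: "holo W F"
  shows "continuous_on W (\<lambda>p. dd F p v)"
proof -
  have "continuous (at p) (\<lambda>p. dd F p v)" if p: "p \<in> W" for p
  proof -
    obtain e where e: "e > 0" "ball p e \<subseteq> W" using W p open_contains_ball by blast
    define R where "R = e / (2 * (norm v + 1))"
    have R: "R > 0" "R * norm v < e / 2"
      using e by (auto simp: R_def field_simps add_pos_nonneg)
    have mem: "q + cscale t v \<in> W" if "q \<in> ball p (e/2)" "norm t \<le> R" for q t
    proof -
      have "norm (cscale t v) < e / 2"
        using that R mult_right_mono[of "norm t" R "norm v"] by (simp add: norm_cscale)
      then have "dist p (q + cscale t v) < e"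
        using that(1) by (intro dist_triangle_lt[of _ q]) (simp add: dist_norm)
      then show ?thesis using e by auto
    qed
    have "continuous_on (ball p (e/2)) (\<lambda>q. integral (cbox 0 1) (\<lambda>t::real. exp (- (2 * of_real pi * \<i> * t)) / R *
            F (1 *\<^sub>R q + cscale (of_real R * exp (2 * of_real pi * \<i> * t)) v)))"
      by (intro integral_continuous_on_param, unfold case_prod_beta,
          intro continuous_intros continuous_on_compose2[OF holo_continuous_on[OF F]])
         (use R mem in \<open>auto simp: norm_mult\<close>)
    then have "continuous_on (ball p (e/2)) (\<lambda>q. dd F q v)"
      by (rule continuous_on_eq) (rule cauchy_formula[OF F R(1) mem, symmetric], auto)
    then show ?thesis
      using e by (simp add: continuous_on_eq_continuous_at)
  qed
  then show ?thesis by (simp add: continuous_at_imp_continuous_on)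
qed

lemma holo_integral:
  fixes lam :: "'b::euclidean_space \<Rightarrow> real"
  assumes W: "open W" and F: "holo W F" and V: "open V"
    and mem: "\<And>p t. p \<in> V \<Longrightarrow> t \<in> cbox a b \<Longrightarrow> lam t *\<^sub>R p + c t \<in> W"
    and cont: "continuous_on (cbox a b) w" "continuous_on (cbox a b) lam" "continuous_on (cbox a b) c"
  shows "holo V (\<lambda>p. integral (cbox a b) (\<lambda>t. w t * F (lam t *\<^sub>R p + c t)))"
    "p \<in> V \<Longrightarrow> dd (\<lambda>p. integral (cbox a b) (\<lambda>t. w t * F (lam t *\<^sub>R p + c t))) p v
       = integral (cbox a b) (\<lambda>t. w t * of_real (lam t) * dd F (lam t *\<^sub>R p + c t) v)"
proof -
  let ?I = "\<lambda>p. integral (cbox a b) (\<lambda>t. w t * F (lam t *\<^sub>R p + c t))"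
  let ?J = "\<lambda>p v. integral (cbox a b) (\<lambda>t. w t * of_real (lam t) * dd F (lam t *\<^sub>R p + c t) v)"
  have contF: "continuous_on (cbox a b) (\<lambda>t. w t * F (lam t *\<^sub>R p + c t))" if "p \<in> V" for p
    by (intro continuous_intros cont continuous_on_compose2[OF holo_continuous_on[OF F]])
       (use mem[OF that] in \<open>simp add: image_subset_iff\<close>)
  have contJ: "continuous_on (cbox a b) (\<lambda>t. w t * of_real (lam t) * dd F (lam t *\<^sub>R p + c t) v)" if "p \<in> V" for p v
    by (intro continuous_intros cont continuous_on_compose2[OF continuous_on_dd_direction[OF W F]])
       (use mem[OF that] in \<open>simp add: image_subset_iff\<close>)
  have "(?I has_derivative ?J p) (at p) \<and> (\<forall>d v. ?J p (cscale d v) = d * ?J p v)" if p: "p \<in> V" for p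
  proof
    obtain e where e: "e > 0" "ball p e \<subseteq> V" using V p open_contains_ball by blast
    define fx where "fx q t = Blinfun (\<lambda>v. w t * of_real (lam t) * dd F (lam t *\<^sub>R q + c t) v)" for q t
    have bl: "bounded_linear (\<lambda>v. w t * of_real (lam t) * dd F (lam t *\<^sub>R q + c t) v)" if "q \<in> V" "t \<in> cbox a b" for q t
      by (intro bounded_linear_mult_right bounded_linear_compose[OF bounded_linear_mult_right] bounded_linear_dd[OF F] mem that)
    have fx: "blinfun_apply (fx q t) v = w t * of_real (lam t) * dd F (lam t *\<^sub>R q + c t) v" if "q \<in> V" "t \<in> cbox a b" for q t v
      unfolding fx_def by (simp add: bounded_linear_Blinfun_apply[OF bl[OF that]])
    have der: "((\<lambda>q. w t * F (lam t *\<^sub>R q + c t)) has_derivative blinfun_apply (fx q t)) (at q within ball p e)"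
      if "q \<in> ball p e" "t \<in> cbox a b" for q t
    proof -
      have q: "q \<in> V" using that e by auto
      have "((\<lambda>q. lam t *\<^sub>R q + c t) has_derivative (\<lambda>v. lam t *\<^sub>R v)) (at q)"
        by (auto intro!: derivative_eq_intros)
      from has_derivative_compose[OF this, of F]
      have "((\<lambda>q. F (lam t *\<^sub>R q + c t)) has_derivative (\<lambda>v. dd F (lam t *\<^sub>R q + c t) (lam t *\<^sub>R v))) (at q)"
        using holo_has_dd(1)[OF F mem[OF q that(2)]] by simp
      then have "((\<lambda>q. w t * F (lam t *\<^sub>R q + c t)) has_derivative (\<lambda>v. w t * dd F (lam t *\<^sub>R q + c t) (lam t *\<^sub>R v))) (at q)"
        by (rule has_derivative_mult_right)
      moreover have "(\<lambda>v. w t * dd F (lam t *\<^sub>R q + c t) (lam t *\<^sub>R v)) = blinfun_apply (fx q t)"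
        using linear_scale[OF bounded_linear.linear[OF bounded_linear_dd[OF F mem[OF q that(2)]]]]
        by (auto simp: fx[OF q that(2)] scaleR_conv_of_real)
      ultimately show ?thesis by (simp add: has_derivative_at_withinI)
    qed
    have cfx: "continuous_on (ball p e \<times> cbox a b) (\<lambda>(x, t). fx x t)"
    proof (rule continuous_on_blinfun_componentwise)
      fix i :: "'a phase" assume "i \<in> Basis"
      have "continuous_on (ball p e \<times> cbox a b) (\<lambda>z. w (snd z) * of_real (lam (snd z)) * dd F (lam (snd z) *\<^sub>R fst z + c (snd z)) i)"
        by (intro continuous_intros continuous_on_compose2[OF cont(1)] continuous_on_compose2[OF cont(2)]
            continuous_on_compose2[OF cont(3)] continuous_on_compose2[OF continuous_on_dd_direction[OF W F]])
           (use mem e in auto)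
      then show "continuous_on (ball p e \<times> cbox a b) (\<lambda>x. blinfun_apply (case x of (x, t) \<Rightarrow> fx x t) i)"
        by (rule continuous_on_eq) (use e in \<open>auto simp: fx subset_iff\<close>)
    qed
    have "(?I has_derivative integral (cbox a b) (fx p)) (at p within ball p e)"
      by (rule leibniz_rule[OF der _ cfx])
         (use e contF in \<open>auto intro!: integrable_continuous\<close>)
    then have "(?I has_derivative integral (cbox a b) (fx p)) (at p)"
      using e by (simp add: at_within_open[of p "ball p e"])
    moreover have "blinfun_apply (integral (cbox a b) (fx p)) v = ?J p v" for v
    proof -
      have "continuous_on (cbox a b) (\<lambda>t. (\<lambda>(x, t). fx x t) (p, t))"
        by (rule continuous_on_compose2[OF cfx]) (use e in \<open>auto intro!: continuous_intros\<close>)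
      then have "fx p integrable_on cbox a b"
        by (intro integrable_continuous) simp
      then have "blinfun_apply (integral (cbox a b) (fx p)) v = integral (cbox a b) (\<lambda>t. fx p t v)"
        by (rule blinfun_apply_integral)
      also have "\<dots> = ?J p v"
        by (rule integral_cong) (simp add: fx p)
      finally show ?thesis .
    qed
    then have "blinfun_apply (integral (cbox a b) (fx p)) = ?J p" by (rule ext)
    ultimately show "(?I has_derivative ?J p) (at p)" by simp
    show "\<forall>d v. ?J p (cscale d v) = d * ?J p v"
    proof (intro allI)
      fix d v
      have "?J p (cscale d v) = integral (cbox a b) (\<lambda>t. d * (w t * of_real (lam t) * dd F (lam t *\<^sub>R p + c t) v))"
        by (rule integral_cong) (simp add: holo_has_dd(2)[OF F mem[OF p]])
      then show "?J p (cscale d v) = d * ?J p v" by simp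
    qed
  qed
  then have d: "(?I has_derivative ?J p) (at p)" "?J p (cscale d v) = d * ?J p v" if "p \<in> V" for p d v
    using that by blast+
  show "holo V ?I" by (rule holoI(1)[of V ?I ?J, OF d])
  show "dd ?I p v = ?J p v" if "p \<in> V" by (rule holoI(2)[of V ?I ?J, OF d that])
qed

lemma local_disc_room:
  assumes W: "open W" and p: "p \<in> W"
  obtains R e where "R > 0" "e > 0" "ball p e \<subseteq> W"
    "\<And>q t. q \<in> ball p e \<Longrightarrow> norm t \<le> R \<Longrightarrow> q + cscale t v \<in> W"
proof -
  obtain e where e: "e > 0" "ball p e \<subseteq> W" using W p open_contains_ball by blast
  define R where "R = e / (2 * (norm v + 1))"
  have R: "R > 0" "R * norm v < e / 2"
    using e by (auto simp: R_def field_simps add_pos_nonneg)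
  have mem: "q + cscale t v \<in> W" if "q \<in> ball p (e/2)" "norm t \<le> R" for q t
  proof -
    have "norm (cscale t v) < e / 2"
      using that R mult_right_mono[of "norm t" R "norm v"] by (simp add: norm_cscale)
    then have "dist p (q + cscale t v) < e"
      using that(1) by (intro dist_triangle_lt[of _ q]) (simp add: dist_norm)
    then show ?thesis using e by auto
  qed
  have "ball p (e/2) \<subseteq> W" using e subset_ball[of "e/2" e p] by auto
  with e show ?thesis by (intro that[of R "e/2", OF R(1) _ _ mem]) simp_all
qed

text \<open>
  A derivative is locally a Cauchy integral of the function over a circle in a fixed direction, and
  hence holomorphic in the base point by differentiation under the integral. Differentiating that
  integral in a second direction gives the Cauchy formula for the other order of differentiation.
\<close>

lemma
  assumes W: "open W" and F: "holo W F"
  shows holo_dd: "holo W (\<lambda>p. dd F p v)"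
    and dd_commute: "p \<in> W \<Longrightarrow> dd (\<lambda>p. dd F p v) p u = dd (\<lambda>p. dd F p u) p v"
proof -
  have loc: "\<exists>e>0. ball p e \<subseteq> W \<and> holo (ball p e) (\<lambda>p. dd F p v) \<and>
      dd (\<lambda>p. dd F p v) p u = integral (cbox 0 1) (\<lambda>t::real. exp (- (2 * of_real pi * \<i> * t)) / R *
            dd F (1 *\<^sub>R p + cscale (of_real R * exp (2 * of_real pi * \<i> * t)) v) u)"
    if p: "p \<in> W" and R: "R > 0" "e > 0" "ball p e \<subseteq> W" 
      "\<And>q t. q \<in> ball p e \<Longrightarrow> norm t \<le> R \<Longrightarrow> q + cscale t v \<in> W" for p u v R e
  proof -
    let ?w = "\<lambda>t::real. exp (- (2 * of_real pi * \<i> * t)) / of_real R"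
    let ?c = "\<lambda>t::real. cscale (of_real R * exp (2 * of_real pi * \<i> * t)) v"
    have eq: "integral (cbox 0 1) (\<lambda>t. ?w t * F (1 *\<^sub>R q + ?c t)) = dd F q v" if "q \<in> ball p e" for q
      by (rule cauchy_formula[OF F R(1) R(4)[OF that], symmetric])
    have mem: "1 *\<^sub>R q + ?c t \<in> W" if "q \<in> ball p e" for q t
      using R(4)[OF that] R(1) by (simp add: norm_mult)
    have c: "continuous_on (cbox 0 1) ?w" "continuous_on (cbox 0 1) (\<lambda>t::real. 1::real)" "continuous_on (cbox 0 1) ?c"
      using R(1) by (auto intro!: continuous_intros)
    let ?I = "\<lambda>q. integral (cbox 0 1) (\<lambda>t. ?w t * F (1 *\<^sub>R q + ?c t))"
    have hi1: "holo (ball p e) ?I"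
      by (rule holo_integral(1)[OF W F open_ball _ c]) (rule mem)
    have hi2: "dd ?I p u = integral (cbox 0 1) (\<lambda>t. ?w t * of_real 1 * dd F (1 *\<^sub>R p + ?c t) u)"
      by (rule holo_integral(2)[OF W F open_ball _ c centre_in_ball[THEN iffD2, OF R(2)]]) (rule mem)
    have "holo (ball p e) (\<lambda>p. dd F p v)"
      by (rule holo_cong[OF open_ball eq hi1])
    moreover have "dd (\<lambda>p. dd F p v) p u = dd (\<lambda>q. integral (cbox 0 1) (\<lambda>t. ?w t * F (1 *\<^sub>R q + ?c t))) p u"
      by (rule dd_cong[OF open_ball eq[symmetric] centre_in_ball[THEN iffD2, OF R(2)]])
    ultimately show ?thesis
      using hi2 R(2,3)
      by (intro exI[of _ e] conjI) simp_all
  qed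
  show h: "holo W (\<lambda>p. dd F p v)" for v
    unfolding holo_def
  proof
    fix p assume p: "p \<in> W"
    obtain R e where Re: "R > 0" "e > 0" "ball p e \<subseteq> W" 
      "\<And>q t. q \<in> ball p e \<Longrightarrow> norm t \<le> R \<Longrightarrow> q + cscale t v \<in> W"
      using local_disc_room[OF W p] by metis
    obtain e' where "e' > 0" "holo (ball p e') (\<lambda>p. dd F p v)"
      using loc[OF p Re] by blast
    then show "\<exists>L. ((\<lambda>p. dd F p v) has_derivative L) (at p) \<and> (\<forall>c v. L (cscale c v) = c * L v)"
      unfolding holo_def by auto
  qed
  show "dd (\<lambda>p. dd F p v) p u = dd (\<lambda>p. dd F p u) p v" if p: "p \<in> W"
  proof -
    obtain R e where Re: "R > 0" "e > 0" "ball p e \<subseteq> W" 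
      "\<And>q t. q \<in> ball p e \<Longrightarrow> norm t \<le> R \<Longrightarrow> q + cscale t v \<in> W"
      using local_disc_room[OF W p] by metis
    have "dd (\<lambda>p. dd F p u) p v = integral (cbox 0 1) (\<lambda>t::real. exp (- (2 * of_real pi * \<i> * t)) / R *
            dd F (1 *\<^sub>R p + cscale (of_real R * exp (2 * of_real pi * \<i> * t)) v) u)"
      by (rule cauchy_formula[OF h Re(1)]) (use Re(2) in \<open>auto intro!: Re(4)\<close>)
    moreover note loc[OF p Re, of u]
    ultimately show ?thesis by metis
  qed
qed

text \<open>
  The theorem of Weierstrass on series of holomorphic functions: Cauchy's estimate turns the summable
  bounds \<open>B m\<close> of the terms into locally uniform summable bounds of their derivatives.
\<close>

lemma
  assumes W: "open W" and G: "\<And>m. holo W (G m)" and B: "\<And>m p. p \<in> W \<Longrightarrow> norm (G m p) \<le> B m" "summable B"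
  shows holo_series: "holo W (\<lambda>p. \<Sum>m. G m p)"
    and dd_series: "p \<in> W \<Longrightarrow> (\<lambda>m. dd (G m) p v) sums dd (\<lambda>p. \<Sum>m. G m p) p v"
    and summable_norm_dd: "p \<in> W \<Longrightarrow> summable (\<lambda>m. norm (dd (G m) p v))"
proof -
  let ?g = "\<lambda>p v. \<Sum>m. dd (G m) p v"
  let ?S = "\<lambda>p. \<Sum>m. G m p"
  have loc: "\<exists>e>0. ball p e \<subseteq> W \<and> (\<forall>q\<in>ball p e. \<forall>m v. norm (dd (G m) q v) \<le> B m * norm v / e)" if p: "p \<in> W" for p
  proof -
    obtain e where e: "e > 0" "ball p e \<subseteq> W" using W p open_contains_ball by blast
    have "norm (dd (G m) q v) \<le> B m * norm v / (e/2)" if q: "q \<in> ball p (e/2)" for q m v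
    proof (cases "v = 0")
      case True
      have "q \<in> W" using q e subset_ball[of "e/2" e p] by auto
      then show ?thesis using dd_lin(4)[OF G] True by simp
    next
      case False
      define R where "R = (e/2) / norm v"
      have R: "R > 0" using e False by (simp add: R_def)
      have mem: "q + cscale t v \<in> W" if "norm t \<le> R" for t
      proof -
        have "norm (cscale t v) \<le> e / 2"
          using that False mult_right_mono[of "norm t" R "norm v"] by (simp add: norm_cscale R_def)
        then have "dist p (q + cscale t v) < e"
          using q by (intro dist_triangle_lt[of _ q]) (simp add: dist_norm)
        then show ?thesis using e by auto
      qed
      have "norm (dd (G m) q v) \<le> B m / R"
        by (rule cauchy_bound[OF G R mem]) (auto intro!: B mem)
      then show ?thesis by (simp add: R_def algebra_simps)
    qed
    moreover have "ball p (e/2) \<subseteq> W" using e subset_ball[of "e/2" e p] by auto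
    ultimately show ?thesis using e by (intro exI[of _ "e/2"] conjI ballI allI) simp_all
  qed
  have sm: "summable (\<lambda>m. norm (dd (G m) p v))" if p: "p \<in> W" for p v
  proof -
    obtain e where e: "e > 0" "\<And>m v. norm (dd (G m) p v) \<le> B m * norm v / e"
      using loc[OF p] by auto
    show ?thesis
      by (rule summable_comparison_test'[where g="\<lambda>m. B m * (norm v / e)"])
         (use e summable_mult2[OF B(2), of "norm v / e"] in auto)
  qed
  then show "p \<in> W \<Longrightarrow> summable (\<lambda>m. norm (dd (G m) p v))" .
  have main: "(?S has_derivative ?g p) (at p)" if p: "p \<in> W" for p
  proof -
    obtain e where e: "e > 0" "ball p e \<subseteq> W" "\<And>m v q. q \<in> ball p e \<Longrightarrow> norm (dd (G m) q v) \<le> B m * norm v / e"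
      using loc[OF p] by auto
    have Bpos: "0 \<le> B m" for m using B(1)[OF p] norm_ge_zero order_trans by blast
    have smq: "summable (\<lambda>m. norm (dd (G m) q v))" if "q \<in> ball p e" for q v
      by (rule sm) (use that e in blast)
    have "\<exists>g. \<forall>x\<in>ball p e. (\<lambda>n. G n x) sums (g x) \<and> (g has_derivative ?g x) (at x within ball p e)"
    proof (rule has_derivative_series)
      show "(G n has_derivative dd (G n) x) (at x within ball p e)" if "x \<in> ball p e" for n x
        by (rule has_derivative_at_withinI, rule holo_has_dd(1)[OF G]) (use that e in blast)
      show "\<forall>\<^sub>F n in sequentially. \<forall>x\<in>ball p e. \<forall>h. norm ((\<Sum>i<n. dd (G i) x h) - ?g x h) \<le> d * norm h" if d: "d > 0" for d
      proof -
        have "(\<lambda>n. \<Sum>i. B (i + n)) \<longlonglongrightarrow> 0" by (rule suminf_exist_split2[OF B(2)])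
        then have "\<forall>\<^sub>F n in sequentially. (\<Sum>i. B (i + n)) < d * e"
          by (rule order_tendstoD) (use d e in auto)
        then show ?thesis
        proof eventually_elim
          case (elim n)
          show ?case
          proof (intro ballI allI)
            fix x h assume x: "x \<in> ball p e"
            have s: "summable (\<lambda>m. dd (G m) x h)" by (rule summable_norm_cancel[OF smq[OF x]])
            have s2: "summable (\<lambda>i. B (i + n) * (norm h / e))" 
              by (intro summable_mult2 summable_ignore_initial_segment B)
            have s1: "summable (\<lambda>i. norm (dd (G (i + n)) x h))"
              using summable_ignore_initial_segment[OF smq[OF x], of n] by simp
            have "(\<Sum>i<n. dd (G i) x h) - ?g x h = - (\<Sum>i. dd (G (i + n)) x h)"
              using suminf_minus_initial_segment[OF s, of n] by simp
            then have "norm ((\<Sum>i<n. dd (G i) x h) - ?g x h) = norm (\<Sum>i. dd (G (i + n)) x h)" by simp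
            also have "\<dots> \<le> (\<Sum>i. norm (dd (G (i + n)) x h))"
              by (rule summable_norm[OF s1])
            also have "\<dots> \<le> (\<Sum>i. B (i + n) * (norm h / e))"
              by (rule suminf_le[OF _ s1 s2]) (use e(3)[OF x] in simp)
            also have "\<dots> = (\<Sum>i. B (i + n)) * (norm h / e)"
              by (intro suminf_mult2[symmetric] summable_ignore_initial_segment B)
            also have "\<dots> \<le> (d * e) * (norm h / e)"
              by (intro mult_right_mono) (use elim e in auto)
            finally show "norm ((\<Sum>i<n. dd (G i) x h) - ?g x h) \<le> d * norm h" using e by simp
          qed
        qed
      qed
      show "p \<in> ball p e" using e by simp
      have "summable (\<lambda>n. G n p)"
        by (rule summable_comparison_test'[OF B(2)]) (use B(1)[OF p] in auto)
      then show "(\<lambda>n. G n p) sums (\<Sum>n. G n p)" by (rule summable_sums)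
    qed auto
    then obtain g where g: "\<And>x. x \<in> ball p e \<Longrightarrow> (\<lambda>n. G n x) sums (g x)"
        "\<And>x. x \<in> ball p e \<Longrightarrow> (g has_derivative ?g x) (at x within ball p e)" by blast
    have "(g has_derivative ?g p) (at p)"
      using g(2)[of p] e by (simp add: at_within_open[of p "ball p e"])
    then show ?thesis
      by (rule has_derivative_transform_within_open[OF _ open_ball[of p e]])
         (use g(1) e in \<open>auto simp: sums_unique\<close>)
  qed
  have lin: "?g p (cscale c v) = c * ?g p v" if p: "p \<in> W" for p c v
    using holo_has_dd(2)[OF G p] suminf_mult[OF summable_norm_cancel[OF sm[OF p, of v]]] by simp
  show "holo W ?S" by (rule holoI(1)[OF main lin])
  show "(\<lambda>m. dd (G m) p v) sums dd ?S p v" if p: "p \<in> W"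
    using holoI(2)[OF main lin p, of v] summable_sums[OF summable_norm_cancel[OF sm[OF p, of v]]] by simp
qed

section \<open>Lie series of a vector field\<close>

text \<open>
  The \<open>2n\<close> coordinates of a phase point are indexed by \<open>'n + 'n\<close>, with \<open>Inl\<close> for actions and \<open>Inr\<close> for
  angles, so that vector fields, gradients and brackets are single sums over this type.
\<close>

definition coord_vec :: "'n + 'n \<Rightarrow> 'n::finite phase" where
  "coord_vec a = (case a of Inl i \<Rightarrow> (axis i 1, 0) | Inr i \<Rightarrow> (0, axis i 1))"

definition coord :: "'n + 'n \<Rightarrow> 'n::finite phase \<Rightarrow> complex" where
  "coord a p = (case a of Inl i \<Rightarrow> fst p $ i | Inr i \<Rightarrow> snd p $ i)"

definition of_coords :: "('n + 'n \<Rightarrow> complex) \<Rightarrow> 'n::finite phase" where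
  "of_coords c = (\<chi> i. c (Inl i), \<chi> i. c (Inr i))"

definition pd :: "'n + 'n \<Rightarrow> ('n::finite phase \<Rightarrow> complex) \<Rightarrow> 'n phase \<Rightarrow> complex" where
  "pd a F p = dd F p (coord_vec a)"

definition Lie :: "('n + 'n \<Rightarrow> 'n::finite phase \<Rightarrow> complex) \<Rightarrow> ('n phase \<Rightarrow> complex) \<Rightarrow> 'n phase \<Rightarrow> complex" where
  "Lie X F p = (\<Sum>a\<in>UNIV. X a p * pd a F p)"

lemma sum_UNIV_Plus: "(\<Sum>a\<in>UNIV. f a) = (\<Sum>i\<in>UNIV. f (Inl i)) + (\<Sum>i\<in>UNIV. f (Inr i))"
  for f :: "'a::finite + 'b::finite \<Rightarrow> 'c::comm_monoid_add"
  using sum.Plus[of UNIV UNIV f] by simp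

lemma coord_of_coords [simp]: "coord a (of_coords c) = c a"
  by (simp add: coord_def of_coords_def split: sum.split)

lemma phase_eqI: "(\<And>a. coord a p = coord a q) \<Longrightarrow> p = q"
  by (metis (no_types, lifting) coord_def prod_eq_iff sum.case(1) sum.case(2) vec_eq_iff)

lemma coord_coord_vec: "coord a (coord_vec b) = (if a = b then 1 else 0)"
  by (auto simp: coord_def coord_vec_def axis_def split: sum.split)

lemma coord_simps [simp]:
  "coord a (p + q) = coord a p + coord a q" "coord a (p - q) = coord a p - coord a q" "coord a 0 = 0" "coord a (cscale c p) = c * coord a p"
  by (simp_all add: coord_def split: sum.split)

lemma coord_sum: "coord a (sum f A) = (\<Sum>x\<in>A. coord a (f x))"
  by (induction A rule: infinite_finite_induct) simp_all

lemma bounded_linear_coord: "bounded_linear (coord a)"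
proof -
  have "bounded_linear (\<lambda>p::'a phase. fst p $ i)" "bounded_linear (\<lambda>p::'a phase. snd p $ i)" for i
    by (rule bounded_linear_compose[OF bounded_linear_vec_nth bounded_linear_fst])
       (rule bounded_linear_compose[OF bounded_linear_vec_nth bounded_linear_snd])
  then show ?thesis unfolding coord_def by (cases a) simp_all
qed

lemma holo_coord: "holo W (coord a)" and dd_coord: "dd (coord a) p v = coord a v"
  by (rule holo_linear[OF bounded_linear_coord], simp)+

lemma pd_coord: "pd a (coord b) p = (if a = b then 1 else 0)"
  by (simp add: pd_def dd_coord coord_coord_vec)

lemma phase_expand: "p = (\<Sum>a\<in>UNIV. cscale (coord a p) (coord_vec a))"
  by (rule phase_eqI) (simp add: coord_sum coord_coord_vec if_distrib cong: if_cong)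

lemma dd_expand:
  assumes "holo W F" "p \<in> W"
  shows "dd F p v = (\<Sum>a\<in>UNIV. coord a v * pd a F p)"
  by (subst phase_expand[of v]) (simp add: dd_lin(5)[OF assms] holo_has_dd(2)[OF assms] pd_def)

lemma Lie_dd:
  assumes "holo W F" "p \<in> W"
  shows "Lie X F p = dd F p (of_coords (\<lambda>a. X a p))"
  by (simp add: dd_expand[OF assms] Lie_def)

lemma holo_pd: "open W \<Longrightarrow> holo W F \<Longrightarrow> holo W (pd a F)"
  unfolding pd_def by (rule holo_dd)

lemma pd_commute: "open W \<Longrightarrow> holo W F \<Longrightarrow> p \<in> W \<Longrightarrow> pd a (pd b F) p = pd b (pd a F) p"
  unfolding pd_def by (rule dd_commute)

lemma holo_Lie:
  assumes "open W" "\<And>a. holo W (X a)" "holo W F"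
  shows "holo W (Lie X F)"
  unfolding Lie_def by (intro holo_sum(1) holo_mult(1) assms holo_pd)

lemma holo_Lie_pow:
  assumes "open W" "\<And>a. holo W (X a)" "holo W F"
  shows "holo W ((Lie X ^^ m) F)"
  by (induction m) (simp_all add: assms holo_Lie)

lemma Lie_cong:
  assumes "open W" "\<And>p. p \<in> W \<Longrightarrow> F p = G p" "p \<in> W"
  shows "Lie X F p = Lie X G p"
  unfolding Lie_def pd_def using dd_cong[OF assms(1,2)] assms(3) by simp

lemma Lie_pow_cong:
  assumes "open W" "\<And>p. p \<in> W \<Longrightarrow> F p = G p"
  shows "p \<in> W \<Longrightarrow> (Lie X ^^ m) F p = (Lie X ^^ m) G p"
proof (induction m arbitrary: p)
  case (Suc m)
  show ?case unfolding funpow.simps o_apply by (rule Lie_cong[OF assms(1) Suc.IH Suc.prems])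
qed (simp add: assms)

lemma Lie_sum:
  assumes "\<And>i. i \<in> A \<Longrightarrow> holo W (F i)" "p \<in> W"
  shows "Lie X (\<lambda>p. \<Sum>i\<in>A. c i * F i p) p = (\<Sum>i\<in>A. c i * Lie X (F i) p)"
proof -
  have "dd (\<lambda>p. \<Sum>i\<in>A. c i * F i p) p v = (\<Sum>i\<in>A. c i * dd (F i) p v)" for v
    by (subst holo_sum(2)[of A W]) (simp_all add: assms holo_cmult(1) holo_cmult(2)[of W])
  then have "Lie X (\<lambda>p. \<Sum>i\<in>A. c i * F i p) p = (\<Sum>a\<in>UNIV. \<Sum>i\<in>A. c i * (X a p * dd (F i) p (coord_vec a)))"
    unfolding Lie_def pd_def by (simp add: sum_distrib_left mult_ac)
  then show ?thesis
    by (subst (asm) sum.swap) (simp add: Lie_def pd_def sum_distrib_left)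
qed

lemma Lie_pow_sum:
  assumes "open W" "\<And>a. holo W (X a)" "\<And>i. i \<in> A \<Longrightarrow> holo W (F i)"
  shows "p \<in> W \<Longrightarrow> (Lie X ^^ m) (\<lambda>p. \<Sum>i\<in>A. c i * F i p) p = (\<Sum>i\<in>A. c i * (Lie X ^^ m) (F i) p)"
proof (induction m arbitrary: p)
  case (Suc m)
  have "(Lie X ^^ Suc m) (\<lambda>p. \<Sum>i\<in>A. c i * F i p) p = Lie X (\<lambda>p. \<Sum>i\<in>A. c i * (Lie X ^^ m) (F i) p) p"
    unfolding funpow.simps o_apply by (rule Lie_cong[OF assms(1) Suc.IH Suc.prems])
  also have "\<dots> = (\<Sum>i\<in>A. c i * (Lie X ^^ Suc m) (F i) p)"
    using Suc.prems assms by (subst Lie_sum[of A W]) (simp_all add: holo_Lie_pow)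
  finally show ?case .
qed simp

lemma Lie_pow_const: "(Lie X ^^ m) (\<lambda>p. c) p = (if m = 0 then c else 0)"
proof (induction m arbitrary: p)
  case (Suc m)
  have "(Lie X ^^ Suc m) (\<lambda>p. c) p = Lie X (\<lambda>p. if m = 0 then c else 0) p"
    unfolding funpow.simps o_apply by (rule Lie_cong[of UNIV]) (simp_all add: Suc.IH)
  also have "\<dots> = 0" unfolding Lie_def pd_def by (simp add: dd_const)
  finally show ?case by simp
qed simp

subsection \<open>The Leibniz formula\<close>

lemma sum_Pascal:
  fixes a :: "nat \<Rightarrow> nat \<Rightarrow> complex"
  shows "(\<Sum>j\<le>m. of_nat (m choose j) * (a (Suc j) (m - j) + a j (Suc m - j)))
       = (\<Sum>j\<le>Suc m. of_nat (Suc m choose j) * a j (Suc m - j))"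
proof -
  have "(\<Sum>j\<le>Suc m. of_nat (Suc m choose j) * a j (Suc m - j))
      = a 0 (Suc m) + (\<Sum>j\<le>m. of_nat (Suc m choose Suc j) * a (Suc j) (m - j))"
    by (subst sum.atMost_Suc_shift) simp
  also have "\<dots> = (\<Sum>j\<le>m. of_nat (m choose j) * a (Suc j) (m - j)) +
       (a 0 (Suc m) + (\<Sum>j\<le>m. of_nat (m choose Suc j) * a (Suc j) (m - j)))"
    by (simp add: algebra_simps sum.distrib)
  also have "a 0 (Suc m) + (\<Sum>j\<le>m. of_nat (m choose Suc j) * a (Suc j) (m - j))
     = (\<Sum>j\<le>Suc m. of_nat (m choose j) * a j (Suc m - j))"
    by (subst sum.atMost_Suc_shift) simp
  also have "\<dots> = (\<Sum>j\<le>m. of_nat (m choose j) * a j (Suc m - j))" by simp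
  finally show ?thesis by (simp add: algebra_simps sum.distrib)
qed

text \<open>
  The Leibniz formula for the iterates of a derivation, for an arbitrary bracket \<open>B\<close>: it is applied to
  the product of functions, and to the Poisson bracket when the field is Hamiltonian.
\<close>

lemma Lie_pow_bilinear:
  assumes W: "open W" and X: "\<And>a. holo W (X a)"
    and B: "\<And>F G. holo W F \<Longrightarrow> holo W G \<Longrightarrow> holo W (B F G)"
    and L: "\<And>F G p. holo W F \<Longrightarrow> holo W G \<Longrightarrow> p \<in> W \<Longrightarrow> Lie X (B F G) p = B (Lie X F) G p + B F (Lie X G) p"
    and FG: "holo W F" "holo W G"
  shows "p \<in> W \<Longrightarrow> (Lie X ^^ m) (B F G) p
    = (\<Sum>j\<le>m. of_nat (m choose j) * B ((Lie X ^^ j) F) ((Lie X ^^ (m - j)) G) p)"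
proof (induction m arbitrary: p)
  case (Suc m)
  note h = holo_Lie_pow[OF W X FG(1)] holo_Lie_pow[OF W X FG(2)]
  have "(Lie X ^^ Suc m) (B F G) p =
      Lie X (\<lambda>p. \<Sum>j\<le>m. of_nat (m choose j) * B ((Lie X ^^ j) F) ((Lie X ^^ (m - j)) G) p) p"
    unfolding funpow.simps o_apply by (rule Lie_cong[OF W Suc.IH Suc.prems])
  also have "\<dots> = (\<Sum>j\<le>m. of_nat (m choose j) * Lie X (B ((Lie X ^^ j) F) ((Lie X ^^ (m - j)) G)) p)"
    using Suc.prems by (intro Lie_sum[of _ W] B h) auto
  also have "\<dots> = (\<Sum>j\<le>m. of_nat (m choose j) *
      (B ((Lie X ^^ Suc j) F) ((Lie X ^^ (m - j)) G) p + B ((Lie X ^^ j) F) ((Lie X ^^ (Suc m - j)) G) p))"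
  proof (intro sum.cong refl)
    fix j assume j: "j \<in> {..m}"
    then have *: "Suc m - j = Suc (m - j)" by auto
    show "of_nat (m choose j) * Lie X (B ((Lie X ^^ j) F) ((Lie X ^^ (m - j)) G)) p = of_nat (m choose j) *
      (B ((Lie X ^^ Suc j) F) ((Lie X ^^ (m - j)) G) p + B ((Lie X ^^ j) F) ((Lie X ^^ (Suc m - j)) G) p)"
      unfolding * by (simp add: L[OF h Suc.prems])
  qed
  also have "\<dots> = (\<Sum>j\<le>Suc m. of_nat (Suc m choose j) * B ((Lie X ^^ j) F) ((Lie X ^^ (Suc m - j)) G) p)"
    by (rule sum_Pascal[where a="\<lambda>i j. B ((Lie X ^^ i) F) ((Lie X ^^ j) G) p"])
  finally show ?case .
qed simp

lemma binomial_scale: "j \<le> m \<Longrightarrow> of_nat (m choose j) / fact m = (1 / fact j * (1 / fact (m - j)) :: complex)"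
  by (simp add: binomial_fact field_simps)

lemma Lie_mult:
  assumes "holo W F" "holo W G" "p \<in> W"
  shows "Lie X (\<lambda>p. F p * G p) p = Lie X F p * G p + F p * Lie X G p"
  unfolding Lie_def pd_def
  by (simp add: holo_mult(2)[OF assms] sum_distrib_left sum_distrib_right sum.distrib[symmetric] algebra_simps)

lemma Lie_pow_mult:
  assumes W: "open W" and X: "\<And>a. holo W (X a)" and FG: "holo W F" "holo W G" "p \<in> W"
  shows "(Lie X ^^ m) (\<lambda>p. F p * G p) p / fact m
    = (\<Sum>j\<le>m. ((Lie X ^^ j) F p / fact j) * ((Lie X ^^ (m - j)) G p / fact (m - j)))"
proof -
  have "(Lie X ^^ m) (\<lambda>p. F p * G p) p =
     (\<Sum>j\<le>m. of_nat (m choose j) * ((Lie X ^^ j) F p * (Lie X ^^ (m - j)) G p))"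
    by (rule Lie_pow_bilinear[where B="\<lambda>F G p. F p * G p", OF W X _ _ FG]; (rule holo_mult(1) Lie_mult, assumption+))
  then have "(Lie X ^^ m) (\<lambda>p. F p * G p) p / fact m =
     (\<Sum>j\<le>m. of_nat (m choose j) / fact m * ((Lie X ^^ j) F p * (Lie X ^^ (m - j)) G p))"
    by (simp add: sum_divide_distrib)
  also have "\<dots> = (\<Sum>j\<le>m. ((Lie X ^^ j) F p / fact j) * ((Lie X ^^ (m - j)) G p / fact (m - j)))"
    by (intro sum.cong refl) (simp add: binomial_scale)
  finally show ?thesis .
qed

subsection \<open>Boxes\<close>

definition pbox :: "'n::finite phase \<Rightarrow> real \<Rightarrow> real \<Rightarrow> 'n phase set" where
  "pbox p \<rho> \<sigma> = {q. norm (fst q - fst p) \<le> \<rho> \<and> (\<forall>i. norm (snd q $ i - snd p $ i) \<le> \<sigma>)}"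

definition obox :: "'n::finite phase \<Rightarrow> real \<Rightarrow> real \<Rightarrow> 'n phase set" where
  "obox p \<rho> \<sigma> = {q. norm (fst q - fst p) < \<rho> \<and> (\<forall>i. norm (snd q $ i - snd p $ i) < \<sigma>)}"

lemma open_obox: "open (obox p \<rho> \<sigma>)"
proof -
  have "obox p \<rho> \<sigma> = {q. norm (fst q - fst p) < \<rho>} \<inter> (\<Inter>i. {q. norm (snd q $ i - snd p $ i) < \<sigma>})"
    by (auto simp: obox_def)
  also have "open \<dots>"
    by (intro open_Int open_INT ballI open_Collect_less continuous_intros) auto
  finally show ?thesis .
qed

lemma closed_pbox: "closed (pbox p \<rho> \<sigma>)"
proof -
  have "pbox p \<rho> \<sigma> = {q. norm (fst q - fst p) \<le> \<rho>} \<inter> (\<Inter>i. {q. norm (snd q $ i - snd p $ i) \<le> \<sigma>})"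
    by (auto simp: pbox_def)
  also have "closed \<dots>"
    by (intro closed_Int closed_INT ballI closed_Collect_le continuous_intros)
  finally show ?thesis .
qed

lemma norm_le_sum_cmod: "norm (z :: complex^'n) \<le> (\<Sum>i\<in>UNIV. norm (z $ i))"
  by (simp add: norm_vec_def L2_set_le_sum)

lemma compact_pbox: "compact (pbox p \<rho> \<sigma>)"
proof -
  have sub: "pbox p \<rho> \<sigma> \<subseteq> cball (fst p) \<rho> \<times> cball (snd p) (real CARD('a) * \<sigma>)"
  proof
    fix q assume q: "q \<in> pbox p \<rho> \<sigma>"
    have "norm (snd q - snd p) \<le> (\<Sum>i\<in>(UNIV::'a set). norm ((snd q - snd p) $ i))" by (rule norm_le_sum_cmod)
    also have "\<dots> \<le> (\<Sum>i\<in>(UNIV::'a set). \<sigma>)"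
      by (rule sum_mono) (use q in \<open>simp add: pbox_def\<close>)
    finally show "q \<in> cball (fst p) \<rho> \<times> cball (snd p) (real CARD('a) * \<sigma>)"
      using q by (simp add: pbox_def dist_norm norm_minus_commute mem_Times_iff)
  qed
  show ?thesis
    by (simp add: compact_eq_bounded_closed closed_pbox bounded_subset[OF bounded_Times[OF bounded_cball bounded_cball] sub])
qed

lemma convex_obox: "convex (obox p \<rho> \<sigma>)"
proof -
  have c: "convex {z::complex. cmod (z - a) < \<sigma>}" for a
    using convex_ball[of a \<sigma>] by (simp add: ball_def dist_norm norm_minus_commute)
  have eq: "obox p \<rho> \<sigma> = (fst -` ball (fst p) \<rho>) \<inter> (\<Inter>i. (\<lambda>q. snd q $ i) -` {z. cmod (z - snd p $ i) < \<sigma>})"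
    by (auto simp: obox_def dist_norm norm_minus_commute)
  have "linear (\<lambda>q::'a phase. snd q $ i)" for i
    by (rule bounded_linear.linear, rule bounded_linear_compose[OF bounded_linear_vec_nth bounded_linear_snd])
  then show ?thesis unfolding eq
    by (intro convex_Int convex_INT convex_linear_vimage c convex_ball bounded_linear.linear[OF bounded_linear_fst])
qed

lemma obox_sub_pbox: "obox p \<rho> \<sigma> \<subseteq> pbox p \<rho> \<sigma>"
  by (auto simp: obox_def pbox_def less_imp_le)

lemma center_obox: "0 < \<rho> \<Longrightarrow> 0 < \<sigma> \<Longrightarrow> p \<in> obox p \<rho> \<sigma>"
  by (simp add: obox_def)

lemma pbox_mono: "\<rho> \<le> \<rho>' \<Longrightarrow> \<sigma> \<le> \<sigma>' \<Longrightarrow> pbox p \<rho> \<sigma> \<subseteq> pbox p \<rho>' \<sigma>'"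
  unfolding pbox_def by (simp add: Collect_mono_iff) (meson order_trans)

lemma power_div_fact_le_exp: "0 \<le> x \<Longrightarrow> x ^ n / fact n \<le> exp (x::real)"
proof -
  assume x: "0 \<le> x"
  have "(\<Sum>i\<in>{n}. x ^ i /\<^sub>R fact i) \<le> (\<Sum>i. x ^ i /\<^sub>R fact i)"
    by (rule sum_le_suminf[OF summable_exp_generic]) (use x in auto)
  then show ?thesis by (simp add: exp_def field_simps)
qed

text \<open>
  Each application of the field costs, by Cauchy's estimate along the field, the fraction \<open>\<epsilon>\<close> of the box
  and gives the factor \<open>c / \<epsilon>\<close>. With \<open>\<epsilon> = 1 / (2m)\<close> and \<open>m\<close> applications half of the box is left, and
  \<open>m\<^sup>m / m! \<le> e\<^sup>m\<close> absorbs the growth of the product.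
\<close>

lemma Lie_pow_bound_steps:
  fixes p :: "'n::finite phase"
  assumes W: "open W" and X: "\<And>a. holo W (X a)" and sub: "pbox p \<rho> \<sigma> \<subseteq> W"
    and pos: "\<rho> > 0" "\<sigma> > 0" "c \<ge> 0" "\<epsilon> > 0"
    and Xb: "\<And>q. q \<in> pbox p \<rho> \<sigma> \<Longrightarrow> norm (\<chi> i. X (Inl i) q) \<le> c * \<rho>"
      "\<And>q i. q \<in> pbox p \<rho> \<sigma> \<Longrightarrow> norm (X (Inr i) q) \<le> c * \<sigma>"
    and G: "holo W G" and M: "\<And>q. q \<in> pbox p \<rho> \<sigma> \<Longrightarrow> norm (G q) \<le> M"
  shows "real j * \<epsilon> \<le> 1 \<Longrightarrow> q \<in> pbox p ((1 - j * \<epsilon>) * \<rho>) ((1 - j * \<epsilon>) * \<sigma>) \<Longrightarrow>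
     norm ((Lie X ^^ j) G q) \<le> M * (c / \<epsilon>) ^ j"
proof (induction j arbitrary: q)
  case 0
  then show ?case using M by simp
next
  case (Suc j)
  let ?l = "1 - real (Suc j) * \<epsilon>" and ?l' = "1 - real j * \<epsilon>"
  let ?v = "of_coords (\<lambda>a. X a q)"
  have l: "?l' = ?l + \<epsilon>" by (simp add: algebra_simps)
  have le: "?l' \<le> 1" "?l \<le> 1" using pos by simp_all
  have j1: "real j * \<epsilon> \<le> 1" using Suc.prems(1) pos by (simp add: algebra_simps)
  have sub1: "pbox p (?l' * \<rho>) (?l' * \<sigma>) \<subseteq> pbox p \<rho> \<sigma>"
    by (rule pbox_mono) (use pos le mult_right_mono[of ?l' 1 \<rho>] mult_right_mono[of ?l' 1 \<sigma>] in simp_all)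
  have q1: "q \<in> pbox p \<rho> \<sigma>"
  proof -
    have "pbox p (?l * \<rho>) (?l * \<sigma>) \<subseteq> pbox p \<rho> \<sigma>"
      by (rule pbox_mono) (use pos in \<open>simp_all add: algebra_simps\<close>)
    then show ?thesis using Suc.prems(2) by blast
  qed
  have qW: "q \<in> W" using q1 sub by blast
  have h: "holo W ((Lie X ^^ j) G)" by (rule holo_Lie_pow[OF W X G])
  have eq: "(Lie X ^^ Suc j) G q = dd ((Lie X ^^ j) G) q ?v"
    by (simp add: Lie_dd[OF h qW])
  have fs: "fst ?v = (\<chi> i. X (Inl i) q)" "snd ?v $ i = X (Inr i) q" for i
    by (simp_all add: of_coords_def)
  show ?case
  proof (cases "c = 0")
    case True
    then have "fst ?v = 0" "\<And>i. snd ?v $ i = 0"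
      using Xb[OF q1] by (simp_all add: fs)
    then have "?v = 0" by (simp add: prod_eq_iff vec_eq_iff)
    then show ?thesis using dd_lin(4)[OF h qW] True eq by simp
  next
    case False
    define R where "R = \<epsilon> / c"
    have R: "R > 0" "R * c = \<epsilon>" using False pos by (simp_all add: R_def)
    have mem: "q + cscale t ?v \<in> pbox p (?l' * \<rho>) (?l' * \<sigma>)" if t: "norm t \<le> R" for t
      unfolding pbox_def
    proof (safe)
      have "norm (fst (q + cscale t ?v) - fst p) \<le> norm (fst q - fst p) + norm (t *s fst ?v)"
        using norm_triangle_ineq[of "fst q - fst p" "t *s fst ?v"] by (simp add: algebra_simps)
      also have "norm (t *s fst ?v) \<le> R * (c * \<rho>)"
        unfolding norm_vec_cmult using Xb(1)[OF q1] t fs R by (intro mult_mono) simp_all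
      also have "norm (fst q - fst p) \<le> ?l * \<rho>" using Suc.prems(2) by (simp add: pbox_def)
      also have "?l * \<rho> + R * (c * \<rho>) = ?l' * \<rho>"
        using R(2) by (simp add: l algebra_simps)
      finally show "norm (fst (q + cscale t ?v) - fst p) \<le> ?l' * \<rho>" by simp
    next
      fix i
      have "norm (snd (q + cscale t ?v) $ i - snd p $ i) \<le> norm (snd q $ i - snd p $ i) + norm (t * X (Inr i) q)"
        using norm_triangle_ineq[of "snd q $ i - snd p $ i" "t * X (Inr i) q"] fs(2) by (simp add: algebra_simps)
      also have "norm (t * X (Inr i) q) \<le> R * (c * \<sigma>)"
        unfolding norm_mult using Xb(2)[OF q1] t R by (intro mult_mono) simp_all
      also have "norm (snd q $ i - snd p $ i) \<le> ?l * \<sigma>" using Suc.prems(2) by (simp add: pbox_def)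
      also have "?l * \<sigma> + R * (c * \<sigma>) = ?l' * \<sigma>"
        using R(2) by (simp add: l algebra_simps)
      finally show "norm (snd (q + cscale t ?v) $ i - snd p $ i) \<le> ?l' * \<sigma>" by simp
    qed
    have "norm (dd ((Lie X ^^ j) G) q ?v) \<le> (M * (c / \<epsilon>) ^ j) / R"
    proof (rule cauchy_bound[OF h R(1)])
      show "q + cscale t ?v \<in> W" if "norm t \<le> R" for t using mem[OF that] sub1 sub by blast
      show "norm ((Lie X ^^ j) G (q + cscale t ?v)) \<le> M * (c / \<epsilon>) ^ j" if "norm t = R" for t
        by (rule Suc.IH[OF j1 mem]) (use that in simp)
    qed
    then show ?thesis unfolding eq by (simp add: R_def mult_ac)
  qed
qed

lemma pow_fact_exp: 
  assumes "0 \<le> c" shows "(real m * c) ^ m / fact m \<le> (exp 1 * c) ^ m"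
proof -
  have "(real m * c) ^ m / fact m = (real m ^ m / fact m) * c ^ m" by (simp add: power_mult_distrib)
  also have "\<dots> \<le> exp (real m) * c ^ m"
    by (intro mult_right_mono power_div_fact_le_exp) (use assms in simp_all)
  also have "\<dots> = (exp 1 * c) ^ m"
    by (simp add: power_mult_distrib flip: exp_of_nat_mult)
  finally show ?thesis .
qed

subsection \<open>The time-one map\<close>

definition lie_series :: "('n + 'n \<Rightarrow> 'n::finite phase \<Rightarrow> complex) \<Rightarrow> ('n phase \<Rightarrow> complex) \<Rightarrow> 'n phase \<Rightarrow> complex" where
  "lie_series X G p = (\<Sum>m. (Lie X ^^ m) G p / fact m)"

definition flow :: "('n + 'n \<Rightarrow> 'n::finite phase \<Rightarrow> complex) \<Rightarrow> 'n phase \<Rightarrow> 'n phase" where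
  "flow X p = of_coords (\<lambda>a. lie_series X (coord a) p)"

text \<open>
  A field that is defined near a box around \<open>p\<close> and whose components are small fractions of the sides
  of the box. The Lie series at the single point \<open>p\<close> are studied; the bounds are stated in each
  direction relative to the corresponding side of the box.
\<close>

locale lie_box =
  fixes X :: "'n + 'n \<Rightarrow> 'n::finite phase \<Rightarrow> complex" and W :: "'n phase set" and p :: "'n phase" and \<rho> \<sigma> c :: real
  assumes W: "open W" and X: "\<And>a. holo W (X a)" and sub: "pbox p \<rho> \<sigma> \<subseteq> W"
    and pos: "\<rho> > 0" "\<sigma> > 0" "c \<ge> 0"
    and Xb: "\<And>q. q \<in> pbox p \<rho> \<sigma> \<Longrightarrow> norm (\<chi> i. X (Inl i) q) \<le> c * \<rho>"
      "\<And>q i. q \<in> pbox p \<rho> \<sigma> \<Longrightarrow> norm (X (Inr i) q) \<le> c * \<sigma>"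
    and small: "2 * exp 1 * c < 1"
begin

lemma Lie_pow_bound:
  assumes G: "holo W G" and M: "\<And>q. q \<in> pbox p \<rho> \<sigma> \<Longrightarrow> norm (G q) \<le> M" and q: "q \<in> pbox p (\<rho>/2) (\<sigma>/2)"
  shows "norm ((Lie X ^^ m) G q / fact m) \<le> M * (2 * exp 1 * c) ^ m"
proof (cases "m = 0")
  case True
  have "pbox p (\<rho>/2) (\<sigma>/2) \<subseteq> pbox p \<rho> \<sigma>" by (rule pbox_mono) (use pos in simp_all)
  then have "norm (G q) \<le> M" by (rule M[OF subsetD]) (rule q)
  with True show ?thesis by simp
next
  case False
  have "0 \<le> norm (G p)" by simp
  also have "\<dots> \<le> M" by (rule M) (use pos in \<open>simp add: pbox_def\<close>)
  finally have M0: "0 \<le> M" .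
  have "norm ((Lie X ^^ m) G q) \<le> M * (c / (1 / (2 * real m))) ^ m"
    using False Lie_pow_bound_steps[OF W X sub pos _ Xb G M, of "1 / (2 * real m)" m q] q by simp
  also have "\<dots> = M * (real m * (2 * c)) ^ m" by (simp add: mult_ac)
  finally have "norm ((Lie X ^^ m) G q) / fact m \<le> M * (real m * (2 * c)) ^ m / fact m"
    by (rule divide_right_mono) simp
  also have "\<dots> = M * ((real m * (2 * c)) ^ m / fact m)" by simp
  also have "\<dots> \<le> M * (exp 1 * (2 * c)) ^ m"
    by (intro mult_left_mono pow_fact_exp M0) (use pos in simp)
  finally show ?thesis by (simp add: norm_divide mult_ac)
qed

lemma bounded_on_box:
  assumes "holo W G" obtains M where "\<And>q. q \<in> pbox p \<rho> \<sigma> \<Longrightarrow> norm (G q) \<le> M"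
proof -
  have "compact (G ` pbox p \<rho> \<sigma>)"
    by (rule compact_continuous_image[OF continuous_on_subset[OF holo_continuous_on[OF assms] sub] compact_pbox])
  then obtain M where "\<forall>z\<in>G ` pbox p \<rho> \<sigma>. norm z \<le> M"
    using compact_imp_bounded bounded_iff by metis
  then show ?thesis using that by blast
qed

lemma summable_bound: "summable (\<lambda>m. M * (2 * exp 1 * c) ^ m)"
  by (intro summable_mult summable_geometric) (use small pos in simp)

lemma center: "p \<in> pbox p (\<rho>/2) (\<sigma>/2)" "p \<in> W"
  using pos sub by (auto simp: pbox_def)

lemma summable_norm_Lie:
  assumes "holo W G"
  shows "summable (\<lambda>m. norm ((Lie X ^^ m) G p / fact m))"
proof -
  obtain M where M: "\<And>q. q \<in> pbox p \<rho> \<sigma> \<Longrightarrow> norm (G q) \<le> M"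
    using bounded_on_box[OF assms] by blast
  show ?thesis
    by (rule summable_comparison_test'[OF summable_bound[of M]])
       (use Lie_pow_bound[OF assms M center(1)] in simp)
qed

lemma lie_series_const: "lie_series X (\<lambda>q. a) p = a"
  unfolding lie_series_def
  by (subst suminf_finite[of "{0}"]) (simp_all add: Lie_pow_const)

lemma lie_series_sum:
  assumes "\<And>i. i \<in> A \<Longrightarrow> holo W (F i)"
  shows "lie_series X (\<lambda>q. \<Sum>i\<in>A. a i * F i q) p = (\<Sum>i\<in>A. a i * lie_series X (F i) p)"
proof -
  have s: "summable (\<lambda>m. a i * ((Lie X ^^ m) (F i) p / fact m))" if "i \<in> A" for i
    by (rule summable_mult[OF summable_norm_cancel[OF summable_norm_Lie[OF assms[OF that]]]])
  have "lie_series X (\<lambda>q. \<Sum>i\<in>A. a i * F i q) p = (\<Sum>m. \<Sum>i\<in>A. a i * ((Lie X ^^ m) (F i) p / fact m))"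
    unfolding lie_series_def by (simp add: Lie_pow_sum[OF W X assms center(2)] sum_divide_distrib)
  also have "\<dots> = (\<Sum>i\<in>A. \<Sum>m. a i * ((Lie X ^^ m) (F i) p / fact m))"
    by (rule suminf_sum[OF s])
  also have "\<dots> = (\<Sum>i\<in>A. a i * lie_series X (F i) p)"
    unfolding lie_series_def
    by (intro sum.cong refl suminf_mult summable_norm_cancel[OF summable_norm_Lie[OF assms]])
  finally show ?thesis .
qed

lemma lie_series_mult:
  assumes "holo W F" "holo W G"
  shows "lie_series X (\<lambda>q. F q * G q) p = lie_series X F p * lie_series X G p"
  unfolding lie_series_def Lie_pow_mult[OF W X assms center(2)]
  by (rule sums_unique[OF Cauchy_product_sums[OF summable_norm_Lie[OF assms(1)] summable_norm_Lie[OF assms(2)]], symmetric])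

lemma lie_series_cong:
  assumes "\<And>q. q \<in> W \<Longrightarrow> F q = G q"
  shows "lie_series X F p = lie_series X G p"
  unfolding lie_series_def by (simp add: Lie_pow_cong[OF W assms center(2)])

text \<open>
  Evaluation of the Lie series at \<open>p\<close> is a character of the algebra of holomorphic functions on a
  convex neighbourhood. By Hadamard's lemma the functions vanishing at a point \<open>w\<close> form the ideal
  generated by the coordinate differences, so a character is determined by its values on coordinates:
  it is evaluation at the image of \<open>p\<close>.
\<close>

lemma lie_series_eq_flow:
  assumes cv: "convex W" and w: "flow X p \<in> W" and G: "holo W G"
  shows "lie_series X G p = G (flow X p)"
proof -
  define w where "w = flow X p"
  have wW: "w \<in> W" using w by (simp add: w_def)
  \<comment> \<open>Hadamard quotients: \<open>G z - G w = \<Sum>\<^sub>a (z\<^sub>a - w\<^sub>a) Q\<^sub>a z\<close>.\<close>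
  define Q where "Q a z = integral (cbox 0 1) (\<lambda>t::real. 1 * pd a G (t *\<^sub>R z + (1 - t) *\<^sub>R w))" for a z
  have mem: "t *\<^sub>R z + (1 - t) *\<^sub>R w \<in> W" if "z \<in> W" "t \<in> cbox 0 1" for z and t :: real
    using convexD_alt[OF cv wW that(1), of t] that(2) by (simp add: add.commute)
  have hQ: "holo W (Q a)" for a
    unfolding Q_def
    by (rule holo_integral(1)[OF W holo_pd[OF W G] W mem]) (auto intro!: continuous_intros)
  have rep: "G z = G w + (\<Sum>a\<in>UNIV. (coord a z - coord a w) * Q a z)" if z: "z \<in> W" for z
  proof -
    let ?g = "\<lambda>t::real. t *\<^sub>R z + (1 - t) *\<^sub>R w"
    have d: "((\<lambda>t. G (?g t)) has_vector_derivative (\<Sum>a\<in>UNIV. (coord a z - coord a w) * pd a G (?g t))) (at t within {0..1})"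
      if t: "t \<in> {0..1}" for t
    proof -
      have "?g t \<in> W" using mem[OF z, of t] t by simp
      note dG = holo_has_dd(1)[OF G this] and ex = dd_expand[OF G this]
      have "(?g has_derivative (\<lambda>h. h *\<^sub>R (z - w))) (at t within {0..1})"
        by (auto intro!: derivative_eq_intros simp: algebra_simps)
      from has_derivative_compose[OF this dG]
      have "((\<lambda>t. G (?g t)) has_derivative (\<lambda>h. dd G (?g t) (h *\<^sub>R (z - w)))) (at t within {0..1})" .
      moreover have "dd G (?g t) (h *\<^sub>R (z - w)) = h *\<^sub>R (\<Sum>a\<in>UNIV. (coord a z - coord a w) * pd a G (?g t))" for h
        using holo_has_dd(2)[OF G \<open>?g t \<in> W\<close>, of "of_real h" "z - w"] ex[of "z - w"]
        by (simp add: scaleR_conv_of_real)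
      ultimately show ?thesis by (simp add: has_vector_derivative_def)
    qed
    have i: "(\<lambda>t. pd a G (?g t)) integrable_on {0..1}" for a
    proof -
      have "continuous_on {0..1} (\<lambda>t. pd a G (?g t))"
        by (intro continuous_on_compose2[OF holo_continuous_on[OF holo_pd[OF W G]]] continuous_intros)
           (use mem[OF z] in \<open>simp add: image_subset_iff\<close>)
      then show ?thesis by (rule integrable_continuous_interval)
    qed
    have "((\<lambda>t. \<Sum>a\<in>UNIV. (coord a z - coord a w) * pd a G (?g t)) has_integral G (?g 1) - G (?g 0)) {0..1}"
      by (rule fundamental_theorem_of_calculus[OF _ d]) simp_all
    then have "G z - G w = integral {0..1} (\<lambda>t. \<Sum>a\<in>UNIV. (coord a z - coord a w) * pd a G (?g t))"
      by (simp add: integral_unique)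
    also have "\<dots> = (\<Sum>a\<in>UNIV. (coord a z - coord a w) * integral {0..1} (\<lambda>t. pd a G (?g t)))"
      by (subst integral_sum) (simp_all add: i integrable_on_mult_right)
    finally show ?thesis by (simp add: Q_def diff_eq_eq add.commute)
  qed
  let ?D = "\<lambda>a z. coord a z - coord a w"
  have hD: "holo W (?D a)" for a by (intro holo_diff(1) holo_coord holo_const)
  have lD: "lie_series X (?D a) p = 0" for a
  proof -
    have "lie_series X (?D a) p = lie_series X (\<lambda>q. \<Sum>i\<in>{True, False}. (if i then 1 else - 1) * (if i then coord a q else coord a w)) p"
      by simp
    also have "\<dots> = (\<Sum>i\<in>{True, False}. (if i then 1 else - 1) * lie_series X (\<lambda>q. if i then coord a q else coord a w) p)"
      by (rule lie_series_sum, rename_tac i, case_tac i) (simp_all add: holo_coord holo_const)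
    also have "\<dots> = lie_series X (coord a) p - coord a w" by (simp add: lie_series_const)
    also have "\<dots> = 0" by (simp add: w_def flow_def)
    finally show ?thesis .
  qed
  \<comment> \<open>The value \<open>G w\<close> and the Hadamard terms as one finite sum, indexed by an option type.\<close>
  let ?T = "\<lambda>a z. case a of None \<Rightarrow> G w | Some b \<Rightarrow> ?D b z * Q b z"
  have "lie_series X G p = lie_series X (\<lambda>z. \<Sum>a\<in>UNIV. 1 * ?T a z) p"
    by (rule lie_series_cong) (simp add: rep UNIV_option_conv sum.reindex)
  also have "\<dots> = (\<Sum>a\<in>UNIV. 1 * lie_series X (?T a) p)"
    by (rule lie_series_sum, rename_tac a, case_tac a) (simp_all add: holo_const holo_mult(1)[OF hD hQ])
  also have "\<dots> = G w"
    by (simp add: UNIV_option_conv sum.reindex lie_series_const lie_series_mult[OF hD hQ] lD)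
  finally show ?thesis by (simp add: w_def)
qed

text \<open>
  On the half box the terms have a common geometric bound, so that the Lie series can be differentiated
  term by term.
\<close>

lemma
  assumes G: "holo W G"
  shows holo_lie_series: "holo (obox p (\<rho>/2) (\<sigma>/2)) (lie_series X G)"
    and pd_lie_series_sums: "(\<lambda>m. pd a ((Lie X ^^ m) G) p / fact m) sums pd a (lie_series X G) p"
    and pd_lie_series_summable: "summable (\<lambda>m. norm (pd a ((Lie X ^^ m) G) p / fact m))"
proof -
  let ?O = "obox p (\<rho>/2) (\<sigma>/2)"
  let ?G = "\<lambda>m q. (Lie X ^^ m) G q / fact m"
  have OW: "?O \<subseteq> W"
  proof -
    have "pbox p (\<rho>/2) (\<sigma>/2) \<subseteq> pbox p \<rho> \<sigma>" by (rule pbox_mono) (use pos in simp_all)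
    then show ?thesis using obox_sub_pbox sub by blast
  qed
  obtain M where M: "\<And>q. q \<in> pbox p \<rho> \<sigma> \<Longrightarrow> norm (G q) \<le> M"
    using bounded_on_box[OF G] by blast
  have hm: "holo W (?G m)" "dd (?G m) p v = dd ((Lie X ^^ m) G) p v / fact m" for m v
    using holo_cmult[OF holo_Lie_pow[OF W X G], where c="1 / fact m"] center(2) by simp_all
  have h: "holo ?O (?G m)" for m
    by (rule holo_subset[OF hm(1) OW])
  have B: "norm (?G m q) \<le> M * (2 * exp 1 * c) ^ m" if "q \<in> ?O" for m q
    by (rule Lie_pow_bound[OF G M]) (use that obox_sub_pbox in blast)+
  have pO: "p \<in> ?O" by (rule center_obox) (use pos in simp_all)
  have eq: "lie_series X G = (\<lambda>q. \<Sum>m. ?G m q)" by (simp add: lie_series_def fun_eq_iff)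
  show "holo ?O (lie_series X G)"
    unfolding eq by (rule holo_series[OF open_obox h B summable_bound])
  show "(\<lambda>m. pd a ((Lie X ^^ m) G) p / fact m) sums pd a (lie_series X G) p"
    using dd_series[OF open_obox h B summable_bound pO, of "coord_vec a"] unfolding eq pd_def hm(2) .
  show "summable (\<lambda>m. norm (pd a ((Lie X ^^ m) G) p / fact m))"
    using summable_norm_dd[OF open_obox h B summable_bound pO, of "coord_vec a"] unfolding pd_def hm(2) .
qed

end

section \<open>Poisson brackets\<close>

text \<open>
  Conjugate coordinates: \<open>conj_index\<close> exchanges the action and the angle of a pair, and \<open>conj_sign\<close> is
  the sign that makes \<open>\<Sum>\<^sub>a conj_sign a \<partial>\<^sub>a F \<partial>\<^bsub>conj_index a\<^esub> G\<close> the canonical bracket.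
\<close>

definition conj_sign :: "'n + 'n \<Rightarrow> complex" where "conj_sign a = (case a of Inl _ \<Rightarrow> 1 | Inr _ \<Rightarrow> - 1)"

definition conj_index :: "'n + 'n \<Rightarrow> 'n + 'n" where "conj_index a = (case a of Inl i \<Rightarrow> Inr i | Inr i \<Rightarrow> Inl i)"

text \<open>
  The Hamiltonian field of \<open>\<phi>\<close> has action components \<open>\<partial>\<phi> / \<partial>x\<close> and angle components \<open>- \<partial>\<phi> / \<partial>y\<close>. With this
  sign its Lie derivative maps a function \<open>h\<close> of the actions to \<open>h' \<cdot> \<partial>\<phi> / \<partial>x\<close>.
\<close>

definition ham :: "('n::finite phase \<Rightarrow> complex) \<Rightarrow> 'n + 'n \<Rightarrow> 'n phase \<Rightarrow> complex" where
  "ham \<phi> a p = conj_sign a * pd (conj_index a) \<phi> p"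

definition pbracket :: "('n::finite phase \<Rightarrow> complex) \<Rightarrow> ('n phase \<Rightarrow> complex) \<Rightarrow> 'n phase \<Rightarrow> complex" where
  "pbracket F G p = (\<Sum>a\<in>UNIV. conj_sign a * (pd a F p * pd (conj_index a) G p))"

lemma conj_index_conj_index [simp]: "conj_index (conj_index a) = a" and conj_sign_conj_index [simp]: "conj_sign (conj_index a) = - conj_sign a"
  and conj_sign_conj_sign [simp]: "conj_sign a * conj_sign a = 1"
  by (simp_all add: conj_index_def conj_sign_def split: sum.split)

lemma bij_conj_index: "bij conj_index"
  by (rule bij_betw_byWitness[where f'=conj_index]) auto

lemma sum_conj_index: "(\<Sum>a\<in>UNIV. f (conj_index a)) = (\<Sum>a\<in>(UNIV :: ('n::finite + 'n) set). (f a :: complex))"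
  using sum.reindex_bij_betw[OF bij_conj_index] by auto

lemma Lie_ham: "Lie (ham \<phi>) F p = pbracket F \<phi> p"
  by (simp add: Lie_def ham_def pbracket_def mult_ac)

lemma holo_pbracket: "open W \<Longrightarrow> holo W F \<Longrightarrow> holo W G \<Longrightarrow> holo W (pbracket F G)"
  unfolding pbracket_def by (intro holo_sum(1) holo_cmult(1) holo_mult(1) holo_pd)

lemma pd_pbracket:
  assumes W: "open W" "holo W F" "holo W G" "p \<in> W"
  shows "pd b (pbracket F G) p = (\<Sum>a\<in>UNIV. conj_sign a * (pd b (pd a F) p * pd (conj_index a) G p + pd a F p * pd b (pd (conj_index a) G) p))"
proof -
  let ?t = "\<lambda>a p. conj_sign a * (pd a F p * pd (conj_index a) G p)"
  have h: "holo W (\<lambda>p. pd a F p * pd (conj_index a) G p)" for a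
    by (intro holo_mult(1) holo_pd W)
  have t: "holo W (?t a)" for a by (rule holo_cmult(1)[OF h])
  have "pd b (pbracket F G) p = dd (\<lambda>p. \<Sum>a\<in>UNIV. ?t a p) p (coord_vec b)"
    unfolding pd_def[of b] pbracket_def ..
  also have "\<dots> = (\<Sum>a\<in>UNIV. dd (?t a) p (coord_vec b))"
    by (rule holo_sum(2)[of UNIV W ?t, OF t W(4)])
  also have "\<dots> = (\<Sum>a\<in>UNIV. conj_sign a * (pd b (pd a F) p * pd (conj_index a) G p + pd a F p * pd b (pd (conj_index a) G) p))"
    using W(4) by (simp add: holo_cmult(2)[OF h] holo_mult(2)[OF holo_pd[OF W(1,2)] holo_pd[OF W(1,3)]] pd_def[of b] add.commute)
  finally show ?thesis .
qed

text \<open>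
  Both sides are expanded in second derivatives. Those of \<open>F\<close> and of \<open>G\<close> match term by term, while the
  two sums with second derivatives of \<open>\<phi>\<close> cancel after exchanging conjugate indices.
\<close>

lemma Jacobi:
  assumes W: "open W" "holo W \<phi>" "holo W F" "holo W G" "p \<in> W"
  shows "Lie (ham \<phi>) (pbracket F G) p = pbracket (Lie (ham \<phi>) F) G p + pbracket F (Lie (ham \<phi>) G) p"
proof -
  have L: "Lie (ham \<phi>) F = pbracket F \<phi>" for F by (rule ext) (rule Lie_ham)
  define P where "P a b = pd a (pd b \<phi>) p" for a b
  define S where "S a b = pd a (pd b F) p" for a b
  define T where "T a b = pd a (pd b G) p" for a b
  have sy: "P a b = P b a" "S a b = S b a" "T a b = T b a" for a b
    unfolding P_def S_def T_def by (rule pd_commute[OF W(1)]; use W in simp)+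
  define f g h where "f a = pd a F p" and "g a = pd a G p" and "h a = pd a \<phi> p" for a
  have 1: "Lie (ham \<phi>) (pbracket F G) p = (\<Sum>b\<in>UNIV. \<Sum>a\<in>UNIV. conj_sign b * conj_sign a * (S b a * g (conj_index a) * h (conj_index b) + f a * T b (conj_index a) * h (conj_index b)))"
    unfolding L pbracket_def[of "pbracket F G"] pd_pbracket[OF W(1,3,4,5)] S_def T_def f_def g_def h_def
    by (simp add: sum_distrib_left sum_distrib_right algebra_simps)
  have 2: "pbracket (Lie (ham \<phi>) F) G p = (\<Sum>a\<in>UNIV. \<Sum>b\<in>UNIV. conj_sign b * conj_sign a * (S a b * h (conj_index b) * g (conj_index a) + f b * P a (conj_index b) * g (conj_index a)))"
    unfolding L pbracket_def[of "pbracket F \<phi>"] pd_pbracket[OF W(1,3,2,5)] S_def T_def f_def g_def h_def P_def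
    by (simp add: sum_distrib_left sum_distrib_right algebra_simps)
  have 3: "pbracket F (Lie (ham \<phi>) G) p = (\<Sum>a\<in>UNIV. \<Sum>b\<in>UNIV. conj_sign b * conj_sign a * (f a * T (conj_index a) b * h (conj_index b) + f a * g b * P (conj_index a) (conj_index b)))"
    unfolding L pbracket_def[of F "pbracket G \<phi>"] pd_pbracket[OF W(1,4,2,5)] S_def T_def f_def g_def h_def P_def
    by (simp add: sum_distrib_left sum_distrib_right algebra_simps)
  have 4: "(\<Sum>a\<in>UNIV. \<Sum>b\<in>UNIV. conj_sign b * conj_sign a * (f b * P a (conj_index b) * g (conj_index a)))
      = - (\<Sum>a\<in>UNIV. \<Sum>b\<in>UNIV. conj_sign b * conj_sign a * (f a * g b * P (conj_index a) (conj_index b)))"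
  proof -
    have "(\<Sum>a\<in>UNIV. \<Sum>b\<in>UNIV. conj_sign b * conj_sign a * (f b * P a (conj_index b) * g (conj_index a)))
        = (\<Sum>b\<in>UNIV. \<Sum>a\<in>UNIV. conj_sign b * conj_sign a * (f b * P a (conj_index b) * g (conj_index a)))"
      by (rule sum.swap)
    also have "\<dots> = (\<Sum>b\<in>UNIV. \<Sum>a\<in>UNIV. conj_sign b * conj_sign (conj_index a) * (f b * P (conj_index a) (conj_index b) * g (conj_index (conj_index a))))"
      by (rule sum.cong[OF refl], subst sum_conj_index[symmetric], rule refl)
    also have "\<dots> = - (\<Sum>b\<in>UNIV. \<Sum>a\<in>UNIV. conj_sign a * conj_sign b * (f b * g a * P (conj_index b) (conj_index a)))"
      unfolding sum_negf[symmetric] by (intro sum.cong refl) (simp add: sy(1) mult_ac)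
    finally show ?thesis .
  qed
  show ?thesis
    unfolding 1 2 3 using 4 sum.swap[of "\<lambda>b a. conj_sign b * conj_sign a * (S b a * g (conj_index a) * h (conj_index b) + f a * T b (conj_index a) * h (conj_index b))" UNIV UNIV]
    by (simp add: sum.distrib algebra_simps sy)
qed

context lie_box
begin

text \<open>
  By the Jacobi identity a Hamiltonian field acts as a derivation of the Poisson bracket, so that its
  Lie series is a homomorphism of brackets by the same Cauchy product argument as for products.
\<close>

lemma pbracket_lie_series:
  assumes Xh: "X = ham \<phi>" and h: "holo W \<phi>" "holo W F" "holo W G"
  shows "pbracket (lie_series X F) (lie_series X G) p = lie_series X (pbracket F G) p"
proof -
  let ?f = "\<lambda>a m. pd a ((Lie X ^^ m) F) p / fact m" and ?g = "\<lambda>a m. pd a ((Lie X ^^ m) G) p / fact m"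
  have c: "(\<lambda>m. \<Sum>j\<le>m. ?f a j * ?g (conj_index a) (m - j)) sums (pd a (lie_series X F) p * pd (conj_index a) (lie_series X G) p)" for a
    using Cauchy_product_sums[OF pd_lie_series_summable[OF h(2), of a] pd_lie_series_summable[OF h(3), of "conj_index a"]]
    unfolding sums_unique[OF pd_lie_series_sums[OF h(2), of a], symmetric] sums_unique[OF pd_lie_series_sums[OF h(3), of "conj_index a"], symmetric] .
  have s: "(\<lambda>m. \<Sum>a\<in>UNIV. conj_sign a * (\<Sum>j\<le>m. ?f a j * ?g (conj_index a) (m - j))) sums pbracket (lie_series X F) (lie_series X G) p"
    unfolding pbracket_def by (intro sums_sum sums_mult c)
  have e: "(\<Sum>a\<in>UNIV. conj_sign a * (\<Sum>j\<le>m. ?f a j * ?g (conj_index a) (m - j))) = (Lie X ^^ m) (pbracket F G) p / fact m" for m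
  proof -
    have "(Lie X ^^ m) (pbracket F G) p = (\<Sum>j\<le>m. of_nat (m choose j) * pbracket ((Lie X ^^ j) F) ((Lie X ^^ (m - j)) G) p)"
    proof (rule Lie_pow_bilinear[where B=pbracket, OF W X _ _ h(2,3) center(2)])
      show "holo W (pbracket F G)" if "holo W F" "holo W G" for F G
        by (rule holo_pbracket[OF W that])
      show "Lie X (pbracket F G) q = pbracket (Lie X F) G q + pbracket F (Lie X G) q" if "holo W F" "holo W G" "q \<in> W" for F G q
        unfolding Xh by (rule Jacobi[OF W h(1) that])
    qed
    then have "(Lie X ^^ m) (pbracket F G) p / fact m =
       (\<Sum>j\<le>m. of_nat (m choose j) / fact m * pbracket ((Lie X ^^ j) F) ((Lie X ^^ (m - j)) G) p)"
      by (simp add: sum_divide_distrib)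
    also have "\<dots> = (\<Sum>j\<le>m. \<Sum>a\<in>UNIV. conj_sign a * (?f a j * ?g (conj_index a) (m - j)))"
      by (intro sum.cong refl) (simp add: binomial_scale pbracket_def sum_distrib_left mult_ac)
    also have "\<dots> = (\<Sum>a\<in>UNIV. \<Sum>j\<le>m. conj_sign a * (?f a j * ?g (conj_index a) (m - j)))"
      by (rule sum.swap)
    finally show ?thesis by (simp add: sum_distrib_left)
  qed
  show ?thesis
    using sums_unique[OF s] unfolding e lie_series_def by simp
qed

lemma symp_form_coord: "symp_form u v = (\<Sum>a\<in>UNIV. conj_sign a * (coord a u * coord (conj_index a) v))"
  unfolding sum_UNIV_Plus
  by (simp add: symp_form_def conj_sign_def conj_index_def coord_def sum_subtractf sum_negf mult_ac)

text \<open>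
  For the coordinate functions \<open>pbracket_lie_series\<close> says \<open>A J A\<^sup>T = J\<close> for the Jacobian matrix \<open>A\<close>. As
  \<open>J\<^sup>2 = - 1\<close>, the matrix \<open>- J A\<^sup>T J\<close> is a right inverse of \<open>A\<close> and therefore a left inverse, which is
  \<open>A\<^sup>T J A = J\<close>, the invariance of the symplectic form.
\<close>

lemma flow_symplectic:
  assumes Xh: "X = ham \<phi>" and h: "holo W \<phi>"
  defines "L \<equiv> \<lambda>v. of_coords (\<lambda>b. dd (lie_series X (coord b)) p v)"
  shows "(flow X has_derivative L) (at p)" "symp_form (L u) (L v) = symp_form u v"
proof -
  let ?O = "obox p (\<rho>/2) (\<sigma>/2)"
  have pO: "p \<in> ?O" by (rule center_obox) (use pos in simp_all)
  note hl = holo_lie_series[OF holo_coord]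
  have d: "(lie_series X (coord b) has_derivative dd (lie_series X (coord b)) p) (at p)" for b
    by (rule holo_has_dd(1)[OF hl pO])
  have v: "((\<lambda>q. \<chi> i. f i q) has_derivative (\<lambda>v. \<chi> i. f' i v)) (at p)"
    if "\<And>i. (f i has_derivative f' i) (at p)" for f :: "'n \<Rightarrow> 'n phase \<Rightarrow> complex" and f'
    by (subst has_derivative_componentwise_within) 
       (use that in \<open>auto simp: Basis_vec_def inner_axis intro!: derivative_eq_intros\<close>)
  show "(flow X has_derivative L) (at p)"
    unfolding flow_def[abs_def] L_def of_coords_def
    by (intro has_derivative_Pair v d)
  define A :: "complex^('n+'n)^('n+'n)" where "A = (\<chi> b a. pd a (lie_series X (coord b)) p)"
  define J :: "complex^('n+'n)^('n+'n)" where "J = (\<chi> a b. if b = conj_index a then conj_sign a else 0)"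
  have J: "(J *v x) $ a = conj_sign a * x $ conj_index a" for x a
    by (simp add: J_def matrix_vector_mult_def if_distrib if_distribR cong: if_cong)
  have Jl: "(J ** B) $ a $ b = conj_sign a * B $ conj_index a $ b" for B a b
    by (simp add: J_def matrix_matrix_mult_def if_distrib if_distribR cong: if_cong)
  have JJ: "J ** J = - mat 1"
    unfolding vec_eq_iff Jl by (auto simp: J_def mat_def)
  have AJA: "A ** (J ** transpose A) = J"
  proof -
    have "(A ** (J ** transpose A)) $ b $ d = J $ b $ d" for b d
    proof -
      have "(A ** (J ** transpose A)) $ b $ d = pbracket (lie_series X (coord b)) (lie_series X (coord d)) p"
        unfolding matrix_matrix_mult_def[of A] by (simp add: Jl) (simp add: pbracket_def A_def transpose_def mult_ac)
      also have "\<dots> = lie_series X (pbracket (coord b) (coord d)) p"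
        by (rule pbracket_lie_series[OF Xh h holo_coord holo_coord])
      also have "pbracket (coord b) (coord d) = (\<lambda>q. if d = conj_index b then conj_sign b else 0)"
      proof (rule ext)
        fix q
        have "pbracket (coord b) (coord d) q = (\<Sum>a\<in>UNIV. if a = b then conj_sign b * (if d = conj_index b then 1 else 0) else 0)"
          unfolding pbracket_def pd_coord by (rule sum.cong) simp_all
        then show "pbracket (coord b) (coord d) q = (if d = conj_index b then conj_sign b else 0)" by simp
      qed
      finally show ?thesis by (simp add: lie_series_const J_def)
    qed
    then show ?thesis by (simp add: vec_eq_iff)
  qed
  have neg: "B ** (- C) = - (B ** C)" "(- B) ** C = - (B ** C)" for B C :: "complex^('n+'n)^('n+'n)"
    by (simp_all add: matrix_matrix_mult_def vec_eq_iff sum_negf)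
  have "A ** (- (J ** (transpose A ** J))) = - ((A ** (J ** transpose A)) ** J)"
    by (simp add: neg matrix_mul_assoc)
  also have "\<dots> = mat 1" by (simp add: AJA JJ)
  finally have "- (J ** (transpose A ** J)) ** A = mat 1"
    by (simp add: matrix_left_right_inverse)
  then have "J ** (- (J ** (transpose A ** J)) ** A) = J" by simp
  moreover have "J ** (- (J ** (transpose A ** J)) ** A) = - ((J ** J) ** (transpose A ** (J ** A)))"
    by (simp add: neg matrix_mul_assoc)
  ultimately have AtJA: "transpose A ** (J ** A) = J"
    by (simp add: JJ neg)
  have Lc: "coord b (L u) = (A *v (\<chi> a. coord a u)) $ b" for b u
    by (simp add: L_def A_def matrix_vector_mult_def dd_expand[OF hl pO] mult.commute)
  have sf: "symp_form u v = (\<Sum>a\<in>UNIV. x $ a * (J *v y) $ a)"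
    if "\<And>a. coord a u = x $ a" "\<And>a. coord a v = y $ a" for u v :: "'n phase" and x y
    by (simp add: symp_form_coord that J mult_ac)
  let ?x = "\<chi> a. coord a u" and ?y = "\<chi> a. coord a v"
  have "symp_form (L u) (L v) = (\<Sum>a\<in>UNIV. (A *v ?x) $ a * (J *v (A *v ?y)) $ a)"
    by (rule sf) (rule Lc)+
  also have "\<dots> = (\<Sum>a\<in>UNIV. \<Sum>b\<in>UNIV. A $ a $ b * ?x $ b * ((J ** A) *v ?y) $ a)"
    by (simp add: matrix_vector_mult_def[of A ?x] sum_distrib_right matrix_vector_mul_assoc)
  also have "\<dots> = (\<Sum>b\<in>UNIV. \<Sum>a\<in>UNIV. A $ a $ b * ?x $ b * ((J ** A) *v ?y) $ a)"
    by (rule sum.swap)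
  also have "\<dots> = (\<Sum>b\<in>UNIV. ?x $ b * (transpose A *v ((J ** A) *v ?y)) $ b)"
    unfolding matrix_vector_mult_def[of "transpose A"] by (simp add: transpose_def sum_distrib_left mult_ac)
  also have "transpose A *v ((J ** A) *v ?y) = J *v ?y"
    by (simp add: matrix_vector_mul_assoc AtJA)
  also have "(\<Sum>b\<in>UNIV. ?x $ b * (J *v ?y) $ b) = symp_form u v"
    by (rule sf[symmetric]) simp_all
  finally show "symp_form (L u) (L v) = symp_form u v" .
qed

end

section \<open>Fourier coefficients\<close>

abbreviation cube :: "(real^'n) set" where "cube \<equiv> cbox 0 (\<chi> i. 2 * pi)"

abbreviation l1 :: "int^'n \<Rightarrow> real" where "l1 k \<equiv> real_of_int (int_l1norm k)"

definition kvec :: "int^'n \<Rightarrow> complex^'n" where "kvec k = (\<chi> i. of_int (k $ i))"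

definition unit_vec :: "'n \<Rightarrow> complex^'n" where "unit_vec i = axis i 1"

definition cis_k :: "int^'n \<Rightarrow> complex^'n \<Rightarrow> complex" where "cis_k k x = exp (\<i> * kdot k x)"

lemma kdot_simps: "kdot (k + l) x = kdot k x + kdot l x" "kdot (k - l) x = kdot k x - kdot l x"
    "kdot 0 x = 0" "kdot (- k) x = - kdot k x" "kdot k 0 = 0"
    "kdot k (x + z) = kdot k x + kdot k z" "kdot k (c *s x) = c * kdot k x" "kdot k (unit_vec i) = of_int (k $ i)"
  by (simp_all add: kdot_def unit_vec_def axis_def algebra_simps sum.distrib sum_subtractf sum_negf sum_distrib_left
       if_distrib cong: if_cong)

lemma cis_k_simps: "cis_k (k + l) x = cis_k k x * cis_k l x" "cis_k (k - l) x = cis_k k x * cis_k (- l) x"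
    "cis_k 0 x = 1" "cis_k k (x + z) = cis_k k x * cis_k k z" "cis_k (- k) x = exp (- (\<i> * kdot k x))"
    "cis_k (- k) x * cis_k k x = 1"
  by (simp_all add: cis_k_def kdot_simps algebra_simps exp_add exp_diff exp_minus divide_inverse)

lemma cis_k_period [simp]: "cis_k k (x + period m) = cis_k k x"
proof -
  have "\<i> * kdot k (period m) = 2 * of_int (\<Sum>i\<in>UNIV. k $ i * m $ i) * of_real pi * \<i>"
    by (simp add: kdot_def period_def sum_distrib_left sum_distrib_right mult_ac)
  then have "cis_k k (period m) = exp (2 * of_int (\<Sum>i\<in>UNIV. k $ i * m $ i) * of_real pi * \<i>)"
    by (simp add: cis_k_def mult_ac)
  also have "\<dots> = 1" 
    unfolding exp_eq_1 by (intro conjI exI[of _ "\<Sum>i\<in>UNIV. k $ i * m $ i"]) simp_all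
  finally show ?thesis by (simp add: cis_k_simps)
qed

lemma int_l1norm_nonneg: "0 \<le> int_l1norm k" and int_l1norm_minus [simp]: "int_l1norm (- k) = int_l1norm k"
  and int_l1norm_triangle: "int_l1norm (k + l) \<le> int_l1norm k + int_l1norm l"
  unfolding int_l1norm_def sum.distrib[symmetric] by (auto intro!: sum_nonneg sum_mono)

lemma norm_kvec: "norm (kvec k) \<le> l1 k"
  using norm_le_sum_cmod[of "kvec k"] by (simp add: kvec_def int_l1norm_def)

lemma norm_cis_k_real: "norm (cis_k k (cvec x)) = 1"
proof -
  have "kdot k (cvec x) = of_real (\<Sum>i\<in>UNIV. of_int (k $ i) * x $ i)"
    by (simp add: kdot_def cvec_def)
  then have "\<i> * kdot k (cvec x) = \<i> * of_real (\<Sum>i\<in>UNIV. of_int (k $ i) * x $ i)" by simp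
  then show ?thesis unfolding cis_k_def using norm_exp_i_times by metis
qed

lemma norm_cis_k: "norm (cis_k k x) \<le> exp (l1 k * s)" if "\<And>i. \<bar>Im (x $ i)\<bar> \<le> s"
proof -
  have "Re (\<i> * kdot k x) = - (\<Sum>i\<in>UNIV. of_int (k $ i) * Im (x $ i))"
    by (simp add: kdot_def)
  also have "\<dots> \<le> (\<Sum>i\<in>UNIV. \<bar>of_int (k $ i)\<bar> * s)"
    unfolding sum_negf[symmetric]
  proof (rule sum_mono)
    fix i
    have "- (of_int (k $ i) * Im (x $ i)) \<le> \<bar>of_int (k $ i)\<bar> * \<bar>Im (x $ i)\<bar>"
      by (metis abs_ge_minus_self abs_mult)
    also have "\<dots> \<le> \<bar>of_int (k $ i)\<bar> * s" by (intro mult_left_mono that) simp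
    finally show "- (of_int (k $ i) * Im (x $ i)) \<le> \<bar>of_int (k $ i)\<bar> * s" .
  qed
  also have "\<dots> = l1 k * s" by (simp add: int_l1norm_def sum_distrib_right)
  finally show ?thesis by (simp add: cis_k_def norm_exp_eq_Re)
qed

subsection \<open>Complex domains\<close>

lemma open_cnbhd: "open (cnbhd D r)"
proof -
  have "cnbhd D r = (\<Union>y\<in>D. ball (cvec y) r)"
    by (auto simp: cnbhd_def dist_norm norm_minus_commute)
  then show ?thesis by auto
qed

lemma open_strip: "open (strip s)"
proof -
  have "strip s = (\<Inter>j. {x. \<bar>Im (x $ j)\<bar> < s})" by (auto simp: strip_def)
  also have "open \<dots>" by (intro open_INT ballI open_Collect_less continuous_intros) auto
  finally show ?thesis .
qed

lemma open_phase_dom [simp]: "open (phase_dom D r s)"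
  unfolding phase_dom_def by (intro open_Times open_cnbhd open_strip)

lemma mem_phase_dom: "(y, x) \<in> phase_dom D r s \<longleftrightarrow> y \<in> cnbhd D r \<and> x \<in> strip s"
    "p \<in> phase_dom D r s \<longleftrightarrow> fst p \<in> cnbhd D r \<and> snd p \<in> strip s"
  by (auto simp: phase_dom_def mem_Times_iff)

lemma cvec_strip: "0 < s \<Longrightarrow> cvec x \<in> strip s"
  by (simp add: strip_def cvec_def)

lemma strip_add_real: "x \<in> strip s \<Longrightarrow> x + cvec a \<in> strip s"
  by (simp add: strip_def cvec_def)

lemma period_cvec: "period m = cvec (\<chi> i. 2 * pi * of_int (m $ i))"
  by (simp add: period_def cvec_def)

lemma strip_period [simp]: "x + period m \<in> strip s \<longleftrightarrow> x \<in> strip s"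
  by (simp add: strip_def period_def)

lemma cnbhd_mono: "r' \<le> r \<Longrightarrow> cnbhd D r' \<subseteq> cnbhd D r"
  by (force simp: cnbhd_def)

lemma strip_mono: "s' \<le> s \<Longrightarrow> strip s' \<subseteq> strip s"
  unfolding strip_def by (auto intro: order_less_le_trans)

lemma phase_dom_mono: "r' \<le> r \<Longrightarrow> s' \<le> s \<Longrightarrow> phase_dom D r' s' \<subseteq> phase_dom D r s"
  unfolding phase_dom_def using cnbhd_mono strip_mono by blast

lemma cnbhd_add: "y \<in> cnbhd D (r - \<rho>) \<Longrightarrow> norm v \<le> \<rho> \<Longrightarrow> y + v \<in> cnbhd D r"
proof -
  assume "y \<in> cnbhd D (r - \<rho>)" and v: "norm v \<le> \<rho>"
  then obtain y0 where "y0 \<in> D" "norm (y - cvec y0) < r - \<rho>" by (auto simp: cnbhd_def)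
  moreover have "norm (y + v - cvec y0) \<le> norm (y - cvec y0) + norm v"
    using norm_triangle_ineq[of "y - cvec y0" v] by (simp add: algebra_simps)
  ultimately show ?thesis using v by (force simp: cnbhd_def)
qed

lemma strip_add: "x \<in> strip (s - \<sigma>) \<Longrightarrow> (\<And>i. norm (v $ i) \<le> \<sigma>) \<Longrightarrow> x + v \<in> strip s"
proof -
  assume x: "x \<in> strip (s - \<sigma>)" and v: "\<And>i. norm (v $ i) \<le> \<sigma>"
  have "\<bar>Im ((x + v) $ i)\<bar> < s" for i
  proof -
    have "\<bar>Im ((x + v) $ i)\<bar> \<le> \<bar>Im (x $ i)\<bar> + norm (v $ i)"
      using abs_Im_le_cmod[of "v $ i"] by simp
    moreover have "\<bar>Im (x $ i)\<bar> < s - \<sigma>" using x by (simp add: strip_def)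
    ultimately show ?thesis using v[of i] by linarith
  qed
  then show ?thesis by (simp add: strip_def)
qed

subsection \<open>Periodic holomorphic functions\<close>

text \<open>
  Regularity, reality and size are kept apart: holomorphy with periodicity, real values at real points,
  and a bound of the weighted Fourier norm. The bound is expressed by finite partial sums, so
  that it is meaningful without summability (\<open>fnorm_le_iff\<close>).
\<close>

definition holo_torus :: "(real^'n) set \<Rightarrow> real \<Rightarrow> real \<Rightarrow> ('n::finite phase \<Rightarrow> complex) \<Rightarrow> bool" where
  "holo_torus D r s F \<longleftrightarrow> holo (phase_dom D r s) F \<and>
     (\<forall>y x m. (y, x) \<in> phase_dom D r s \<longrightarrow> F (y, x + period m) = F (y, x))"

definition real_torus :: "(real^'n) set \<Rightarrow> real \<Rightarrow> real \<Rightarrow> ('n::finite phase \<Rightarrow> complex) \<Rightarrow> bool" where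
  "real_torus D r s F \<longleftrightarrow> (\<forall>y x. (y, x) \<in> phase_dom D r s \<and> real_vec y \<and> real_vec x \<longrightarrow> F (y, x) \<in> \<real>)"

definition fnorm_le :: "(real^'n) set \<Rightarrow> real \<Rightarrow> real \<Rightarrow> ('n::finite phase \<Rightarrow> complex) \<Rightarrow> real \<Rightarrow> bool" where
  "fnorm_le D r s F M \<longleftrightarrow> (\<forall>y\<in>cnbhd D r. \<forall>T. finite T \<longrightarrow> (\<Sum>k\<in>T. norm (fcoeff F k y) * exp (l1 k * s)) \<le> M)"

lemma real_analytic_torus_iff: "real_analytic_torus D r s F \<longleftrightarrow> holo_torus D r s F \<and> real_torus D r s F"
proof -
  have "(\<forall>c v. L (cscale c v) = c * L v) \<longleftrightarrow> (\<forall>c u v. L (c *s u, c *s v) = c * L (u, v))" for L :: "'a phase \<Rightarrow> complex"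
    by (simp add: cscale_def split_paired_All)
  then show ?thesis
    unfolding real_analytic_torus_def holo_torus_def real_torus_def holo_def by (simp only:) blast
qed

lemma holo_torus_mono: "holo_torus D r s F \<Longrightarrow> r' \<le> r \<Longrightarrow> s' \<le> s \<Longrightarrow> holo_torus D r' s' F"
  unfolding holo_torus_def by (auto intro: holo_subset[OF _ phase_dom_mono] dest: subsetD[OF phase_dom_mono])

lemma real_torus_mono: "real_torus D r s F \<Longrightarrow> r' \<le> r \<Longrightarrow> s' \<le> s \<Longrightarrow> real_torus D r' s' F"
  unfolding real_torus_def by (auto dest: subsetD[OF phase_dom_mono])

lemma fnorm_le_mono:
  assumes "fnorm_le D r s F M" "r' \<le> r" "s' \<le> s" "M \<le> M'"
  shows "fnorm_le D r' s' F M'"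
  unfolding fnorm_le_def
proof (intro ballI allI impI)
  fix y T assume y: "y \<in> cnbhd D r'" and T: "finite (T :: (int^'a) set)"
  have "(\<Sum>k\<in>T. norm (fcoeff F k y) * exp (l1 k * s')) \<le> (\<Sum>k\<in>T. norm (fcoeff F k y) * exp (l1 k * s))"
    using assms(3) int_l1norm_nonneg by (intro sum_mono mult_left_mono) (auto intro!: mult_left_mono)
  also have "\<dots> \<le> M" using assms(1) cnbhd_mono[OF assms(2)] y T by (auto simp: fnorm_le_def)
  finally show "(\<Sum>k\<in>T. norm (fcoeff F k y) * exp (l1 k * s')) \<le> M'" using assms(4) by simp
qed

lemma holo_torus_holo: "holo_torus D r s F \<Longrightarrow> holo (phase_dom D r s) F" by (simp add: holo_torus_def)

lemma holo_torus_const: "holo_torus D r s (\<lambda>p. c)" by (simp add: holo_torus_def holo_const)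

lemma holo_torus_add: "holo_torus D r s F \<Longrightarrow> holo_torus D r s G \<Longrightarrow> holo_torus D r s (\<lambda>p. F p + G p)"
  by (simp add: holo_torus_def holo_add)

lemma holo_torus_mult: "holo_torus D r s F \<Longrightarrow> holo_torus D r s G \<Longrightarrow> holo_torus D r s (\<lambda>p. F p * G p)"
  by (simp add: holo_torus_def holo_mult)

lemma holo_torus_cmult: "holo_torus D r s F \<Longrightarrow> holo_torus D r s (\<lambda>p. c * F p)"
  by (simp add: holo_torus_def holo_cmult)

lemma holo_torus_diff: "holo_torus D r s F \<Longrightarrow> holo_torus D r s G \<Longrightarrow> holo_torus D r s (\<lambda>p. F p - G p)"
  by (simp add: holo_torus_def holo_diff)

lemma holo_torus_sum: "(\<And>i. i \<in> A \<Longrightarrow> holo_torus D r s (F i)) \<Longrightarrow> holo_torus D r s (\<lambda>p. \<Sum>i\<in>A. F i p)"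
  by (simp add: holo_torus_def holo_sum)

lemma holo_torus_dd:
  assumes "holo_torus D r s F"
  shows "holo_torus D r s (\<lambda>p. dd F p v)"
  unfolding holo_torus_def
proof (intro conjI allI impI)
  show "holo (phase_dom D r s) (\<lambda>p. dd F p v)" by (rule holo_dd[OF open_phase_dom holo_torus_holo[OF assms]])
  fix y x and m :: "int^'a" assume p: "(y, x) \<in> phase_dom D r s"
  have "dd F (1 *\<^sub>R (y, x) + (0, period m)) (1 *\<^sub>R v) = dd (\<lambda>q. F (1 *\<^sub>R q + (0, period m))) (y, x) v"
  proof (rule holo_compose_linear(2)[OF holo_torus_holo[OF assms] bounded_linear_scaleR_right _ _ p, symmetric])
    show "1 *\<^sub>R cscale c v = cscale c (1 *\<^sub>R v)" for c and v :: "'a phase" by simp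
    show "1 *\<^sub>R p + (0, period m) \<in> phase_dom D r s" if "p \<in> phase_dom D r s" for p
      using that by (simp add: mem_phase_dom(2))
  qed
  also have "\<dots> = dd F (y, x) v"
  proof (rule dd_cong[OF open_phase_dom _ p])
    fix q assume q: "q \<in> phase_dom D r s"
    have "F (fst q, snd q + period m) = F (fst q, snd q)"
      using assms q unfolding holo_torus_def by simp
    then show "F (1 *\<^sub>R q + (0, period m)) = F q" by (cases q) simp
  qed
  finally show "dd F (y, x + period m) v = dd F (y, x) v" by simp
qed

lemma holo_torus_pd: "holo_torus D r s F \<Longrightarrow> holo_torus D r s (pd a F)"
  unfolding pd_def[abs_def] by (rule holo_torus_dd)

lemma bounded_linear_kdot: "bounded_linear (kdot k)"
  unfolding kdot_def[abs_def]
  by (intro bounded_linear_sum bounded_linear_compose[OF bounded_linear_mult_right bounded_linear_vec_nth])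

lemma holo_kdot: "holo W (\<lambda>p. kdot k (snd p))" "dd (\<lambda>p. kdot k (snd p)) p v = kdot k (snd v)"
  by (rule holo_linear[OF bounded_linear_compose[OF bounded_linear_kdot bounded_linear_snd]], simp add: kdot_simps)+

lemma holo_cis: "holo W (\<lambda>p. cis_k k (snd p))"
    and dd_cis: "dd (\<lambda>p. cis_k k (snd p)) p v = cis_k k (snd p) * (\<i> * kdot k (snd v))"
proof -
  have h: "holo W (\<lambda>p. \<i> * kdot k (snd p))" for W by (rule holo_cmult(1)[OF holo_kdot(1)])
  show "holo W (\<lambda>p. cis_k k (snd p))" unfolding cis_k_def by (rule holo_exp(1)[OF h])
  show "dd (\<lambda>p. cis_k k (snd p)) p v = cis_k k (snd p) * (\<i> * kdot k (snd v))"
  proof -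
    have "dd (\<lambda>p. \<i> * kdot k (snd p)) p v = \<i> * dd (\<lambda>p. kdot k (snd p)) p v"
      by (rule holo_cmult(2)[OF holo_kdot(1)[of UNIV] UNIV_I])
    then show ?thesis
      unfolding cis_k_def holo_exp(2)[OF h[of UNIV] UNIV_I] by (simp add: holo_kdot(2))
  qed
qed

lemma holo_torus_cis: "holo_torus D r s (\<lambda>p. cis_k k (snd p))"
  by (simp add: holo_torus_def holo_cis)

subsection \<open>Integrals over the torus\<close>

text \<open>
  The shifted cube is cut along the face of the original one, and the part that sticks out is moved
  back by a period.
\<close>

lemma integral_periodic_shift:
  fixes g :: "real^'n \<Rightarrow> complex"
  assumes c: "continuous_on UNIV g" and p: "\<And>x. g (x + (2 * pi) *\<^sub>R axis j 1) = g x" and a: "0 \<le> a" "a \<le> 2 * pi"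
  shows "integral cube (\<lambda>x. g (x + a *\<^sub>R axis j 1)) = integral cube g"
proof -
  define lo hi where "lo u = (\<chi> i. if i = j then u else 0)"
    and "hi v = (\<chi> i. if i = j then v else 2 * pi)" for u v :: real
  define B where "B u v = cbox (lo u :: real^'n) (hi v)" for u v
  have cont: "continuous_on S g" for S using c continuous_on_subset by blast
  have split: "integral (B u w) g = integral (B u v) g + integral (B v w) g" if "u \<le> v" "v \<le> w" for u v w
  proof -
    have e: "axis j (1::real) \<in> Basis" by (simp add: axis_in_Basis_iff)
    have "B u w \<inter> {x. x \<bullet> axis j 1 \<le> v} = B u v" "B u w \<inter> {x. x \<bullet> axis j 1 \<ge> v} = B v w"
      using that by (auto simp: B_def lo_def hi_def mem_box_cart inner_axis split: if_splits) (smt (verit))+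
    with integral_split[OF integrable_continuous[OF cont, of "lo u" "hi w"] e, of v] show ?thesis
      by (simp add: B_def)
  qed
  have shift: "integral (B u v) (\<lambda>x. g (x + b *\<^sub>R axis j 1)) = integral (B (u + b) (v + b)) g" for u v b
  proof -
    have "lo u + b *\<^sub>R axis j 1 = lo (u + b)" "hi v + b *\<^sub>R axis j 1 = hi (v + b)"
      by (auto simp: lo_def hi_def vec_eq_iff axis_def)
    with integral_shift_cbox_plus[of "lo u" "hi v" g "b *\<^sub>R axis j 1"] show ?thesis
      by (simp add: B_def o_def add.commute)
  qed
  have B0: "cube = B 0 (2 * pi)"
    by (simp add: B_def lo_def hi_def zero_vec_def)
  have "integral cube (\<lambda>x. g (x + a *\<^sub>R axis j 1)) = integral (B a (2 * pi + a)) g"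
    by (simp add: B0 shift)
  also have "\<dots> = integral (B a (2 * pi)) g + integral (B (2 * pi) (2 * pi + a)) g"
    using a by (intro split) auto
  also have "integral (B (2 * pi) (2 * pi + a)) g = integral (B 0 a) g"
    using shift[of 0 a "2 * pi"] by (simp add: p add.commute)
  also have "integral (B a (2 * pi)) g + integral (B 0 a) g = integral (B 0 (2 * pi)) g"
    using split[of 0 a "2 * pi"] a by simp
  finally show ?thesis by (simp add: B0)
qed

lemma continuous_on_cvec [continuous_intros]: "continuous_on S f \<Longrightarrow> continuous_on S (\<lambda>x. cvec (f x))"
  unfolding cvec_def by (intro continuous_intros)

lemma continuous_on_kdot [continuous_intros]: "continuous_on S f \<Longrightarrow> continuous_on S (\<lambda>x. kdot k (f x))"
  unfolding kdot_def by (intro continuous_intros)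

lemma continuous_on_cis_k [continuous_intros]: "continuous_on S f \<Longrightarrow> continuous_on S (\<lambda>x. cis_k k (f x))"
  unfolding cis_k_def by (intro continuous_intros)

lemma continuous_on_slice:
  assumes "holo_torus D r s F" "y \<in> cnbhd D r" "0 < s"
  shows "continuous_on S (\<lambda>x. F (y, cvec x))"
  by (rule continuous_on_compose2[OF holo_continuous_on[OF holo_torus_holo[OF assms(1)]]])
     (use assms cvec_strip in \<open>auto intro!: continuous_intros simp: mem_phase_dom\<close>)

lemma axis_period: "cvec ((2 * pi) *\<^sub>R axis j 1) = period (axis j 1)"
  by (simp add: cvec_def period_def axis_def vec_eq_iff)

lemma cvec_add: "cvec (a + b) = cvec a + cvec b"
  by (simp add: cvec_def vec_eq_iff)

lemma cvec_axis: "cvec (a *\<^sub>R axis j 1) = of_real a *s unit_vec j"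
  by (simp add: cvec_def unit_vec_def axis_def vec_eq_iff)

lemma slice_integral:
  assumes F: "holo_torus D r s F" and s: "0 < s" and w: "continuous_on cube w"
  shows "holo (phase_dom D r s) (\<lambda>p. integral cube (\<lambda>\<xi>. w \<xi> * F (1 *\<^sub>R p + (0, cvec \<xi>))))"
    "p \<in> phase_dom D r s \<Longrightarrow> dd (\<lambda>p. integral cube (\<lambda>\<xi>. w \<xi> * F (1 *\<^sub>R p + (0, cvec \<xi>)))) p v
      = integral cube (\<lambda>\<xi>. w \<xi> * dd F (p + (0, cvec \<xi>)) v)"
proof -
  have mem: "1 *\<^sub>R p + (0, cvec \<xi>) \<in> phase_dom D r s" if "p \<in> phase_dom D r s" for p \<xi>
    using that strip_add_real[of "snd p" s \<xi>] by (simp add: mem_phase_dom(2))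
  have c: "continuous_on cube (\<lambda>\<xi>. (0 :: complex^'a, cvec \<xi>))" "continuous_on cube (\<lambda>\<xi>. 1 :: real)"
    by (intro continuous_intros)+
  show "holo (phase_dom D r s) (\<lambda>p. integral cube (\<lambda>\<xi>. w \<xi> * F (1 *\<^sub>R p + (0, cvec \<xi>))))"
    by (rule holo_integral(1)[OF open_phase_dom holo_torus_holo[OF F] open_phase_dom mem w c(2,1)])
  show "dd (\<lambda>p. integral cube (\<lambda>\<xi>. w \<xi> * F (1 *\<^sub>R p + (0, cvec \<xi>)))) p v
      = integral cube (\<lambda>\<xi>. w \<xi> * dd F (p + (0, cvec \<xi>)) v)" if "p \<in> phase_dom D r s"
    using holo_integral(2)[OF open_phase_dom holo_torus_holo[OF F] open_phase_dom mem w c(2,1) that] by simp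
qed

text \<open>Translation invariance of the mean over the torus, in differentiated form.\<close>

lemma integral_angle_derivative:
  assumes F: "holo_torus D r s F" and y: "y \<in> cnbhd D r" and s: "0 < s"
  shows "integral cube (\<lambda>x. dd F (y, cvec x) (0, unit_vec j)) = 0"
proof -
  let ?P = "\<lambda>p. integral cube (\<lambda>\<xi>. 1 * F (1 *\<^sub>R p + (0, cvec \<xi>)))"
  note P = slice_integral[OF F s continuous_on_const[of _ 1]]
  have p0: "(y, 0) \<in> phase_dom D r s" using y s by (simp add: mem_phase_dom strip_def)
  have "((\<lambda>t. ?P ((y, 0) + cscale t (0, unit_vec j))) has_field_derivative dd ?P (y, 0) (0, unit_vec j)) (at 0)"
    using holo_line[OF P(1), of "(y,0)" 0 "(0, unit_vec j)"] p0 by simp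
  then have "((\<lambda>h. (?P ((y, 0) + cscale h (0, unit_vec j)) - ?P (y, 0)) / h) \<longlongrightarrow> dd ?P (y, 0) (0, unit_vec j)) (at 0)"
    by (simp add: DERIV_def)
  moreover have "filterlim (\<lambda>n. of_real (inverse (real (Suc n))) :: complex) (at 0) sequentially"
    unfolding filterlim_at
    using tendsto_of_real[OF LIMSEQ_inverse_real_of_nat, where 'a=complex] by (simp del: of_nat_Suc)
  ultimately have lim: "(\<lambda>n. (?P ((y, 0) + cscale (of_real (inverse (real (Suc n)))) (0, unit_vec j)) - ?P (y, 0)) / of_real (inverse (real (Suc n))))
      \<longlonglongrightarrow> dd ?P (y, 0) (0, unit_vec j)"
    by (rule filterlim_compose)
  have const: "?P ((y, 0) + cscale (of_real a) (0, unit_vec j)) = ?P (y, 0)" if a: "0 \<le> a" "a \<le> 1" for a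
  proof -
    have e: "cscale (of_real a) (0, unit_vec j) = (0, cvec (a *\<^sub>R axis j 1))"
      by (simp add: cscale_def cvec_axis)
    have "integral cube (\<lambda>x. F (y, cvec (x + a *\<^sub>R axis j 1))) = integral cube (\<lambda>x. F (y, cvec x))"
    proof (rule integral_periodic_shift[OF continuous_on_slice[OF F y s]])
      show "F (y, cvec (x + (2 * pi) *\<^sub>R axis j 1)) = F (y, cvec x)" for x
        using F y cvec_strip[OF s, of x] unfolding holo_torus_def by (simp add: cvec_add axis_period mem_phase_dom)
    qed (use a pi_gt3 in auto)
    then show ?thesis by (simp add: e cvec_add add.commute del: cscale_simps(4))
  qed
  have cn: "?P ((y, 0) + cscale (of_real (inverse (real (Suc n)))) (0, unit_vec j)) = ?P (y, 0)" for n
    by (rule const) (simp_all add: inverse_eq_divide)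
  have "(\<lambda>n. 0 :: complex) \<longlonglongrightarrow> dd ?P (y, 0) (0, unit_vec j)"
    using lim unfolding cn by simp
  then have "dd ?P (y, 0) (0, unit_vec j) = 0" by (simp add: LIMSEQ_const_iff)
  then show ?thesis using P(2)[OF p0] by simp
qed

lemma fcoeff_cis: "fcoeff F k y = integral cube (\<lambda>x. F (y, cvec x) * cis_k (- k) (cvec x)) / of_real ((2 * pi) ^ CARD('n))"
  for F :: "'n::finite phase \<Rightarrow> complex"
  by (simp add: fcoeff_def cis_k_simps)

lemma fcoeff_cong:
  assumes "\<And>x. F (y, cvec x) = G (y, cvec x)" shows "fcoeff F k y = fcoeff G k y"
  unfolding fcoeff_def assms ..

lemma fcoeff_add:
  assumes "holo_torus D r s F" "holo_torus D r s G" "y \<in> cnbhd D r" "0 < s"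
  shows "fcoeff (\<lambda>p. F p + G p) k y = fcoeff F k y + fcoeff G k y"
  unfolding fcoeff_cis ring_distribs
  by (subst integral_add) (auto intro!: integrable_continuous continuous_intros continuous_on_slice assms simp: add_divide_distrib)

lemma fcoeff_cmult: "fcoeff (\<lambda>p. a (fst p) * F p) k y = a y * fcoeff F k y"
  unfolding fcoeff_cis by (simp add: mult.assoc)

lemma fcoeff_cmult_const: "fcoeff (\<lambda>p. c * F p) k y = c * fcoeff F k y"
  using fcoeff_cmult[of "\<lambda>_. c"] .

lemma fcoeff_diff:
  assumes "holo_torus D r s F" "holo_torus D r s G" "y \<in> cnbhd D r" "0 < s"
  shows "fcoeff (\<lambda>p. F p - G p) k y = fcoeff F k y - fcoeff G k y"
  using fcoeff_add[OF assms(1) holo_torus_cmult[OF assms(2)] assms(3,4), of "-1"] fcoeff_cmult_const[of "-1" G] by simp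

lemma fcoeff_zero: "fcoeff (\<lambda>p. 0) k y = 0"
  by (simp add: fcoeff_def)

lemma fcoeff_sum:
  assumes "\<And>i. i \<in> A \<Longrightarrow> holo_torus D r s (F i)" "y \<in> cnbhd D r" "0 < s"
  shows "fcoeff (\<lambda>p. \<Sum>i\<in>A. F i p) k y = (\<Sum>i\<in>A. fcoeff (F i) k y)"
  using assms(1)
proof (induction A rule: infinite_finite_induct)
  case (insert i A)
  then show ?case
    using fcoeff_add[OF insert.prems[of i] holo_torus_sum[of A D r s F] assms(2,3)] by simp
qed (simp_all add: fcoeff_zero)

lemma fcoeff_shift: "fcoeff (\<lambda>p. cis_k l (snd p) * F p) k y = fcoeff F (k - l) y"
proof -
  have "cis_k l x * F (y, x) * cis_k (- k) x = F (y, x) * cis_k (- (k - l)) x" for x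
    using cis_k_simps(1)[of l "-k" x] by (simp add: mult_ac)
  then show ?thesis unfolding fcoeff_cis snd_conv by (simp only:)
qed

text \<open>
  Integration by parts on the torus, by applying \<open>integral_angle_derivative\<close> to the product of \<open>F\<close> with a
  character.
\<close>

lemma fcoeff_angle_derivative:
  assumes F: "holo_torus D r s F" and y: "y \<in> cnbhd D r" and s: "0 < s"
  shows "fcoeff (\<lambda>p. dd F p (0, unit_vec j)) k y = \<i> * of_int (k $ j) * fcoeff F k y"
proof -
  let ?E = "\<lambda>p. cis_k (- k) (snd p)"
  have E: "holo_torus D r s ?E" by (rule holo_torus_cis)
  have "integral cube (\<lambda>x. dd (\<lambda>p. F p * ?E p) (y, cvec x) (0, unit_vec j)) = 0"
    by (rule integral_angle_derivative[OF holo_torus_mult[OF F E] y s])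
  also have "(\<lambda>x. dd (\<lambda>p. F p * ?E p) (y, cvec x) (0, unit_vec j)) =
      (\<lambda>x. dd F (y, cvec x) (0, unit_vec j) * cis_k (- k) (cvec x) - (\<i> * of_int (k $ j)) * (F (y, cvec x) * cis_k (- k) (cvec x)))"
    using y cvec_strip[OF s] 
    by (intro ext, subst holo_mult(2)[OF holo_torus_holo[OF F] holo_torus_holo[OF E]])
       (simp_all add: mem_phase_dom dd_cis kdot_simps algebra_simps)
  also have "integral cube \<dots> = integral cube (\<lambda>x. dd F (y, cvec x) (0, unit_vec j) * cis_k (- k) (cvec x))
      - integral cube (\<lambda>x. (\<i> * of_int (k $ j)) * (F (y, cvec x) * cis_k (- k) (cvec x)))"
    by (rule integral_diff; intro integrable_continuous continuous_intros continuous_on_slice[OF F y s]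
          continuous_on_slice[OF holo_torus_dd[OF F] y s])
  finally show ?thesis unfolding fcoeff_cis by (simp add: field_simps)
qed

lemma fcoeff_const_cis:
  assumes s: "y \<in> cnbhd D r"
  shows "fcoeff (\<lambda>p. cis_k l (snd p)) k y = (if k = l then 1 else 0)"
proof -
  have "fcoeff (\<lambda>p. cis_k l (snd p) * 1) k y = fcoeff (\<lambda>p. 1) (k - l) y" by (rule fcoeff_shift)
  moreover have "fcoeff (\<lambda>p. 1) m y = (if m = 0 then 1 else 0)" for m :: "int^'a"
  proof (cases "m = 0")
    case True
    have "measure lborel (cube :: (real^'a) set) = (2 * pi) ^ CARD('a)"
      by (subst content_cbox_cart) (auto simp: interval_ne_empty_cart)
    then show ?thesis using True by (simp add: fcoeff_cis cis_k_simps of_real_def)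
  next
    case False
    then obtain j where j: "m $ j \<noteq> 0" by (auto simp: vec_eq_iff)
    have "fcoeff (\<lambda>p. dd (\<lambda>p. 1) p (0, unit_vec j)) m y = \<i> * of_int (m $ j) * fcoeff (\<lambda>p. 1) m y"
      by (rule fcoeff_angle_derivative[OF holo_torus_const[of D r 1] s]) simp
    then show ?thesis using j False by (simp add: dd_const fcoeff_zero)
  qed
  ultimately show ?thesis by simp
qed

text \<open>
  A Fourier coefficient as a function on phase space that does not depend on the angles, so that the
  calculus of holomorphic functions above applies to it.
\<close>

definition coeff_fun :: "('n::finite phase \<Rightarrow> complex) \<Rightarrow> int^'n \<Rightarrow> 'n phase \<Rightarrow> complex" where
  "coeff_fun F k p = fcoeff F k (fst p)"

lemma
  assumes F: "holo_torus D r s F" and s: "0 < s"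
  shows holo_coeff_fun: "holo (cnbhd D r \<times> UNIV) (coeff_fun F k)"
    and dd_coeff_fun: "fst p \<in> cnbhd D r \<Longrightarrow> dd (coeff_fun F k) p v = fcoeff (\<lambda>p. dd F p (fst v, 0)) k (fst p)"
proof -
  let ?N = "of_real ((2 * pi) ^ CARD('a)) :: complex"
  let ?P = "\<lambda>p. integral cube (\<lambda>\<xi>. cis_k (- k) (cvec \<xi>) * F (1 *\<^sub>R p + (0, cvec \<xi>)))"
  let ?A = "\<lambda>p :: 'a phase. (fst p, 0 :: complex^'a)"
  have w: "continuous_on cube (\<lambda>\<xi>. cis_k (- k) (cvec \<xi>))" by (intro continuous_intros)
  note P = slice_integral[OF F s w]
  have A: "bounded_linear ?A" "\<And>c v. ?A (cscale c v) = cscale c (?A v)"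
    by (intro bounded_linear_Pair bounded_linear_fst bounded_linear_zero) (simp add: cscale_def)
  have mem: "?A p + 0 \<in> phase_dom D r s" if "p \<in> cnbhd D r \<times> UNIV" for p
    using that s by (simp add: mem_phase_dom mem_Times_iff strip_def)
  have eq: "coeff_fun F k = (\<lambda>p. (1 / ?N) * ?P (?A p + 0))"
    by (simp add: coeff_fun_def fcoeff_cis mult.commute fun_eq_iff)
  have h: "holo (cnbhd D r \<times> UNIV) (\<lambda>p. ?P (?A p + 0))"
    by (rule holo_compose_linear(1)[OF P(1) A mem])
  show "holo (cnbhd D r \<times> UNIV) (coeff_fun F k)"
    unfolding eq by (rule holo_cmult(1)[OF h])
  assume "fst p \<in> cnbhd D r"
  then have p: "p \<in> cnbhd D r \<times> UNIV" by (simp add: mem_Times_iff)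
  have "dd (coeff_fun F k) p v = (1 / ?N) * dd ?P (?A p + 0) (?A v)"
  proof -
    have "dd (coeff_fun F k) p v = (1 / ?N) * dd (\<lambda>p. ?P (?A p + 0)) p v"
      unfolding eq by (rule holo_cmult(2)[OF h p])
    also have "dd (\<lambda>p. ?P (?A p + 0)) p v = dd ?P (?A p + 0) (?A v)"
      by (rule holo_compose_linear(2)[OF P(1) A mem p])
    finally show ?thesis .
  qed
  also have "\<dots> = fcoeff (\<lambda>p. dd F p (fst v, 0)) k (fst p)"
    unfolding P(2)[OF mem[OF p]] by (simp add: fcoeff_cis mult.commute)
  finally show "dd (coeff_fun F k) p v = fcoeff (\<lambda>p. dd F p (fst v, 0)) k (fst p)" .
qed

lemma holo_torus_coeff_fun: "holo_torus D r s F \<Longrightarrow> 0 < s \<Longrightarrow> holo_torus D r s' (coeff_fun F k)"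
  using holo_subset[OF holo_coeff_fun, of D r s F "phase_dom D r s'" k] by (auto simp: holo_torus_def coeff_fun_def phase_dom_def)

subsection \<open>Fourier inversion\<close>

definition zero_coeffs :: "(real^'n \<Rightarrow> complex) \<Rightarrow> bool" where
  "zero_coeffs u \<longleftrightarrow> continuous_on UNIV u \<and> (\<forall>k. integral cube (\<lambda>x. u x * cis_k k (cvec x)) = 0)"

definition ecirc :: "real^'n \<Rightarrow> complex^'n" where "ecirc x = (\<chi> i. cis (x $ i))"

definition torus_set :: "(complex^'n) set" where "torus_set = {z. \<forall>i. norm (z $ i) = 1}"

lemma ecirc_in_torus: "ecirc x \<in> torus_set"
  by (simp add: ecirc_def torus_set_def)

lemma compact_torus: "compact (torus_set :: (complex^'n) set)"
proof -
  have "(torus_set :: (complex^'n) set) = (\<Inter>i. {z. norm (z $ i) = 1})" by (auto simp: torus_set_def)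
  also have "closed \<dots>" by (intro closed_INT ballI closed_Collect_eq continuous_intros)
  finally have "closed (torus_set :: (complex^'n) set)" .
  moreover have "bounded (torus_set :: (complex^'n) set)"
    unfolding bounded_iff
    by (intro exI[of _ "real CARD('n)"] ballI order_trans[OF norm_le_sum_cmod]) (simp add: torus_set_def)
  ultimately show ?thesis by (simp add: compact_eq_bounded_closed)
qed

lemma continuous_on_ecirc [continuous_intros]: "continuous_on S ecirc"
  unfolding ecirc_def cis_conv_exp by (intro continuous_intros)

lemma ecirc_component: "ecirc x $ i = cis_k (axis i 1) (cvec x)"
  by (simp add: ecirc_def cis_k_def cis_conv_exp kdot_def cvec_def axis_def if_distrib if_distribR cong: if_cong)

lemma cnj_cis_k: "real_vec x \<Longrightarrow> cnj (cis_k k x) = cis_k (- k) x"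
proof -
  assume "real_vec x"
  then have "cnj (kdot k x) = kdot k x"
    by (simp add: kdot_def real_vec_def Reals_cnj_iff)
  then show ?thesis by (simp add: cis_k_def exp_cnj kdot_simps)
qed

lemma real_vec_cvec [simp]: "real_vec (cvec x)"
  by (simp add: real_vec_def cvec_def)

text \<open>
  The real multipliers that preserve orthogonality to all characters. Since they form a ring that
  separates points, Stone-Weierstrass applies to them directly, without a description of
  the trigonometric polynomials.
\<close>

definition mult_ring :: "(complex^'n \<Rightarrow> real) set" where
  "mult_ring = {q. continuous_on torus_set q \<and> (\<forall>u. zero_coeffs u \<longrightarrow> zero_coeffs (\<lambda>x. u x * of_real (q (ecirc x))))}"

lemma zero_coeffs_cis: "zero_coeffs u \<Longrightarrow> zero_coeffs (\<lambda>x. u x * cis_k l (cvec x))"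
  unfolding zero_coeffs_def by (auto simp: mult.assoc simp flip: cis_k_simps(1) intro!: continuous_intros)

lemma zero_coeffs_add: "zero_coeffs u \<Longrightarrow> zero_coeffs v \<Longrightarrow> zero_coeffs (\<lambda>x. u x + v x)"
proof -
  assume u: "zero_coeffs u" and v: "zero_coeffs v"
  then have c: "continuous_on UNIV u" "continuous_on UNIV v" by (simp_all add: zero_coeffs_def)
  have "integral cube (\<lambda>x. (u x + v x) * cis_k k (cvec x)) = 0" for k
  proof -
    have "integral cube (\<lambda>x. (u x + v x) * cis_k k (cvec x)) = integral cube (\<lambda>x. u x * cis_k k (cvec x)) + integral cube (\<lambda>x. v x * cis_k k (cvec x))"
      unfolding ring_distribs
      by (rule integral_add; intro integrable_continuous continuous_intros continuous_on_subset[OF c(1)] continuous_on_subset[OF c(2)] subset_UNIV)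
    then show ?thesis using u v by (simp add: zero_coeffs_def)
  qed
  then show ?thesis using c by (auto simp: zero_coeffs_def intro!: continuous_intros)
qed

lemma zero_coeffs_cmult: "zero_coeffs u \<Longrightarrow> zero_coeffs (\<lambda>x. c * u x)"
  unfolding zero_coeffs_def by (auto simp: mult.assoc intro!: continuous_intros)

lemma function_ring_torus: "function_ring_on mult_ring (torus_set :: (complex^'n) set)"
proof
  show "compact (torus_set :: (complex^'n) set)" by (rule compact_torus)
  show "continuous_on torus_set f" if "f \<in> mult_ring" for f :: "complex^'n \<Rightarrow> real"
    using that by (simp add: mult_ring_def)
  show "(\<lambda>z. f z + g z) \<in> mult_ring" if "f \<in> mult_ring" "g \<in> mult_ring" for f g :: "complex^'n \<Rightarrow> real"
    using that by (auto simp: mult_ring_def ring_distribs intro!: continuous_intros zero_coeffs_add)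
  show "(\<lambda>z. f z * g z) \<in> mult_ring" if "f \<in> mult_ring" "g \<in> mult_ring" for f g :: "complex^'n \<Rightarrow> real"
  proof -
    have "zero_coeffs (\<lambda>x. u x * of_real (f (ecirc x)) * of_real (g (ecirc x)))" if "zero_coeffs u" for u
      using that \<open>f \<in> mult_ring\<close> \<open>g \<in> mult_ring\<close> by (simp add: mult_ring_def)
    then show ?thesis using that by (auto simp: mult_ring_def mult.assoc intro!: continuous_intros)
  qed
  show "(\<lambda>_. c) \<in> (mult_ring :: (complex^'n \<Rightarrow> real) set)" for c
    using zero_coeffs_cmult[where c="of_real c"] by (auto simp: mult_ring_def mult.commute)
  have ReIm: "(\<lambda>z. Re (c * z $ i)) \<in> (mult_ring :: (complex^'n \<Rightarrow> real) set)" for i c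
  proof -
    have "zero_coeffs (\<lambda>x. u x * of_real (Re (c * ecirc x $ i)))" if u: "zero_coeffs u" for u
    proof -
      have "complex_of_real (Re (c * ecirc x $ i)) = (c / 2) * cis_k (axis i 1) (cvec x) + (cnj c / 2) * cis_k (- axis i 1) (cvec x)" for x
      proof -
        have "cnj (ecirc x $ i) = cis_k (- axis i 1) (cvec x)"
          by (simp add: ecirc_component cnj_cis_k)
        then show ?thesis
          using complex_add_cnj[of "c * ecirc x $ i"] by (simp add: ecirc_component field_simps)
      qed
      then have "(\<lambda>x. u x * of_real (Re (c * ecirc x $ i))) =
          (\<lambda>x. (c / 2) * (u x * cis_k (axis i 1) (cvec x)) + (cnj c / 2) * (u x * cis_k (- axis i 1) (cvec x)))"
        by (simp add: fun_eq_iff algebra_simps)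
      then show ?thesis using u by (simp only: zero_coeffs_add zero_coeffs_cmult zero_coeffs_cis)
    qed
    then show ?thesis by (auto simp: mult_ring_def intro!: continuous_intros)
  qed
  show "\<exists>f\<in>mult_ring. f x \<noteq> f y" if ne: "x \<noteq> y" for x y :: "complex^'n"
  proof -
    obtain i where "x $ i \<noteq> y $ i" using ne vec_eq_iff[of x y] by blast
    then have "Re (1 * x $ i) \<noteq> Re (1 * y $ i) \<or> Re (- \<i> * x $ i) \<noteq> Re (- \<i> * y $ i)"
      by (auto simp: complex_eq_iff)
    then show ?thesis
    proof
      assume "Re (1 * x $ i) \<noteq> Re (1 * y $ i)"
      then show ?thesis by (rule bexI[OF _ ReIm])
    next
      assume "Re (- \<i> * x $ i) \<noteq> Re (- \<i> * y $ i)"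
      then show ?thesis by (rule bexI[OF _ ReIm])
    qed
  qed
qed

text \<open>
  Near a point \<open>e\<^sup>i\<^sup>a\<close> of the torus a preimage of \<open>z\<close> is \<open>a + Im (Ln (z / e\<^sup>i\<^sup>a))\<close>, which is continuous in \<open>z\<close>
  because the principal logarithm is continuous near \<open>1\<close>.
\<close>

lemma periodic_factor:
  fixes u :: "real^'n \<Rightarrow> complex"
  assumes c: "continuous_on UNIV u" and p: "\<And>x m. u (x + (\<chi> i. 2 * pi * of_int (m $ i))) = u x"
  obtains v where "continuous_on torus_set v" "\<And>x. v (ecirc x) = u x"
proof -
  have e: "u x = u x'" if "ecirc x = ecirc x'" for x x'
  proof -
    have "\<exists>n::int. x $ i = x' $ i + 2 * pi * of_int n" for i
    proof -
      have "cis (x $ i) = cis (x' $ i)" using that by (simp add: ecirc_def vec_eq_iff)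
      then have "cis (x $ i - x' $ i) = 1" by (simp add: cis_divide[symmetric])
      then have "cos (x $ i - x' $ i) = 1" by (simp add: complex_eq_iff)
      then obtain n :: int where "x $ i - x' $ i = of_int n * 2 * pi" by (auto simp: cos_one_2pi_int)
      then show ?thesis by (intro exI[of _ n]) (simp add: algebra_simps)
    qed
    then obtain n :: "'n \<Rightarrow> int" where n: "\<And>i. x $ i = x' $ i + 2 * pi * of_int (n i)" by metis
    have "x = x' + (\<chi> i. 2 * pi * of_int ((\<chi> i. n i) $ i))" by (simp add: vec_eq_iff n)
    then show ?thesis using p[of x' "\<chi> i. n i"] by simp
  qed
  define v where "v z = u (\<chi> i. Arg (z $ i))" for z
  have cis: "cis (Im (Ln w)) = w" if "norm w = 1" for w
  proof -
    have "w \<noteq> 0" using that by auto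
    then have "exp (of_real (Re (Ln w)) + \<i> * of_real (Im (Ln w))) = w"
      using exp_Ln[of w] complex_eq[of "Ln w"] by simp
    moreover have "Re (Ln w) = 0" using Re_Ln[OF \<open>w \<noteq> 0\<close>] that by simp
    ultimately show ?thesis by (simp add: cis_conv_exp)
  qed
  have vE: "v (ecirc x) = u x" for x
    unfolding v_def
    by (rule e) (simp add: ecirc_def vec_eq_iff cis_Arg)
  have surj: "\<exists>x. z = ecirc x" if "z \<in> torus_set" for z :: "complex^'n"
    using that cis by (intro exI[of _ "\<chi> i. Im (Ln (z $ i))"]) (simp add: ecirc_def torus_set_def vec_eq_iff)
  have "continuous (at z0 within torus_set) v" if z0: "z0 \<in> torus_set" for z0
  proof -
    obtain x0 where x0: "z0 = ecirc x0" using surj[OF z0] by blast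
    have z0n1: "norm (z0 $ i) = 1" for i using z0 by (simp add: torus_set_def)
    have z0n2: "z0 $ i \<noteq> 0" for i using z0n1[of i] by auto
    note z0n = z0n1 z0n2
    have eq: "v z = u (\<chi> i. x0 $ i + Im (Ln (z $ i / z0 $ i)))" if z: "z \<in> torus_set" for z
    proof -
      have "z $ i = cis (x0 $ i + Im (Ln (z $ i / z0 $ i)))" for i
      proof -
        have "norm (z $ i / z0 $ i) = 1" using z z0n by (simp add: torus_set_def norm_divide)
        from cis[OF this] have a: "z $ i = z0 $ i * cis (Im (Ln (z $ i / z0 $ i)))" using z0n(2)[of i] by simp
        have b: "z0 $ i = cis (x0 $ i)" using x0 by (simp add: ecirc_def)
        show ?thesis unfolding cis_mult[symmetric] by (subst b[symmetric]) (rule a)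
      qed
      then have "z = ecirc (\<chi> i. x0 $ i + Im (Ln (z $ i / z0 $ i)))" by (simp add: ecirc_def vec_eq_iff)
      then show ?thesis using vE by metis
    qed
    have "continuous (at z0 within torus_set) (\<lambda>z. u (\<chi> i. x0 $ i + Im (Ln (z $ i / z0 $ i))))"
    proof (rule continuous_within_compose3[where g=u])
      show "isCont u (\<chi> i. x0 $ i + Im (Ln (z0 $ i / z0 $ i)))"
        using c by (simp add: continuous_on_eq_continuous_at)
      show "continuous (at z0 within torus_set) (\<lambda>z. \<chi> i. x0 $ i + Im (Ln (z $ i / z0 $ i)))"
      proof (rule continuous_at_imp_continuous_at_within)
        have "isCont (\<lambda>z. x0 $ i + Im (Ln (z $ i / z0 $ i))) z0" for i
        proof (intro continuous_intros isCont_Ln' isCont_Im)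
          show "z0 $ i / z0 $ i \<notin> \<real>\<^sub>\<le>\<^sub>0" using z0n(2)[of i] by simp
        qed (rule z0n(2))
        then show "isCont (\<lambda>z. \<chi> i. x0 $ i + Im (Ln (z $ i / z0 $ i))) z0"
          unfolding isCont_def by (intro tendsto_vec_lambda)
      qed
    qed
    then show ?thesis
      by (rule continuous_transform_within[OF _ zero_less_one z0]) (simp add: eq)
  qed
  then have "continuous_on torus_set v" by (simp add: continuous_on_eq_continuous_within)
  with vE show ?thesis using that by blast
qed

text \<open>
  By Stone-Weierstrass a continuous function on the torus is a uniform limit of functions \<open>q\<close>
  multiplication by which preserves orthogonality to all characters; testing against
  \<open>Re u\<close> and \<open>Im u\<close> gives \<open>\<integral> (Re u)\<^sup>2 = \<integral> (Im u)\<^sup>2 = 0\<close>.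
\<close>

lemma zero_coeffs_imp_zero:
  fixes u :: "real^'n \<Rightarrow> complex"
  assumes z: "zero_coeffs u" and p: "\<And>x m. u (x + (\<chi> i. 2 * pi * of_int (m $ i))) = u x"
  shows "u x = 0"
proof -
  have c: "continuous_on UNIV u" using z by (simp add: zero_coeffs_def)
  obtain v where v: "continuous_on torus_set v" "\<And>x. v (ecirc x) = u x"
    using periodic_factor[OF c p] by blast
  have cu: "continuous_on cube u" using c continuous_on_subset by blast
  have test: "integral cube (\<lambda>x. u x * of_real (f (ecirc x))) = 0"
    if f: "continuous_on torus_set f" for f :: "complex^'n \<Rightarrow> real"
  proof (rule ccontr)
    let ?J = "integral cube (\<lambda>x. u x * of_real (f (ecirc x)))"
    let ?N = "integral cube (\<lambda>x. norm (u x))"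
    assume "?J \<noteq> 0"
    define e where "e = norm ?J / (?N + 1)"
    have N: "0 \<le> ?N" by (intro integral_nonneg integrable_continuous continuous_intros cu) simp
    have e: "e > 0" using \<open>?J \<noteq> 0\<close> N by (simp add: e_def add_nonneg_pos)
    obtain q where q: "q \<in> mult_ring" "\<And>z. z \<in> torus_set \<Longrightarrow> \<bar>f z - q z\<bar> < e"
      using function_ring_on.Stone_Weierstrass_basic[OF function_ring_torus f e] by blast
    have cq: "continuous_on cube (\<lambda>x. q (ecirc x))" "continuous_on cube (\<lambda>x. f (ecirc x))"
      using q(1) continuous_on_compose2[OF _ continuous_on_ecirc, of torus_set q cube]
        continuous_on_compose2[OF f continuous_on_ecirc, of cube]
      by (simp_all add: mult_ring_def image_subset_iff ecirc_in_torus)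
    have "integral cube (\<lambda>x. u x * of_real (q (ecirc x)) * cis_k 0 (cvec x)) = 0"
      using q(1) z unfolding mult_ring_def zero_coeffs_def by blast
    then have q0: "integral cube (\<lambda>x. u x * of_real (q (ecirc x))) = 0" by (simp add: cis_k_simps)
    have "?J = ?J - integral cube (\<lambda>x. u x * of_real (q (ecirc x)))" using q0 by simp
    also have "\<dots> = integral cube (\<lambda>x. u x * of_real (f (ecirc x)) - u x * of_real (q (ecirc x)))"
      by (rule integral_diff[symmetric]; intro integrable_continuous continuous_intros cu cq)
    finally have J: "?J = integral cube (\<lambda>x. u x * of_real (f (ecirc x) - q (ecirc x)))"
      by (simp add: algebra_simps)
    have "norm ?J \<le> integral cube (\<lambda>x. norm (u x) * e)"
      unfolding J
    proof (rule integral_norm_bound_integral)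
      show "norm (u x * of_real (f (ecirc x) - q (ecirc x))) \<le> norm (u x) * e" for x
        unfolding norm_mult norm_of_real
        by (intro mult_left_mono less_imp_le[OF q(2)] ecirc_in_torus) simp
    qed (intro integrable_continuous continuous_intros cu cq)+
    also have "\<dots> = ?N * e" by simp
    also have "\<dots> < (?N + 1) * e" using e by (simp add: ring_distribs)
    also have "\<dots> = norm ?J" using N by (simp add: e_def)
    finally show False by simp
  qed
  have part: "L (u x) = 0" if L: "L = Re \<or> L = Im" and x: "x \<in> cube" for L x
  proof (rule ccontr)
    assume "L (u x) \<noteq> 0"
    have bl: "bounded_linear L" using L bounded_linear_Re bounded_linear_Im by auto
    note cL = bounded_linear.continuous_on[OF bl]
    have i: "(\<lambda>x. u x * of_real (L (v (ecirc x)))) integrable_on cube"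
      unfolding v(2) by (intro integrable_continuous continuous_intros cu cL)
    have "((\<lambda>x. u x * of_real (L (v (ecirc x)))) has_integral 0) cube"
      using test[OF cL[OF v(1)]] i by (metis integrable_integral)
    from has_integral_linear[OF this bl]
    have "((\<lambda>x. L (u x) * L (u x)) has_integral 0) cube"
      using L by (auto simp: o_def v(2))
    moreover have "continuous_on cube (\<lambda>x. L (u x) * L (u x))" by (intro continuous_intros cu cL)
    moreover have "box 0 (\<chi> i. 2 * pi) \<noteq> ({} :: (real^'n) set)"
      by (simp add: interval_ne_empty_cart)
    ultimately have "L (u x) * L (u x) = 0"
      using has_integral_0_cbox_imp_0[of 0 "\<chi> i. 2 * pi" "\<lambda>x. L (u x) * L (u x)" x] x by simp
    then show False using \<open>L (u x) \<noteq> 0\<close> by simp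
  qed
  have z0: "u x = 0" if "x \<in> cube" for x
    using part[of Re x] part[of Im x] that by (simp add: complex_eq_iff)
  define m :: "int^'n" where "m = (\<chi> i. - \<lfloor>x $ i / (2 * pi)\<rfloor>)"
  have "x + (\<chi> i. 2 * pi * of_int (m $ i)) \<in> cube"
  proof -
    have "0 \<le> x $ i + 2 * pi * of_int (m $ i) \<and> x $ i + 2 * pi * of_int (m $ i) \<le> 2 * pi" for i
    proof -
      let ?a = "x $ i / (2 * pi)"
      have "x $ i + 2 * pi * of_int (m $ i) = 2 * pi * (?a - of_int \<lfloor>?a\<rfloor>)" by (simp add: m_def algebra_simps)
      moreover have "0 \<le> ?a - of_int \<lfloor>?a\<rfloor>" "?a - of_int \<lfloor>?a\<rfloor> \<le> 1" by linarith+
      ultimately show ?thesis by (simp add: mult_left_le)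
    qed
    then show ?thesis by (simp add: mem_box_cart)
  qed
  then show ?thesis using z0 p by metis
qed

section \<open>The weighted Fourier norm\<close>

lemma fnorm_le_summable:
  assumes "fnorm_le D r s F M" "y \<in> cnbhd D r"
  shows "(\<lambda>k. norm (fcoeff F k y) * exp (l1 k * s)) summable_on A"
    and "(\<Sum>\<^sub>\<infinity>k\<in>A. norm (fcoeff F k y) * exp (l1 k * s)) \<le> M"
proof -
  let ?f = "\<lambda>k. norm (fcoeff F k y) * exp (l1 k * s)"
  have b: "sum ?f T \<le> M" if "finite T" for T
    using assms that unfolding fnorm_le_def by blast
  have bd: "bdd_above (sum ?f ` {T. T \<subseteq> A \<and> finite T})"
    by (rule bdd_aboveI[of _ M]) (use b in blast)
  show s: "?f summable_on A"
    by (rule nonneg_bdd_above_summable_on[OF _ bd]) simp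
  show "infsum ?f A \<le> M"
    by (rule infsum_le_finite_sums[OF s b])
qed

lemma fnorm_le_pos: "fnorm_le D r s F M \<Longrightarrow> y \<in> cnbhd D r \<Longrightarrow> 0 \<le> M"
  unfolding fnorm_le_def by (drule bspec, assumption, drule spec[of _ "{}"]) simp

lemma fproj_term_bound:
  assumes "(y, x) \<in> phase_dom D r s"
  shows "norm (fcoeff F k y * cis_k k x) \<le> norm (fcoeff F k y) * exp (l1 k * s)"
  unfolding norm_mult
  by (intro mult_left_mono norm_cis_k) (use assms in \<open>auto simp: mem_phase_dom strip_def less_imp_le\<close>)

lemma fproj_eq: "fproj S F p = (\<Sum>\<^sub>\<infinity>k\<in>S. fcoeff F k (fst p) * cis_k k (snd p))"
  by (simp add: fproj_def cis_k_def case_prod_beta)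

lemma fproj_abs_summable:
  assumes "fnorm_le D r s F M" "(y, x) \<in> phase_dom D r s"
  shows "(\<lambda>k. norm (fcoeff F k y * cis_k k x)) summable_on S"
  by (rule summable_on_comparison_test[OF fnorm_le_summable(1)[OF assms(1), of y]])
     (use fproj_term_bound[OF assms(2)] assms in \<open>simp_all add: mem_phase_dom\<close>)

lemma norm_fproj_le:
  assumes "fnorm_le D r s F M" "(y, x) \<in> phase_dom D r s"
  shows "norm (fproj S F (y, x)) \<le> M"
proof -
  have y: "y \<in> cnbhd D r" using assms by (simp add: mem_phase_dom)
  have "norm (fproj S F (y, x)) \<le> (\<Sum>\<^sub>\<infinity>k\<in>S. norm (fcoeff F k y * cis_k k x))"
    unfolding fproj_eq fst_conv snd_conv by (rule norm_infsum_bound[OF fproj_abs_summable[OF assms]])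
  also have "\<dots> \<le> (\<Sum>\<^sub>\<infinity>k\<in>S. norm (fcoeff F k y) * exp (l1 k * s))"
    by (rule infsum_mono[OF fproj_abs_summable[OF assms] fnorm_le_summable(1)[OF assms(1) y]])
       (rule fproj_term_bound[OF assms(2)])
  also have "\<dots> \<le> M" by (rule fnorm_le_summable(2)[OF assms(1) y])
  finally show ?thesis .
qed

lemma finite_int_l1_ball: "finite {k :: int^'n. int_l1norm k \<le> N}"
proof -
  have "{k :: int^'n. int_l1norm k \<le> N} \<subseteq> vec_lambda ` (PiE UNIV (\<lambda>_. {-N..N}))"
  proof
    fix k :: "int^'n" assume k: "k \<in> {k. int_l1norm k \<le> N}"
    have "\<bar>k $ i\<bar> \<le> N" for i
    proof -
      have "\<bar>k $ i\<bar> \<le> (\<Sum>i\<in>UNIV. \<bar>k $ i\<bar>)" by (rule member_le_sum) auto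
      then show ?thesis using k by (simp add: int_l1norm_def)
    qed
    then have "vec_nth k \<in> PiE UNIV (\<lambda>_. {-N..N})" by (auto simp: abs_le_iff) (metis minus_le_iff)
    then show "k \<in> vec_lambda ` (PiE UNIV (\<lambda>_. {-N..N}))"
      by (intro image_eqI[of _ _ "vec_nth k"]) (simp_all add: vec_nth_inverse)
  qed
  then show ?thesis by (rule finite_subset) (intro finite_imageI finite_PiE, auto)
qed

lemma strip_shrink:
  fixes x :: "complex^'n"
  assumes "x \<in> strip s" obtains s' where "s' < s" "x \<in> strip s'"
proof -
  define m where "m = Max (range (\<lambda>j. \<bar>Im (x $ j)\<bar>))"
  have le: "\<bar>Im (x $ j)\<bar> \<le> m" for j unfolding m_def by (intro Max_ge) auto
  have "m \<in> range (\<lambda>j. \<bar>Im (x $ j)\<bar>)" unfolding m_def by (intro Max_in) auto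
  then have "m < s" using assms by (auto simp: strip_def)
  show ?thesis
  proof (rule that[of "(m + s) / 2"])
    show "(m + s) / 2 < s" using \<open>m < s\<close> by simp
    have "\<bar>Im (x $ j)\<bar> < (m + s) / 2" for j using le[of j] \<open>m < s\<close> by simp
    then show "x \<in> strip ((m + s) / 2)" by (simp add: strip_def)
  qed
qed

text \<open>
  The coefficients are bounded in the weighted \<open>\<ell>\<^sup>1\<close> norm only pointwise in the actions. Grouping
  the Fourier modes by their length gives a series that converges locally uniformly.
\<close>

lemma holo_fproj:
  fixes S :: "(int^'n) set"
  assumes F: "holo_torus D r s F" and s: "0 < s" and M: "fnorm_le D r s F M"
  shows "holo (phase_dom D r s) (fproj S F)"
proof -
  have "\<exists>L. (fproj S F has_derivative L) (at p) \<and> (\<forall>c v. L (cscale c v) = c * L v)" if p: "p \<in> phase_dom D r s" for p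
  proof -
    obtain s' where s': "s' < s" "snd p \<in> strip s'"
      using strip_shrink p mem_phase_dom(2) by blast
    let ?W = "phase_dom D r s'"
    have pW: "p \<in> ?W" using p s' by (simp add: mem_phase_dom(2))
    have Wsub: "?W \<subseteq> phase_dom D r s" using s' phase_dom_mono[of r r s' s] by simp
    define Sh where "Sh m = {k\<in>S. int_l1norm k = int m}" for m
    have fin: "finite (Sh m)" for m
      by (rule finite_subset[OF _ finite_int_l1_ball[of "int m"]]) (auto simp: Sh_def)
    define G where "G m q = (\<Sum>k\<in>Sh m. coeff_fun F k q * cis_k k (snd q))" for m q
    have hG: "holo ?W (G m)" for m
      unfolding G_def by (intro holo_sum(1) holo_mult(1) holo_cis holo_torus_holo[OF holo_torus_coeff_fun[OF F s]])
    have bG: "norm (G m q) \<le> M * exp (- (s - s')) ^ m" if q: "q \<in> ?W" for m q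
    proof -
      have y: "fst q \<in> cnbhd D r" and q': "(fst q, snd q) \<in> ?W" using q by (simp_all add: mem_phase_dom)
      have "norm (G m q) \<le> (\<Sum>k\<in>Sh m. norm (fcoeff F k (fst q) * cis_k k (snd q)))"
        unfolding G_def coeff_fun_def by (rule norm_sum)
      also have "\<dots> \<le> (\<Sum>k\<in>Sh m. (norm (fcoeff F k (fst q)) * exp (l1 k * s)) * exp (- (s - s')) ^ m)"
      proof (rule sum_mono)
        fix k assume k: "k \<in> Sh m"
        have "norm (fcoeff F k (fst q) * cis_k k (snd q)) \<le> norm (fcoeff F k (fst q)) * exp (l1 k * s')"
          by (rule fproj_term_bound[OF q'])
        also have "exp (l1 k * s') = exp (l1 k * s) * exp (- (s - s')) ^ m"
        proof -
          have "exp (- (s - s')) ^ m = exp (l1 k * (s' - s))"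
            using k by (simp add: Sh_def flip: exp_of_nat_mult)
          then show ?thesis by (simp add: exp_add[symmetric] algebra_simps)
        qed
        finally show "norm (fcoeff F k (fst q) * cis_k k (snd q)) \<le> norm (fcoeff F k (fst q)) * exp (l1 k * s) * exp (- (s - s')) ^ m"
          by (simp add: mult.assoc)
      qed
      also have "\<dots> = (\<Sum>k\<in>Sh m. norm (fcoeff F k (fst q)) * exp (l1 k * s)) * exp (- (s - s')) ^ m"
        by (simp add: sum_distrib_right)
      also have "\<dots> \<le> M * exp (- (s - s')) ^ m"
        by (intro mult_right_mono) (use M y fin in \<open>simp_all add: fnorm_le_def\<close>)
      finally show ?thesis .
    qed
    have sG: "summable (\<lambda>m. M * exp (- (s - s')) ^ m)"
      by (intro summable_mult summable_geometric) (use s' in simp)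
    have eq: "(\<Sum>m. G m q) = fproj S F q" if q: "q \<in> ?W" for q
    proof -
      have q': "(fst q, snd q) \<in> phase_dom D r s" using q Wsub by auto
      let ?f = "\<lambda>k. fcoeff F k (fst q) * cis_k k (snd q)"
      have hs: "(?f has_sum fproj S F q) S"
        unfolding fproj_eq by (rule has_sum_infsum[OF abs_summable_summable[OF fproj_abs_summable[OF M q']]])
      define Bl where "Bl N = {k\<in>S. int_l1norm k < int N}" for N
      have fl: "filterlim Bl (finite_subsets_at_top S) sequentially"
        unfolding filterlim_iff eventually_finite_subsets_at_top
      proof (intro allI impI, elim exE conjE)
        fix P X assume X: "finite X" "X \<subseteq> S" "\<forall>Y. finite Y \<and> X \<subseteq> Y \<and> Y \<subseteq> S \<longrightarrow> P Y"
        define N where "N = nat (Max (insert 0 (int_l1norm ` X))) + 1"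
        have N: "int_l1norm k < int N" if "k \<in> X" for k
        proof -
          have "int_l1norm k \<le> Max (insert 0 (int_l1norm ` X))" using that X by (intro Max_ge) auto
          then show ?thesis by (simp add: N_def)
        qed
        have "finite (Bl n)" for n
          by (rule finite_subset[OF _ finite_int_l1_ball[of "int n"]]) (auto simp: Bl_def)
        moreover have "X \<subseteq> Bl n" if "n \<ge> N" for n
          using N X(2) that by (fastforce simp: Bl_def)
        ultimately have "P (Bl n)" if "n \<ge> N" for n
          using X(3) that by (auto simp: Bl_def)
        then show "\<forall>\<^sub>F n in sequentially. P (Bl n)" unfolding eventually_sequentially by blast
      qed
      have "(\<lambda>N. sum ?f (Bl N)) \<longlonglongrightarrow> fproj S F q"
        using filterlim_compose[OF hs[unfolded has_sum_def] fl] .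
      moreover have "sum ?f (Bl N) = (\<Sum>m<N. G m q)" for N
      proof -
        have "Bl N = (\<Union>m<N. Sh m)"
        proof (intro set_eqI iffI)
          fix k assume k: "k \<in> Bl N"
          then have "k \<in> Sh (nat (int_l1norm k))" "nat (int_l1norm k) < N"
            using int_l1norm_nonneg[of k] by (simp_all add: Bl_def Sh_def nat_less_iff)
          then show "k \<in> (\<Union>m<N. Sh m)" by blast
        qed (auto simp: Bl_def Sh_def)
        moreover have "sum ?f (\<Union>m<N. Sh m) = (\<Sum>m<N. sum ?f (Sh m))"
        proof (rule sum.UNION_disjoint)
          show "\<forall>i\<in>{..<N}. finite (Sh i)" using fin by blast
          show "\<forall>i\<in>{..<N}. \<forall>j\<in>{..<N}. i \<noteq> j \<longrightarrow> Sh i \<inter> Sh j = {}" by (auto simp: Sh_def)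
        qed simp
        ultimately have "sum ?f (Bl N) = (\<Sum>m<N. sum ?f (Sh m))" by simp
        then show ?thesis by (simp add: G_def coeff_fun_def)
      qed
      ultimately have "(\<lambda>m. G m q) sums fproj S F q" by (simp add: sums_def)
      then show ?thesis by (rule sums_unique[symmetric])
    qed
    have "holo ?W (fproj S F)"
      by (rule holo_cong[OF open_phase_dom eq holo_series[OF open_phase_dom hG bG sG]])
    then show ?thesis using pW unfolding holo_def by blast
  qed
  then show ?thesis unfolding holo_def by blast
qed

lemma holo_torus_fproj:
  assumes F: "holo_torus D r s F" and s: "0 < s" and M: "fnorm_le D r s F M"
  shows "holo_torus D r s (fproj S F)"
  unfolding holo_torus_def using holo_fproj[OF assms] by (simp add: fproj_eq)

lemma integral_has_limit:
  fixes f :: "'a \<Rightarrow> real^'n \<Rightarrow> complex"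
  assumes u: "uniform_limit cube f g L" and c: "\<And>n. continuous_on cube (f n)" and L: "L \<noteq> bot"
    and I: "(\<lambda>n. integral cube (f n)) = I"
  shows "((\<lambda>n. I n) \<longlongrightarrow> integral cube g) L"
proof -
  obtain I' J where "\<And>n. (f n has_integral I' n) cube" "(g has_integral J) cube" "(I' \<longlongrightarrow> J) L"
    using uniform_limit_integral_cbox[OF u c L] by blast
  then show ?thesis using I by (metis integral_unique ext)
qed

text \<open>
  The partial sums converge uniformly on the torus, so that the orthogonality of the characters can be
  used term by term.
\<close>

lemma fcoeff_fproj:
  fixes F :: "'n::finite phase \<Rightarrow> complex"
  assumes s: "0 < s" and M: "fnorm_le D r s F M" and y: "y \<in> cnbhd D r"
  shows "fcoeff (fproj S F) l y = (if l \<in> S then fcoeff F l y else 0)"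
proof -
  let ?N = "of_real ((2 * pi) ^ CARD('n)) :: complex"
  let ?f = "\<lambda>k \<xi>. fcoeff F k y * cis_k k (cvec \<xi>) * cis_k (- l) (cvec \<xi>)"
  have nf: "norm (?f k \<xi>) \<le> norm (fcoeff F k y) * exp (l1 k * s)" for k \<xi>
  proof -
    have "norm (?f k \<xi>) = norm (fcoeff F k y) * 1" by (simp add: norm_mult norm_cis_k_real)
    also have "\<dots> \<le> norm (fcoeff F k y) * exp (l1 k * s)"
      by (intro mult_left_mono) (use s int_l1norm_nonneg[of k] in simp_all)
    finally show ?thesis .
  qed
  have u: "uniform_limit cube (\<lambda>T \<xi>. \<Sum>k\<in>T. ?f k \<xi>) (\<lambda>\<xi>. \<Sum>\<^sub>\<infinity>k\<in>S. ?f k \<xi>) (finite_subsets_at_top S)"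
    by (rule Weierstrass_m_test_general[OF nf fnorm_le_summable(1)[OF M y]])
  have c: "continuous_on cube (\<lambda>\<xi>. \<Sum>k\<in>T. ?f k \<xi>)" for T by (intro continuous_intros)
  have one: "integral cube (\<lambda>\<xi>. cis_k k (cvec \<xi>) * cis_k (- l) (cvec \<xi>)) = (if k = l then ?N else 0)" for k
    using fcoeff_const_cis[OF y, of k l] by (simp add: fcoeff_cis field_simps split: if_splits)
  have I: "(\<lambda>T. integral cube (\<lambda>\<xi>. \<Sum>k\<in>T. ?f k \<xi>)) = (\<lambda>T. \<Sum>k\<in>T. fcoeff F k y * (if k = l then ?N else 0))"
  proof
    fix T
    show "integral cube (\<lambda>\<xi>. \<Sum>k\<in>T. ?f k \<xi>) = (\<Sum>k\<in>T. fcoeff F k y * (if k = l then ?N else 0))"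
    proof (cases "finite T")
      case True
      have "integral cube (\<lambda>\<xi>. \<Sum>k\<in>T. ?f k \<xi>) = (\<Sum>k\<in>T. integral cube (?f k))"
        by (rule integral_sum[OF True]) (intro integrable_continuous continuous_intros)
      also have "\<dots> = (\<Sum>k\<in>T. fcoeff F k y * (if k = l then ?N else 0))"
        unfolding one[symmetric] by (simp add: mult.assoc)
      finally show ?thesis .
    qed simp
  qed
  have lim: "((\<lambda>T. \<Sum>k\<in>T. fcoeff F k y * (if k = l then ?N else 0)) \<longlongrightarrow> integral cube (\<lambda>\<xi>. \<Sum>\<^sub>\<infinity>k\<in>S. ?f k \<xi>)) (finite_subsets_at_top S)"
    by (rule integral_has_limit[OF u c finite_subsets_at_top_neq_bot I])
  have ev: "\<forall>\<^sub>F T in finite_subsets_at_top S. (\<Sum>k\<in>T. fcoeff F k y * (if k = l then ?N else 0)) = (if l \<in> S then fcoeff F l y * ?N else 0)"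
  proof (cases "l \<in> S")
    case True
    then have "\<forall>\<^sub>F T in finite_subsets_at_top S. finite T \<and> {l} \<subseteq> T \<and> T \<subseteq> S"
      unfolding eventually_finite_subsets_at_top by (intro exI[of _ "{l}"]) simp
    then show ?thesis
      by eventually_elim (use True in \<open>auto simp: if_distrib cong: if_cong\<close>)
  next
    case False
    then show ?thesis
      by (intro eventually_finite_subsets_at_top_weakI) (auto intro!: sum.neutral)
  qed
  have "integral cube (\<lambda>\<xi>. \<Sum>\<^sub>\<infinity>k\<in>S. ?f k \<xi>) = (if l \<in> S then fcoeff F l y * ?N else 0)"
    by (rule tendsto_unique[OF finite_subsets_at_top_neq_bot lim tendsto_eventually[OF ev]])
  moreover have "(\<Sum>\<^sub>\<infinity>k\<in>S. ?f k \<xi>) = fproj S F (y, cvec \<xi>) * cis_k (- l) (cvec \<xi>)" for \<xi>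
    unfolding fproj_eq fst_conv snd_conv
    by (rule infsum_cmult_left')
  ultimately show ?thesis by (simp add: fcoeff_cis split: if_splits)
qed

text \<open>
  The difference \<open>F - \<Sum>\<^sub>k F\<^sub>k e\<^sup>i\<^sup>k\<^sup>x\<close> has no Fourier coefficients and so vanishes on real angles. A complex
  angle vector \<open>a + \<i> b\<close> lies on the complex line \<open>t \<mapsto> a + t b\<close>, whose real points are real angle
  vectors, and the identity theorem on this line gives the claim.
\<close>

theorem Fourier_inversion:
  assumes F: "holo_torus D r s F" and s: "0 < s" and M: "fnorm_le D r s F M" and p: "p \<in> phase_dom D r s"
  shows "fproj UNIV F p = F p"
proof -
  let ?G = "\<lambda>p. F p - fproj UNIV F p"
  note P = holo_torus_fproj[OF F s M, of UNIV]
  have G: "holo_torus D r s ?G" by (rule holo_torus_diff[OF F P])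
  obtain y x where pyx: "p = (y, x)" by (cases p)
  have y: "y \<in> cnbhd D r" and x: "x \<in> strip s" using p pyx by (simp_all add: mem_phase_dom)
  have real: "?G (y, cvec \<xi>) = 0" for \<xi>
  proof (rule zero_coeffs_imp_zero)
    have "integral cube (\<lambda>x. ?G (y, cvec x) * cis_k k (cvec x)) = 0" for k
    proof -
      have "fcoeff ?G (- k) y = 0"
        by (simp add: fcoeff_diff[OF F P y s] fcoeff_fproj[OF s M y])
      then show ?thesis by (simp add: fcoeff_cis)
    qed
    then show "zero_coeffs (\<lambda>\<xi>. ?G (y, cvec \<xi>))"
      unfolding zero_coeffs_def using continuous_on_slice[OF G y s] by blast
    show "?G (y, cvec (x + (\<chi> i. 2 * pi * of_int (m $ i)))) = ?G (y, cvec x)" for x m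
    proof -
      have "(y, cvec x) \<in> phase_dom D r s" using y cvec_strip[OF s] by (simp add: mem_phase_dom)
      then show ?thesis using G unfolding holo_torus_def cvec_add period_cvec[symmetric] by blast
    qed
  qed
  define a b where "a = (\<chi> i. Re (x $ i))" and "b = (\<chi> i. Im (x $ i))"
  define T where "T = {t. cvec a + t *s cvec b \<in> strip s}"
  have Teq: "T = (\<Inter>i. (\<lambda>t. Im t * b $ i) -` {-s<..<s})"
    by (auto simp: T_def strip_def cvec_def abs_less_iff) (force simp: minus_less_iff)+
  have lin: "linear (\<lambda>t. Im t * c)" for c
    by (rule bounded_linear.linear[OF bounded_linear_compose[OF bounded_linear_mult_left bounded_linear_Im]])
  have T1: "convex T" unfolding Teq by (intro convex_INT convex_linear_vimage lin convex_real_interval)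
  have T2: "open T" unfolding Teq
    by (intro open_INT finite ballI open_vimage open_greaterThanLessThan continuous_intros)
  have T3: "(\<lambda>t. ?G ((y, cvec a) + cscale t (0, cvec b))) holomorphic_on T"
    by (rule line_holomorphic[OF holo_torus_holo[OF G]]) (use y in \<open>simp add: mem_phase_dom T_def cscale_def\<close>)
  have T4: "of_real t \<in> T" for t
    using s by (simp add: T_def strip_def cvec_def)
  have T5: "(0 :: complex) islimpt range of_real"
    unfolding islimpt_sequential
  proof (intro exI conjI allI)
    show "of_real (inverse (real (Suc n))) \<in> range of_real - {0 :: complex}" for n
      by (rule DiffI[OF rangeI]) (simp del: of_nat_Suc)
    show "(\<lambda>n. of_real (inverse (real (Suc n)))) \<longlonglongrightarrow> (0 :: complex)"
      using tendsto_of_real[OF LIMSEQ_inverse_real_of_nat, where 'a=complex] by simp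
  qed
  have T6: "?G ((y, cvec a) + cscale t (0, cvec b)) = 0" if tr: "t \<in> range of_real" for t
  proof -
    obtain t' where "t = of_real t'" using tr by blast
    then have "(y, cvec a) + cscale t (0, cvec b) = (y, cvec (a + t' *\<^sub>R b))"
      by (simp add: cscale_def cvec_def vec_eq_iff)
    then show ?thesis using real by simp
  qed
  have x_eq: "cvec a + \<i> *s cvec b = x"
    by (simp add: a_def b_def cvec_def vec_eq_iff complex_eq[symmetric])
  have T7: "\<i> \<in> T" using x x_eq by (simp add: T_def)
  have "range of_real \<subseteq> T" using T4 by blast
  moreover have "0 \<in> T" using T4[of 0] by simp
  ultimately have "?G ((y, cvec a) + cscale \<i> (0, cvec b)) = 0"
    by (rule analytic_continuation[OF T3 T2 convex_connected[OF T1] _ _ T5 T6 T7])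
  moreover have "(y, cvec a) + cscale \<i> (0, cvec b) = p"
    using x_eq pyx by (simp add: cscale_def)
  ultimately show ?thesis by simp
qed

lemma fnorm_le_norm_le:
  assumes "holo_torus D r s F" "0 < s" "fnorm_le D r s F M" "p \<in> phase_dom D r s"
  shows "norm (F p) \<le> M"
  using norm_fproj_le[OF assms(3), of "fst p" "snd p" UNIV] assms(4) Fourier_inversion[OF assms] by simp

lemma fnorm_le_coeff_mono:
  assumes "fnorm_le D r s F M" "\<And>k y. y \<in> cnbhd D r \<Longrightarrow> norm (fcoeff G k y) \<le> c * norm (fcoeff F k y)" "0 \<le> c"
  shows "fnorm_le D r s G (c * M)"
  unfolding fnorm_le_def
proof (intro ballI allI impI)
  fix y T assume y: "y \<in> cnbhd D r" and T: "finite (T :: (int^'a) set)"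
  have "(\<Sum>k\<in>T. norm (fcoeff G k y) * exp (l1 k * s)) \<le> (\<Sum>k\<in>T. c * (norm (fcoeff F k y) * exp (l1 k * s)))"
    unfolding mult.assoc[symmetric] by (intro sum_mono mult_right_mono assms(2) y) simp
  also have "\<dots> = c * (\<Sum>k\<in>T. norm (fcoeff F k y) * exp (l1 k * s))" by (simp add: sum_distrib_left)
  also have "\<dots> \<le> c * M" using assms y T by (intro mult_left_mono) (auto simp: fnorm_le_def)
  finally show "(\<Sum>k\<in>T. norm (fcoeff G k y) * exp (l1 k * s)) \<le> c * M" .
qed

lemma fnorm_le_cmult: "fnorm_le D r s F M \<Longrightarrow> fnorm_le D r s (\<lambda>p. c * F p) (norm c * M)"
  by (erule fnorm_le_coeff_mono) (simp_all add: fcoeff_cmult_const norm_mult)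

lemma fnorm_le_add:
  assumes "holo_torus D r s F" "holo_torus D r s G" "0 < s" "fnorm_le D r s F M" "fnorm_le D r s G M'"
  shows "fnorm_le D r s (\<lambda>p. F p + G p) (M + M')"
  unfolding fnorm_le_def
proof (intro ballI allI impI)
  fix y T assume y: "y \<in> cnbhd D r" and T: "finite (T :: (int^'a) set)"
  have "(\<Sum>k\<in>T. norm (fcoeff (\<lambda>p. F p + G p) k y) * exp (l1 k * s)) \<le>
      (\<Sum>k\<in>T. norm (fcoeff F k y) * exp (l1 k * s) + norm (fcoeff G k y) * exp (l1 k * s))"
    unfolding fcoeff_add[OF assms(1,2) y assms(3)] ring_distribs[symmetric]
    by (intro sum_mono mult_right_mono norm_triangle_ineq) simp
  also have "\<dots> \<le> M + M'"
    unfolding sum.distrib using assms(4,5) y T by (intro add_mono) (auto simp: fnorm_le_def)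
  finally show "(\<Sum>k\<in>T. norm (fcoeff (\<lambda>p. F p + G p) k y) * exp (l1 k * s)) \<le> M + M'" .
qed

lemma
  assumes G: "\<And>m. holo_torus D r s (G m)" and s: "0 < s" and M: "\<And>m. fnorm_le D r s (G m) (B m)" and B: "summable B"
  shows holo_torus_suminf: "holo_torus D r s (\<lambda>p. \<Sum>m. G m p)"
    and fnorm_le_suminf: "fnorm_le D r s (\<lambda>p. \<Sum>m. G m p) (\<Sum>m. B m)"
proof -
  note bd = fnorm_le_norm_le[OF G s M]
  show "holo_torus D r s (\<lambda>p. \<Sum>m. G m p)"
    unfolding holo_torus_def using holo_series[OF open_phase_dom holo_torus_holo[OF G] bd B] G by (simp add: holo_torus_def)
  show "fnorm_le D r s (\<lambda>p. \<Sum>m. G m p) (\<Sum>m. B m)"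
    unfolding fnorm_le_def
  proof (intro ballI allI impI)
    fix y T assume y: "y \<in> cnbhd D r" and T: "finite (T :: (int^'a) set)"
    have sums: "(\<lambda>m. fcoeff (G m) k y) sums fcoeff (\<lambda>p. \<Sum>m. G m p) k y" for k
    proof -
      let ?f = "\<lambda>m \<xi>. G m (y, cvec \<xi>) * cis_k (- k) (cvec \<xi>)"
      have "norm (?f m \<xi>) \<le> B m" for m \<xi>
        using bd[of "(y, cvec \<xi>)" m] y cvec_strip[OF s, of \<xi>] by (simp add: norm_mult norm_cis_k_real mem_phase_dom)
      then have u: "uniform_limit cube (\<lambda>n \<xi>. \<Sum>m<n. ?f m \<xi>) (\<lambda>\<xi>. \<Sum>m. ?f m \<xi>) sequentially"
        by (intro Weierstrass_m_test[OF _ B])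
      have coeff_fun: "continuous_on cube (?f m)" for m by (intro continuous_intros continuous_on_slice[OF G y s])
      have "(\<lambda>n. \<Sum>m<n. integral cube (?f m)) \<longlonglongrightarrow> integral cube (\<lambda>\<xi>. \<Sum>m. ?f m \<xi>)"
        by (rule integral_has_limit[OF u])
           (auto intro!: continuous_on_sum coeff_fun integral_sum integrable_continuous)
      then have "(\<lambda>m. integral cube (?f m)) sums integral cube (\<lambda>\<xi>. \<Sum>m. ?f m \<xi>)" by (simp add: sums_def)
      moreover have "(\<Sum>m. ?f m \<xi>) = (\<Sum>m. G m (y, cvec \<xi>)) * cis_k (- k) (cvec \<xi>)" for \<xi>
      proof -
        have "summable (\<lambda>m. G m (y, cvec \<xi>))"
          by (rule summable_comparison_test'[OF B])
             (use bd[of "(y, cvec \<xi>)"] y cvec_strip[OF s, of \<xi>] in \<open>simp add: mem_phase_dom\<close>)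
        then show ?thesis by (rule suminf_mult2[symmetric])
      qed
      ultimately show ?thesis unfolding fcoeff_cis by (simp add: sums_divide)
    qed
    have bk: "norm (fcoeff (G m) k y) * exp (l1 k * s) \<le> B m" for m k
    proof -
      have "\<forall>T. finite T \<longrightarrow> (\<Sum>k\<in>T. norm (fcoeff (G m) k y) * exp (l1 k * s)) \<le> B m"
        using M[of m] y by (simp add: fnorm_le_def)
      from this[rule_format, of "{k}"] show ?thesis by simp
    qed
    have sn: "summable (\<lambda>m. norm (fcoeff (G m) k y) * exp (l1 k * s))" for k
      by (rule summable_comparison_test'[OF B]) (use bk in simp)
    have sn': "summable (\<lambda>m. norm (fcoeff (G m) k y))" for k
      using summable_mult2[OF sn[of k], of "exp (- l1 k * s)"] by (simp add: mult.assoc flip: exp_add)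
    have "(\<Sum>k\<in>T. norm (fcoeff (\<lambda>p. \<Sum>m. G m p) k y) * exp (l1 k * s)) \<le>
        (\<Sum>k\<in>T. \<Sum>m. norm (fcoeff (G m) k y) * exp (l1 k * s))"
    proof (rule sum_mono)
      fix k
      have "norm (fcoeff (\<lambda>p. \<Sum>m. G m p) k y) \<le> (\<Sum>m. norm (fcoeff (G m) k y))"
        unfolding sums_unique[OF sums] by (rule summable_norm[OF sn'])
      then have "norm (fcoeff (\<lambda>p. \<Sum>m. G m p) k y) * exp (l1 k * s) \<le> (\<Sum>m. norm (fcoeff (G m) k y)) * exp (l1 k * s)"
        by (rule mult_right_mono) simp
      also have "\<dots> = (\<Sum>m. norm (fcoeff (G m) k y) * exp (l1 k * s))" by (rule suminf_mult2[OF sn'])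
      finally show "norm (fcoeff (\<lambda>p. \<Sum>m. G m p) k y) * exp (l1 k * s) \<le> (\<Sum>m. norm (fcoeff (G m) k y) * exp (l1 k * s))" .
    qed
    also have "\<dots> = (\<Sum>m. \<Sum>k\<in>T. norm (fcoeff (G m) k y) * exp (l1 k * s))"
      by (rule suminf_sum[OF sn, symmetric])
    also have "\<dots> \<le> (\<Sum>m. B m)"
      by (intro suminf_le summable_sum sn B) (use M y T in \<open>simp add: fnorm_le_def\<close>)
    finally show "(\<Sum>k\<in>T. norm (fcoeff (\<lambda>p. \<Sum>m. G m p) k y) * exp (l1 k * s)) \<le> (\<Sum>m. B m)" .
  qed
qed

lemma fnorm_le_iff: "0 \<le> M \<Longrightarrow> fnorm D r s F \<le> ennreal M \<longleftrightarrow> fnorm_le D r s F M"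
proof -
  assume M: "0 \<le> M"
  have "fnorm D r s F \<le> ennreal M \<longleftrightarrow>
    (\<forall>y\<in>cnbhd D r. \<forall>T. finite T \<longrightarrow> (\<Sum>k\<in>T. ennreal (norm (fcoeff F k y) * exp (l1 k * s))) \<le> ennreal M)"
    unfolding fnorm_def SUP_le_iff by (subst nonneg_infsum_complete) (auto simp: SUP_le_iff)
  also have "\<dots> \<longleftrightarrow> fnorm_le D r s F M"
    unfolding fnorm_le_def using M by (simp add: sum_ennreal)
  finally show ?thesis .
qed

section \<open>Poisson brackets in the weighted Fourier norm\<close>

definition coeff_deriv :: "('n::finite phase \<Rightarrow> complex) \<Rightarrow> int^'n \<Rightarrow> complex^'n \<Rightarrow> complex^'n \<Rightarrow> complex" where
  "coeff_deriv F k y v = fcoeff (\<lambda>p. dd F p (v, 0)) k y"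

lemma dd_coeff_fun_coeff_deriv:
  assumes "holo_torus D r s F" "0 < s" "fst p \<in> cnbhd D r"
  shows "dd (coeff_fun F k) p v = coeff_deriv F k (fst p) (fst v)"
  unfolding coeff_deriv_def by (rule dd_coeff_fun[OF assms])

lemma coeff_deriv_lin:
  assumes F: "holo_torus D r s F" "0 < s" and y: "y \<in> cnbhd D r"
  shows "coeff_deriv F k y 0 = 0" "coeff_deriv F k y (c *s v) = c * coeff_deriv F k y v"
    "coeff_deriv F k y (\<Sum>i\<in>A. f i) = (\<Sum>i\<in>A. coeff_deriv F k y (f i))"
proof -
  have eq: "coeff_deriv F k y v = dd (coeff_fun F k) (y, 0) (v, 0)" for v
    using dd_coeff_fun_coeff_deriv[OF F, of "(y, 0)"] y by simp
  note h = holo_coeff_fun[OF F, of k]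
  have p: "(y, 0) \<in> cnbhd D r \<times> (UNIV :: (complex^'a) set)" using y by simp
  show "coeff_deriv F k y 0 = 0" unfolding eq using dd_lin(4)[OF h p] by (simp add: zero_prod_def)
  have "dd (coeff_fun F k) (y, 0) (cscale c (v, 0)) = c * dd (coeff_fun F k) (y, 0) (v, 0)"
    by (rule holo_has_dd(2)[OF h p])
  then show "coeff_deriv F k y (c *s v) = c * coeff_deriv F k y v" unfolding eq by (simp add: cscale_def)
  have "(\<Sum>i\<in>A. (f i, 0 :: complex^'a)) = (\<Sum>i\<in>A. f i, 0)"
    by (simp add: prod_eq_iff fst_sum snd_sum)
  then show "coeff_deriv F k y (\<Sum>i\<in>A. f i) = (\<Sum>i\<in>A. coeff_deriv F k y (f i))"
    unfolding eq using dd_lin(5)[OF h p, of "\<lambda>i. (f i, 0)" A] by simp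
qed

text \<open>
  The Cauchy estimate, applied to the scalar function obtained by pairing the coefficients with
  the weights \<open>e\<^bsup>\<bar>k\<bar>\<^sub>1 s\<^esup>\<close> times the phases that make all terms of the derivative positive.
\<close>

lemma fnorm_le_coeff_deriv:
  assumes F: "holo_torus D r s F" "0 < s" and M: "fnorm_le D r s F M" and y: "y \<in> cnbhd D (r - \<rho>)" and \<rho>: "0 < \<rho>" and T: "finite T"
  shows "(\<Sum>k\<in>T. norm (coeff_deriv F k y v) * exp (l1 k * s)) \<le> M * norm v / \<rho>"
proof -
  have yr: "y \<in> cnbhd D r" using y cnbhd_mono[of "r - \<rho>" r D] \<rho> by auto
  show ?thesis
  proof (cases "v = 0")
    case True
    then show ?thesis by (simp add: coeff_deriv_lin(1)[OF F yr])
  next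
    case False
    define c where "c k = of_real (exp (l1 k * s)) * cnj (sgn (coeff_deriv F k y v))" for k
    let ?W = "cnbhd D r \<times> (UNIV :: (complex^'a) set)"
    let ?\<Phi> = "\<lambda>p. \<Sum>k\<in>T. c k * coeff_fun F k p"
    have h: "holo ?W (\<lambda>p. c k * coeff_fun F k p)" for k by (rule holo_cmult(1)[OF holo_coeff_fun[OF F]])
    have p: "(y, 0) \<in> ?W" using yr by simp
    have "dd ?\<Phi> (y, 0) (v, 0) = (\<Sum>k\<in>T. c k * coeff_deriv F k y v)"
      unfolding holo_sum(2)[of T ?W "\<lambda>k p. c k * coeff_fun F k p", OF h p]
      using holo_cmult(2)[OF holo_coeff_fun[OF F] p] dd_coeff_fun_coeff_deriv[OF F, of "(y, 0)"] yr by simp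
    also have "\<dots> = (\<Sum>k\<in>T. of_real (norm (coeff_deriv F k y v) * exp (l1 k * s)))"
    proof (rule sum.cong[OF refl])
      fix k
      have "cnj (sgn z) * z = of_real (norm z)" for z :: complex
        by (cases "z = 0") (simp_all add: sgn_eq field_simps complex_norm_square[symmetric] power2_eq_square)
      then show "c k * coeff_deriv F k y v = of_real (norm (coeff_deriv F k y v) * exp (l1 k * s))"
        by (simp add: c_def mult_ac)
    qed
    finally have eq: "dd ?\<Phi> (y, 0) (v, 0) = of_real (\<Sum>k\<in>T. norm (coeff_deriv F k y v) * exp (l1 k * s))" by simp
    have "norm (dd ?\<Phi> (y, 0) (v, 0)) \<le> M / (\<rho> / norm v)"
    proof (rule cauchy_bound[OF holo_sum(1)[OF h]])
      show "0 < \<rho> / norm v" using \<rho> False by simp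
      have mem: "y + t *s v \<in> cnbhd D r" if "norm t \<le> \<rho> / norm v" for t :: complex
        by (rule cnbhd_add[OF y]) (use that False in \<open>simp add: norm_vec_cmult field_simps\<close>)
      show "(y, 0) + cscale t (v, 0) \<in> ?W" if "norm t \<le> \<rho> / norm v" for t
        using mem[OF that] by (simp add: cscale_def)
      fix t :: complex assume t: "norm t = \<rho> / norm v"
      have "norm (?\<Phi> ((y, 0) + cscale t (v, 0))) \<le> (\<Sum>k\<in>T. norm (c k) * norm (fcoeff F k (y + t *s v)))"
        by (rule order_trans[OF norm_sum]) (simp add: norm_mult coeff_fun_def cscale_def)
      also have "\<dots> \<le> (\<Sum>k\<in>T. norm (fcoeff F k (y + t *s v)) * exp (l1 k * s))"
        by (intro sum_mono) (simp add: c_def norm_mult norm_sgn mult.commute)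
      also have "\<dots> \<le> M"
        using M[unfolded fnorm_le_def, rule_format, OF mem[of t] T] t by simp
      finally show "norm (?\<Phi> ((y, 0) + cscale t (v, 0))) \<le> M" .
    qed
    then show ?thesis unfolding eq norm_of_real by (simp add: sum_nonneg abs_of_nonneg)
  qed
qed

lemma mult_exp_neg_le: "0 < \<sigma> \<Longrightarrow> t * exp (- (t * \<sigma>)) \<le> 1 / (exp 1 * \<sigma>)" for t \<sigma> :: real
proof -
  assume \<sigma>: "0 < \<sigma>"
  have "t * \<sigma> \<le> exp (t * \<sigma> - 1)" using exp_ge_add_one_self[of "t * \<sigma> - 1"] by simp
  then have "t * \<sigma> * exp (- (t * \<sigma>)) \<le> exp (t * \<sigma> - 1) * exp (- (t * \<sigma>))" by (intro mult_right_mono) simp_all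
  also have "\<dots> = 1 / exp 1" by (simp add: exp_diff exp_minus)
  finally show ?thesis using \<sigma> by (simp add: field_simps)
qed

lemma fnorm_le_weighted_length:
  assumes M: "fnorm_le D r s F M" and y: "y \<in> cnbhd D r" and \<sigma>: "0 < \<sigma>" and T: "finite T"
  shows "(\<Sum>k\<in>T. l1 k * (norm (fcoeff F k y) * exp (l1 k * (s - \<sigma>)))) \<le> M / (exp 1 * \<sigma>)"
proof -
  have "(\<Sum>k\<in>T. l1 k * (norm (fcoeff F k y) * exp (l1 k * (s - \<sigma>)))) \<le>
      (\<Sum>k\<in>T. 1 / (exp 1 * \<sigma>) * (norm (fcoeff F k y) * exp (l1 k * s)))"
  proof (rule sum_mono)
    fix k
    have "l1 k * (norm (fcoeff F k y) * exp (l1 k * (s - \<sigma>))) = (l1 k * exp (- (l1 k * \<sigma>))) * (norm (fcoeff F k y) * exp (l1 k * s))"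
      by (simp add: right_diff_distrib exp_diff exp_minus divide_inverse)
    also have "\<dots> \<le> 1 / (exp 1 * \<sigma>) * (norm (fcoeff F k y) * exp (l1 k * s))"
      by (intro mult_right_mono mult_exp_neg_le[OF \<sigma>]) simp
    finally show "l1 k * (norm (fcoeff F k y) * exp (l1 k * (s - \<sigma>))) \<le> 1 / (exp 1 * \<sigma>) * (norm (fcoeff F k y) * exp (l1 k * s))" .
  qed
  also have "\<dots> = 1 / (exp 1 * \<sigma>) * (\<Sum>k\<in>T. norm (fcoeff F k y) * exp (l1 k * s))" by (simp add: sum_distrib_left)
  also have "\<dots> \<le> 1 / (exp 1 * \<sigma>) * M"
    using M y T \<sigma> by (intro mult_left_mono) (auto simp: fnorm_le_def)
  finally show ?thesis by simp
qed

lemma holo_torus_ham: "holo_torus D r s \<phi> \<Longrightarrow> holo_torus D r s (ham \<phi> a)"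
  unfolding ham_def[abs_def] by (intro holo_torus_cmult holo_torus_pd)

lemma holo_torus_Lie: "(\<And>a. holo_torus D r s (X a)) \<Longrightarrow> holo_torus D r s F \<Longrightarrow> holo_torus D r s (Lie X F)"
  unfolding Lie_def[abs_def] by (intro holo_torus_sum holo_torus_mult holo_torus_pd)

text \<open>
  Generating functions have finitely many modes, so that their Hamiltonian field and its brackets are
  finite sums and no interchange of limits is needed.
\<close>

definition trig_poly :: "(real^'n) set \<Rightarrow> real \<Rightarrow> real \<Rightarrow> (int^'n) set \<Rightarrow> ('n::finite phase \<Rightarrow> complex) \<Rightarrow> bool" where
  "trig_poly D r s S \<phi> \<longleftrightarrow> finite S \<and> holo_torus D r s \<phi> \<and> 0 < s \<and>
     (\<forall>p\<in>phase_dom D r s. \<phi> p = (\<Sum>l\<in>S. coeff_fun \<phi> l p * cis_k l (snd p)))"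

lemma dd_trig_poly:
  assumes "trig_poly D r s S \<phi>" and p: "p \<in> phase_dom D r s"
  shows "dd \<phi> p v = (\<Sum>l\<in>S. cis_k l (snd p) * (\<i> * kdot l (snd v) * coeff_fun \<phi> l p + coeff_deriv \<phi> l (fst p) (fst v)))"
proof -
  have t: "finite S" "holo_torus D r s \<phi>" "0 < s" "\<And>q. q \<in> phase_dom D r s \<Longrightarrow> \<phi> q = (\<Sum>l\<in>S. coeff_fun \<phi> l q * cis_k l (snd q))"
    using assms by (auto simp: trig_poly_def)
  have y: "fst p \<in> cnbhd D r" using p by (simp add: mem_phase_dom(2))
  note c = holo_torus_holo[OF holo_torus_coeff_fun[OF t(2,3), of s]]
  have "dd \<phi> p v = dd (\<lambda>p. \<Sum>l\<in>S. coeff_fun \<phi> l p * cis_k l (snd p)) p v"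
    by (rule dd_cong[OF open_phase_dom t(4) p])
  also have "\<dots> = (\<Sum>l\<in>S. dd (\<lambda>p. coeff_fun \<phi> l p * cis_k l (snd p)) p v)"
    by (rule holo_sum(2)[of S "phase_dom D r s" "\<lambda>l p. coeff_fun \<phi> l p * cis_k l (snd p)", OF holo_mult(1)[OF c holo_cis] p])
  also have "\<dots> = (\<Sum>l\<in>S. cis_k l (snd p) * (\<i> * kdot l (snd v) * coeff_fun \<phi> l p + coeff_deriv \<phi> l (fst p) (fst v)))"
    by (intro sum.cong refl, subst holo_mult(2)[OF c holo_cis p])
       (simp add: dd_cis dd_coeff_fun_coeff_deriv[OF t(2,3) y] algebra_simps)
  finally show ?thesis .
qed

lemma ham_trig_poly:
  assumes "trig_poly D r s S \<phi>" and p: "p \<in> phase_dom D r s"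
  shows "ham \<phi> (Inl i) p = (\<Sum>l\<in>S. cis_k l (snd p) * (\<i> * of_int (l $ i) * coeff_fun \<phi> l p))"
    "ham \<phi> (Inr i) p = - (\<Sum>l\<in>S. cis_k l (snd p) * coeff_deriv \<phi> l (fst p) (unit_vec i))"
proof -
  have t: "holo_torus D r s \<phi>" "0 < s" using assms by (auto simp: trig_poly_def)
  have y: "fst p \<in> cnbhd D r" using p by (simp add: mem_phase_dom(2))
  show "ham \<phi> (Inl i) p = (\<Sum>l\<in>S. cis_k l (snd p) * (\<i> * of_int (l $ i) * coeff_fun \<phi> l p))"
    by (simp add: ham_def conj_sign_def conj_index_def pd_def dd_trig_poly[OF assms] coord_vec_def coeff_deriv_lin(1)[OF t y] kdot_simps flip: unit_vec_def)
  show "ham \<phi> (Inr i) p = - (\<Sum>l\<in>S. cis_k l (snd p) * coeff_deriv \<phi> l (fst p) (unit_vec i))"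
    by (simp add: ham_def conj_sign_def conj_index_def pd_def dd_trig_poly[OF assms] coord_vec_def kdot_simps flip: unit_vec_def)
qed

lemma vec_unit_vec_expand: "v = (\<Sum>i\<in>UNIV. (v $ i) *s unit_vec i)"
  by (simp add: vec_eq_iff unit_vec_def axis_def if_distrib cong: if_cong)

lemma Lie_ham_trig_poly:
  assumes \<phi>: "trig_poly D r s S \<phi>" and F: "holo_torus D r s F" and p: "p \<in> phase_dom D r s"
  shows "Lie (ham \<phi>) F p = (\<Sum>l\<in>S. cis_k l (snd p) * (\<i> * coeff_fun \<phi> l p * dd F p (kvec l, 0)
           - (\<Sum>i\<in>UNIV. coeff_deriv \<phi> l (fst p) (unit_vec i) * dd F p (0, unit_vec i))))"
proof -
  note lin = dd_expand[OF holo_torus_holo[OF F] p]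
  have kv: "dd F p (kvec l, 0) = (\<Sum>i\<in>UNIV. of_int (l $ i) * pd (Inl i) F p)" for l
    by (simp add: lin sum_UNIV_Plus coord_def kvec_def)
  have "Lie (ham \<phi>) F p = (\<Sum>i\<in>UNIV. ham \<phi> (Inl i) p * pd (Inl i) F p) + (\<Sum>i\<in>UNIV. ham \<phi> (Inr i) p * pd (Inr i) F p)"
    by (simp add: Lie_def sum_UNIV_Plus)
  also have "(\<Sum>i\<in>UNIV. ham \<phi> (Inl i) p * pd (Inl i) F p) = (\<Sum>l\<in>S. cis_k l (snd p) * (\<i> * coeff_fun \<phi> l p * dd F p (kvec l, 0)))"
    unfolding ham_trig_poly[OF \<phi> p] kv sum_distrib_left sum_distrib_right
    by (subst sum.swap) (simp add: mult_ac)
  also have "(\<Sum>i\<in>UNIV. ham \<phi> (Inr i) p * pd (Inr i) F p) = (\<Sum>l\<in>S. - (cis_k l (snd p) * (\<Sum>i\<in>UNIV. coeff_deriv \<phi> l (fst p) (unit_vec i) * dd F p (0, unit_vec i))))"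
    unfolding ham_trig_poly[OF \<phi> p] sum_distrib_left sum_distrib_right pd_def coord_vec_def unit_vec_def sum_negf
    by (subst sum.swap) (simp add: sum_distrib_left mult_ac sum_negf)
  finally show ?thesis
    by (simp add: right_diff_distrib sum_subtractf sum_negf)
qed

text \<open>
  The bracket as a convolution over the modes of \<open>\<phi>\<close>, where a derivative in the angles becomes a
  multiplication by the mode, so that only derivatives of coefficients in the direction of modes remain.
\<close>

lemma fcoeff_Lie_ham:
  assumes \<phi>: "trig_poly D r s S \<phi>" and F: "holo_torus D r s F" and y: "y \<in> cnbhd D r"
  shows "fcoeff (Lie (ham \<phi>) F) k y =
     (\<Sum>l\<in>S. \<i> * (fcoeff \<phi> l y * coeff_deriv F (k - l) y (kvec l) - coeff_deriv \<phi> l y (kvec (k - l)) * fcoeff F (k - l) y))"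
proof -
  have t: "holo_torus D r s \<phi>" "0 < s" using \<phi> by (auto simp: trig_poly_def)
  have pdcf: "holo_torus D r s (\<lambda>p. coeff_deriv \<phi> l (fst p) v)" for l v
    using holo_torus_coeff_fun[OF holo_torus_dd[OF t(1), of "(v, 0)"] t(2), of s l] by (simp add: coeff_fun_def[abs_def] coeff_deriv_def)
  let ?in = "\<lambda>l p. \<i> * coeff_fun \<phi> l p * dd F p (kvec l, 0) - (\<Sum>i\<in>UNIV. coeff_deriv \<phi> l (fst p) (unit_vec i) * dd F p (0, unit_vec i))"
  have p1: "holo_torus D r s (\<lambda>p. \<i> * coeff_fun \<phi> l p * dd F p (kvec l, 0))" for l
    by (intro holo_torus_mult holo_torus_const holo_torus_coeff_fun[OF t] holo_torus_dd[OF F])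
  have p2: "holo_torus D r s (\<lambda>p. coeff_deriv \<phi> l (fst p) (unit_vec i) * dd F p (0, unit_vec i))" for l i
    by (intro holo_torus_mult pdcf holo_torus_dd[OF F])
  have pin: "holo_torus D r s (?in l)" for l
    by (intro holo_torus_diff holo_torus_sum p1 p2)
  have "fcoeff (Lie (ham \<phi>) F) k y = fcoeff (\<lambda>p. \<Sum>l\<in>S. cis_k l (snd p) * ?in l p) k y"
    by (rule fcoeff_cong, rule Lie_ham_trig_poly[OF \<phi> F]) (use y cvec_strip[OF t(2)] in \<open>simp add: mem_phase_dom\<close>)
  also have "\<dots> = (\<Sum>l\<in>S. fcoeff (?in l) (k - l) y)"
    by (subst fcoeff_sum[OF holo_torus_mult[OF holo_torus_cis pin] y t(2)]) (simp add: fcoeff_shift)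
  also have "\<dots> = (\<Sum>l\<in>S. \<i> * (fcoeff \<phi> l y * coeff_deriv F (k - l) y (kvec l) - coeff_deriv \<phi> l y (kvec (k - l)) * fcoeff F (k - l) y))"
  proof (rule sum.cong[OF refl])
    fix l
    define m where "m = k - l"
    let ?m = m
    have "fcoeff (\<lambda>p. \<i> * coeff_fun \<phi> l p * dd F p (kvec l, 0)) ?m y = \<i> * fcoeff \<phi> l y * coeff_deriv F ?m y (kvec l)"
      unfolding coeff_fun_def coeff_deriv_def by (rule fcoeff_cmult[where a="\<lambda>y. \<i> * fcoeff \<phi> l y"])
    moreover have "fcoeff (\<lambda>p. \<Sum>i\<in>UNIV. coeff_deriv \<phi> l (fst p) (unit_vec i) * dd F p (0, unit_vec i)) ?m y
       = (\<Sum>i\<in>UNIV. coeff_deriv \<phi> l y (unit_vec i) * (\<i> * of_int (?m $ i) * fcoeff F ?m y))"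
      by (subst fcoeff_sum[OF p2 y t(2)])
         (simp add: fcoeff_cmult[where a="\<lambda>y. coeff_deriv \<phi> l y (unit_vec _)"] fcoeff_angle_derivative[OF F y t(2)])
    moreover have "coeff_deriv \<phi> l y (kvec ?m) = (\<Sum>i\<in>UNIV. of_int (?m $ i) * coeff_deriv \<phi> l y (unit_vec i))"
      by (subst vec_unit_vec_expand[of "kvec ?m"]) (simp add: coeff_deriv_lin(2,3)[OF t y] kvec_def)
    ultimately show "fcoeff (?in l) (k - l) y = \<i> * (fcoeff \<phi> l y * coeff_deriv F (k - l) y (kvec l) - coeff_deriv \<phi> l y (kvec (k - l)) * fcoeff F (k - l) y)"
      unfolding m_def[symmetric] fcoeff_diff[OF p1 holo_torus_sum[OF p2] y t(2)]
      by (simp add: right_diff_distrib sum_distrib_left sum_distrib_right mult_ac)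
  qed
  finally show ?thesis .
qed

text \<open>
  The index pairs \<open>(l, k - l)\<close> are distinct, so that a convolution sum is part of a full double sum.
\<close>

lemma sum_difference_le:
  fixes g :: "int^'n \<Rightarrow> int^'n \<Rightarrow> real"
  assumes "finite T" "finite S" "\<And>l m. 0 \<le> g l m"
  shows "(\<Sum>k\<in>T. \<Sum>l\<in>S. g l (k - l)) \<le> (\<Sum>l\<in>S. \<Sum>m\<in>(\<lambda>(k, l). k - l) ` (T \<times> S). g l m)"
proof -
  have "(\<Sum>k\<in>T. \<Sum>l\<in>S. g l (k - l)) = (\<Sum>l\<in>S. \<Sum>k\<in>T. g l (k - l))" by (rule sum.swap)
  also have "\<dots> \<le> (\<Sum>l\<in>S. \<Sum>m\<in>(\<lambda>(k, l). k - l) ` (T \<times> S). g l m)"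
  proof (rule sum_mono)
    fix l assume l: "l \<in> S"
    have "(\<Sum>k\<in>T. g l (k - l)) = (\<Sum>m\<in>(\<lambda>k. k - l) ` T. g l m)"
      by (subst sum.reindex) (auto simp: inj_on_def)
    also have "\<dots> \<le> (\<Sum>m\<in>(\<lambda>(k, l). k - l) ` (T \<times> S). g l m)"
      by (rule sum_mono2) (use assms l in auto)
    finally show "(\<Sum>k\<in>T. g l (k - l)) \<le> (\<Sum>m\<in>(\<lambda>(k, l). k - l) ` (T \<times> S). g l m)" .
  qed
  finally show ?thesis .
qed

text \<open>
  The basic estimate. In the bracket the mode \<open>l\<close> of \<open>\<phi>\<close> and the mode \<open>m\<close> of \<open>F\<close> interact through \<open>l \<cdot> \<partial>\<^sub>y F\<^sub>m\<close>
  and \<open>m \<cdot> \<partial>\<^sub>y \<phi>\<^sub>l\<close>. The first is controlled by the Cauchy estimate for \<open>F\<close> in the actions and the length of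
  \<open>l\<close>, collected in \<open>A\<close>; the second by the loss of angle width of \<open>F\<close>, which pays for \<open>\<bar>m\<bar>\<^sub>1\<close>, and by \<open>B\<close>.
  Only \<open>F\<close> loses domain here, and \<open>A\<close> and \<open>B\<close> are the fixed bounds on the field. This is what later lets a
  function with a larger domain be bracketed cheaply.
\<close>

lemma fnorm_le_Lie_ham:
  assumes \<phi>: "trig_poly D r\<phi> s\<phi> S \<phi>" and F: "holo_torus D ra sa F" and M: "fnorm_le D ra sa F M"
    and dom: "r \<le> r\<phi>" "s \<le> s\<phi>" "r \<le> ra - \<rho>" "s \<le> sa - \<sigma>" and pos: "0 < \<rho>" "0 < \<sigma>" "0 < s"
    and A: "\<And>y. y \<in> cnbhd D r \<Longrightarrow> (\<Sum>l\<in>S. l1 l * (norm (fcoeff \<phi> l y) * exp (l1 l * s))) \<le> A"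
    and B: "\<And>y v. y \<in> cnbhd D r \<Longrightarrow> (\<Sum>l\<in>S. norm (coeff_deriv \<phi> l y v) * exp (l1 l * s)) \<le> B * norm v"
    and B0: "0 \<le> B"
  shows "fnorm_le D r s (Lie (ham \<phi>) F) ((A / \<rho> + B / (exp 1 * \<sigma>)) * M)"
  unfolding fnorm_le_def
proof (intro ballI allI impI)
  fix y T assume y: "y \<in> cnbhd D r" and T: "finite (T :: (int^'a) set)"
  define r0 where "r0 = min r\<phi> ra"
  have ra: "s < sa" "r < ra" using dom pos by linarith+
  have \<phi>': "trig_poly D r s S \<phi>"
    using \<phi> dom pos holo_torus_mono[of D r\<phi> s\<phi> \<phi> r s] phase_dom_mono[of r r\<phi> s s\<phi> D] by (auto simp: trig_poly_def)
  have S: "finite S" using \<phi> by (simp add: trig_poly_def)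
  have F': "holo_torus D r s F" using holo_torus_mono[OF F] ra by simp
  have Fs: "holo_torus D ra s F" using holo_torus_mono[OF F] ra by simp
  have Ms: "fnorm_le D ra s F M" using fnorm_le_mono[OF M] ra by simp
  let ?e = "\<lambda>k. exp (l1 k * s)"
  let ?T = "(\<lambda>(k, l). k - l) ` (T \<times> S)"
  have finT: "finite ?T" using T S by simp
  have yra: "y \<in> cnbhd D (ra - \<rho>)" using y cnbhd_mono[OF dom(3)] by blast
  have yra': "y \<in> cnbhd D ra" using y cnbhd_mono[of r ra D] ra by auto
  let ?u = "\<lambda>l m. (norm (fcoeff \<phi> l y) * ?e l) * (norm (coeff_deriv F m y (kvec l)) * ?e m)"
  let ?w = "\<lambda>l m. (norm (coeff_deriv \<phi> l y (kvec m)) * ?e l) * (norm (fcoeff F m y) * ?e m)"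
  have trm: "norm (fcoeff (Lie (ham \<phi>) F) k y) * ?e k \<le> (\<Sum>l\<in>S. ?u l (k - l) + ?w l (k - l))" for k
  proof -
    have "norm (fcoeff (Lie (ham \<phi>) F) k y) * ?e k \<le> (\<Sum>l\<in>S. norm (\<i> * (fcoeff \<phi> l y * coeff_deriv F (k - l) y (kvec l) - coeff_deriv \<phi> l y (kvec (k - l)) * fcoeff F (k - l) y))) * ?e k"
      unfolding fcoeff_Lie_ham[OF \<phi>' F' y] by (intro mult_right_mono norm_sum) simp
    also have "\<dots> \<le> (\<Sum>l\<in>S. ?u l (k - l) + ?w l (k - l))"
      unfolding sum_distrib_right
    proof (rule sum_mono)
      fix l assume "l \<in> S"
      have "l1 k \<le> l1 l + l1 (k - l)" using int_l1norm_triangle[of l "k - l"] by simp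
      then have "l1 k * s \<le> l1 l * s + l1 (k - l) * s"
        using pos(3) mult_right_mono[of "l1 k" "l1 l + l1 (k - l)" s] by (simp add: ring_distribs)
      then have ek: "?e k \<le> ?e l * ?e (k - l)" by (simp flip: exp_add)
      have "norm (\<i> * (fcoeff \<phi> l y * coeff_deriv F (k - l) y (kvec l) - coeff_deriv \<phi> l y (kvec (k - l)) * fcoeff F (k - l) y)) * ?e k
        \<le> (norm (fcoeff \<phi> l y) * norm (coeff_deriv F (k - l) y (kvec l)) + norm (coeff_deriv \<phi> l y (kvec (k - l))) * norm (fcoeff F (k - l) y)) * (?e l * ?e (k - l))"
        by (rule mult_mono[OF _ ek]) (auto simp: norm_mult intro: order_trans[OF norm_triangle_ineq4])
      then show "norm (\<i> * (fcoeff \<phi> l y * coeff_deriv F (k - l) y (kvec l) - coeff_deriv \<phi> l y (kvec (k - l)) * fcoeff F (k - l) y)) * ?e k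
        \<le> ?u l (k - l) + ?w l (k - l)"
        by (simp add: ring_distribs mult_ac)
    qed
    finally show ?thesis .
  qed
  have "(\<Sum>k\<in>T. norm (fcoeff (Lie (ham \<phi>) F) k y) * ?e k) \<le> (\<Sum>k\<in>T. \<Sum>l\<in>S. ?u l (k - l) + ?w l (k - l))"
    by (rule sum_mono) (rule trm)
  also have "\<dots> \<le> (\<Sum>l\<in>S. \<Sum>m\<in>?T. ?u l m + ?w l m)"
    by (rule sum_difference_le[OF T S]) simp
  also have "\<dots> = (\<Sum>l\<in>S. (norm (fcoeff \<phi> l y) * ?e l) * (\<Sum>m\<in>?T. norm (coeff_deriv F m y (kvec l)) * ?e m))
      + (\<Sum>m\<in>?T. (\<Sum>l\<in>S. norm (coeff_deriv \<phi> l y (kvec m)) * ?e l) * (norm (fcoeff F m y) * ?e m))"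
    by (simp add: sum.distrib sum_distrib_left sum_distrib_right sum.swap[of _ ?T])
  also have "\<dots> \<le> A / \<rho> * M + B / (exp 1 * \<sigma>) * M"
  proof (rule add_mono)
    have "(\<Sum>l\<in>S. (norm (fcoeff \<phi> l y) * ?e l) * (\<Sum>m\<in>?T. norm (coeff_deriv F m y (kvec l)) * ?e m)) \<le>
       (\<Sum>l\<in>S. (norm (fcoeff \<phi> l y) * ?e l) * (M * l1 l / \<rho>))"
    proof (intro sum_mono mult_left_mono)
      fix l
      have "(\<Sum>m\<in>?T. norm (coeff_deriv F m y (kvec l)) * ?e m) \<le> M * norm (kvec l) / \<rho>"
        by (rule fnorm_le_coeff_deriv[OF Fs pos(3) Ms yra pos(1) finT])
      also have "\<dots> \<le> M * l1 l / \<rho>"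
        by (intro divide_right_mono mult_left_mono norm_kvec fnorm_le_pos[OF M yra']) (use pos in simp)
      finally show "(\<Sum>m\<in>?T. norm (coeff_deriv F m y (kvec l)) * ?e m) \<le> M * l1 l / \<rho>" .
    qed simp
    also have "\<dots> = (\<Sum>l\<in>S. l1 l * (norm (fcoeff \<phi> l y) * ?e l)) * (M / \<rho>)"
      unfolding sum_distrib_right by (intro sum.cong refl) simp
    also have "\<dots> \<le> A * (M / \<rho>)"
      by (intro mult_right_mono A[OF y] divide_nonneg_pos fnorm_le_pos[OF M yra'] pos)
    finally show "(\<Sum>l\<in>S. (norm (fcoeff \<phi> l y) * ?e l) * (\<Sum>m\<in>?T. norm (coeff_deriv F m y (kvec l)) * ?e m)) \<le> A / \<rho> * M"
      by simp
    have "(\<Sum>m\<in>?T. (\<Sum>l\<in>S. norm (coeff_deriv \<phi> l y (kvec m)) * ?e l) * (norm (fcoeff F m y) * ?e m))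
       \<le> (\<Sum>m\<in>?T. (B * l1 m) * (norm (fcoeff F m y) * exp (l1 m * (sa - \<sigma>))))"
    proof (intro sum_mono mult_mono mult_left_mono)
      fix m
      have "(\<Sum>l\<in>S. norm (coeff_deriv \<phi> l y (kvec m)) * ?e l) \<le> B * norm (kvec m)" by (rule B[OF y])
      also have "\<dots> \<le> B * l1 m" by (intro mult_left_mono norm_kvec B0)
      finally show "(\<Sum>l\<in>S. norm (coeff_deriv \<phi> l y (kvec m)) * ?e l) \<le> B * l1 m" .
      show "?e m \<le> exp (l1 m * (sa - \<sigma>))"
        using dom(4) int_l1norm_nonneg[of m] by (simp add: mult_left_mono)
      show "0 \<le> B * l1 m" using B0 int_l1norm_nonneg[of m] by simp
    qed simp_all
    also have "\<dots> = B * (\<Sum>m\<in>?T. l1 m * (norm (fcoeff F m y) * exp (l1 m * (sa - \<sigma>))))"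
      by (simp add: sum_distrib_left mult_ac)
    also have "\<dots> \<le> B * (M / (exp 1 * \<sigma>))"
      by (intro mult_left_mono fnorm_le_weighted_length[OF M yra' pos(2) finT] B0)
    finally show "(\<Sum>m\<in>?T. (\<Sum>l\<in>S. norm (coeff_deriv \<phi> l y (kvec m)) * ?e l) * (norm (fcoeff F m y) * ?e m)) \<le> B / (exp 1 * \<sigma>) * M"
      by simp
  qed
  finally show "(\<Sum>k\<in>T. norm (fcoeff (Lie (ham \<phi>) F) k y) * ?e k) \<le> (A / \<rho> + B / (exp 1 * \<sigma>)) * M"
    by (simp add: ring_distribs)
qed

section \<open>Reality\<close>

lemma DERIV_in_Reals:
  fixes g :: "complex \<Rightarrow> complex"
  assumes d: "(g has_field_derivative d) (at 0)" and g: "\<And>t::real. 0 \<le> t \<Longrightarrow> t < e \<Longrightarrow> g (of_real t) \<in> \<real>" and e: "0 < e"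
  shows "d \<in> \<real>"
proof -
  have "((\<lambda>h. (g (0 + h) - g 0) / h) \<longlongrightarrow> d) (at 0)"
    using d by (simp add: DERIV_def)
  moreover have "filterlim (\<lambda>n. of_real (inverse (real (Suc n))) :: complex) (at 0) sequentially"
    unfolding filterlim_at
    using tendsto_of_real[OF LIMSEQ_inverse_real_of_nat, where 'a=complex] by (simp del: of_nat_Suc)
  ultimately have lim: "(\<lambda>n. (g (0 + of_real (inverse (real (Suc n)))) - g 0) / of_real (inverse (real (Suc n)))) \<longlonglongrightarrow> d"
    by (rule filterlim_compose)
  have "\<forall>\<^sub>F n in sequentially. inverse (real (Suc n)) < e"
    using order_tendstoD(2)[OF LIMSEQ_inverse_real_of_nat e] .
  then have "\<forall>\<^sub>F n in sequentially. (g (0 + of_real (inverse (real (Suc n)))) - g 0) / of_real (inverse (real (Suc n))) \<in> \<real>"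
  proof eventually_elim
    case (elim n)
    have "g (of_real (inverse (real (Suc n)))) \<in> \<real>" by (rule g) (use elim in simp_all)
    moreover have "g 0 \<in> \<real>" using g[of 0] e by simp
    ultimately show ?case by (intro Reals_divide Reals_diff Reals_of_real) simp_all
  qed
  then show ?thesis
    by (rule Lim_in_closed_set[OF closed_complex_Reals _ sequentially_bot lim])
qed

text \<open>
  At a real point the derivative is a limit of difference quotients along a real direction.
\<close>

lemma real_torus_pd:
  assumes F: "holo_torus D r s F" and R: "real_torus D r s F"
  shows "real_torus D r s (pd a F)"
  unfolding real_torus_def
proof (intro allI impI, elim conjE)
  fix y x assume p: "(y, x) \<in> phase_dom D r s" and yx: "real_vec y" "real_vec x"
  let ?g = "\<lambda>t. F ((y, x) + cscale t (coord_vec a))"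
  have der: "(?g has_field_derivative pd a F (y, x)) (at 0)"
    using holo_line[OF holo_torus_holo[OF F], of "(y, x)" 0 "coord_vec a"] p by (simp add: pd_def)
  obtain d where d: "d > 0" "ball (y, x) d \<subseteq> phase_dom D r s"
    using open_phase_dom p open_contains_ball by blast
  define e where "e = d / (norm (coord_vec a) + 1)"
  have e: "0 < e" using d by (simp add: e_def add_nonneg_pos)
  have real: "?g (of_real t) \<in> \<real>" if t: "0 \<le> t" "t < e" for t :: real
  proof -
    have "t * norm (coord_vec a) \<le> t * (norm (coord_vec a) + 1)" using t by (intro mult_left_mono) simp_all
    also have "\<dots> < d"
    proof -
      have "0 < norm (coord_vec a) + 1" by (simp add: add_nonneg_pos)
      then show ?thesis using t(2) unfolding e_def by (simp only: pos_less_divide_eq)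
    qed
    finally have "(y, x) + cscale (of_real t) (coord_vec a) \<in> ball (y, x) d"
      using t by (simp add: dist_norm norm_cscale)
    then have dom: "(y, x) + cscale (of_real t) (coord_vec a) \<in> phase_dom D r s" using d by blast
    have "real_vec (fst (coord_vec a))" "real_vec (snd (coord_vec a))"
      by (auto simp: real_vec_def coord_vec_def axis_def split: sum.split)
    then have "real_vec (fst ((y, x) + cscale (of_real t) (coord_vec a)))" "real_vec (snd ((y, x) + cscale (of_real t) (coord_vec a)))"
      using yx by (auto simp: real_vec_def scaleR_conv_of_real[where 'a=complex] intro!: Reals_add Reals_mult)
    then show ?thesis
      using R dom unfolding real_torus_def by (metis prod.collapse)
  qed
  show "pd a F (y, x) \<in> \<real>" by (rule DERIV_in_Reals[OF der real e])
qed

lemma real_torus_mult: "real_torus D r s F \<Longrightarrow> real_torus D r s G \<Longrightarrow> real_torus D r s (\<lambda>p. F p * G p)"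
  and real_torus_add: "real_torus D r s F \<Longrightarrow> real_torus D r s G \<Longrightarrow> real_torus D r s (\<lambda>p. F p + G p)"
  and real_torus_diff: "real_torus D r s F \<Longrightarrow> real_torus D r s G \<Longrightarrow> real_torus D r s (\<lambda>p. F p - G p)"
  by (simp_all add: real_torus_def)

lemma real_torus_cmult: "real_torus D r s F \<Longrightarrow> real_torus D r s (\<lambda>p. of_real c * F p)"
  by (simp add: real_torus_def)

lemma real_torus_sum: "(\<And>i. i \<in> A \<Longrightarrow> real_torus D r s (F i)) \<Longrightarrow> real_torus D r s (\<lambda>p. \<Sum>i\<in>A. F i p)"
  by (simp add: real_torus_def sum_in_Reals)

lemma real_torus_ham: "holo_torus D r s \<phi> \<Longrightarrow> real_torus D r s \<phi> \<Longrightarrow> real_torus D r s (ham \<phi> a)"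
  using real_torus_cmult[OF real_torus_pd, of D r s \<phi> "case a of Inl _ \<Rightarrow> 1 | Inr _ \<Rightarrow> - 1" "conj_index a"]
  by (simp add: ham_def[abs_def] conj_sign_def split: sum.splits)

lemma real_torus_Lie:
  "(\<And>a. real_torus D r s (X a)) \<Longrightarrow> holo_torus D r s F \<Longrightarrow> real_torus D r s F \<Longrightarrow> real_torus D r s (Lie X F)"
  unfolding Lie_def[abs_def] by (intro real_torus_sum real_torus_mult real_torus_pd)

lemma suminf_in_Reals:
  fixes f :: "nat \<Rightarrow> complex"
  assumes "summable f" "\<And>m. f m \<in> \<real>" shows "suminf f \<in> \<real>"
proof -
  have "(\<lambda>m. Im (f m)) sums Im (suminf f)" by (intro sums_Im summable_sums assms)
  moreover have "Im (f m) = 0" for m using assms(2) complex_is_Real_iff by blast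
  ultimately have "Im (suminf f) = 0" using sums_unique2[OF _ sums_zero] by simp
  then show ?thesis by (simp add: complex_is_Real_iff)
qed

section \<open>Symplectic maps between complex domains\<close>

lemma map_has_derivative:
  fixes \<Psi> :: "'n::finite phase \<Rightarrow> 'n phase"
  assumes "\<And>a. ((\<lambda>q. coord a (\<Psi> q)) has_derivative f' a) (at p)"
  shows "(\<Psi> has_derivative (\<lambda>v. of_coords (\<lambda>a. f' a v))) (at p)"
proof -
  have v: "((\<lambda>q. \<chi> i. f i q) has_derivative (\<lambda>v. \<chi> i. f' i v)) (at p)"
    if "\<And>i. (f i has_derivative f' i) (at p)" for f :: "'n \<Rightarrow> 'n phase \<Rightarrow> complex" and f'
    by (subst has_derivative_componentwise_within) 
       (use that in \<open>auto simp: Basis_vec_def inner_axis intro!: derivative_eq_intros\<close>)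
  have "((\<lambda>q. of_coords (\<lambda>a. coord a (\<Psi> q))) has_derivative (\<lambda>v. of_coords (\<lambda>a. f' a v))) (at p)"
    unfolding of_coords_def by (intro has_derivative_Pair v assms)
  moreover have "(\<lambda>q. of_coords (\<lambda>a. coord a (\<Psi> q))) = \<Psi>"
    by (rule ext, rule phase_eqI) simp
  ultimately show ?thesis by simp
qed

lemma holo_compose_map:
  fixes \<Psi> :: "'n::finite phase \<Rightarrow> 'n phase"
  assumes F: "holo W F" and \<Psi>: "\<And>a. holo V (\<lambda>q. coord a (\<Psi> q))" and sub: "\<And>q. q \<in> V \<Longrightarrow> \<Psi> q \<in> W"
  shows "holo V (\<lambda>q. F (\<Psi> q))"
  unfolding holo_def
proof
  fix p assume p: "p \<in> V"
  let ?L = "\<lambda>v. of_coords (\<lambda>a. dd (\<lambda>q. coord a (\<Psi> q)) p v)"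
  have d: "(\<Psi> has_derivative ?L) (at p)"
    by (rule map_has_derivative) (rule holo_has_dd(1)[OF \<Psi> p])
  have "((\<lambda>q. F (\<Psi> q)) has_derivative (\<lambda>v. dd F (\<Psi> p) (?L v))) (at p)"
    by (rule has_derivative_compose[OF d holo_has_dd(1)[OF F sub[OF p]]])
  moreover have "?L (cscale c v) = cscale c (?L v)" for c v
    by (rule phase_eqI) (simp add: holo_has_dd(2)[OF \<Psi> p])
  then have "\<forall>c v. dd F (\<Psi> p) (?L (cscale c v)) = c * dd F (\<Psi> p) (?L v)"
    by (simp add: holo_has_dd(2)[OF F sub[OF p]])
  ultimately show "\<exists>L. ((\<lambda>q. F (\<Psi> q)) has_derivative L) (at p) \<and> (\<forall>c v. L (cscale c v) = c * L v)" by blast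
qed

text \<open>
  A symplectic change of variables from the domain with widths \<open>r'\<close>, \<open>s'\<close> into the one with widths \<open>r\<close>, \<open>s\<close>,
  with displacement at most \<open>dy\<close> in the actions and \<open>dx\<close> in the angles. Displacements add under
  composition.
\<close>

definition symplectic_map :: "(real^'n) set \<Rightarrow> real \<Rightarrow> real \<Rightarrow> real \<Rightarrow> real \<Rightarrow> ('n::finite phase \<Rightarrow> 'n phase) \<Rightarrow> real \<Rightarrow> real \<Rightarrow> bool" where
  "symplectic_map D r s r' s' \<Psi> dy dx \<longleftrightarrow> symplectic_change D r' s' \<Psi> \<and> (\<forall>p\<in>phase_dom D r' s'. \<Psi> p \<in> phase_dom D r s) \<and>
     (\<forall>p\<in>phase_dom D r' s'. l1norm (fst (\<Psi> p) - fst p) \<le> dy \<and> (\<forall>i. norm (snd (\<Psi> p) $ i - snd p $ i) \<le> dx))"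

lemma symplectic_changeD:
  assumes "symplectic_change D r s \<Psi>"
  shows "holo_torus D r s (\<lambda>p. fst (\<Psi> p) $ i)" "real_torus D r s (\<lambda>p. fst (\<Psi> p) $ i)"
    "holo_torus D r s (\<lambda>p. snd (\<Psi> p) $ i - snd p $ i)" "real_torus D r s (\<lambda>p. snd (\<Psi> p) $ i - snd p $ i)"
  using assms unfolding symplectic_change_def real_analytic_torus_iff by blast+

lemma symplectic_change_holo:
  assumes "symplectic_change D r s \<Psi>"
  shows "holo (phase_dom D r s) (\<lambda>p. coord a (\<Psi> p))"
proof (cases a)
  case (Inl i)
  then show ?thesis using holo_torus_holo[OF symplectic_changeD(1)[OF assms]] by (simp add: coord_def)
next
  case (Inr i)
  have "holo (phase_dom D r s) (\<lambda>p. (snd (\<Psi> p) $ i - snd p $ i) + coord (Inr i) p)"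
    by (rule holo_add(1)[OF holo_torus_holo[OF symplectic_changeD(3)[OF assms]] holo_coord])
  then show ?thesis using Inr by (simp add: coord_def)
qed

lemma symplectic_change_period:
  assumes "symplectic_change D r s \<Psi>" "(y, x) \<in> phase_dom D r s"
  shows "\<Psi> (y, x + period m) = (fst (\<Psi> (y, x)), snd (\<Psi> (y, x)) + period m)"
proof -
  have "fst (\<Psi> (y, x + period m)) $ i = fst (\<Psi> (y, x)) $ i" for i
    using symplectic_changeD(1)[OF assms(1), of i] assms(2) by (simp add: holo_torus_def)
  moreover have "snd (\<Psi> (y, x + period m)) $ i = snd (\<Psi> (y, x)) $ i + period m $ i" for i
    using symplectic_changeD(3)[OF assms(1), of i] assms(2) by (simp add: holo_torus_def algebra_simps)
  ultimately show ?thesis by (simp add: prod_eq_iff vec_eq_iff)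
qed

lemma symplectic_change_real:
  assumes "symplectic_change D r s \<Psi>" "(y, x) \<in> phase_dom D r s" "real_vec y" "real_vec x"
  shows "real_vec (fst (\<Psi> (y, x)))" "real_vec (snd (\<Psi> (y, x)))"
proof -
  show "real_vec (fst (\<Psi> (y, x)))"
    using symplectic_changeD(2)[OF assms(1)] assms(2-4) by (simp add: real_torus_def real_vec_def)
  have "(snd (\<Psi> (y, x)) $ i - x $ i) + x $ i \<in> \<real>" for i
    using symplectic_changeD(4)[OF assms(1), of i] assms(2-4)
    by (intro Reals_add) (simp_all add: real_torus_def real_vec_def)
  then show "real_vec (snd (\<Psi> (y, x)))" by (simp add: real_vec_def)
qed

lemma
  assumes \<Psi>: "symplectic_map D r s r' s' \<Psi> dy dx"
  shows holo_torus_compose: "holo_torus D r s F \<Longrightarrow> holo_torus D r' s' (\<lambda>p. F (\<Psi> p))"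
    and real_torus_compose: "real_torus D r s F \<Longrightarrow> real_torus D r' s' (\<lambda>p. F (\<Psi> p))"
proof -
  have sc: "symplectic_change D r' s' \<Psi>" and sub: "\<And>p. p \<in> phase_dom D r' s' \<Longrightarrow> \<Psi> p \<in> phase_dom D r s"
    using \<Psi> by (simp_all add: symplectic_map_def)
  show "holo_torus D r' s' (\<lambda>p. F (\<Psi> p))" if F: "holo_torus D r s F"
    unfolding holo_torus_def
  proof (intro conjI allI impI)
    show "holo (phase_dom D r' s') (\<lambda>p. F (\<Psi> p))"
      by (rule holo_compose_map[OF holo_torus_holo[OF F] symplectic_change_holo[OF sc] sub])
    fix y x and m :: "int^'a" assume p: "(y, x) \<in> phase_dom D r' s'"
    have "(fst (\<Psi> (y, x)), snd (\<Psi> (y, x))) \<in> phase_dom D r s" using sub[OF p] by simp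
    then have "F (fst (\<Psi> (y, x)), snd (\<Psi> (y, x)) + period m) = F (fst (\<Psi> (y, x)), snd (\<Psi> (y, x)))"
      using F unfolding holo_torus_def by blast
    then show "F (\<Psi> (y, x + period m)) = F (\<Psi> (y, x))"
      by (simp add: symplectic_change_period[OF sc p])
  qed
  show "real_torus D r' s' (\<lambda>p. F (\<Psi> p))" if F: "real_torus D r s F"
    unfolding real_torus_def
  proof (intro allI impI, elim conjE)
    fix y x assume p: "(y, x) \<in> phase_dom D r' s'" "real_vec y" "real_vec x"
    have "(fst (\<Psi> (y, x)), snd (\<Psi> (y, x))) \<in> phase_dom D r s" using sub[OF p(1)] by simp
    then have "F (fst (\<Psi> (y, x)), snd (\<Psi> (y, x))) \<in> \<real>"
      using F symplectic_change_real[OF sc p] unfolding real_torus_def by blast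
    then show "F (\<Psi> (y, x)) \<in> \<real>" by simp
  qed
qed

lemma l1norm_triangle: "l1norm (a + b) \<le> l1norm a + l1norm b"
  unfolding l1norm_def sum.distrib[symmetric] by (intro sum_mono) (simp add: norm_triangle_ineq)

lemma symplectic_map_compose:
  assumes \<Psi>: "symplectic_map D r s r' s' \<Psi> dy dx" and \<Phi>: "symplectic_map D r' s' r'' s'' \<Phi> dy' dx'"
  shows "symplectic_map D r s r'' s'' (\<lambda>p. \<Psi> (\<Phi> p)) (dy + dy') (dx + dx')"
proof -
  have sc: "symplectic_change D r' s' \<Psi>" "symplectic_change D r'' s'' \<Phi>"
    and sub: "\<And>p. p \<in> phase_dom D r' s' \<Longrightarrow> \<Psi> p \<in> phase_dom D r s" "\<And>p. p \<in> phase_dom D r'' s'' \<Longrightarrow> \<Phi> p \<in> phase_dom D r' s'"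
    and b: "\<And>p. p \<in> phase_dom D r' s' \<Longrightarrow> l1norm (fst (\<Psi> p) - fst p) \<le> dy"
      "\<And>p i. p \<in> phase_dom D r' s' \<Longrightarrow> norm (snd (\<Psi> p) $ i - snd p $ i) \<le> dx"
      "\<And>p. p \<in> phase_dom D r'' s'' \<Longrightarrow> l1norm (fst (\<Phi> p) - fst p) \<le> dy'"
      "\<And>p i. p \<in> phase_dom D r'' s'' \<Longrightarrow> norm (snd (\<Phi> p) $ i - snd p $ i) \<le> dx'"
    using \<Psi> \<Phi> by (simp_all add: symplectic_map_def)
  have sum: "snd (\<Psi> (\<Phi> p)) $ i - snd p $ i = (snd (\<Psi> (\<Phi> p)) $ i - snd (\<Phi> p) $ i) + (snd (\<Phi> p) $ i - snd p $ i)" for p i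
    by simp
  have "symplectic_change D r'' s'' (\<lambda>p. \<Psi> (\<Phi> p))"
    unfolding symplectic_change_def real_analytic_torus_iff
  proof (intro conjI allI ballI)
    fix i
    show "holo_torus D r'' s'' (\<lambda>p. fst (\<Psi> (\<Phi> p)) $ i)"
      by (rule holo_torus_compose[OF \<Phi> symplectic_changeD(1)[OF sc(1)]])
    show "real_torus D r'' s'' (\<lambda>p. fst (\<Psi> (\<Phi> p)) $ i)"
      by (rule real_torus_compose[OF \<Phi> symplectic_changeD(2)[OF sc(1)]])
    show "holo_torus D r'' s'' (\<lambda>p. snd (\<Psi> (\<Phi> p)) $ i - snd p $ i)"
      unfolding sum by (rule holo_torus_add[OF holo_torus_compose[OF \<Phi> symplectic_changeD(3)[OF sc(1)]] symplectic_changeD(3)[OF sc(2)]])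
    show "real_torus D r'' s'' (\<lambda>p. snd (\<Psi> (\<Phi> p)) $ i - snd p $ i)"
      unfolding sum by (rule real_torus_add[OF real_torus_compose[OF \<Phi> symplectic_changeD(4)[OF sc(1)]] symplectic_changeD(4)[OF sc(2)]])
  next
    have i: "inj_on \<Phi> (phase_dom D r'' s'')" "inj_on \<Psi> (phase_dom D r' s')"
      using sc by (simp_all add: symplectic_change_def)
    have "\<Phi> ` phase_dom D r'' s'' \<subseteq> phase_dom D r' s'" using sub(2) by (rule image_subsetI)
    then have "inj_on (\<Psi> \<circ> \<Phi>) (phase_dom D r'' s'')"
      by (rule comp_inj_on[OF i(1) inj_on_subset[OF i(2)]])
    then show "inj_on (\<lambda>p. \<Psi> (\<Phi> p)) (phase_dom D r'' s'')" by (simp add: o_def)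
  next
    fix p assume p: "p \<in> phase_dom D r'' s''"
    obtain L where L: "(\<Phi> has_derivative L) (at p)" "\<And>u v. symp_form (L u) (L v) = symp_form u v"
      using sc(2) p unfolding symplectic_change_def by blast
    obtain L' where L': "(\<Psi> has_derivative L') (at (\<Phi> p))" "\<And>u v. symp_form (L' u) (L' v) = symp_form u v"
      using sc(1) sub(2)[OF p] unfolding symplectic_change_def by blast
    show "\<exists>L. ((\<lambda>p. \<Psi> (\<Phi> p)) has_derivative L) (at p) \<and> (\<forall>u v. symp_form (L u) (L v) = symp_form u v)"
      using has_derivative_compose[OF L(1) L'(1)] L(2) L'(2) by (intro exI[of _ "\<lambda>v. L' (L v)"]) simp
  qed
  moreover have "l1norm (fst (\<Psi> (\<Phi> p)) - fst p) \<le> dy + dy'" if p: "p \<in> phase_dom D r'' s''" for p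
  proof -
    have "l1norm ((fst (\<Psi> (\<Phi> p)) - fst (\<Phi> p)) + (fst (\<Phi> p) - fst p)) \<le> dy + dy'"
      by (rule order_trans[OF l1norm_triangle add_mono[OF b(1)[OF sub(2)[OF p]] b(3)[OF p]]])
    then show ?thesis by simp
  qed
  moreover have "norm (snd (\<Psi> (\<Phi> p)) $ i - snd p $ i) \<le> dx + dx'" if p: "p \<in> phase_dom D r'' s''" for p i
    unfolding sum by (rule order_trans[OF norm_triangle_ineq add_mono[OF b(2)[OF sub(2)[OF p]] b(4)[OF p]]])
  ultimately show ?thesis
    using sub by (simp add: symplectic_map_def)
qed

section \<open>One step of the normal form\<close>

lemma norm_vec_le_of_sums:
  assumes "(\<Sum>i\<in>UNIV. norm (z $ i)) \<le> A" shows "norm (z :: complex^'n) \<le> A"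
  using norm_le_sum_cmod[of z] assms by simp

text \<open>
  This reduces bounds on the \<open>\<ell>\<^sup>1\<close> norm of a vector-valued function to bounds on scalar functions.
\<close>

lemma sum_norm_eq_unimodular:
  fixes z :: "'n::finite \<Rightarrow> complex"
  obtains c where "\<And>i. norm (c i) \<le> 1" "(\<Sum>i\<in>UNIV. c i * z i) = of_real (\<Sum>i\<in>UNIV. norm (z i))"
proof -
  have "cnj (sgn w) * w = of_real (norm w)" for w :: complex
    by (cases "w = 0") (simp_all add: sgn_eq field_simps complex_norm_square[symmetric] power2_eq_square)
  then show ?thesis by (intro that[of "\<lambda>i. cnj (sgn (z i))"]) (simp_all add: norm_sgn)
qed

text \<open>
  Along the segment from \<open>q\<close> to \<open>q + v\<close> Cauchy's estimate bounds the derivative by \<open>M / (R - 1)\<close>, as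
  discs of radius \<open>R - 1\<close> around its points stay in the domain.
\<close>

lemma mean_value_line:
  assumes G: "holo W G" and R: "1 < R" and mem: "\<And>t. norm t \<le> R \<Longrightarrow> q + cscale t v \<in> W" and M: "\<And>p. p \<in> W \<Longrightarrow> norm (G p) \<le> M"
  shows "norm (G (q + v) - G q) \<le> M / (R - 1)"
proof -
  have d: "((\<lambda>t. G (q + cscale t v)) has_field_derivative dd G (q + cscale t v) v) (at t within cball 0 1)" if "t \<in> cball 0 1" for t
    by (rule has_field_derivative_at_within[OF holo_line[OF G mem]]) (use that R in simp)
  have b: "norm (dd G (q + cscale t v) v) \<le> M / (R - 1)" if "t \<in> cball 0 1" for t
  proof -
    have mem': "q + cscale t v + cscale u v \<in> W" if "norm u \<le> R - 1" for u
    proof -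
      have "norm (t + u) \<le> R" using norm_triangle_ineq[of t u] that \<open>t \<in> cball 0 1\<close> by simp
      from mem[OF this] show ?thesis by (simp add: cscale_add_left add.assoc)
    qed
    show ?thesis by (rule cauchy_bound[OF G _ mem' M[OF mem']]) (use R in simp_all)
  qed
  have "norm (G (q + cscale 1 v) - G (q + cscale 0 v)) \<le> M / (R - 1) * norm (1 - 0 :: complex)"
    by (rule field_differentiable_bound[OF convex_cball d b]) simp_all
  then show ?thesis by simp
qed

lemma holo_torus_cong: "(\<And>p. p \<in> phase_dom D r s \<Longrightarrow> F p = G p) \<Longrightarrow> holo_torus D r s F \<Longrightarrow> holo_torus D r s G"
proof -
  assume eq: "\<And>p. p \<in> phase_dom D r s \<Longrightarrow> F p = G p" and F: "holo_torus D r s F"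
  have "holo (phase_dom D r s) G" by (rule holo_cong[OF open_phase_dom eq holo_torus_holo[OF F]])
  moreover have "G (y, x + period m) = G (y, x)" if "(y, x) \<in> phase_dom D r s" for y x m
    using F that eq[of "(y, x)"] eq[of "(y, x + period m)"] by (simp add: holo_torus_def mem_phase_dom)
  ultimately show ?thesis by (simp add: holo_torus_def)
qed

lemma real_torus_cong: "(\<And>p. p \<in> phase_dom D r s \<Longrightarrow> F p = G p) \<Longrightarrow> real_torus D r s F \<Longrightarrow> real_torus D r s G"
  by (simp add: real_torus_def)

text \<open>
  One step: \<open>\<phi>\<close> is the generating function, \<open>P\<close> its norm, and \<open>\<rho>\<close>, \<open>\<sigma>\<close> are the losses of width. The domain is
  shrunk three times by this amount: the field is bounded on the first smaller domain, the Lie series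
  converge on the second, and the time-one map is injective on the third. The number \<open>\<kappa>\<close> is the ratio of
  the convergent geometric series.
\<close>

locale nf_step =
  fixes D :: "(real^'n::finite) set" and r s \<rho> \<sigma> P \<kappa> :: real and S :: "(int^'n) set" and \<phi> :: "'n phase \<Rightarrow> complex"
  assumes \<phi>: "trig_poly D r s S \<phi>" and \<phi>_real: "real_torus D r s \<phi>" and P: "fnorm_le D r s \<phi> P"
    and pos: "0 < \<rho>" "0 < \<sigma>" "0 \<le> P" and \<kappa>: "\<kappa> = 2 * P / (\<rho> * \<sigma>)" "\<kappa> \<le> 1 / 8"
    and room: "3 * \<sigma> < s"
begin

abbreviation "X \<equiv> ham \<phi>"
text \<open>
  Bounds of the action and angle components of the field: \<open>\<partial>\<phi> / \<partial>x\<close> costs \<open>1 / (e \<sigma>)\<close> and \<open>\<partial>\<phi> / \<partial>y\<close> costs \<open>1 / \<rho>\<close>.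
\<close>

abbreviation "A \<equiv> P / (exp 1 * \<sigma>)"
abbreviation "B \<equiv> P / \<rho>"

lemma \<kappa>_pos: "0 \<le> \<kappa>" using \<kappa> pos by simp

lemma AB: "A \<le> \<kappa> / 2 * \<rho>" "B = \<kappa> / 2 * \<sigma>" "0 \<le> A" "0 \<le> B" "A / \<rho> + B / (exp 1 * \<sigma>) = \<kappa> / exp 1"
proof -
  have "P * 1 \<le> P * exp 1" using pos by (intro mult_left_mono) simp_all
  then show "A \<le> \<kappa> / 2 * \<rho>" using pos by (simp add: \<kappa> field_simps)
qed (use pos in \<open>simp_all add: \<kappa> field_simps\<close>)

lemma trig_poly_facts: "holo_torus D r s \<phi>" "0 < s" "finite S" using \<phi> by (simp_all add: trig_poly_def)

lemma doms: "r - \<rho> \<le> r" "s - \<sigma> \<le> s" "0 < s - \<sigma>" "0 < s - 2 * \<sigma>" "r - 2 * \<rho> \<le> r - \<rho>" "s - 2 * \<sigma> \<le> s - \<sigma>"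
  using pos room by auto

lemma holo_torus_X: "holo_torus D (r - \<rho>) (s - \<sigma>) (X a)"
  by (rule holo_torus_mono[OF holo_torus_ham[OF trig_poly_facts(1)]]) (use doms in auto)

lemma real_torus_X: "real_torus D (r - \<rho>) (s - \<sigma>) (X a)"
  by (rule real_torus_mono[OF real_torus_ham[OF trig_poly_facts(1) \<phi>_real]]) (use doms in auto)

lemma A_bound: "y \<in> cnbhd D (r - \<rho>) \<Longrightarrow> finite T \<Longrightarrow> (\<Sum>l\<in>T. l1 l * (norm (fcoeff \<phi> l y) * exp (l1 l * (s - \<sigma>)))) \<le> A"
  by (rule fnorm_le_weighted_length[OF P]) (use pos cnbhd_mono[OF doms(1)] in auto)

lemma B_bound: "y \<in> cnbhd D (r - \<rho>) \<Longrightarrow> finite T \<Longrightarrow> (\<Sum>l\<in>T. norm (coeff_deriv \<phi> l y v) * exp (l1 l * (s - \<sigma>))) \<le> B * norm v"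
  using fnorm_le_coeff_deriv[OF holo_torus_mono[OF trig_poly_facts(1) order_refl doms(2)] doms(3) fnorm_le_mono[OF P order_refl doms(2) order_refl] _ pos(1), of y T v]
  by simp

text \<open>
  For all weights \<open>c\<close> of modulus at most \<open>1\<close> the bound \<open>A\<close> holds for the sum over all actions at once, because
  \<open>\<Sum>\<^sub>i \<bar>l\<^sub>i\<bar> = \<bar>l\<bar>\<^sub>1\<close>. A separate bound for each component would lose a factor of the dimension.
\<close>

lemma fnorm_le_X_action:
  assumes c: "\<And>i. norm (c i) \<le> 1"
  shows "fnorm_le D (r - \<rho>) (s - \<sigma>) (\<lambda>p. \<Sum>i\<in>UNIV. c i * X (Inl i) p) A"
  unfolding fnorm_le_def
proof (intro ballI allI impI)
  fix y T assume y: "y \<in> cnbhd D (r - \<rho>)" and T: "finite (T :: (int^'n) set)"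
  have yr: "y \<in> cnbhd D r" using y cnbhd_mono[OF doms(1)] by blast
  have "norm (fcoeff (\<lambda>p. \<Sum>i\<in>UNIV. c i * X (Inl i) p) l y) \<le> l1 l * norm (fcoeff \<phi> l y)" for l
  proof -
    have X: "X (Inl i) = (\<lambda>p. dd \<phi> p (0, unit_vec i))" for i
      by (simp add: ham_def[abs_def] conj_sign_def conj_index_def pd_def coord_vec_def unit_vec_def)
    have "fcoeff (\<lambda>p. \<Sum>i\<in>UNIV. c i * X (Inl i) p) l y = (\<Sum>i\<in>UNIV. c i * (\<i> * of_int (l $ i) * fcoeff \<phi> l y))"
      by (subst fcoeff_sum[OF holo_torus_cmult[OF holo_torus_X] y doms(3)])
         (simp add: fcoeff_cmult_const X fcoeff_angle_derivative[OF trig_poly_facts(1) yr trig_poly_facts(2)])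
    also have "norm \<dots> \<le> (\<Sum>i\<in>UNIV. \<bar>of_int (l $ i)\<bar> * norm (fcoeff \<phi> l y))"
      by (rule order_trans[OF norm_sum sum_mono]) (simp add: norm_mult mult_left_le_one_le c)
    finally show ?thesis by (simp add: int_l1norm_def sum_distrib_right)
  qed
  then have "(\<Sum>l\<in>T. norm (fcoeff (\<lambda>p. \<Sum>i\<in>UNIV. c i * X (Inl i) p) l y) * exp (l1 l * (s - \<sigma>)))
     \<le> (\<Sum>l\<in>T. l1 l * (norm (fcoeff \<phi> l y) * exp (l1 l * (s - \<sigma>))))"
    unfolding mult.assoc[symmetric] by (intro sum_mono mult_right_mono) simp_all
  also have "\<dots> \<le> A" by (rule A_bound[OF y T])
  finally show "(\<Sum>l\<in>T. norm (fcoeff (\<lambda>p. \<Sum>i\<in>UNIV. c i * X (Inl i) p) l y) * exp (l1 l * (s - \<sigma>))) \<le> A" .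
qed

lemma fnorm_le_X_angle: "fnorm_le D (r - \<rho>) (s - \<sigma>) (X (Inr i)) B"
  unfolding fnorm_le_def
proof (intro ballI allI impI)
  fix y T assume y: "y \<in> cnbhd D (r - \<rho>)" and T: "finite (T :: (int^'n) set)"
  have X: "X (Inr i) = (\<lambda>p. - 1 * dd \<phi> p (unit_vec i, 0))"
    by (simp add: ham_def[abs_def] conj_sign_def conj_index_def pd_def coord_vec_def unit_vec_def)
  have "fcoeff (X (Inr i)) l y = - coeff_deriv \<phi> l y (unit_vec i)" for l
    unfolding X fcoeff_cmult_const coeff_deriv_def by simp
  then have "(\<Sum>l\<in>T. norm (fcoeff (X (Inr i)) l y) * exp (l1 l * (s - \<sigma>))) \<le> B * norm (unit_vec i :: complex^'n)"
    using B_bound[OF y T, of "unit_vec i"] by simp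
  also have "norm (unit_vec i :: complex^'n) = 1"
    by (simp add: unit_vec_def norm_vec_def L2_set_def axis_def if_distrib if_distribR cong: if_cong)
  finally show "(\<Sum>l\<in>T. norm (fcoeff (X (Inr i)) l y) * exp (l1 l * (s - \<sigma>))) \<le> B" by simp
qed

lemma X_action_bound:
  assumes q: "q \<in> phase_dom D (r - \<rho>) (s - \<sigma>)"
  shows "(\<Sum>i\<in>UNIV. norm (X (Inl i) q)) \<le> A"
proof -
  obtain c where c: "\<And>i. norm (c i) \<le> 1" "(\<Sum>i\<in>UNIV. c i * X (Inl i) q) = of_real (\<Sum>i\<in>UNIV. norm (X (Inl i) q))"
    using sum_norm_eq_unimodular[of "\<lambda>i. X (Inl i) q"] by blast
  have "norm (\<Sum>i\<in>UNIV. c i * X (Inl i) q) \<le> A"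
    by (rule fnorm_le_norm_le[OF holo_torus_sum[OF holo_torus_cmult[OF holo_torus_X]] doms(3) fnorm_le_X_action[OF c(1)] q])
  then show ?thesis unfolding c(2) norm_of_real by simp
qed

lemma X_angle_bound: "q \<in> phase_dom D (r - \<rho>) (s - \<sigma>) \<Longrightarrow> norm (X (Inr i) q) \<le> B"
  by (rule fnorm_le_norm_le[OF holo_torus_X doms(3) fnorm_le_X_angle])

lemma fnorm_le_Lie_from:
  assumes F: "holo_torus D ra sa F" and M: "fnorm_le D ra sa F M" and d: "0 < \<delta>" "0 < \<delta>'" "r' \<le> ra - \<delta>" "s' \<le> sa - \<delta>'"
    and r': "r' \<le> r - \<rho>" "s' \<le> s - \<sigma>" "0 < s'"
  shows "fnorm_le D r' s' (Lie X F) ((A / \<delta> + B / (exp 1 * \<delta>')) * M)"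
proof (rule fnorm_le_Lie_ham[OF \<phi> F M _ _ d(3,4,1,2) r'(3)])
  have e: "exp (l1 l * s') \<le> exp (l1 l * (s - \<sigma>))" for l :: "int^'n"
    using r' int_l1norm_nonneg[of l] by (simp add: mult_left_mono)
  fix y assume "y \<in> cnbhd D r'"
  then have y: "y \<in> cnbhd D (r - \<rho>)" using cnbhd_mono[OF r'(1)] by blast
  have "(\<Sum>l\<in>S. l1 l * (norm (fcoeff \<phi> l y) * exp (l1 l * s'))) \<le> (\<Sum>l\<in>S. l1 l * (norm (fcoeff \<phi> l y) * exp (l1 l * (s - \<sigma>))))"
    by (intro sum_mono mult_left_mono e) (simp_all add: int_l1norm_nonneg)
  also have "\<dots> \<le> A" by (rule A_bound[OF y trig_poly_facts(3)])
  finally show "(\<Sum>l\<in>S. l1 l * (norm (fcoeff \<phi> l y) * exp (l1 l * s'))) \<le> A" .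
  fix v
  have "(\<Sum>l\<in>S. norm (coeff_deriv \<phi> l y v) * exp (l1 l * s')) \<le> (\<Sum>l\<in>S. norm (coeff_deriv \<phi> l y v) * exp (l1 l * (s - \<sigma>)))"
    by (intro sum_mono mult_left_mono e) simp
  also have "\<dots> \<le> B * norm v" by (rule B_bound[OF y trig_poly_facts(3)])
  finally show "(\<Sum>l\<in>S. norm (coeff_deriv \<phi> l y v) * exp (l1 l * s')) \<le> B * norm v" .
qed (use r' pos doms AB in auto)

lemma holo_torus_Lie_pow: "holo_torus D (r - \<rho>) (s - \<sigma>) F \<Longrightarrow> holo_torus D (r - \<rho>) (s - \<sigma>) ((Lie X ^^ m) F)"
  by (induction m) (simp_all add: holo_torus_Lie holo_torus_X)

lemma real_torus_Lie_pow: "holo_torus D (r - \<rho>) (s - \<sigma>) F \<Longrightarrow> real_torus D (r - \<rho>) (s - \<sigma>) F \<Longrightarrow> real_torus D (r - \<rho>) (s - \<sigma>) ((Lie X ^^ m) F)"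
  by (induction m) (simp_all add: real_torus_Lie real_torus_X holo_torus_Lie_pow)

text \<open>
  The loss of width is distributed equally over the \<open>m\<close> applications of the field.
\<close>

lemma fnorm_le_Lie_pow_steps:
  assumes F: "holo_torus D (r - \<rho>) (s - \<sigma>) F" and M: "fnorm_le D (r - \<rho>) (s - \<sigma>) F M" and m: "0 < m"
  shows "j \<le> m \<Longrightarrow> fnorm_le D (r - \<rho> - j * (\<rho> / m)) (s - \<sigma> - j * (\<sigma> / m)) ((Lie X ^^ j) F) ((real m * (\<kappa> / exp 1)) ^ j * M)"
proof (induction j)
  case 0
  then show ?case using M by simp
next
  case (Suc j)
  have le: "real (Suc j) * (\<sigma> / m) \<le> \<sigma>" "real (Suc j) * (\<rho> / m) \<le> \<rho>" "real j * (\<rho> / m) \<ge> 0" "real j * (\<sigma> / m) \<ge> 0"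
  proof -
    have q: "real (Suc j) / m \<le> 1" using Suc.prems m by simp
    show "real (Suc j) * (\<sigma> / m) \<le> \<sigma>" "real (Suc j) * (\<rho> / m) \<le> \<rho>"
      using mult_right_mono[OF q, of \<sigma>] mult_right_mono[OF q, of \<rho>] pos by simp_all
  qed (use pos in simp_all)
  have "fnorm_le D (r - \<rho> - Suc j * (\<rho> / m)) (s - \<sigma> - Suc j * (\<sigma> / m)) (Lie X ((Lie X ^^ j) F))
     ((A / (\<rho> / m) + B / (exp 1 * (\<sigma> / m))) * ((real m * (\<kappa> / exp 1)) ^ j * M))"
  proof (rule fnorm_le_Lie_from[OF holo_torus_mono[OF holo_torus_Lie_pow[OF F]] Suc.IH])
    show "0 < s - \<sigma> - real (Suc j) * (\<sigma> / real m)" using le(1) doms(4) by linarith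
  qed (use Suc.prems m pos le in \<open>simp_all add: algebra_simps add_divide_distrib\<close>)
  also have "A / (\<rho> / m) + B / (exp 1 * (\<sigma> / m)) = real m * (\<kappa> / exp 1)"
    unfolding AB(5)[symmetric] by (simp add: algebra_simps)
  finally show ?case by (simp add: mult_ac)
qed

lemma fnorm_le_Lie_pow:
  assumes F: "holo_torus D (r - \<rho>) (s - \<sigma>) F" and M: "fnorm_le D (r - \<rho>) (s - \<sigma>) F M" "0 \<le> M"
  shows "fnorm_le D (r - 2 * \<rho>) (s - 2 * \<sigma>) (\<lambda>p. (Lie X ^^ m) F p / fact m) (\<kappa> ^ m * M)"
proof (cases "m = 0")
  case True
  then show ?thesis using fnorm_le_mono[OF M(1) doms(5,6)] by simp
next
  case False
  have "fnorm_le D (r - 2 * \<rho>) (s - 2 * \<sigma>) ((Lie X ^^ m) F) ((real m * (\<kappa> / exp 1)) ^ m * M)"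
    using fnorm_le_Lie_pow_steps[OF F M(1), of m m] False by (simp add: algebra_simps)
  from fnorm_le_cmult[OF this, where c="1 / fact m"]
  have "fnorm_le D (r - 2 * \<rho>) (s - 2 * \<sigma>) (\<lambda>p. (Lie X ^^ m) F p / fact m) ((real m * (\<kappa> / exp 1)) ^ m / fact m * M)"
    by (simp add: norm_divide)
  then show ?thesis
  proof (rule fnorm_le_mono[OF _ order_refl order_refl])
    show "(real m * (\<kappa> / exp 1)) ^ m / fact m * M \<le> \<kappa> ^ m * M"
      using pow_fact_exp[of "\<kappa> / exp 1" m] \<kappa>_pos by (intro mult_right_mono M(2)) simp
  qed
qed

text \<open>
  Lie series with modified coefficients. The remainder of a step consists of such series, and the weight
  decides how its terms are counted.
\<close>

definition weighted_series :: "(nat \<Rightarrow> real) \<Rightarrow> ('n phase \<Rightarrow> complex) \<Rightarrow> 'n phase \<Rightarrow> complex" where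
  "weighted_series c F p = (\<Sum>m. of_real (c m) * ((Lie X ^^ m) F p / fact m))"

lemma
  assumes F: "holo_torus D (r - \<rho>) (s - \<sigma>) F" and M: "fnorm_le D (r - \<rho>) (s - \<sigma>) F M" "0 \<le> M" and c: "\<And>m. \<bar>c m\<bar> \<le> b m" and b: "(\<lambda>m. b m * \<kappa> ^ m) sums T"
  shows holo_torus_weighted_series: "holo_torus D (r - 2 * \<rho>) (s - 2 * \<sigma>) (weighted_series c F)"
    and fnorm_le_weighted_series: "fnorm_le D (r - 2 * \<rho>) (s - 2 * \<sigma>) (weighted_series c F) (T * M)"
    and real_torus_weighted_series: "real_torus D (r - \<rho>) (s - \<sigma>) F \<Longrightarrow> real_torus D (r - 2 * \<rho>) (s - 2 * \<sigma>) (weighted_series c F)"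
    and summable_weighted_series: "p \<in> phase_dom D (r - 2 * \<rho>) (s - 2 * \<sigma>) \<Longrightarrow> summable (\<lambda>m. of_real (c m) * ((Lie X ^^ m) F p / fact m))"
proof -
  let ?G = "\<lambda>m p. of_real (c m) * ((Lie X ^^ m) F p / fact m)"
  have G1: "holo_torus D (r - 2 * \<rho>) (s - 2 * \<sigma>) (\<lambda>p. (Lie X ^^ m) F p / fact m)" for m
    using holo_torus_cmult[OF holo_torus_mono[OF holo_torus_Lie_pow[OF F] doms(5,6)], where c="1 / fact m"] by simp
  have G: "holo_torus D (r - 2 * \<rho>) (s - 2 * \<sigma>) (?G m)" for m by (rule holo_torus_cmult[OF G1])
  have nG: "fnorm_le D (r - 2 * \<rho>) (s - 2 * \<sigma>) (?G m) (b m * \<kappa> ^ m * M)" for m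
    by (rule fnorm_le_mono[OF fnorm_le_cmult[OF fnorm_le_Lie_pow[OF F M]] order_refl order_refl])
       (use c M(2) \<kappa>_pos in \<open>simp add: mult_right_mono mult.assoc\<close>)
  have sb: "(\<lambda>m. b m * \<kappa> ^ m * M) sums (T * M)" by (rule sums_mult2[OF b])
  note sm = sums_summable[OF sb]
  show "holo_torus D (r - 2 * \<rho>) (s - 2 * \<sigma>) (weighted_series c F)"
    using holo_torus_suminf[OF G doms(4) nG sm] by (simp add: weighted_series_def[abs_def])
  show "fnorm_le D (r - 2 * \<rho>) (s - 2 * \<sigma>) (weighted_series c F) (T * M)"
    using fnorm_le_suminf[OF G doms(4) nG sm] by (simp add: weighted_series_def[abs_def] sums_unique[OF sb, symmetric])
  show s: "summable (\<lambda>m. ?G m p)" if p: "p \<in> phase_dom D (r - 2 * \<rho>) (s - 2 * \<sigma>)" for p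
    by (rule summable_comparison_test'[OF sm]) (rule fnorm_le_norm_le[OF G doms(4) nG p])
  show "real_torus D (r - 2 * \<rho>) (s - 2 * \<sigma>) (weighted_series c F)" if R: "real_torus D (r - \<rho>) (s - \<sigma>) F"
    unfolding real_torus_def weighted_series_def
  proof (intro allI impI suminf_in_Reals, elim conjE)
    fix y x m assume "(y, x) \<in> phase_dom D (r - 2 * \<rho>) (s - 2 * \<sigma>) \<and> real_vec y \<and> real_vec x"
    then have "(Lie X ^^ m) F (y, x) \<in> \<real>"
      using real_torus_mono[OF real_torus_Lie_pow[OF F R] doms(5,6), of m] unfolding real_torus_def by blast
    moreover have "(fact m :: complex) \<in> \<real>" by (metis Reals_of_real of_real_fact)
    ultimately show "?G m (y, x) \<in> \<real>" by (intro Reals_mult Reals_divide Reals_of_real)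
  qed (use s in blast)
qed

lemma geometric_kappa: "(\<lambda>m. 1 * \<kappa> ^ m) sums (1 / (1 - \<kappa>))" "(\<lambda>m. (if m = 0 then 0 else 1) * \<kappa> ^ m) sums (\<kappa> / (1 - \<kappa>))"
proof -
  show g: "(\<lambda>m. 1 * \<kappa> ^ m) sums (1 / (1 - \<kappa>))" using geometric_sums[of \<kappa>] \<kappa>_pos \<kappa>(2) by simp
  have "(\<lambda>m. \<kappa> ^ Suc m) sums (\<kappa> * (1 / (1 - \<kappa>)))" using sums_mult[OF g, of \<kappa>] by simp
  then have "(\<lambda>m. (if Suc m = 0 then 0 else 1) * \<kappa> ^ Suc m) sums (\<kappa> * (1 / (1 - \<kappa>)))" by simp
  from sums_Suc_imp[where f="\<lambda>m. (if m = 0 then 0 else 1) * \<kappa> ^ m", OF _ this]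
  show "(\<lambda>m. (if m = 0 then 0 else 1) * \<kappa> ^ m) sums (\<kappa> / (1 - \<kappa>))" by simp
qed

text \<open>
  The weights of the remainder: \<open>c1\<close> turns \<open>1 / m!\<close> into \<open>1 / (m + 1)!\<close> and occurs after one field has been
  applied separately, \<open>c2\<close> omits the undisturbed term, and \<open>c3\<close> is the part of \<open>exp\<close> that is not cancelled by
  the homological equation.
\<close>

definition c1 :: "nat \<Rightarrow> real" where "c1 m = 1 / (real m + 1)"
definition c2 :: "nat \<Rightarrow> real" where "c2 m = (if m = 0 then 0 else 1)"
definition c3 :: "nat \<Rightarrow> real" where "c3 m = 1 - 1 / (real m + 1)"

lemma c_bounds: "\<bar>c1 m\<bar> \<le> 1" "\<bar>c2 m\<bar> \<le> (if m = 0 then 0 else 1)" "\<bar>c3 m\<bar> \<le> (if m = 0 then 0 else 1)"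
  by (simp_all add: c1_def c2_def c3_def)

lemma c1_fact: "of_real (c1 m) * (z / fact m) = (z / fact (Suc m) :: complex)"
  by (simp add: c1_def field_simps)

subsection \<open>The displacement\<close>

text \<open>
  The displacement of coordinate \<open>a\<close>, since \<open>\<Sum>\<^sub>m\<^sub>\<ge>\<^sub>1 L\<^sup>m x\<^sub>a / m! = \<Sum>\<^sub>m L\<^sup>m X\<^sub>a / (m + 1)!\<close>.
\<close>

abbreviation "Z a \<equiv> weighted_series c1 (X a)"

lemma fnorm_le_X: "\<exists>M\<ge>0. fnorm_le D (r - \<rho>) (s - \<sigma>) (X a) M"
proof (cases a)
  case (Inl i)
  have "fnorm_le D (r - \<rho>) (s - \<sigma>) (\<lambda>p. \<Sum>j\<in>UNIV. (if j = i then 1 else 0) * X (Inl j) p) A"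
    by (rule fnorm_le_X_action) simp
  then show ?thesis using Inl AB(3) by (auto simp: if_distrib if_distribR cong: if_cong)
qed (use fnorm_le_X_angle AB(4) in blast)

lemma holo_torus_Z: "holo_torus D (r - 2 * \<rho>) (s - 2 * \<sigma>) (Z a)" and real_torus_Z: "real_torus D (r - 2 * \<rho>) (s - 2 * \<sigma>) (Z a)"
  and summable_Z: "p \<in> phase_dom D (r - 2 * \<rho>) (s - 2 * \<sigma>) \<Longrightarrow> summable (\<lambda>m. of_real (c1 m) * ((Lie X ^^ m) (X a) p / fact m))"
proof -
  obtain M where M: "M \<ge> 0" "fnorm_le D (r - \<rho>) (s - \<sigma>) (X a) M" using fnorm_le_X by blast
  show "holo_torus D (r - 2 * \<rho>) (s - 2 * \<sigma>) (Z a)" by (rule holo_torus_weighted_series[OF holo_torus_X M(2,1) c_bounds(1) geometric_kappa(1)])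
  show "real_torus D (r - 2 * \<rho>) (s - 2 * \<sigma>) (Z a)" by (rule real_torus_weighted_series[OF holo_torus_X M(2,1) c_bounds(1) geometric_kappa(1) real_torus_X])
  show "p \<in> phase_dom D (r - 2 * \<rho>) (s - 2 * \<sigma>) \<Longrightarrow> summable (\<lambda>m. of_real (c1 m) * ((Lie X ^^ m) (X a) p / fact m))"
    by (rule summable_weighted_series[OF holo_torus_X M(2,1) c_bounds(1) geometric_kappa(1)])
qed

lemma Z_combination_bound:
  assumes c: "\<And>i. norm (c i) \<le> 1" and p: "p \<in> phase_dom D (r - 2 * \<rho>) (s - 2 * \<sigma>)"
  shows "norm (\<Sum>i\<in>UNIV. c i * Z (Inl i) p) \<le> A / (1 - \<kappa>)"
proof -
  let ?F = "\<lambda>p. \<Sum>i\<in>UNIV. c i * X (Inl i) p"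
  have F: "holo_torus D (r - \<rho>) (s - \<sigma>) ?F" by (rule holo_torus_sum[OF holo_torus_cmult[OF holo_torus_X]])
  have p1: "p \<in> phase_dom D (r - \<rho>) (s - \<sigma>)" using p phase_dom_mono[OF doms(5,6)] by blast
  have "weighted_series c1 ?F p = (\<Sum>m. \<Sum>i\<in>UNIV. c i * (of_real (c1 m) * ((Lie X ^^ m) (X (Inl i)) p / fact m)))"
    unfolding weighted_series_def Lie_pow_sum[OF open_phase_dom holo_torus_holo[OF holo_torus_X] holo_torus_holo[OF holo_torus_X] p1]
    by (simp add: sum_distrib_left sum_divide_distrib mult_ac)
  also have "\<dots> = (\<Sum>i\<in>UNIV. \<Sum>m. c i * (of_real (c1 m) * ((Lie X ^^ m) (X (Inl i)) p / fact m)))"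
    by (intro suminf_sum summable_mult summable_Z[OF p])
  also have "\<dots> = (\<Sum>i\<in>UNIV. c i * Z (Inl i) p)"
    unfolding weighted_series_def by (intro sum.cong refl suminf_mult summable_Z[OF p])
  finally have eq: "(\<Sum>i\<in>UNIV. c i * Z (Inl i) p) = weighted_series c1 ?F p" by simp
  have "norm (weighted_series c1 ?F p) \<le> 1 / (1 - \<kappa>) * A"
    by (rule fnorm_le_norm_le[OF holo_torus_weighted_series[OF F fnorm_le_X_action[OF c] AB(3) c_bounds(1) geometric_kappa(1)] doms(4)
          fnorm_le_weighted_series[OF F fnorm_le_X_action[OF c] AB(3) c_bounds(1) geometric_kappa(1)] p])
  then show ?thesis unfolding eq by (simp add: mult_ac)
qed

lemma Z_action_bound:
  assumes p: "p \<in> phase_dom D (r - 2 * \<rho>) (s - 2 * \<sigma>)"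
  shows "(\<Sum>i\<in>UNIV. norm (Z (Inl i) p)) \<le> A / (1 - \<kappa>)"
proof -
  obtain c where c: "\<And>i. norm (c i) \<le> 1" "(\<Sum>i\<in>UNIV. c i * Z (Inl i) p) = of_real (\<Sum>i\<in>UNIV. norm (Z (Inl i) p))"
    using sum_norm_eq_unimodular[of "\<lambda>i. Z (Inl i) p"] by blast
  show ?thesis using Z_combination_bound[where c=c, OF c(1) p] unfolding c(2) norm_of_real by simp
qed

lemma Z_angle_bound:
  assumes p: "p \<in> phase_dom D (r - 2 * \<rho>) (s - 2 * \<sigma>)"
  shows "norm (Z (Inr i) p) \<le> B / (1 - \<kappa>)"
  using fnorm_le_norm_le[OF holo_torus_Z doms(4) fnorm_le_weighted_series[OF holo_torus_X fnorm_le_X_angle AB(4) c_bounds(1) geometric_kappa(1)] p] by (simp add: mult_ac)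

lemma disp_small: "A / (1 - \<kappa>) \<le> \<rho> / 14" "B / (1 - \<kappa>) \<le> \<sigma> / 14"
proof -
  have k: "1 - \<kappa> \<ge> 7 / 8" using \<kappa>(2) by simp
  have "A / (1 - \<kappa>) \<le> A / (7 / 8)" by (intro divide_left_mono k AB(3)) (use k in simp)
  also have "A / (7/8) \<le> (1 / 8 / 2 * \<rho>) / (7 / 8)"
    by (intro divide_right_mono order_trans[OF AB(1)] mult_right_mono divide_right_mono \<kappa>(2)) (use pos in simp_all)
  finally show "A / (1 - \<kappa>) \<le> \<rho> / 14" by simp
  have "B / (1 - \<kappa>) \<le> B / (7 / 8)" by (intro divide_left_mono k AB(4)) (use k in simp)
  also have "B / (7/8) \<le> (1 / 8 / 2 * \<sigma>) / (7 / 8)"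
    unfolding AB(2) by (intro divide_right_mono mult_right_mono \<kappa>(2)) (use pos in simp_all)
  finally show "B / (1 - \<kappa>) \<le> \<sigma> / 14" by simp
qed

lemma obox_sub: "p \<in> phase_dom D (r' - \<rho>) (s' - \<sigma>) \<Longrightarrow> obox p \<rho> \<sigma> \<subseteq> phase_dom D r' s'"
proof
  fix q assume p: "p \<in> phase_dom D (r' - \<rho>) (s' - \<sigma>)" and q: "q \<in> obox p \<rho> \<sigma>"
  have "fst p + (fst q - fst p) \<in> cnbhd D r'"
    by (rule cnbhd_add[of _ D r' \<rho>]) (use p q in \<open>simp_all add: mem_phase_dom(2) obox_def\<close>)
  moreover have "snd p + (snd q - snd p) \<in> strip s'"
    by (rule strip_add[of _ s' \<sigma>]) (use p q in \<open>simp_all add: mem_phase_dom(2) obox_def less_imp_le\<close>)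
  ultimately show "q \<in> phase_dom D r' s'" by (simp add: mem_phase_dom(2))
qed

lemma lie_box_at: 
  assumes p: "p \<in> phase_dom D (r - 2 * \<rho>) (s - 2 * \<sigma>)"
  shows "lie_box X (obox p \<rho> \<sigma>) p (\<rho> / 2) (\<sigma> / 2) \<kappa>"
proof
  have "p \<in> phase_dom D (r - \<rho> - \<rho>) (s - \<sigma> - \<sigma>)" using p by (simp add: algebra_simps)
  note sub = obox_sub[OF this]
  show "open (obox p \<rho> \<sigma>)" by (rule open_obox)
  show "holo (obox p \<rho> \<sigma>) (X a)" for a by (rule holo_subset[OF holo_torus_holo[OF holo_torus_X] sub])
  show sub2: "pbox p (\<rho>/2) (\<sigma>/2) \<subseteq> obox p \<rho> \<sigma>"
  proof
    fix q assume q: "q \<in> pbox p (\<rho>/2) (\<sigma>/2)"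
    have "norm (fst q - fst p) \<le> \<rho> / 2" "norm (snd q $ i - snd p $ i) \<le> \<sigma> / 2" for i
      using q by (simp_all add: pbox_def)
    moreover have "\<rho> / 2 < \<rho>" "\<sigma> / 2 < \<sigma>" using pos by simp_all
    ultimately have "norm (fst q - fst p) < \<rho>" "norm (snd q $ i - snd p $ i) < \<sigma>" for i
      by (meson le_less_trans)+
    then show "q \<in> obox p \<rho> \<sigma>" by (simp add: obox_def)
  qed
  fix q i assume "q \<in> pbox p (\<rho>/2) (\<sigma>/2)"
  then have q: "q \<in> phase_dom D (r - \<rho>) (s - \<sigma>)" using sub sub2 by blast
  have "norm (\<chi> i. X (Inl i) q) \<le> A"
    by (rule norm_vec_le_of_sums) (simp add: X_action_bound[OF q])
  from order_trans[OF this AB(1)] show "norm (\<chi> i. X (Inl i) q) \<le> \<kappa> * (\<rho> / 2)" by simp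
  show "norm (X (Inr i) q) \<le> \<kappa> * (\<sigma> / 2)" using X_angle_bound[OF q, of i] AB(2) by simp
next
  have "2 * exp 1 * \<kappa> \<le> 2 * 3 * (1 / 8)"
    using exp_le \<kappa>(2) \<kappa>_pos by (intro mult_mono) simp_all
  then show "2 * exp 1 * \<kappa> < 1" by simp
qed (use pos \<kappa>_pos in auto)

lemma Lie_coord: "Lie X (coord a) = X a"
  by (rule ext) (simp add: Lie_def pd_coord if_distrib cong: if_cong)

lemma lie_series_coord:
  assumes p: "p \<in> phase_dom D (r - 2 * \<rho>) (s - 2 * \<sigma>)"
  shows "lie_series X (coord a) p = coord a p + Z a p"
proof -
  have t: "(Lie X ^^ Suc m) (coord a) p / fact (Suc m) = of_real (c1 m) * ((Lie X ^^ m) (X a) p / fact m)" for m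
    unfolding c1_fact by (simp add: funpow_Suc_right Lie_coord del: funpow.simps fact_Suc)
  have "summable (\<lambda>m. (Lie X ^^ Suc m) (coord a) p / fact (Suc m))"
    unfolding t by (rule summable_Z[OF p])
  then have "summable (\<lambda>m. (Lie X ^^ m) (coord a) p / fact m)" by (subst summable_Suc_iff[symmetric])
  from suminf_split_head[OF this] show ?thesis
    unfolding t lie_series_def weighted_series_def by simp
qed

lemma coord_flow: "p \<in> phase_dom D (r - 2 * \<rho>) (s - 2 * \<sigma>) \<Longrightarrow> coord a (flow X p) = coord a p + Z a p"
  by (simp add: flow_def lie_series_coord)

lemma flow_displacement:
  assumes p: "p \<in> phase_dom D (r - 2 * \<rho>) (s - 2 * \<sigma>)"
  shows "l1norm (fst (flow X p) - fst p) \<le> A / (1 - \<kappa>)" "norm (snd (flow X p) $ i - snd p $ i) \<le> B / (1 - \<kappa>)"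
proof -
  have "(fst (flow X p) - fst p) $ i = Z (Inl i) p" "snd (flow X p) $ i - snd p $ i = Z (Inr i) p" for i
    using coord_flow[OF p, of "Inl i"] coord_flow[OF p, of "Inr i"] by (simp_all add: coord_def)
  then show "l1norm (fst (flow X p) - fst p) \<le> A / (1 - \<kappa>)" "norm (snd (flow X p) $ i - snd p $ i) \<le> B / (1 - \<kappa>)"
    using Z_action_bound[OF p] Z_angle_bound[OF p] by (simp_all add: l1norm_def)
qed

lemma flow_in_obox:
  assumes p: "p \<in> phase_dom D (r - 2 * \<rho>) (s - 2 * \<sigma>)"
  shows "flow X p \<in> obox p \<rho> \<sigma>"
proof -
  have "norm (fst (flow X p) - fst p) \<le> A / (1 - \<kappa>)"
    by (rule norm_vec_le_of_sums) (use flow_displacement(1)[OF p] in \<open>simp add: l1norm_def\<close>)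
  moreover have "A / (1 - \<kappa>) < \<rho>" "B / (1 - \<kappa>) < \<sigma>" using disp_small pos by linarith+
  ultimately show ?thesis
    using flow_displacement(2)[OF p] by (auto simp: obox_def intro: le_less_trans)
qed

lemma flow_compose:
  assumes p: "p \<in> phase_dom D (r - 2 * \<rho>) (s - 2 * \<sigma>)" and G: "holo (phase_dom D (r - \<rho>) (s - \<sigma>)) G"
  shows "G (flow X p) = lie_series X G p" "summable (\<lambda>m. (Lie X ^^ m) G p / fact m)"
proof -
  have "p \<in> phase_dom D (r - \<rho> - \<rho>) (s - \<sigma> - \<sigma>)" using p by (simp add: algebra_simps)
  note sub = obox_sub[OF this]
  have h: "holo (obox p \<rho> \<sigma>) G" by (rule holo_subset[OF G sub])
  show "G (flow X p) = lie_series X G p"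
    by (rule lie_box.lie_series_eq_flow[OF lie_box_at[OF p] convex_obox flow_in_obox[OF p] h, symmetric])
  show "summable (\<lambda>m. (Lie X ^^ m) G p / fact m)"
    by (rule summable_norm_cancel[OF lie_box.summable_norm_Lie[OF lie_box_at[OF p] h]])
qed

text \<open>
  If two points \<open>p\<close>, \<open>q\<close> have the same image, their difference \<open>v\<close> equals a difference of displacements.
  It is measured by \<open>d\<close>, the least number with \<open>\<bar>v\<^sub>y\<bar>\<^sub>1 \<le> d \<rho>\<close> and \<open>\<bar>v\<^sub>x\<bar>\<^sub>\<infinity> \<le> d \<sigma>\<close>. The size of the displacement gives
  \<open>d \<le> 1/7\<close>. Hence the disc \<open>\<bar>t\<bar> \<le> 1/d\<close> fits into the domain, and Cauchy's estimate on the line through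
  \<open>p\<close> and \<open>q\<close> shows that the displacements differ by so little that \<open>d \<le> d/12\<close>, whence \<open>p = q\<close>.
\<close>

lemma flow_inj: "inj_on (flow X) (phase_dom D (r - 3 * \<rho>) (s - 3 * \<sigma>))"
proof (rule inj_onI, rule ccontr)
  let ?W = "phase_dom D (r - 2 * \<rho>) (s - 2 * \<sigma>)"
  fix p q assume p: "p \<in> phase_dom D (r - 3 * \<rho>) (s - 3 * \<sigma>)" and q: "q \<in> phase_dom D (r - 3 * \<rho>) (s - 3 * \<sigma>)"
    and eq: "flow X p = flow X q" and ne: "p \<noteq> q"
  have sub: "phase_dom D (r - 3 * \<rho>) (s - 3 * \<sigma>) \<subseteq> ?W" by (rule phase_dom_mono) (use pos in simp_all)
  have pW: "p \<in> ?W" and qW: "q \<in> ?W" using p q sub by blast+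
  define v where "v = p - q"
  have coord_v: "coord a v = - (Z a p - Z a q)" for a
  proof -
    have "coord a p + Z a p = coord a q + Z a q"
      using coord_flow[OF pW, of a] coord_flow[OF qW, of a] eq by simp
    then have "coord a p - coord a q = - (Z a p - Z a q)" by (simp add: algebra_simps)
    then show ?thesis by (simp add: v_def)
  qed
  define ly where "ly = (\<Sum>i\<in>UNIV. norm (coord (Inl i) v))"
  define lx where "lx i = norm (coord (Inr i) v)" for i
  define d where "d = max (ly / \<rho>) (Max (range (\<lambda>i. lx i / \<sigma>)))"
  have lyd: "ly \<le> d * \<rho>" using pos by (simp add: d_def field_simps max_def)
  have lxd: "lx i \<le> d * \<sigma>" for i
  proof -
    have "lx i / \<sigma> \<le> Max (range (\<lambda>i. lx i / \<sigma>))" by (rule Max_ge) auto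
    then have "lx i / \<sigma> \<le> d" by (simp add: d_def)
    then show ?thesis using pos by (simp add: field_simps)
  qed
  have d_le: "d \<le> c" if "ly \<le> c * \<rho>" "\<And>i. lx i \<le> c * \<sigma>" for c
    unfolding d_def using that pos by (simp add: field_simps)
  have ly0: "0 \<le> ly" by (simp add: ly_def sum_nonneg)
  have d0: "0 < d"
  proof (rule ccontr)
    assume "\<not> 0 < d"
    then have "d * \<rho> \<le> 0" "d * \<sigma> \<le> 0" using pos by (simp_all add: mult_nonpos_nonneg)
    then have "ly \<le> 0" "lx i \<le> 0" for i using lyd lxd[of i] by linarith+
    then have "ly = 0" and x0: "coord (Inr i) v = 0" for i using ly0 by (simp_all add: lx_def)
    then have y0: "coord (Inl i) v = 0" for i by (simp add: ly_def sum_nonneg_eq_0_iff)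
    have "v = 0" 
    proof (rule phase_eqI)
      fix a show "coord a v = coord a 0" using x0 y0 by (cases a) simp_all
    qed
    then show False using ne by (simp add: v_def)
  qed
  have d7: "d \<le> 1 / 7"
  proof (rule d_le)
    have "ly \<le> (\<Sum>i\<in>UNIV. norm (Z (Inl i) p) + norm (Z (Inl i) q))"
      unfolding ly_def by (rule sum_mono) (simp only: coord_v norm_minus_cancel norm_triangle_ineq4)
    also have "\<dots> \<le> \<rho> / 14 + \<rho> / 14"
      unfolding sum.distrib by (intro add_mono order_trans[OF Z_action_bound disp_small(1)] pW qW)
    finally show "ly \<le> 1 / 7 * \<rho>" by simp
    fix i
    have "lx i \<le> norm (Z (Inr i) p) + norm (Z (Inr i) q)"
      unfolding lx_def by (simp only: coord_v norm_minus_cancel norm_triangle_ineq4)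
    also have "\<dots> \<le> \<sigma> / 14 + \<sigma> / 14"
      by (intro add_mono order_trans[OF Z_angle_bound disp_small(2)] pW qW)
    finally show "lx i \<le> 1 / 7 * \<sigma>" by simp
  qed
  have mem: "q + cscale t v \<in> ?W" if t: "norm t \<le> 1 / d" for t
  proof -
    have td: "norm t * d \<le> 1" using t d0 by (simp add: field_simps)
    have y: "norm (t *s fst v) \<le> \<rho>"
    proof -
      have "norm (fst v) \<le> ly" by (rule norm_vec_le_of_sums) (simp add: ly_def coord_def)
      then have "norm t * norm (fst v) \<le> norm t * (d * \<rho>)" using lyd by (intro mult_left_mono) simp_all
      also have "\<dots> \<le> 1 * \<rho>" unfolding mult.assoc[symmetric] by (intro mult_right_mono td) (use pos in simp)
      finally show ?thesis by (simp add: norm_vec_cmult)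
    qed
    have x: "norm ((t *s snd v) $ i) \<le> \<sigma>" for i
    proof -
      have "norm t * norm (snd v $ i) \<le> norm t * (d * \<sigma>)" using lxd[of i] by (intro mult_left_mono) (simp_all add: lx_def coord_def)
      also have "\<dots> \<le> 1 * \<sigma>" unfolding mult.assoc[symmetric] by (intro mult_right_mono td) (use pos in simp)
      finally show ?thesis by (simp add: norm_mult)
    qed
    have "fst q + t *s fst v \<in> cnbhd D (r - 2 * \<rho>)"
      by (rule cnbhd_add[OF _ y]) (use q in \<open>simp add: mem_phase_dom(2) algebra_simps\<close>)
    moreover have "snd q + t *s snd v \<in> strip (s - 2 * \<sigma>)"
      by (rule strip_add[OF _ x]) (use q in \<open>simp add: mem_phase_dom(2) algebra_simps\<close>)
    ultimately show ?thesis by (simp add: mem_phase_dom(2))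
  qed
  have R: "1 < 1 / d" and R6: "1 / (1 / d - 1) \<le> 7 / 6 * d"
  proof -
    show "1 < 1 / d" using d0 d7 by (simp add: field_simps)
    have "1 / (1 / d - 1) = d / (1 - d)" using d0 by (simp add: field_simps)
    also have "\<dots> \<le> d / (6 / 7)" by (rule divide_left_mono) (use d0 d7 in simp_all)
    finally show "1 / (1 / d - 1) \<le> 7 / 6 * d" by simp
  qed
  have diff: "norm (G p - G q) \<le> M * (7 / 6 * d)"
    if G: "holo ?W G" and M: "\<And>p. p \<in> ?W \<Longrightarrow> norm (G p) \<le> M" and M0: "0 \<le> M" for G M
  proof -
    have "norm (G (q + v) - G q) \<le> M / (1 / d - 1)" by (rule mean_value_line[OF G R mem M])
    also have "\<dots> \<le> M * (7 / 6 * d)" using mult_left_mono[OF R6 M0] by simp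
    finally show ?thesis by (simp add: v_def)
  qed
  have "d \<le> d / 12"
  proof (rule d_le)
    obtain c where c: "\<And>i. norm (c i) \<le> 1" "(\<Sum>i\<in>UNIV. c i * (Z (Inl i) p - Z (Inl i) q)) = of_real (\<Sum>i\<in>UNIV. norm (Z (Inl i) p - Z (Inl i) q))"
      using sum_norm_eq_unimodular[of "\<lambda>i. Z (Inl i) p - Z (Inl i) q"] by blast
    let ?G = "\<lambda>p. \<Sum>i\<in>UNIV. c i * Z (Inl i) p"
    have "ly = (\<Sum>i\<in>UNIV. norm (Z (Inl i) p - Z (Inl i) q))"
      unfolding ly_def by (simp only: coord_v norm_minus_cancel)
    also have "\<dots> = norm (?G p - ?G q)"
    proof -
      have "?G p - ?G q = of_real (\<Sum>i\<in>UNIV. norm (Z (Inl i) p - Z (Inl i) q))"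
        unfolding c(2)[symmetric] by (simp add: right_diff_distrib sum_subtractf)
      then show ?thesis by (simp add: sum_nonneg abs_of_nonneg del: of_real_sum)
    qed
    also have "\<dots> \<le> \<rho> / 14 * (7 / 6 * d)"
      by (rule diff[OF holo_torus_holo[OF holo_torus_sum[OF holo_torus_cmult[OF holo_torus_Z]]] order_trans[OF Z_combination_bound[where c=c, OF c(1)] disp_small(1)]])
         (use pos in simp_all)
    finally show "ly \<le> d / 12 * \<rho>" by (simp add: mult.commute)
    fix i
    have "lx i = norm (Z (Inr i) p - Z (Inr i) q)"
      unfolding lx_def by (simp only: coord_v norm_minus_cancel)
    also have "\<dots> \<le> \<sigma> / 14 * (7 / 6 * d)"
      by (rule diff[OF holo_torus_holo[OF holo_torus_Z] order_trans[OF Z_angle_bound disp_small(2)]]) (use pos in simp_all)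
    finally show "lx i \<le> d / 12 * \<sigma>" by (simp add: mult.commute)
  qed
  then show False using d0 by simp
qed

lemma symplectic_map_flow: "symplectic_map D r s (r - 3 * \<rho>) (s - 3 * \<sigma>) (flow X) (A / (1 - \<kappa>)) (B / (1 - \<kappa>))"
proof -
  let ?W = "phase_dom D (r - 2 * \<rho>) (s - 2 * \<sigma>)" and ?V = "phase_dom D (r - 3 * \<rho>) (s - 3 * \<sigma>)"
  have sub: "?V \<subseteq> ?W" by (rule phase_dom_mono) (use pos in simp_all)
  have le: "r - 3 * \<rho> \<le> r - 2 * \<rho>" "s - 3 * \<sigma> \<le> s - 2 * \<sigma>" using pos by simp_all
  note pZ = holo_torus_mono[OF holo_torus_Z le] and rZ = real_torus_mono[OF real_torus_Z le]
  have "symplectic_change D (r - 3 * \<rho>) (s - 3 * \<sigma>) (flow X)"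
    unfolding symplectic_change_def real_analytic_torus_iff
  proof (intro conjI allI ballI)
    fix i
    have y: "coord (Inl i) p + Z (Inl i) p = fst (flow X p) $ i" if "p \<in> ?V" for p
      using coord_flow[OF subsetD[OF sub that], of "Inl i"] by (simp add: coord_def)
    have x: "Z (Inr i) p = snd (flow X p) $ i - snd p $ i" if "p \<in> ?V" for p
      using coord_flow[OF subsetD[OF sub that], of "Inr i"] by (simp add: coord_def)
    have pc: "holo_torus D (r - 3 * \<rho>) (s - 3 * \<sigma>) (coord (Inl i))" by (simp add: holo_torus_def holo_coord) (simp add: coord_def)
    have rc: "real_torus D (r - 3 * \<rho>) (s - 3 * \<sigma>) (coord (Inl i))" by (simp add: real_torus_def coord_def real_vec_def)
    show "holo_torus D (r - 3 * \<rho>) (s - 3 * \<sigma>) (\<lambda>p. fst (flow X p) $ i)"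
      by (rule holo_torus_cong[OF y holo_torus_add[OF pc pZ]])
    show "real_torus D (r - 3 * \<rho>) (s - 3 * \<sigma>) (\<lambda>p. fst (flow X p) $ i)"
      by (rule real_torus_cong[OF y real_torus_add[OF rc rZ]])
    show "holo_torus D (r - 3 * \<rho>) (s - 3 * \<sigma>) (\<lambda>p. snd (flow X p) $ i - snd p $ i)"
      by (rule holo_torus_cong[OF x pZ])
    show "real_torus D (r - 3 * \<rho>) (s - 3 * \<sigma>) (\<lambda>p. snd (flow X p) $ i - snd p $ i)"
      by (rule real_torus_cong[OF x rZ])
  next
    show "inj_on (flow X) ?V" by (rule flow_inj)
  next
    fix p assume "p \<in> ?V"
    then have p: "p \<in> ?W" using sub by blast
    then have "p \<in> phase_dom D (r - \<rho> - \<rho>) (s - \<sigma> - \<sigma>)" by (simp add: algebra_simps)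
    then have "obox p \<rho> \<sigma> \<subseteq> phase_dom D (r - \<rho>) (s - \<sigma>)" by (rule obox_sub)
    also have "\<dots> \<subseteq> phase_dom D r s" by (rule phase_dom_mono) (use doms in simp_all)
    finally have "holo (obox p \<rho> \<sigma>) \<phi>" by (rule holo_subset[OF holo_torus_holo[OF trig_poly_facts(1)]])
    from lie_box.flow_symplectic[OF lie_box_at[OF p] refl this]
    show "\<exists>L. (flow X has_derivative L) (at p) \<and> (\<forall>u v. symp_form (L u) (L v) = symp_form u v)" by blast
  qed
  moreover have "flow X p \<in> phase_dom D r s" if "p \<in> ?V" for p
  proof -
    have p: "p \<in> ?W" using sub that by blast
    then have "p \<in> phase_dom D (r - \<rho> - \<rho>) (s - \<sigma> - \<sigma>)" by (simp add: algebra_simps)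
    then have "obox p \<rho> \<sigma> \<subseteq> phase_dom D (r - \<rho>) (s - \<sigma>)" by (rule obox_sub)
    also have "\<dots> \<subseteq> phase_dom D r s" by (rule phase_dom_mono) (use doms in simp_all)
    finally show ?thesis using flow_in_obox[OF p] by blast
  qed
  ultimately show ?thesis
    unfolding symplectic_map_def using flow_displacement[OF subsetD[OF sub]] by blast
qed

subsection \<open>The transformed Hamiltonian\<close>

text \<open>
  The terms are of different nature. The function \<open>b\<close> need not be small but is bracketed from a larger
  domain; \<open>g\<close> and \<open>f\<close> are small and live on the same domain as the field.
\<close>

definition remainder :: "('n phase \<Rightarrow> complex) \<Rightarrow> ('n phase \<Rightarrow> complex) \<Rightarrow> ('n phase \<Rightarrow> complex) \<Rightarrow> 'n phase \<Rightarrow> complex" where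
  "remainder b g f p = weighted_series c1 (Lie X b) p + (weighted_series c2 g p + weighted_series c3 f p)"

text \<open>
  As \<open>L h = - f\<close>, the Lie series of \<open>h\<close> is \<open>h - \<Sum>\<^sub>m L\<^sup>m f / (m + 1)!\<close>. Its first term cancels \<open>f\<close>, and the others
  combine with the Lie series of \<open>f\<close> to the weights \<open>1 / m! - 1 / (m + 1)!\<close>.
\<close>

lemma flow_expansion:
  assumes hh: "holo (phase_dom D (r - \<rho>) (s - \<sigma>)) hh"
    and hom: "\<And>q. q \<in> phase_dom D (r - \<rho>) (s - \<sigma>) \<Longrightarrow> Lie X hh q = - f q"
    and bgf: "holo_torus D (r - \<rho>) (s - \<sigma>) b" "holo_torus D (r - \<rho>) (s - \<sigma>) g" "holo_torus D (r - \<rho>) (s - \<sigma>) f"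
    and p: "p \<in> phase_dom D (r - 2 * \<rho>) (s - 2 * \<sigma>)"
  shows "hh (flow X p) + b (flow X p) + g (flow X p) + f (flow X p) = hh p + b p + g p + remainder b g f p"
proof -
  let ?W = "phase_dom D (r - \<rho>) (s - \<sigma>)"
  have pW: "p \<in> ?W" using p phase_dom_mono[OF doms(5,6)] by blast
  let ?a = "\<lambda>F m. (Lie X ^^ m) F p / fact m"
  have sm: "summable (?a F)" if "holo ?W F" for F by (rule flow_compose(2)[OF p that])
  have head: "F (flow X p) = F p + (\<Sum>m. ?a F (Suc m))" if "holo ?W F" for F
    using flow_compose(1)[OF p that] suminf_split_head[OF sm[OF that]] by (simp add: lie_series_def)
  have hf: "?a hh (Suc m) = - (of_real (c1 m) * ?a f m)" for m
  proof -
    have "(Lie X ^^ Suc m) hh p = (Lie X ^^ m) (Lie X hh) p" by (simp add: funpow_Suc_right del: funpow.simps)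
    also have "\<dots> = (Lie X ^^ m) (\<lambda>q. \<Sum>i\<in>{()}. - 1 * f q) p"
      by (rule Lie_pow_cong[OF open_phase_dom _ pW]) (simp add: hom)
    also have "\<dots> = - (Lie X ^^ m) f p"
      by (subst Lie_pow_sum[OF open_phase_dom holo_torus_holo[OF holo_torus_X] holo_torus_holo[OF bgf(3)] pW]) simp
    finally show ?thesis unfolding c1_fact by simp
  qed
  have s1: "summable (\<lambda>m. of_real (c1 m) * ?a f m)"
  proof -
    have "summable (\<lambda>m. - ?a hh (Suc m))" using sm[OF hh] summable_Suc_iff[of "?a hh"] by (intro summable_minus) simp
    then show ?thesis unfolding hf by simp
  qed
  have H: "hh (flow X p) = hh p - (\<Sum>m. of_real (c1 m) * ?a f m)"
    unfolding head[OF hh] hf suminf_minus[OF s1] by simp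
  have Fb: "b (flow X p) = b p + weighted_series c1 (Lie X b) p"
  proof -
    have "?a b (Suc m) = of_real (c1 m) * ?a (Lie X b) m" for m
      unfolding c1_fact by (simp add: funpow_Suc_right del: funpow.simps fact_Suc)
    then show ?thesis unfolding head[OF holo_torus_holo[OF bgf(1)]] weighted_series_def by simp
  qed
  have Fg: "g (flow X p) = g p + weighted_series c2 g p"
  proof -
    have e: "of_real (c2 (Suc m)) * ?a g (Suc m) = ?a g (Suc m)" for m by (simp add: c2_def del: funpow.simps fact_Suc)
    have "summable (\<lambda>m. ?a g (Suc m))"
      using sm[OF holo_torus_holo[OF bgf(2)]] summable_Suc_iff[of "?a g"] by (rule iffD2[rotated])
    then have "summable (\<lambda>m. of_real (c2 (Suc m)) * ?a g (Suc m))" unfolding e .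
    then have "summable (\<lambda>m. of_real (c2 m) * ?a g m)"
      using summable_Suc_iff[of "\<lambda>m. of_real (c2 m) * ?a g m"] by (rule iffD1[rotated])
    from suminf_split_head[OF this]
    have "weighted_series c2 g p = (\<Sum>m. ?a g (Suc m))" by (simp add: weighted_series_def c2_def)
    then show ?thesis unfolding head[OF holo_torus_holo[OF bgf(2)]] by simp
  qed
  have Ff: "f (flow X p) - (\<Sum>m. of_real (c1 m) * ?a f m) = weighted_series c3 f p"
  proof -
    have "f (flow X p) = (\<Sum>m. ?a f m)" using flow_compose(1)[OF p holo_torus_holo[OF bgf(3)]] by (simp add: lie_series_def)
    then have "f (flow X p) - (\<Sum>m. of_real (c1 m) * ?a f m) = (\<Sum>m. ?a f m - of_real (c1 m) * ?a f m)"
      using suminf_diff[OF sm[OF holo_torus_holo[OF bgf(3)]] s1] by simp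
    also have "\<dots> = weighted_series c3 f p"
    proof -
      have "of_real (c3 m) * z = z - of_real (c1 m) * z" for m and z :: complex
        by (simp add: c3_def c1_def algebra_simps)
      then show ?thesis unfolding weighted_series_def by (simp only:)
    qed
    finally show ?thesis .
  qed
  show ?thesis unfolding remainder_def Fb Fg H Ff[symmetric] by simp
qed

lemma
  assumes b: "holo_torus D rb sb b" "fnorm_le D rb sb b Mb" "0 \<le> Mb" and dl: "0 < \<delta>" "0 < \<delta>'" "r - \<rho> \<le> rb - \<delta>" "s - \<sigma> \<le> sb - \<delta>'"
    and g: "holo_torus D (r - \<rho>) (s - \<sigma>) g" "fnorm_le D (r - \<rho>) (s - \<sigma>) g Mg" "0 \<le> Mg"
    and f: "holo_torus D (r - \<rho>) (s - \<sigma>) f" "fnorm_le D (r - \<rho>) (s - \<sigma>) f Mf" "0 \<le> Mf"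
  shows holo_torus_remainder: "holo_torus D (r - 2 * \<rho>) (s - 2 * \<sigma>) (remainder b g f)"
    and fnorm_le_remainder: "fnorm_le D (r - 2 * \<rho>) (s - 2 * \<sigma>) (remainder b g f)
      ((A / \<delta> + B / (exp 1 * \<delta>')) * Mb / (1 - \<kappa>) + (\<kappa> / (1 - \<kappa>)) * (Mg + Mf))"
    and real_torus_remainder: "real_torus D rb sb b \<Longrightarrow> real_torus D (r - \<rho>) (s - \<sigma>) g \<Longrightarrow> real_torus D (r - \<rho>) (s - \<sigma>) f \<Longrightarrow> real_torus D (r - 2 * \<rho>) (s - 2 * \<sigma>) (remainder b g f)"
proof -
  let ?Mb = "(A / \<delta> + B / (exp 1 * \<delta>')) * Mb"
  have le: "r - \<rho> \<le> rb" "s - \<sigma> \<le> sb" using dl by simp_all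
  have b': "holo_torus D (r - \<rho>) (s - \<sigma>) b" by (rule holo_torus_mono[OF b(1) le])
  have L: "holo_torus D (r - \<rho>) (s - \<sigma>) (Lie X b)" by (rule holo_torus_Lie[OF holo_torus_X b'])
  have nL: "fnorm_le D (r - \<rho>) (s - \<sigma>) (Lie X b) ?Mb"
    by (rule fnorm_le_Lie_from[OF b(1,2) dl order_refl order_refl doms(3)])
  have pL: "0 \<le> ?Mb" using dl b(3) by (intro mult_nonneg_nonneg add_nonneg_nonneg divide_nonneg_pos[OF AB(3)] divide_nonneg_pos[OF AB(4)]) simp_all
  note S = holo_torus_weighted_series[OF L nL pL c_bounds(1) geometric_kappa(1)] holo_torus_weighted_series[OF g c_bounds(2) geometric_kappa(2)] holo_torus_weighted_series[OF f c_bounds(3) geometric_kappa(2)]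
  show "holo_torus D (r - 2 * \<rho>) (s - 2 * \<sigma>) (remainder b g f)"
    unfolding remainder_def[abs_def] by (intro holo_torus_add S)
  have "fnorm_le D (r - 2 * \<rho>) (s - 2 * \<sigma>) (remainder b g f) (1 / (1 - \<kappa>) * ?Mb + (\<kappa> / (1 - \<kappa>) * Mg + \<kappa> / (1 - \<kappa>) * Mf))"
    unfolding remainder_def[abs_def]
    by (intro fnorm_le_add holo_torus_add S doms(4) fnorm_le_weighted_series[OF L nL pL c_bounds(1) geometric_kappa(1)] fnorm_le_weighted_series[OF g c_bounds(2) geometric_kappa(2)] fnorm_le_weighted_series[OF f c_bounds(3) geometric_kappa(2)])
  then show "fnorm_le D (r - 2 * \<rho>) (s - 2 * \<sigma>) (remainder b g f) (?Mb / (1 - \<kappa>) + (\<kappa> / (1 - \<kappa>)) * (Mg + Mf))"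
    by (simp add: distrib_left)
  show "real_torus D (r - 2 * \<rho>) (s - 2 * \<sigma>) (remainder b g f)" if R: "real_torus D rb sb b" "real_torus D (r - \<rho>) (s - \<sigma>) g" "real_torus D (r - \<rho>) (s - \<sigma>) f"
    unfolding remainder_def[abs_def]
    by (intro real_torus_add real_torus_weighted_series[OF L nL pL c_bounds(1) geometric_kappa(1)] real_torus_weighted_series[OF g c_bounds(2) geometric_kappa(2)] real_torus_weighted_series[OF f c_bounds(3) geometric_kappa(2)]
         real_torus_Lie real_torus_X b' real_torus_mono[OF R(1) le] R)
qed

end

section \<open>Projections\<close>

lemma fcoeff_cnj:
  assumes R: "real_torus D r s F" and y: "y \<in> cnbhd D r" "real_vec y" and s: "0 < s"
  shows "fcoeff F (- k) y = cnj (fcoeff F k y)"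
proof -
  have "F (y, cvec x) * cis_k k (cvec x) = cnj (F (y, cvec x) * cis_k (- k) (cvec x))" for x
  proof -
    have "F (y, cvec x) \<in> \<real>" using R y cvec_strip[OF s, of x] by (simp add: real_torus_def mem_phase_dom)
    then show ?thesis by (simp add: Reals_cnj_iff cnj_cis_k)
  qed
  then have "integral cube (\<lambda>x. F (y, cvec x) * cis_k k (cvec x)) = cnj (integral cube (\<lambda>x. F (y, cvec x) * cis_k (- k) (cvec x)))"
    by (simp only: integral_cnj)
  then show ?thesis by (simp add: fcoeff_cis)
qed

lemma real_torus_fproj:
  assumes R: "real_torus D r s F" and s: "0 < s" and S: "\<And>k. k \<in> S \<Longrightarrow> - k \<in> S"
  shows "real_torus D r s (fproj S F)"
  unfolding real_torus_def
proof (intro allI impI, elim conjE)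
  fix y x assume p: "(y, x) \<in> phase_dom D r s" and re: "real_vec y" "real_vec x"
  have y: "y \<in> cnbhd D r" using p by (simp add: mem_phase_dom)
  have "cnj (fproj S F (y, x)) = (\<Sum>\<^sub>\<infinity>k\<in>S. fcoeff F (- k) y * cis_k (- k) x)"
    unfolding fproj_eq infsum_cnj[symmetric] by (simp add: fcoeff_cnj[OF R y re(1) s] cnj_cis_k[OF re(2)])
  also have "\<dots> = (\<Sum>\<^sub>\<infinity>k\<in>S. fcoeff F k y * cis_k k x)"
  proof (rule infsum_reindex_bij_betw)
    show "bij_betw uminus S S"
      by (rule bij_betw_byWitness[where f'=uminus]) (use S in auto)
  qed
  finally show "fproj S F (y, x) \<in> \<real>" by (simp add: Reals_cnj_iff fproj_eq)
qed

lemma fnorm_le_fproj: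
  assumes "0 < s" "fnorm_le D r s F M" shows "fnorm_le D r s (fproj S F) M"
  using fnorm_le_coeff_mono[OF assms(2), of "fproj S F" 1] by (simp add: fcoeff_fproj[OF assms])

lemma fproj_fproj:
  assumes s: "0 < s" and M: "fnorm_le D r s F M" and p: "p \<in> phase_dom D r s"
  shows "fproj T (fproj S F) p = fproj (T \<inter> S) F p"
proof -
  have y: "fst p \<in> cnbhd D r" using p by (simp add: mem_phase_dom(2))
  show ?thesis unfolding fproj_eq[of T "fproj S F" p] fproj_eq[of "T \<inter> S" F p]
    by (rule infsum_cong_neutral) (auto simp: fcoeff_fproj[OF s M y])
qed

lemma fproj_Un:
  assumes M: "fnorm_le D r s F M" and p: "p \<in> phase_dom D r s" and d: "S \<inter> T = {}"
  shows "fproj (S \<union> T) F p = fproj S F p + fproj T F p"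
proof -
  have "(fst p, snd p) \<in> phase_dom D r s" using p by simp
  note sm = abs_summable_summable[OF fproj_abs_summable[OF M this]]
  show ?thesis unfolding fproj_eq by (rule infsum_Un_disjoint[OF sm sm d])
qed

lemma symplectic_map_mono:
  assumes "symplectic_map D r s r' s' \<Psi> dy dx" "r'' \<le> r'" "s'' \<le> s'" "dy \<le> dy'" "dx \<le> dx'"
  shows "symplectic_map D r s r'' s'' \<Psi> dy' dx'"
proof -
  have sub: "phase_dom D r'' s'' \<subseteq> phase_dom D r' s'" by (rule phase_dom_mono[OF assms(2,3)])
  have sc: "symplectic_change D r' s' \<Psi>" using assms(1) by (simp add: symplectic_map_def)
  have "symplectic_change D r'' s'' \<Psi>"
    unfolding symplectic_change_def real_analytic_torus_iff
  proof (intro conjI allI ballI)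
    fix i
    show "holo_torus D r'' s'' (\<lambda>p. fst (\<Psi> p) $ i)" by (rule holo_torus_mono[OF symplectic_changeD(1)[OF sc] assms(2,3)])
    show "real_torus D r'' s'' (\<lambda>p. fst (\<Psi> p) $ i)" by (rule real_torus_mono[OF symplectic_changeD(2)[OF sc] assms(2,3)])
    show "holo_torus D r'' s'' (\<lambda>p. snd (\<Psi> p) $ i - snd p $ i)" by (rule holo_torus_mono[OF symplectic_changeD(3)[OF sc] assms(2,3)])
    show "real_torus D r'' s'' (\<lambda>p. snd (\<Psi> p) $ i - snd p $ i)" by (rule real_torus_mono[OF symplectic_changeD(4)[OF sc] assms(2,3)])
  next
    show "inj_on \<Psi> (phase_dom D r'' s'')"
      by (rule inj_on_subset[OF _ sub]) (use sc in \<open>simp add: symplectic_change_def\<close>)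
  next
    fix p assume "p \<in> phase_dom D r'' s''"
    then have "p \<in> phase_dom D r' s'" using sub by blast
    then show "\<exists>L. (\<Psi> has_derivative L) (at p) \<and> (\<forall>u v. symp_form (L u) (L v) = symp_form u v)"
      using sc unfolding symplectic_change_def by blast
  qed
  moreover have "\<Psi> p \<in> phase_dom D r s \<and> l1norm (fst (\<Psi> p) - fst p) \<le> dy' \<and> (\<forall>i. norm (snd (\<Psi> p) $ i - snd p $ i) \<le> dx')"
    if "p \<in> phase_dom D r'' s''" for p
  proof -
    have "p \<in> phase_dom D r' s'" using sub that by blast
    then have "\<Psi> p \<in> phase_dom D r s" "l1norm (fst (\<Psi> p) - fst p) \<le> dy" "\<And>i. norm (snd (\<Psi> p) $ i - snd p $ i) \<le> dx"
      using assms(1) by (simp_all add: symplectic_map_def)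
    then show ?thesis using assms(4,5) order_trans by blast
  qed
  ultimately show ?thesis unfolding symplectic_map_def by blast
qed

section \<open>The homological equation\<close>

text \<open>
  The modes \<open>S\<close> are those to be removed. As \<open>0 \<in> \<Lambda>\<close>, the zero mode is not among them, and \<open>S = - S\<close>
  because \<open>\<Lambda>\<close> is a group; this symmetry keeps projections of real functions real.
\<close>

locale nonres =
  fixes D :: "(real^'n::finite) set" and r0 \<alpha> :: real and K :: nat and \<Lambda> :: "(int^'n) set" and h :: "complex^'n \<Rightarrow> complex"
  assumes \<alpha>: "0 < \<alpha>" and \<Lambda>: "sublattice \<Lambda>" and h: "real_analytic_act (cnbhd D r0) h"
    and nonres: "nonresonant h \<alpha> K \<Lambda> (cnbhd D r0)"
begin

abbreviation "S \<equiv> {l. l \<notin> \<Lambda> \<and> int_l1norm l \<le> int K}"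

definition hh :: "'n phase \<Rightarrow> complex" where "hh p = h (fst p)"

lemma finite_S: "finite S"
  by (rule finite_subset[OF _ finite_int_l1_ball[of "int K"]]) auto

lemma \<Lambda>_minus: "k \<in> \<Lambda> \<Longrightarrow> - k \<in> \<Lambda>"
  using \<Lambda> unfolding sublattice_def by (metis diff_0)

lemma S_minus: "k \<in> S \<Longrightarrow> - k \<in> S"
  using \<Lambda>_minus[of "- k"] by auto

lemma holo_hh: "holo (phase_dom D r0 s) hh"
  unfolding holo_def
proof
  fix p assume "p \<in> phase_dom D r0 s"
  then have "fst p \<in> cnbhd D r0" by (simp add: mem_phase_dom(2))
  then obtain L where L: "(h has_derivative L) (at (fst p))" "\<And>c v. L (c *s v) = c * L v"
    using h unfolding real_analytic_act_def by blast
  have "(hh has_derivative (\<lambda>v. L (fst v))) (at p)"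
    unfolding hh_def[abs_def]
    by (rule has_derivative_compose[OF bounded_linear_imp_has_derivative[OF bounded_linear_fst] L(1)])
  then show "\<exists>L. (hh has_derivative L) (at p) \<and> (\<forall>c v. L (cscale c v) = c * L v)"
    using L(2) by (intro exI[of _ "\<lambda>v. L (fst v)"]) simp
qed

lemma holo_torus_hh: "holo_torus D r0 s hh"
  using holo_hh by (simp add: holo_torus_def hh_def)

lemma real_torus_hh: "real_torus D r0 s hh"
  using h by (simp add: real_torus_def hh_def real_analytic_act_def mem_phase_dom)

lemma pd_hh: "pd (Inl i) hh p = cgrad h (fst p) $ i" "pd (Inr i) hh p = 0"
  by (simp_all add: pd_def dd_def hh_def coord_vec_def cgrad_def)

definition omega :: "int^'n \<Rightarrow> 'n phase \<Rightarrow> complex" where "omega l p = kdot l (cgrad h (fst p))"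

lemma omega_pd: "omega l = (\<lambda>p. \<Sum>i\<in>UNIV. of_real (of_int (l $ i)) * pd (Inl i) hh p)"
  by (simp add: omega_def kdot_def pd_hh fun_eq_iff)

lemma holo_torus_omega: "holo_torus D r0 s (omega l)" and real_torus_omega: "real_torus D r0 s (omega l)"
  unfolding omega_pd
  by (intro holo_torus_sum holo_torus_cmult holo_torus_pd holo_torus_hh) (intro real_torus_sum real_torus_cmult real_torus_pd holo_torus_hh real_torus_hh)

lemma omega_lower: "p \<in> phase_dom D r0 s \<Longrightarrow> l \<in> S \<Longrightarrow> \<alpha> \<le> norm (omega l p)"
  using nonres by (simp add: nonresonant_def omega_def mem_phase_dom(2))

text \<open>
  The solution \<open>\<phi>\<close> of the homological equation for the modes in \<open>S\<close>.
\<close>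

definition generator :: "('n phase \<Rightarrow> complex) \<Rightarrow> 'n phase \<Rightarrow> complex" where
  "generator f p = (\<Sum>l\<in>S. (\<i> * coeff_fun f l p * inverse (omega l p)) * cis_k l (snd p))"

lemma
  assumes f: "holo_torus D r s f" and s: "0 < s" and r: "r \<le> r0" and M: "fnorm_le D r s f M"
  shows fnorm_le_generator: "fnorm_le D r s (generator f) (M / \<alpha>)"
    and trig_poly_generator: "trig_poly D r s S (generator f)"
    and real_torus_generator: "real_torus D r s f \<Longrightarrow> real_torus D r s (generator f)"
    and Lie_generator: "p \<in> phase_dom D r s \<Longrightarrow> Lie (ham (generator f)) hh p = - fproj S f p"
proof -
  let ?W = "phase_dom D r s"
  have W0: "?W \<subseteq> phase_dom D r0 s" by (rule phase_dom_mono[OF r order_refl])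
  have nz: "omega l p \<noteq> 0" if "p \<in> ?W" "l \<in> S" for p l
    using omega_lower[OF subsetD[OF W0 that(1)] that(2)] \<alpha> by auto
  have inv: "holo_torus D r s (\<lambda>p. inverse (omega l p))" if l: "l \<in> S" for l
  proof -
    have "holo ?W (\<lambda>p. inverse (omega l p))"
      by (rule holo_inverse[OF holo_subset[OF holo_torus_holo[OF holo_torus_omega] W0] nz[OF _ l]])
    then show ?thesis by (simp add: holo_torus_def omega_def)
  qed
  let ?a = "\<lambda>l p. \<i> * coeff_fun f l p * inverse (omega l p)"
  have pa: "holo_torus D r s (?a l)" if "l \<in> S" for l
    by (intro holo_torus_mult holo_torus_const holo_torus_coeff_fun[OF f s] inv that)
  have pt: "holo_torus D r s (\<lambda>p. ?a l p * cis_k l (snd p))" if "l \<in> S" for l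
    by (intro holo_torus_mult[OF pa[OF that] holo_torus_cis])
  have pg: "holo_torus D r s (generator f)"
    unfolding generator_def[abs_def] by (rule holo_torus_sum[OF pt])
  have fc: "fcoeff (generator f) k y = (if k \<in> S then \<i> * fcoeff f k y * inverse (omega k (y, 0)) else 0)" if y: "y \<in> cnbhd D r" for k y
  proof -
    have "fcoeff (generator f) k y = (\<Sum>l\<in>S. fcoeff (\<lambda>p. ?a l p * cis_k l (snd p)) k y)"
      unfolding generator_def[abs_def] by (rule fcoeff_sum[OF pt y s])
    also have "\<dots> = (\<Sum>l\<in>S. (\<i> * fcoeff f l y * inverse (omega l (y, 0))) * (if k = l then 1 else 0))"
    proof (rule sum.cong[OF refl])
      fix l
      have "fcoeff (\<lambda>p. ?a l p * cis_k l (snd p)) k y = (\<i> * fcoeff f l y * inverse (omega l (y, 0))) * fcoeff (\<lambda>p. cis_k l (snd p)) k y"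
        using fcoeff_cmult[where a="\<lambda>y. \<i> * fcoeff f l y * inverse (omega l (y, 0))" and F="\<lambda>p. cis_k l (snd p)"]
        by (simp add: coeff_fun_def omega_def)
      then show "fcoeff (\<lambda>p. ?a l p * cis_k l (snd p)) k y = (\<i> * fcoeff f l y * inverse (omega l (y, 0))) * (if k = l then 1 else 0)"
        by (simp only: fcoeff_const_cis[OF y])
    qed
    also have "\<dots> = (if k \<in> S then \<i> * fcoeff f k y * inverse (omega k (y, 0)) else 0)"
      using finite_S by (simp add: if_distrib cong: if_cong)
    finally show ?thesis .
  qed
  have "fnorm_le D r s (generator f) (1 / \<alpha> * M)"
  proof (rule fnorm_le_coeff_mono[OF M])
    fix k y assume y: "y \<in> cnbhd D r"
    show "norm (fcoeff (generator f) k y) \<le> 1 / \<alpha> * norm (fcoeff f k y)"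
    proof (cases "k \<in> S")
      case True
      have "(y, 0) \<in> ?W" using y s by (simp add: mem_phase_dom strip_def)
      then have "\<alpha> \<le> norm (omega k (y, 0))" using omega_lower[OF subsetD[OF W0] True] by blast
      then have "norm (inverse (omega k (y, 0))) \<le> 1 / \<alpha>" using \<alpha> le_imp_inverse_le[of \<alpha> "norm (omega k (y, 0))"]
        unfolding norm_inverse by (simp add: inverse_eq_divide)
      then have "norm (fcoeff f k y) * norm (inverse (omega k (y, 0))) \<le> norm (fcoeff f k y) * (1 / \<alpha>)" by (rule mult_left_mono) simp
      then show ?thesis unfolding fc[OF y] using True by (simp add: norm_mult)
    next
      case False
      then show ?thesis using \<alpha> unfolding fc[OF y] if_not_P[OF False] by simp
    qed
  qed (use \<alpha> in simp)
  then show "fnorm_le D r s (generator f) (M / \<alpha>)" by simp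
  have cfg: "coeff_fun (generator f) l p = ?a l p" if "l \<in> S" "p \<in> ?W" for l p
    using that fc[of "fst p" l] by (simp add: coeff_fun_def mem_phase_dom(2) omega_def)
  show tr: "trig_poly D r s S (generator f)"
    unfolding trig_poly_def
  proof (intro conjI ballI finite_S pg s)
    fix p assume "p \<in> ?W"
    then show "generator f p = (\<Sum>l\<in>S. coeff_fun (generator f) l p * cis_k l (snd p))"
      unfolding generator_def[of f p] by (intro sum.cong refl) (simp only: cfg)
  qed
  show "real_torus D r s (generator f)" if R: "real_torus D r s f"
    unfolding real_torus_def
  proof (intro allI impI, elim conjE)
    fix y x assume p: "(y, x) \<in> phase_dom D r s" and re: "real_vec y" "real_vec x"
    have y: "y \<in> cnbhd D r" using p by (simp add: mem_phase_dom)
    have om: "omega l (y, x) \<in> \<real>" for l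
      using real_torus_omega[of s l] p W0 re unfolding real_torus_def by blast
    have "cnj (generator f (y, x)) = (\<Sum>l\<in>S. cnj (?a l (y, x) * cis_k l x))"
      by (simp add: generator_def)
    also have "\<dots> = (\<Sum>l\<in>S. ?a (- l) (y, x) * cis_k (- l) x)"
    proof (rule sum.cong[OF refl])
      fix l
      have "omega (- l) (y, x) = - omega l (y, x)" by (simp add: omega_def kdot_simps)
      then show "cnj (?a l (y, x) * cis_k l x) = ?a (- l) (y, x) * cis_k (- l) x"
        using om[of l] by (simp add: coeff_fun_def fcoeff_cnj[OF R y re(1) s] cnj_cis_k[OF re(2)] Reals_cnj_iff)
    qed
    also have "\<dots> = (\<Sum>l\<in>S. ?a l (y, x) * cis_k l x)"
      by (rule sum.reindex_bij_betw[of uminus]) (rule bij_betw_byWitness[where f'=uminus]; use \<Lambda>_minus in force)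
    finally show "generator f (y, x) \<in> \<real>" by (simp add: Reals_cnj_iff generator_def)
  qed
  show "Lie (ham (generator f)) hh p = - fproj S f p" if p: "p \<in> ?W"
  proof -
    have "Lie (ham (generator f)) hh p = (\<Sum>i\<in>UNIV. ham (generator f) (Inl i) p * cgrad h (fst p) $ i)"
      by (simp add: Lie_def sum_UNIV_Plus pd_hh)
    also have "\<dots> = (\<Sum>i\<in>UNIV. \<Sum>l\<in>S. cis_k l (snd p) * (\<i> * of_int (l $ i) * ?a l p) * cgrad h (fst p) $ i)"
      unfolding ham_trig_poly(1)[OF tr p] sum_distrib_right
      by (intro sum.cong refl) (simp only: cfg[OF _ p])
    also have "\<dots> = (\<Sum>l\<in>S. cis_k l (snd p) * (\<i> * ?a l p) * omega l p)"
    proof (subst sum.swap, intro sum.cong refl)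
      fix l
      have om: "omega l p = (\<Sum>i\<in>UNIV. of_int (l $ i) * cgrad h (fst p) $ i)"
        by (simp add: omega_def kdot_def)
      have "(\<Sum>i\<in>UNIV. cis_k l (snd p) * (\<i> * of_int (l $ i) * a) * cgrad h (fst p) $ i)
          = cis_k l (snd p) * (\<i> * a) * omega l p" for a
        unfolding om sum_distrib_left by (simp add: mult_ac)
      then show "(\<Sum>i\<in>UNIV. cis_k l (snd p) * (\<i> * of_int (l $ i) * ?a l p) * cgrad h (fst p) $ i)
          = cis_k l (snd p) * (\<i> * ?a l p) * omega l p" .
    qed
    also have "\<dots> = (\<Sum>l\<in>S. - (coeff_fun f l p * cis_k l (snd p)))"
      by (intro sum.cong refl) (simp add: nz[OF p] mult_ac)
    also have "\<dots> = - fproj S f p"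
      using finite_S by (simp add: fproj_eq coeff_fun_def sum_negf)
    finally show ?thesis .
  qed
qed

text \<open>
  The bookkeeping of one step, with the field generated from \<open>f\<close>: the sum \<open>b + g\<close> is kept, \<open>f\<close> disappears
  and a new remainder \<open>R\<close> is produced. The distances \<open>\<delta>\<close>, \<open>\<delta>'\<close> to the boundary of the domain of \<open>b\<close> are
  independent of the losses \<open>\<rho>\<close>, \<open>\<sigma>\<close>.
\<close>

lemma normal_form_step:
  assumes f: "holo_torus D r s f" "real_torus D r s f" "fnorm_le D r s f M" "0 \<le> M" and fS: "\<And>p. p \<in> phase_dom D r s \<Longrightarrow> fproj S f p = f p"
    and g: "holo_torus D r s g" "real_torus D r s g" "fnorm_le D r s g Mg" "0 \<le> Mg"
    and b: "holo_torus D rb sb b" "real_torus D rb sb b" "fnorm_le D rb sb b Mb" "0 \<le> Mb"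
    and r: "r \<le> r0" and pos: "0 < \<rho>" "0 < \<sigma>" "3 * \<sigma> < s"
    and dl: "0 < \<delta>" "0 < \<delta>'" "r - \<rho> \<le> rb - \<delta>" "s - \<sigma> \<le> sb - \<delta>'"
    and \<kappa>: "\<kappa> = 2 * (M / \<alpha>) / (\<rho> * \<sigma>)" "\<kappa> \<le> 1 / 8"
  shows "\<exists>\<Psi> R. symplectic_map D r s (r - 3 * \<rho>) (s - 3 * \<sigma>) \<Psi> (M / \<alpha> / (exp 1 * \<sigma>) / (1 - \<kappa>)) (M / \<alpha> / \<rho> / (1 - \<kappa>)) \<and>
    holo_torus D (r - 3 * \<rho>) (s - 3 * \<sigma>) R \<and> real_torus D (r - 3 * \<rho>) (s - 3 * \<sigma>) R \<and>
    fnorm_le D (r - 3 * \<rho>) (s - 3 * \<sigma>) R ((M / \<alpha> / (exp 1 * \<sigma>) / \<delta> + M / \<alpha> / \<rho> / (exp 1 * \<delta>')) * Mb / (1 - \<kappa>) + (\<kappa> / (1 - \<kappa>)) * (Mg + M)) \<and>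
    (\<forall>p\<in>phase_dom D (r - 3 * \<rho>) (s - 3 * \<sigma>). hh (\<Psi> p) + b (\<Psi> p) + g (\<Psi> p) + f (\<Psi> p) = hh p + b p + g p + R p)"
proof -
  have s: "0 < s" using pos by simp
  interpret nf_step D r s \<rho> \<sigma> "M / \<alpha>" \<kappa> S "generator f"
    by unfold_locales (use trig_poly_generator[OF f(1) s r f(3)] real_torus_generator[OF f(1) s r f(3) f(2)] fnorm_le_generator[OF f(1) s r f(3)] pos f(4) \<alpha> \<kappa> in auto)
  have le: "r - 3 * \<rho> \<le> r - 2 * \<rho>" "s - 3 * \<sigma> \<le> s - 2 * \<sigma>" using pos by simp_all
  have le1: "r - \<rho> \<le> r" "s - \<sigma> \<le> s" using pos by simp_all
  note g' = holo_torus_mono[OF g(1) le1] fnorm_le_mono[OF g(3) le1 order_refl] g(4)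
  note f' = holo_torus_mono[OF f(1) le1] fnorm_le_mono[OF f(3) le1 order_refl] f(4)
  note b' = b(1,3,4)
  show ?thesis
  proof (intro exI[of _ "flow X"] exI[of _ "remainder b g f"] conjI ballI)
    show "symplectic_map D r s (r - 3 * \<rho>) (s - 3 * \<sigma>) (flow X) (A / (1 - \<kappa>)) (B / (1 - \<kappa>))" by (rule symplectic_map_flow)
    show "holo_torus D (r - 3 * \<rho>) (s - 3 * \<sigma>) (remainder b g f)"
      by (rule holo_torus_mono[OF holo_torus_remainder[OF b' dl g' f'] le])
    show "real_torus D (r - 3 * \<rho>) (s - 3 * \<sigma>) (remainder b g f)"
      by (rule real_torus_mono[OF real_torus_remainder[OF b' dl g' f' b(2) real_torus_mono[OF g(2) le1] real_torus_mono[OF f(2) le1]] le])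
    show "fnorm_le D (r - 3 * \<rho>) (s - 3 * \<sigma>) (remainder b g f) ((A / \<delta> + B / (exp 1 * \<delta>')) * Mb / (1 - \<kappa>) + (\<kappa> / (1 - \<kappa>)) * (Mg + M))"
      by (rule fnorm_le_mono[OF fnorm_le_remainder[OF b' dl g' f'] le order_refl])
    fix p assume p: "p \<in> phase_dom D (r - 3 * \<rho>) (s - 3 * \<sigma>)"
    show "hh (flow X p) + b (flow X p) + g (flow X p) + f (flow X p) = hh p + b p + g p + remainder b g f p"
    proof (rule flow_expansion[OF _ _ _ g'(1) f'(1)])
      show "holo (phase_dom D (r - \<rho>) (s - \<sigma>)) hh"
        by (rule holo_subset[OF holo_hh phase_dom_mono[OF _ order_refl]]) (use r pos in simp)
      show "holo_torus D (r - \<rho>) (s - \<sigma>) b" by (rule holo_torus_mono[OF b(1)]) (use dl in simp_all)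
      show "p \<in> phase_dom D (r - 2 * \<rho>) (s - 2 * \<sigma>)" using p phase_dom_mono[OF le] by blast
      fix q assume "q \<in> phase_dom D (r - \<rho>) (s - \<sigma>)"
      then have "q \<in> phase_dom D r s" using phase_dom_mono[OF le1] by blast
      then show "Lie X hh q = - f q" using Lie_generator[OF f(1) s r f(3)] fS by simp
    qed
  qed
qed

lemma fproj_split:
  assumes R: "holo_torus D r s R" "real_torus D r s R" "fnorm_le D r s R M" and s: "0 < s"
  shows "holo_torus D r s (fproj S R)" "real_torus D r s (fproj S R)" "fnorm_le D r s (fproj S R) M"
    "p \<in> phase_dom D r s \<Longrightarrow> fproj S (fproj S R) p = fproj S R p"
    "holo_torus D r s (\<lambda>p. R p - fproj S R p)" "real_torus D r s (\<lambda>p. R p - fproj S R p)"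
    "y \<in> cnbhd D r \<Longrightarrow> fcoeff (\<lambda>p. R p - fproj S R p) k y = (if k \<in> S then 0 else fcoeff R k y)"
    "fnorm_le D r s (\<lambda>p. R p - fproj S R p) M"
proof -
  show P: "holo_torus D r s (fproj S R)" by (rule holo_torus_fproj[OF R(1) s R(3)])
  show r: "real_torus D r s (fproj S R)" by (rule real_torus_fproj[OF R(2) s S_minus])
  show "fnorm_le D r s (fproj S R) M" by (rule fnorm_le_fproj[OF s R(3)])
  show "p \<in> phase_dom D r s \<Longrightarrow> fproj S (fproj S R) p = fproj S R p"
    using fproj_fproj[OF s R(3), of p S S] by simp
  show "holo_torus D r s (\<lambda>p. R p - fproj S R p)" by (rule holo_torus_diff[OF R(1) P])
  show "real_torus D r s (\<lambda>p. R p - fproj S R p)" by (rule real_torus_diff[OF R(2) r])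
  show c: "fcoeff (\<lambda>p. R p - fproj S R p) k y = (if k \<in> S then 0 else fcoeff R k y)" if "y \<in> cnbhd D r" for k y
    by (simp add: fcoeff_diff[OF R(1) P that s] fcoeff_fproj[OF s R(3) that])
  show "fnorm_le D r s (\<lambda>p. R p - fproj S R p) M"
    using fnorm_le_coeff_mono[OF R(3), of "\<lambda>p. R p - fproj S R p" 1] by (simp add: c)
qed

end

section \<open>Iteration\<close>

locale nf_setup = nonres D r \<alpha> K \<Lambda> h
  for D :: "(real^'n::finite) set" and r \<alpha> K and \<Lambda> :: "(int^'n) set" and h +
  fixes s F \<theta> :: real and f :: "'n phase \<Rightarrow> complex"
  assumes K: "2 \<le> K" and pos: "0 < r" "0 < s"
    and f: "holo_torus D r s f" "real_torus D r s f" "fnorm_le D r s f F" "0 \<le> F"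
    and \<theta>: "\<theta> = 2 ^ 11 * (real K)\<^sup>2 / (\<alpha> * r * s) * F" "\<theta> < 1"
begin

abbreviation "k \<equiv> real K"

text \<open>
  All quantities are expressed by the dimensionless \<open>c\<close>, so that \<open>\<theta> = 2048 K\<^sup>2 c\<close>. The part
  with modes in \<open>S\<close> after step \<open>j + 1\<close> has norm at most \<open>u j * F\<close>; \<open>w\<close> and \<open>v\<close> are the units of the action and angle
  displacements; \<open>rr j\<close> and \<open>ss j\<close> are the widths of the domain at that stage. The first step reduces
  the widths by \<open>r/4\<close> and \<open>s/(2K)\<close>, the others by \<open>r/(4K)\<close> and \<open>s/(2K\<^sup>2)\<close>, so that after \<open>K\<close> steps at least
  \<open>r/2\<close> and \<open>s - s/K\<close> remain.
\<close>

definition c :: real where "c = F / (\<alpha> * r * s)"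
definition u :: "nat \<Rightarrow> real" where "u j = (\<theta> / 8) ^ j * (\<theta> / (8 * k))"
definition w :: real where "w = k * c * r"
definition v :: real where "v = c * s"
definition rr :: "nat \<Rightarrow> real" where "rr j = 3 * r / 4 - real j * (r / (4 * k))"
definition ss :: "nat \<Rightarrow> real" where "ss j = s - s / (2 * k) - real j * (s / (2 * k\<^sup>2))"
text \<open>
  The part of \<open>f\<close> that is never touched: the resonant modes and those of order above \<open>K\<close>.
\<close>

definition b :: "'n phase \<Rightarrow> complex" where "b p = f p - fproj S f p"

lemma k2: "2 \<le> k" "0 < k" using K by simp_all

lemma c0: "0 \<le> c" using f(4) \<alpha> pos by (simp add: c_def)

lemma \<theta>c: "\<theta> = 2048 * k\<^sup>2 * c" by (simp add: \<theta> c_def)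

lemma \<theta>0: "0 \<le> \<theta>" using c0 by (simp add: \<theta>c)

lemma Fc: "F / \<alpha> = c * r * s" using \<alpha> pos by (simp add: c_def)

lemma kc: "k * c \<le> 1 / 4096" "k\<^sup>2 * c < 1 / 2048"
proof -
  show k: "k\<^sup>2 * c < 1 / 2048" using \<theta>(2) by (simp add: \<theta>c)
  have "2 * (k * c) \<le> k * (k * c)" using k2 c0 by (intro mult_right_mono) simp_all
  then show "k * c \<le> 1 / 4096" using k by (simp add: power2_eq_square)
qed

lemma u0: "0 \<le> u j" using \<theta>0 k2 by (simp add: u_def)

lemma ku: "k * u j = (\<theta> / 8) ^ j * (\<theta> / 8)" using k2 by (simp add: u_def)

lemma ku_le: "k * u j \<le> (1 / 8) ^ j * (1 / 8)" "k * u j \<le> 1 / 8 * \<theta>"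
proof -
  have p: "(\<theta> / 8) ^ j \<le> (1 / 8) ^ j" using \<theta>0 \<theta>(2) by (intro power_mono) simp_all
  then show "k * u j \<le> (1 / 8) ^ j * (1 / 8)" unfolding ku using \<theta>0 \<theta>(2) by (intro mult_mono) simp_all
  have "(\<theta> / 8) ^ j \<le> 1" using \<theta>0 \<theta>(2) by (intro power_le_one) simp_all
  then have "(\<theta> / 8) ^ j * (\<theta> / 8) \<le> 1 * (\<theta> / 8)" using \<theta>0 by (intro mult_right_mono) simp_all
  then show "k * u j \<le> 1 / 8 * \<theta>" unfolding ku by simp
qed

lemma u_Suc: "u (Suc j) = \<theta> / 8 * u j" by (simp add: u_def)

lemma u_Suc_le: "2 * u (Suc j) \<le> u j"
  using mult_right_mono[of "\<theta> / 4" 1 "u j"] u0 \<theta>(2) by (simp add: u_Suc)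

lemma u_le_u0: "u j \<le> u 0"
proof (induction j)
  case (Suc j)
  then show ?case using u_Suc_le[of j] u0[of "Suc j"] by linarith
qed simp

lemma exp1: "2 \<le> exp (1::real)" using exp_ge_add_one_self[of 1] by simp

lemma inv_one_minus: "0 \<le> x \<Longrightarrow> x \<le> q \<Longrightarrow> q < 1 \<Longrightarrow> 0 \<le> a \<Longrightarrow> a / (1 - x) \<le> a / (1 - q)" for a x q :: real
  by (intro divide_left_mono) simp_all

lemma div_exp1: "0 \<le> a \<Longrightarrow> a / exp 1 \<le> a / 2" for a :: real
  using exp1 by (intro divide_left_mono) simp_all

lemma b_facts: "holo_torus D r s b" "real_torus D r s b" "fnorm_le D r s b F" "p \<in> phase_dom D r s \<Longrightarrow> f p = b p + fproj S f p"
    "y \<in> cnbhd D r \<Longrightarrow> fcoeff b l y = (if l \<in> S then 0 else fcoeff f l y)"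
  unfolding b_def[abs_def] using fproj_split[OF f(1-3) pos(2)] by simp_all

text \<open>
  After \<open>j + 1\<close> steps the Hamiltonian is \<open>h + b + g + f\<^sub>j\<close>, where \<open>f\<^sub>j\<close> has only modes in \<open>S\<close> and \<open>g\<close>, which
  collects the other modes of the remainders, has none. Since \<open>u\<close> decreases at least by half in each
  step, the bound \<open>(2 u\<^sub>0 - u\<^sub>j) F\<close> of \<open>g\<close> telescopes. In the same way the bounds on the displacement
  with the factors \<open>6 - 8\<^sup>-\<^sup>j\<close> and \<open>16 - 2 \<cdot> 8\<^sup>-\<^sup>j\<close> leave room for the geometrically decreasing later steps.
\<close>

lemma iterate:
  "j \<le> K - 1 \<Longrightarrow> \<exists>\<Psi> g fj. symplectic_map D r s (rr j) (ss j) \<Psi> ((6 - (1/8) ^ j) * w) ((16 - 2 * (1/8) ^ j) * v) \<and>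
     holo_torus D (rr j) (ss j) g \<and> real_torus D (rr j) (ss j) g \<and> fnorm_le D (rr j) (ss j) g ((2 * u 0 - u j) * F) \<and>
     holo_torus D (rr j) (ss j) fj \<and> real_torus D (rr j) (ss j) fj \<and> fnorm_le D (rr j) (ss j) fj (u j * F) \<and>
     (\<forall>p\<in>phase_dom D (rr j) (ss j). fproj S fj p = fj p) \<and>
     (\<forall>y\<in>cnbhd D (rr j). \<forall>l\<in>S. fcoeff g l y = 0) \<and>
     (\<forall>p\<in>phase_dom D (rr j) (ss j). hh (\<Psi> p) + f (\<Psi> p) = hh p + b p + g p + fj p)"
proof (induction j)
  case 0
  \<comment> \<open>Three losses of this size use up \<open>r/4\<close> and \<open>s/(2K)\<close>; then \<open>\<kappa> = 2 (F/\<alpha>) / (\<rho> \<sigma>) = 144 K c \<le> 144/4096 = 9/256\<close>.\<close>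
  let ?\<rho> = "r / 12" and ?\<sigma> = "s / (6 * k)" and ?\<kappa> = "144 * (k * c)"
  note sp = fproj_split[OF f(1-3) pos(2)]
  have z: "holo_torus D r s (\<lambda>p. 0)" "real_torus D r s (\<lambda>p. 0)" "fnorm_le D r s (\<lambda>p. 0) 0"
    by (simp_all add: holo_torus_const real_torus_def fnorm_le_def fcoeff_zero)
  have \<kappa>: "?\<kappa> \<le> 9 / 256" "0 \<le> ?\<kappa>" using kc(1) c0 k2 by simp_all
  have s6: "s / (6 * k) \<le> s / 12" using k2 pos by (intro divide_left_mono) simp_all
  have side: "0 < ?\<rho>" "0 < ?\<sigma>" "3 * ?\<sigma> < s" "?\<kappa> = 2 * (F / \<alpha>) / (?\<rho> * ?\<sigma>)" "?\<kappa> \<le> 1 / 8"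
    unfolding Fc using s6 pos k2 \<kappa> by (simp_all add: field_simps)
  from normal_form_step[where g="\<lambda>p. 0", OF sp(1-3) f(4) sp(4) z order_refl b_facts(1-3) f(4) order_refl side(1-3) side(1,2) order_refl order_refl side(4,5)]
  obtain \<Psi> R where \<Psi>: "symplectic_map D r s (r - 3 * ?\<rho>) (s - 3 * ?\<sigma>) \<Psi> (F / \<alpha> / (exp 1 * ?\<sigma>) / (1 - ?\<kappa>)) (F / \<alpha> / ?\<rho> / (1 - ?\<kappa>))"
    and R: "holo_torus D (r - 3 * ?\<rho>) (s - 3 * ?\<sigma>) R" "real_torus D (r - 3 * ?\<rho>) (s - 3 * ?\<sigma>) R"
    "fnorm_le D (r - 3 * ?\<rho>) (s - 3 * ?\<sigma>) R ((F / \<alpha> / (exp 1 * ?\<sigma>) / ?\<rho> + F / \<alpha> / ?\<rho> / (exp 1 * ?\<sigma>)) * F / (1 - ?\<kappa>) + (?\<kappa> / (1 - ?\<kappa>)) * (0 + F))"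
    and eq: "\<And>p. p \<in> phase_dom D (r - 3 * ?\<rho>) (s - 3 * ?\<sigma>) \<Longrightarrow> hh (\<Psi> p) + b (\<Psi> p) + 0 + fproj S f (\<Psi> p) = hh p + b p + 0 + R p"
    by blast
  have dom: "r - 3 * ?\<rho> = rr 0" "s - 3 * ?\<sigma> = ss 0" using k2 by (simp_all add: rr_def ss_def)
  have "(F / \<alpha> / (exp 1 * ?\<sigma>) / ?\<rho> + F / \<alpha> / ?\<rho> / (exp 1 * ?\<sigma>)) * F / (1 - ?\<kappa>) + (?\<kappa> / (1 - ?\<kappa>)) * (0 + F)
      = (?\<kappa> / exp 1 + ?\<kappa>) * F / (1 - ?\<kappa>)"
    unfolding Fc using pos k2 by (simp add: add_divide_distrib distrib_right)
  also have "\<dots> \<le> (?\<kappa> / 2 + ?\<kappa>) * F / (1 - 9 / 256)"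
  proof (rule order_trans[OF inv_one_minus[OF \<kappa>(2,1)]])
    show "(?\<kappa> / exp 1 + ?\<kappa>) * F / (1 - 9 / 256) \<le> (?\<kappa> / 2 + ?\<kappa>) * F / (1 - 9 / 256)"
      using div_exp1[OF \<kappa>(2)] f(4) by (intro divide_right_mono mult_right_mono add_right_mono) simp_all
  qed (use \<kappa> f(4) in simp_all)
  also have "\<dots> \<le> u 0 * F"
  proof -
    have "u 0 = \<theta> / (8 * k)" by (simp add: u_def)
    also have "\<dots> = 256 * (k * c)" using k2 by (subst \<theta>c) (simp add: power2_eq_square)
    finally have "u 0 = 256 * (k * c)" .
    moreover have "0 \<le> k * c" using k2 c0 by simp
    ultimately have "(?\<kappa> / 2 + ?\<kappa>) / (1 - 9 / 256) \<le> u 0" by simp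
    from mult_right_mono[OF this f(4)] show ?thesis by simp
  qed
  finally have nR: "fnorm_le D (rr 0) (ss 0) R (u 0 * F)"
    using fnorm_le_mono[OF R(3) order_refl order_refl] unfolding dom by blast
  have s0: "0 < ss 0" using s6 pos dom(2) by simp
  note R' = fproj_split[OF R(1,2)[unfolded dom] nR s0]
  have "symplectic_map D r s (rr 0) (ss 0) \<Psi> ((6 - (1/8) ^ 0) * w) ((16 - 2 * (1/8) ^ 0) * v)"
  proof (rule symplectic_map_mono[OF \<Psi>[unfolded dom] order_refl order_refl])
    have w0: "0 \<le> w" using c0 k2 pos by (simp add: w_def)
    have v0: "0 \<le> v" using c0 pos by (simp add: v_def)
    have "F / \<alpha> / (exp 1 * ?\<sigma>) = 6 * w / exp 1" unfolding Fc w_def using pos k2 by simp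
    also have "\<dots> \<le> 3 * w" using div_exp1[of "6 * w"] w0 by simp
    finally have "F / \<alpha> / (exp 1 * ?\<sigma>) / (1 - ?\<kappa>) \<le> 3 * w / (1 - ?\<kappa>)"
      by (rule divide_right_mono) (use \<kappa> in simp)
    also have "\<dots> \<le> 3 * w / (1 - 9 / 256)" by (rule inv_one_minus) (use \<kappa> w0 in simp_all)
    finally show "F / \<alpha> / (exp 1 * ?\<sigma>) / (1 - ?\<kappa>) \<le> (6 - (1/8) ^ 0) * w" using w0 by simp
    have "F / \<alpha> / ?\<rho> = 12 * v" unfolding Fc v_def using pos by simp
    then have "F / \<alpha> / ?\<rho> / (1 - ?\<kappa>) = 12 * v / (1 - ?\<kappa>)" by simp
    also have "\<dots> \<le> 12 * v / (1 - 9 / 256)" by (rule inv_one_minus) (use \<kappa> v0 in simp_all)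
    finally show "F / \<alpha> / ?\<rho> / (1 - ?\<kappa>) \<le> (16 - 2 * (1/8) ^ 0) * v" using v0 by simp
  qed
  moreover have "hh (\<Psi> p) + f (\<Psi> p) = hh p + b p + (R p - fproj S R p) + fproj S R p" if p: "p \<in> phase_dom D (rr 0) (ss 0)" for p
  proof -
    have "\<Psi> p \<in> phase_dom D r s" using \<Psi> p unfolding symplectic_map_def dom by blast
    then show ?thesis using eq[unfolded dom, OF p] b_facts(4)[of "\<Psi> p"] by (simp add: algebra_simps)
  qed
  moreover have "(2 * u 0 - u 0) * F = u 0 * F" by simp
  ultimately show ?case
    using R' by (intro exI[of _ \<Psi>] exI[of _ "\<lambda>p. R p - fproj S R p"] exI[of _ "fproj S R"]) simp
next
  case (Suc j)
  \<comment> \<open>Three losses of this size use up \<open>r/(4K)\<close> and \<open>s/(2K\<^sup>2)\<close>.\<close>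
  let ?\<rho> = "r / (12 * k)" and ?\<sigma> = "s / (6 * k\<^sup>2)" and ?\<kappa> = "144 * (k\<^sup>2 * c) * (k * u j)" and ?E = "u j * F"
  obtain \<Psi> g fj where \<Psi>: "symplectic_map D r s (rr j) (ss j) \<Psi> ((6 - (1/8) ^ j) * w) ((16 - 2 * (1/8) ^ j) * v)"
    and g: "holo_torus D (rr j) (ss j) g" "real_torus D (rr j) (ss j) g" "fnorm_le D (rr j) (ss j) g ((2 * u 0 - u j) * F)"
    and fj: "holo_torus D (rr j) (ss j) fj" "real_torus D (rr j) (ss j) fj" "fnorm_le D (rr j) (ss j) fj ?E" "\<And>p. p \<in> phase_dom D (rr j) (ss j) \<Longrightarrow> fproj S fj p = fj p"
    and gS: "\<And>y l. y \<in> cnbhd D (rr j) \<Longrightarrow> l \<in> S \<Longrightarrow> fcoeff g l y = 0"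
    and eqj: "\<And>p. p \<in> phase_dom D (rr j) (ss j) \<Longrightarrow> hh (\<Psi> p) + f (\<Psi> p) = hh p + b p + g p + fj p"
    using Suc by (metis (no_types, lifting) Suc_leD)
  have kk: "0 \<le> k\<^sup>2 * c" "0 \<le> k * u j" using c0 k2 u0 by simp_all
  have \<kappa>: "0 \<le> ?\<kappa>" "?\<kappa> \<le> 1 / 100"
  proof -
    show "0 \<le> ?\<kappa>" using kk by simp
    have "(k\<^sup>2 * c) * (k * u j) \<le> 1 / 2048 * (1 / 8)"
      using kc(2) ku_le(2)[of j] \<theta>(2) kk by (intro mult_mono) simp_all
    then show "?\<kappa> \<le> 1 / 100" by simp
  qed
  have E0: "0 \<le> ?E" using u0 f(4) by simp
  have Mg0: "0 \<le> (2 * u 0 - u j) * F" using u_le_u0[of j] u0[of 0] f(4) by simp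
  have "?E / \<alpha> = u j * (F / \<alpha>)" by simp
  then have Ea: "?E / \<alpha> = u j * c * r * s" unfolding Fc by (simp only: mult_ac)
  have \<kappa>eq: "?\<kappa> = 2 * (?E / \<alpha>) / (?\<rho> * ?\<sigma>)"
    unfolding Ea using pos k2 by (simp add: field_simps power2_eq_square)
  have jk: "real j + 1 \<le> k - 1" using Suc.prems k2 by linarith
  have rj: "rr j \<le> 3 * r / 4" "ss j \<le> s - s / (2 * k)" using pos k2 by (simp_all add: rr_def ss_def)
  have ssj: "s - s / k \<le> ss j - 3 * ?\<sigma>"
  proof -
    have "(real j + 1) * (s / (2 * k\<^sup>2)) \<le> k * (s / (2 * k\<^sup>2))" using jk pos by (intro mult_right_mono) simp_all
    also have "\<dots> = s / (2 * k)" using k2 by (simp add: power2_eq_square)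
    finally have "(real j + 1) * (s / (2 * k\<^sup>2)) \<le> s / (2 * k)" .
    moreover have "s / k = s / (2 * k) + s / (2 * k)" by (simp add: field_simps)
    moreover have "ss j - 3 * ?\<sigma> = s - s / (2 * k) - (real j + 1) * (s / (2 * k\<^sup>2))"
      by (simp add: ss_def distrib_right add_divide_distrib)
    ultimately show ?thesis by linarith
  qed
  have sk: "s / k \<le> s / 2" using k2 pos by (intro divide_left_mono) simp_all
  have side: "rr j \<le> r" "0 < ?\<rho>" "0 < ?\<sigma>" "3 * ?\<sigma> < ss j" "0 < r / 4" "0 < s / (2 * k)"
    "rr j - ?\<rho> \<le> r - r / 4" "ss j - ?\<sigma> \<le> s - s / (2 * k)" "?\<kappa> \<le> 1 / 8"
  proof -
    show p: "0 < ?\<rho>" "0 < ?\<sigma>" "0 < r / 4" "0 < s / (2 * k)" using pos k2 by simp_all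
    show "rr j \<le> r" "rr j - ?\<rho> \<le> r - r / 4" using rj(1) p pos by simp_all
    show "ss j - ?\<sigma> \<le> s - s / (2 * k)" using rj(2) p by linarith
    show "3 * ?\<sigma> < ss j" using ssj sk pos by linarith
    show "?\<kappa> \<le> 1 / 8" using \<kappa>(2) by simp
  qed
  from normal_form_step[OF fj(1-3) E0 fj(4) g Mg0 b_facts(1-3) f(4) side(1-8) \<kappa>eq side(9)]
  obtain \<Phi> R where \<Phi>: "symplectic_map D (rr j) (ss j) (rr j - 3 * ?\<rho>) (ss j - 3 * ?\<sigma>) \<Phi> (?E / \<alpha> / (exp 1 * ?\<sigma>) / (1 - ?\<kappa>)) (?E / \<alpha> / ?\<rho> / (1 - ?\<kappa>))"
    and R: "holo_torus D (rr j - 3 * ?\<rho>) (ss j - 3 * ?\<sigma>) R" "real_torus D (rr j - 3 * ?\<rho>) (ss j - 3 * ?\<sigma>) R"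
    "fnorm_le D (rr j - 3 * ?\<rho>) (ss j - 3 * ?\<sigma>) R ((?E / \<alpha> / (exp 1 * ?\<sigma>) / (r / 4) + ?E / \<alpha> / ?\<rho> / (exp 1 * (s / (2 * k)))) * F / (1 - ?\<kappa>) + (?\<kappa> / (1 - ?\<kappa>)) * ((2 * u 0 - u j) * F + ?E))"
    and eq: "\<And>p. p \<in> phase_dom D (rr j - 3 * ?\<rho>) (ss j - 3 * ?\<sigma>) \<Longrightarrow> hh (\<Phi> p) + b (\<Phi> p) + g (\<Phi> p) + fj (\<Phi> p) = hh p + b p + g p + R p"
    by blast
  have dom: "rr j - 3 * ?\<rho> = rr (Suc j)" "ss j - 3 * ?\<sigma> = ss (Suc j)"
    using k2 by (simp_all add: rr_def ss_def distrib_right add_divide_distrib)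
  have "(?E / \<alpha> / (exp 1 * ?\<sigma>) / (r / 4) + ?E / \<alpha> / ?\<rho> / (exp 1 * (s / (2 * k)))) * F = 48 * (k\<^sup>2 * c) * ?E / exp 1"
    unfolding Ea using pos k2 by (simp add: field_simps power2_eq_square)
  also have "\<dots> \<le> 48 * (k\<^sup>2 * c) * ?E / 2" using div_exp1[of "48 * (k\<^sup>2 * c) * ?E"] kk E0 by simp
  also have "\<dots> = 24 / 2048 * \<theta> * ?E" by (simp add: \<theta>c)
  finally have 1: "(?E / \<alpha> / (exp 1 * ?\<sigma>) / (r / 4) + ?E / \<alpha> / ?\<rho> / (exp 1 * (s / (2 * k)))) * F \<le> 24 / 2048 * \<theta> * ?E" .
  \<comment> \<open>The size of \<open>g\<close> and \<open>f\<^sub>j\<close> has the factor \<open>1/K\<close> that pays for the narrower steps, as \<open>K u\<^sub>0 \<le> \<theta>/8\<close>.\<close>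
  have 2: "?\<kappa> * ((2 * u 0 - u j) * F + ?E) \<le> 36 / 2048 * \<theta> * ?E"
  proof -
    have "?\<kappa> * ((2 * u 0 - u j) * F + ?E) = 288 * (k\<^sup>2 * c) * (k * u 0) * ?E" by (simp add: algebra_simps)
    also have "\<dots> \<le> 288 * (1 / 2048 * (1 / 8 * \<theta>)) * ?E"
    proof -
      have "(k\<^sup>2 * c) * (k * u 0) \<le> 1 / 2048 * (1 / 8 * \<theta>)"
        by (rule mult_mono[OF less_imp_le[OF kc(2)] ku_le(2)]) (use u0[of 0] k2 in simp_all)
      then have "288 * (k\<^sup>2 * c) * (k * u 0) \<le> 288 * (1 / 2048 * (1 / 8 * \<theta>))"
        by (simp only: mult.assoc[of 288] mult_le_cancel_left_pos zero_less_numeral)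
      then show ?thesis by (rule mult_right_mono[OF _ E0])
    qed
    finally show ?thesis by simp
  qed
  have tE: "0 \<le> \<theta> * ?E" using \<theta>0 E0 by simp
  have "(?E / \<alpha> / (exp 1 * ?\<sigma>) / (r / 4) + ?E / \<alpha> / ?\<rho> / (exp 1 * (s / (2 * k)))) * F / (1 - ?\<kappa>) + (?\<kappa> / (1 - ?\<kappa>)) * ((2 * u 0 - u j) * F + ?E)
     = ((?E / \<alpha> / (exp 1 * ?\<sigma>) / (r / 4) + ?E / \<alpha> / ?\<rho> / (exp 1 * (s / (2 * k)))) * F + ?\<kappa> * ((2 * u 0 - u j) * F + ?E)) / (1 - ?\<kappa>)"
    by (simp only: add_divide_distrib times_divide_eq_left)
  also have "\<dots> \<le> (24 / 2048 * \<theta> * ?E + 36 / 2048 * \<theta> * ?E) / (1 - ?\<kappa>)"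
    by (intro divide_right_mono add_mono 1 2) (use \<kappa> in simp)
  also have "\<dots> \<le> (24 / 2048 * \<theta> * ?E + 36 / 2048 * \<theta> * ?E) / (1 - 1 / 100)"
    by (rule inv_one_minus[OF \<kappa>]) (use tE \<theta>0 E0 u0[of j] f(4) in simp_all)
  also have "\<dots> \<le> u (Suc j) * F"
  proof -
    have "(24 / 2048 * \<theta> * E + 36 / 2048 * \<theta> * E) / (1 - 1 / 100) \<le> \<theta> / 8 * E" if "0 \<le> \<theta> * E" for E
      using that by (simp add: mult.commute)
    from this[OF tE] show ?thesis unfolding u_Suc mult.assoc[of "\<theta> / 8"] .
  qed
  finally have nR: "fnorm_le D (rr (Suc j)) (ss (Suc j)) R (u (Suc j) * F)"
    using fnorm_le_mono[OF R(3) order_refl order_refl] unfolding dom by blast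
  have s0: "0 < ss (Suc j)" using ssj sk pos dom(2) by linarith
  note R' = fproj_split[OF R(1,2)[unfolded dom] nR s0]
  have le: "rr (Suc j) \<le> rr j" "ss (Suc j) \<le> ss j" using side(2,3) unfolding dom[symmetric] by simp_all
  note g' = holo_torus_mono[OF g(1) le] real_torus_mono[OF g(2) le] fnorm_le_mono[OF g(3) le order_refl]
  let ?g = "\<lambda>p. g p + (R p - fproj S R p)"
  have "symplectic_map D r s (rr (Suc j)) (ss (Suc j)) (\<lambda>p. \<Psi> (\<Phi> p)) ((6 - (1/8) ^ Suc j) * w) ((16 - 2 * (1/8) ^ Suc j) * v)"
  proof (rule symplectic_map_mono[OF symplectic_map_compose[OF \<Psi> \<Phi>[unfolded dom]] order_refl order_refl])
    have w0: "0 \<le> w" using c0 k2 pos by (simp add: w_def)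
    have v0: "0 \<le> v" using c0 pos by (simp add: v_def)
    have q0: "(0::real) \<le> (1/8) ^ j" by simp
    have "?E / \<alpha> / (exp 1 * ?\<sigma>) = 6 * (k * u j) * w / exp 1" unfolding Ea w_def using pos k2 by (simp add: power2_eq_square)
    also have "\<dots> \<le> 3 * (k * u j) * w" using div_exp1[of "6 * (k * u j) * w"] w0 kk by simp
    also have "\<dots> \<le> 3 * ((1/8) ^ j * (1/8)) * w" by (intro mult_right_mono mult_left_mono ku_le w0) simp
    finally have "?E / \<alpha> / (exp 1 * ?\<sigma>) / (1 - ?\<kappa>) \<le> 3 * ((1/8) ^ j * (1/8)) * w / (1 - ?\<kappa>)"
      by (rule divide_right_mono) (use \<kappa> in simp)
    also have "\<dots> \<le> 3 * ((1/8) ^ j * (1/8)) * w / (1 - 1 / 100)" by (rule inv_one_minus[OF \<kappa>]) (use w0 in simp_all)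
    also have "\<dots> \<le> 7 / 8 * ((1/8) ^ j * w)" using mult_nonneg_nonneg[OF w0 q0] by simp
    finally show "(6 - (1/8) ^ j) * w + ?E / \<alpha> / (exp 1 * ?\<sigma>) / (1 - ?\<kappa>) \<le> (6 - (1/8) ^ Suc j) * w"
      by (simp add: algebra_simps)
    have "?E / \<alpha> / ?\<rho> = 12 * (k * u j) * v" unfolding Ea v_def using pos k2 by simp
    also have "\<dots> \<le> 12 * ((1/8) ^ j * (1/8)) * v" by (intro mult_right_mono mult_left_mono ku_le v0) simp
    finally have "?E / \<alpha> / ?\<rho> / (1 - ?\<kappa>) \<le> 12 * ((1/8) ^ j * (1/8)) * v / (1 - ?\<kappa>)"
      by (rule divide_right_mono) (use \<kappa> in simp)
    also have "\<dots> \<le> 12 * ((1/8) ^ j * (1/8)) * v / (1 - 1 / 100)" by (rule inv_one_minus[OF \<kappa>]) (use v0 in simp_all)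
    also have "\<dots> \<le> 7 / 4 * ((1/8) ^ j * v)" using mult_nonneg_nonneg[OF v0 q0] by simp
    finally show "(16 - 2 * (1/8) ^ j) * v + ?E / \<alpha> / ?\<rho> / (1 - ?\<kappa>) \<le> (16 - 2 * (1/8) ^ Suc j) * v"
      by (simp add: algebra_simps)
  qed
  moreover have "fnorm_le D (rr (Suc j)) (ss (Suc j)) ?g ((2 * u 0 - u (Suc j)) * F)"
  proof (rule fnorm_le_mono[OF fnorm_le_add[OF g'(1) R'(5) s0 g'(3) R'(8)] order_refl order_refl])
    have "2 * u (Suc j) * F \<le> u j * F" by (rule mult_right_mono[OF u_Suc_le f(4)])
    then show "(2 * u 0 - u j) * F + u (Suc j) * F \<le> (2 * u 0 - u (Suc j)) * F" by (simp add: algebra_simps)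
  qed
  moreover have "fcoeff ?g l y = 0" if y: "y \<in> cnbhd D (rr (Suc j))" and l: "l \<in> S" for l y
  proof -
    have "y \<in> cnbhd D (rr j)" using y cnbhd_mono[OF le(1)] by blast
    then show ?thesis using l by (simp add: fcoeff_add[OF g'(1) R'(5) y s0] gS R'(7)[OF y])
  qed
  moreover have "hh (\<Psi> (\<Phi> p)) + f (\<Psi> (\<Phi> p)) = hh p + b p + ?g p + fproj S R p" if p: "p \<in> phase_dom D (rr (Suc j)) (ss (Suc j))" for p
  proof -
    have "\<Phi> p \<in> phase_dom D (rr j) (ss j)" using \<Phi> p unfolding symplectic_map_def dom by blast
    then show ?thesis using eqj[of "\<Phi> p"] eq[unfolded dom, OF p] by (simp add: algebra_simps)
  qed
  ultimately show ?case
    using R'(1-4) holo_torus_add[OF g'(1) R'(5)] real_torus_add[OF g'(2) R'(6)]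
    by (intro exI[of _ "\<lambda>p. \<Psi> (\<Phi> p)"] exI[of _ ?g] exI[of _ "fproj S R"]) simp
qed

end

section \<open>Resonant and non-resonant parts of the transformed Hamiltonian\<close>

text \<open>
  A mode of order above \<open>K\<close> gains the factor \<open>e\<^bsup>-K (s - s')\<^esup>\<close> when the width decreases from \<open>s\<close> to \<open>s'\<close>.
\<close>

lemma fnorm_le_fproj_tail:
  assumes F: "fnorm_le D r s F M" and s: "0 < s" "s' \<le> s" and T: "\<And>k. k \<in> T \<Longrightarrow> int K < int_l1norm k"
  shows "fnorm_le D r s' (fproj T F) (exp (- (real K * (s - s'))) * M)"
  unfolding fnorm_le_def
proof (intro ballI allI impI)
  fix y A assume y: "y \<in> cnbhd D r" and A: "finite (A :: (int^'a) set)"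
  have "(\<Sum>k\<in>A. norm (fcoeff (fproj T F) k y) * exp (l1 k * s'))
      \<le> (\<Sum>k\<in>A. exp (- (real K * (s - s'))) * (norm (fcoeff F k y) * exp (l1 k * s)))"
  proof (rule sum_mono)
    fix k
    show "norm (fcoeff (fproj T F) k y) * exp (l1 k * s') \<le> exp (- (real K * (s - s'))) * (norm (fcoeff F k y) * exp (l1 k * s))"
    proof (cases "k \<in> T")
      case True
      have "real K \<le> l1 k" using T[OF True] by simp
      then have "real K * (s - s') \<le> l1 k * (s - s')" using s by (intro mult_right_mono) simp_all
      then have "exp (l1 k * s') \<le> exp (- (real K * (s - s')) + l1 k * s)"
        by (simp add: algebra_simps)
      then have "norm (fcoeff F k y) * exp (l1 k * s') \<le> norm (fcoeff F k y) * (exp (- (real K * (s - s'))) * exp (l1 k * s))"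
        unfolding exp_add by (intro mult_left_mono) simp_all
      then show ?thesis using True by (simp add: fcoeff_fproj[OF s(1) F y] mult_ac)
    qed (simp add: fcoeff_fproj[OF s(1) F y])
  qed
  also have "\<dots> \<le> exp (- (real K * (s - s'))) * M"
    using F y A unfolding fnorm_le_def sum_distrib_left[symmetric] by (intro mult_left_mono) simp_all
  finally show "(\<Sum>k\<in>A. norm (fcoeff (fproj T F) k y) * exp (l1 k * s')) \<le> exp (- (real K * (s - s'))) * M" .
qed

lemma fcoeff_eq_0:
  assumes "0 < s" "fnorm_le D r s F M" "\<And>p. p \<in> phase_dom D r s \<Longrightarrow> fproj S F p = F p" "y \<in> cnbhd D r" "k \<notin> S"
  shows "fcoeff F k y = 0"
proof -
  have "fcoeff F k y = fcoeff (fproj S F) k y"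
    by (rule fcoeff_cong) (use assms in \<open>simp add: mem_phase_dom cvec_strip\<close>)
  then show ?thesis using fcoeff_fproj[OF assms(1,2,4)] assms(5) by simp
qed

lemma symplectic_change_image: "symplectic_map D r s r' s' \<Psi> dy dx \<Longrightarrow> \<Psi> ` phase_dom D r' s' \<subseteq> phase_dom D r s"
  unfolding symplectic_map_def by (rule image_subsetI) simp

context nf_setup
begin

abbreviation "s' \<equiv> s * (1 - 1 / k)"

lemma s'_bounds: "s / 2 \<le> s'" "s' \<le> s" "0 < s'"
proof -
  have "s / k \<le> s / 2" using k2 pos by (intro divide_left_mono) simp_all
  moreover have "s' = s - s / k" by (simp add: right_diff_distrib)
  ultimately show 1: "s / 2 \<le> s'" by linarith
  show "0 < s'" using 1 pos by linarith
  show "s' \<le> s" using k2 pos by (simp add: algebra_simps)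
qed

text \<open>
  The last stage \<open>j = K - 1\<close> of the iteration, restricted to the widths of the theorem.
\<close>

lemma normal_form:
  "\<exists>\<Psi> g fj. symplectic_map D r s (r / 2) s' \<Psi> (\<theta> / (2 ^ 7 * k) * r) (\<theta> / (16 * k\<^sup>2) * s) \<and>
     holo_torus D (r / 2) s' g \<and> real_torus D (r / 2) s' g \<and> fnorm_le D (r / 2) s' g ((2 * u 0 - u (K - 1)) * F) \<and>
     holo_torus D (r / 2) s' fj \<and> real_torus D (r / 2) s' fj \<and> fnorm_le D (r / 2) s' fj (u (K - 1) * F) \<and>
     (\<forall>p\<in>phase_dom D (r / 2) s'. fproj S fj p = fj p) \<and>
     (\<forall>y\<in>cnbhd D (r / 2). \<forall>l\<in>S. fcoeff g l y = 0) \<and>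
     (\<forall>p\<in>phase_dom D (r / 2) s'. hh (\<Psi> p) + f (\<Psi> p) = hh p + b p + g p + fj p)"
proof -
  let ?j = "K - 1"
  have kj: "real ?j = k - 1" using K by simp
  have le: "r / 2 \<le> rr ?j" "s' \<le> ss ?j"
    unfolding rr_def ss_def kj using k2 pos by (simp_all add: field_simps power2_eq_square)
  obtain \<Psi> g fj where \<Psi>: "symplectic_map D r s (rr ?j) (ss ?j) \<Psi> ((6 - (1/8) ^ ?j) * w) ((16 - 2 * (1/8) ^ ?j) * v)"
    and g: "holo_torus D (rr ?j) (ss ?j) g" "real_torus D (rr ?j) (ss ?j) g" "fnorm_le D (rr ?j) (ss ?j) g ((2 * u 0 - u ?j) * F)"
    and fj: "holo_torus D (rr ?j) (ss ?j) fj" "real_torus D (rr ?j) (ss ?j) fj" "fnorm_le D (rr ?j) (ss ?j) fj (u ?j * F)" "\<forall>p\<in>phase_dom D (rr ?j) (ss ?j). fproj S fj p = fj p"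
    and gS: "\<forall>y\<in>cnbhd D (rr ?j). \<forall>l\<in>S. fcoeff g l y = 0"
    and eqj: "\<forall>p\<in>phase_dom D (rr ?j) (ss ?j). hh (\<Psi> p) + f (\<Psi> p) = hh p + b p + g p + fj p"
    using iterate[OF order_refl] by blast
  have "(6 - (1/8) ^ ?j) * w \<le> 6 * w" "(16 - 2 * (1/8) ^ ?j) * v \<le> 16 * v"
    using c0 pos k2 by (simp_all add: w_def v_def mult_right_mono)
  moreover have "6 * w \<le> \<theta> / (2 ^ 7 * k) * r" "16 * v \<le> \<theta> / (16 * k\<^sup>2) * s"
    unfolding w_def v_def \<theta>c using c0 pos k2 by (simp_all add: power2_eq_square)
  ultimately have d: "(6 - (1/8) ^ ?j) * w \<le> \<theta> / (2 ^ 7 * k) * r" "(16 - 2 * (1/8) ^ ?j) * v \<le> \<theta> / (16 * k\<^sup>2) * s"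
    by linarith+
  note dom = subsetD[OF phase_dom_mono[OF le]] and dom1 = subsetD[OF cnbhd_mono[OF le(1)]]
  show ?thesis
    by (intro exI[of _ \<Psi>] exI[of _ g] exI[of _ fj] conjI symplectic_map_mono[OF \<Psi> le d]
        holo_torus_mono[OF _ le] real_torus_mono[OF _ le] fnorm_le_mono[OF _ le order_refl] g fj ballI
        bspec[OF fj(4) dom] bspec[OF bspec[OF gS dom1]] bspec[OF eqj dom])
qed

lemma u_last: "u (K - 1) = (\<theta> / 8) ^ K / k"
  using power_minus_mult[of K "\<theta> / 8"] K by (simp add: u_def)

lemma u_last_le: "u (K - 1) \<le> (\<theta> / 8) ^ K * (8 / (exp 1 * k))"
proof -
  have "(\<theta> / 8) ^ K / k * 1 \<le> (\<theta> / 8) ^ K / k * (8 / exp 1)"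
    using exp_le k2 \<theta>0 by (intro mult_left_mono) simp_all
  then show ?thesis unfolding u_last by (simp add: mult.commute)
qed

lemma sbar_le: "sbar s \<theta> \<le> s / 2"
  using min.cobounded1[of "s / 2"] by (simp only: sbar_def split: if_split) simp

text \<open>
  The three sources of non-resonant terms on the width \<open>s/2\<close> compared with the exponential of \<open>-(K - 2) sbar\<close>:
  the high modes of \<open>f\<close> come from width \<open>s\<close>, those of the remainder from \<open>s'\<close>, where
  \<open>K (s' - s/2) = (K - 2) s/2\<close> exactly, and the low modes are bounded by \<open>(\<theta>/8)\<^sup>K\<close>.
\<close>

lemma tail_bounds:
  "exp (- (k * (s - s / 2))) \<le> exp (- (k - 2) * sbar s \<theta>)"
  "exp (- (k * (s' - s / 2))) \<le> exp (- (k - 2) * sbar s \<theta>)"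
  "(\<theta> / 8) ^ K \<le> exp (- (k - 2) * sbar s \<theta>)"
proof -
  have 1: "(k - 2) * sbar s \<theta> \<le> (k - 2) * (s / 2)" using sbar_le k2 by (intro mult_left_mono) simp_all
  have "k * (s' - s / 2) = (k - 2) * (s / 2)" using k2 by (simp add: field_simps)
  then show "exp (- (k * (s' - s / 2))) \<le> exp (- (k - 2) * sbar s \<theta>)"
    unfolding mult_minus_left exp_le_cancel_iff neg_le_iff_le using 1 by linarith
  have "(k - 2) * (s / 2) \<le> k * (s - s / 2)" using pos by (simp add: algebra_simps)
  then show "exp (- (k * (s - s / 2))) \<le> exp (- (k - 2) * sbar s \<theta>)"
    unfolding mult_minus_left exp_le_cancel_iff neg_le_iff_le using 1 by linarith
  show "(\<theta> / 8) ^ K \<le> exp (- (k - 2) * sbar s \<theta>)"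
  proof (cases "\<theta> = 0")
    case False
    then have t: "0 < \<theta>" using \<theta>0 by simp
    have "(\<theta> / 8) ^ K \<le> (\<theta> / 8) ^ (K - 2)" using t \<theta>(2) by (intro power_decreasing) simp_all
    also have "\<dots> = exp (real (K - 2) * ln (\<theta> / 8))" using t by (simp add: exp_of_nat_mult)
    also have "\<dots> = exp (- ((k - 2) * ln (8 / \<theta>)))" using t K by (simp add: ln_div of_nat_diff algebra_simps)
    also have "\<dots> \<le> exp (- ((k - 2) * sbar s \<theta>))"
      unfolding exp_le_cancel_iff neg_le_iff_le using k2 False by (intro mult_left_mono) (simp_all add: sbar_def)
    finally show ?thesis unfolding mult_minus_left .
  qed (use K in \<open>simp add: zero_power\<close>)
qed

lemma u0_2: "2 * u 0 \<le> 1 / k * \<theta>" "2 * u 0 \<le> 1 / 8"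
proof -
  have e: "2 * u 0 = \<theta> / (4 * k)" by (simp add: u_def)
  show "2 * u 0 \<le> 1 / k * \<theta>" unfolding e using \<theta>0 k2 by (simp add: field_simps)
  have "\<theta> / (4 * k) \<le> 1 / (4 * 2)" using \<theta> \<theta>0 k2 by (intro frac_le) simp_all
  then show "2 * u 0 \<le> 1 / 8" unfolding e by simp
qed

lemma b_eq:
  assumes p: "p \<in> phase_dom D r s"
  shows "b p = fproj \<Lambda> f p + trunc_perp K (proj_perp \<Lambda> f) p"
proof -
  let ?T = "{l. int K < int_l1norm l} \<inter> - \<Lambda>"
  have "f p = fproj UNIV f p" using Fourier_inversion[OF f(1) pos(2) f(3) p] by simp
  also have "UNIV = (\<Lambda> \<union> ?T) \<union> S" by auto
  also have "fproj ((\<Lambda> \<union> ?T) \<union> S) f p = fproj (\<Lambda> \<union> ?T) f p + fproj S f p"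
    by (rule fproj_Un[OF f(3) p]) auto
  also have "fproj (\<Lambda> \<union> ?T) f p = fproj \<Lambda> f p + fproj ?T f p"
    by (rule fproj_Un[OF f(3) p]) auto
  finally show ?thesis
    unfolding b_def trunc_perp_def by (simp add: fproj_fproj[OF pos(2) f(3) p])
qed

end

text \<open>
  The outcome of \<open>normal_form\<close>, from which both decompositions of the transformed Hamiltonian are read off.
\<close>

locale nf_result = nf_setup D r \<alpha> K \<Lambda> h s F \<theta> f
  for D :: "(real^'n::finite) set" and r \<alpha> K and \<Lambda> :: "(int^'n) set" and h s F \<theta> and f :: "'n phase \<Rightarrow> complex" +
  fixes g fj :: "'n phase \<Rightarrow> complex"
  assumes g: "holo_torus D (r / 2) s' g" "real_torus D (r / 2) s' g" "fnorm_le D (r / 2) s' g ((2 * u 0 - u (K - 1)) * F)"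
    and fj: "holo_torus D (r / 2) s' fj" "real_torus D (r / 2) s' fj" "fnorm_le D (r / 2) s' fj (u (K - 1) * F)"
      "\<And>p. p \<in> phase_dom D (r / 2) s' \<Longrightarrow> fproj S fj p = fj p"
    and gS: "\<And>y l. y \<in> cnbhd D (r / 2) \<Longrightarrow> l \<in> S \<Longrightarrow> fcoeff g l y = 0"
begin

text \<open>
  The transformed Hamiltonian is \<open>h + W\<close>, where \<open>W = b + f\<^sub>*\<close>.
\<close>

definition fs :: "'n phase \<Rightarrow> complex" where "fs p = g p + fj p"
definition W :: "'n phase \<Rightarrow> complex" where "W p = b p + fs p"

lemma le: "r / 2 \<le> r" "s' \<le> s" using pos s'_bounds by simp_all

lemma fs: "holo_torus D (r / 2) s' fs" "real_torus D (r / 2) s' fs" "fnorm_le D (r / 2) s' fs (2 * u 0 * F)"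
  unfolding fs_def[abs_def] using holo_torus_add[OF g(1) fj(1)] real_torus_add[OF g(2) fj(2)] fnorm_le_add[OF g(1) fj(1) s'_bounds(3) g(3) fj(3)]
  by (simp_all add: algebra_simps)

lemma b': "holo_torus D (r / 2) s' b" "real_torus D (r / 2) s' b" "fnorm_le D (r / 2) s' b F"
  by (rule holo_torus_mono[OF b_facts(1) le] real_torus_mono[OF b_facts(2) le] fnorm_le_mono[OF b_facts(3) le order_refl])+

lemma W: "holo_torus D (r / 2) s' W" "real_torus D (r / 2) s' W" "fnorm_le D (r / 2) s' W (F + 2 * u 0 * F)"
  unfolding W_def[abs_def] by (rule holo_torus_add[OF b'(1) fs(1)] real_torus_add[OF b'(2) fs(2)] fnorm_le_add[OF b'(1) fs(1) s'_bounds(3) b'(3) fs(3)])+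

lemma coeffs:
  assumes y: "y \<in> cnbhd D (r / 2)"
  shows "fcoeff fs l y = fcoeff g l y + fcoeff fj l y"
    and "l \<notin> S \<Longrightarrow> fcoeff fj l y = 0"
    and "fcoeff W l y = (if l \<in> S then 0 else fcoeff f l y) + fcoeff fs l y"
proof -
  have y': "y \<in> cnbhd D r" using y cnbhd_mono[OF le(1)] by blast
  show "fcoeff fs l y = fcoeff g l y + fcoeff fj l y"
    unfolding fs_def[abs_def] by (rule fcoeff_add[OF g(1) fj(1) y s'_bounds(3)])
  show "l \<notin> S \<Longrightarrow> fcoeff fj l y = 0" by (rule fcoeff_eq_0[OF s'_bounds(3) fj(3,4) y])
  show "fcoeff W l y = (if l \<in> S then 0 else fcoeff f l y) + fcoeff fs l y"
    unfolding W_def[abs_def] by (simp only: fcoeff_add[OF b'(1) fs(1) y s'_bounds(3)] b_facts(5)[OF y'])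
qed

lemma fnorm_le_trunc_fs: "fnorm_le D (r / 2) s' (trunc K (proj_perp \<Lambda> fs)) (u (K - 1) * F)"
proof -
  note P = fnorm_le_fproj[OF s'_bounds(3) fs(3), of "- \<Lambda>"]
  have "fnorm_le D (r / 2) s' (trunc K (proj_perp \<Lambda> fs)) (1 * (u (K - 1) * F))"
  proof (rule fnorm_le_coeff_mono[OF fj(3)])
    fix l y assume y: "y \<in> cnbhd D (r / 2)"
    show "norm (fcoeff (trunc K (proj_perp \<Lambda> fs)) l y) \<le> 1 * norm (fcoeff fj l y)"
      unfolding trunc_def fcoeff_fproj[OF s'_bounds(3) P y] fcoeff_fproj[OF s'_bounds(3) fs(3) y]
      by (simp add: coeffs(1)[OF y] gS[OF y])
  qed simp
  then show ?thesis by simp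
qed

lemma resonant_part: "holo_torus D (r / 2) s' (fproj \<Lambda> W)" "real_torus D (r / 2) s' (fproj \<Lambda> W)"
    "p \<in> phase_dom D (r / 2) s' \<Longrightarrow> fproj \<Lambda> (fproj \<Lambda> W) p = fproj \<Lambda> W p"
    "fnorm_le D (r / 2) s' (\<lambda>p. fproj \<Lambda> W p - fproj \<Lambda> f p) (2 * u 0 * F)"
proof -
  show P: "holo_torus D (r / 2) s' (fproj \<Lambda> W)" by (rule holo_torus_fproj[OF W(1) s'_bounds(3) W(3)])
  show "real_torus D (r / 2) s' (fproj \<Lambda> W)" by (rule real_torus_fproj[OF W(2) s'_bounds(3) \<Lambda>_minus])
  show "p \<in> phase_dom D (r / 2) s' \<Longrightarrow> fproj \<Lambda> (fproj \<Lambda> W) p = fproj \<Lambda> W p"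
    using fproj_fproj[OF s'_bounds(3) W(3), of p \<Lambda> \<Lambda>] by simp
  have Pf: "holo_torus D (r / 2) s' (fproj \<Lambda> f)" by (rule holo_torus_mono[OF holo_torus_fproj[OF f(1) pos(2) f(3)] le])
  have "fnorm_le D (r / 2) s' (\<lambda>p. fproj \<Lambda> W p - fproj \<Lambda> f p) (1 * (2 * u 0 * F))"
  proof (rule fnorm_le_coeff_mono[OF fs(3)])
    fix l y assume y: "y \<in> cnbhd D (r / 2)"
    have y': "y \<in> cnbhd D r" using y cnbhd_mono[OF le(1)] by blast
    show "norm (fcoeff (\<lambda>p. fproj \<Lambda> W p - fproj \<Lambda> f p) l y) \<le> 1 * norm (fcoeff fs l y)"
      unfolding fcoeff_diff[OF P Pf y s'_bounds(3)] fcoeff_fproj[OF s'_bounds(3) W(3) y] fcoeff_fproj[OF pos(2) f(3) y']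
      by (simp add: coeffs(3)[OF y])
  qed simp
  then show "fnorm_le D (r / 2) s' (\<lambda>p. fproj \<Lambda> W p - fproj \<Lambda> f p) (2 * u 0 * F)" by simp
qed

text \<open>
  The modes outside \<open>\<Lambda>\<close> come from \<open>f\<^sub>j\<close> if they are in \<open>S\<close>, and from the high modes of \<open>f\<close> and \<open>f\<^sub>*\<close>
  otherwise. Their bounds are at most \<open>1/2\<close>, \<open>1\<close> and \<open>1/8\<close> times the exponential.
\<close>

lemma nonresonant_part: "holo_torus D (r / 2) s' (\<lambda>p. W p - fproj \<Lambda> W p)" "real_torus D (r / 2) s' (\<lambda>p. W p - fproj \<Lambda> W p)"
    "p \<in> phase_dom D (r / 2) s' \<Longrightarrow> fproj \<Lambda> (\<lambda>p. W p - fproj \<Lambda> W p) p = 0"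
    "fnorm_le D (r / 2) (s / 2) (\<lambda>p. W p - fproj \<Lambda> W p) (2 * exp (- (k - 2) * sbar s \<theta>) * F)"
proof -
  let ?N = "\<lambda>p. W p - fproj \<Lambda> W p" and ?T = "- \<Lambda> \<inter> {l. int K < int_l1norm l}" and ?e = "exp (- (k - 2) * sbar s \<theta>)"
  show P: "holo_torus D (r / 2) s' ?N" by (rule holo_torus_diff[OF W(1) resonant_part(1)])
  show "real_torus D (r / 2) s' ?N" by (rule real_torus_diff[OF W(2) resonant_part(2)])
  have c: "fcoeff ?N l y = (if l \<in> \<Lambda> then 0 else fcoeff W l y)" if y: "y \<in> cnbhd D (r / 2)" for l y
    by (simp add: fcoeff_diff[OF W(1) resonant_part(1) y s'_bounds(3)] fcoeff_fproj[OF s'_bounds(3) W(3) y])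
  show "p \<in> phase_dom D (r / 2) s' \<Longrightarrow> fproj \<Lambda> ?N p = 0"
    unfolding fproj_eq[of \<Lambda> ?N p] by (rule infsum_0) (simp add: c mem_phase_dom(2))
  have s2: "0 < s / 2" "s / 2 \<le> s" using pos by simp_all
  note le2 = order_refl[of "r / 2"] s'_bounds(1)
  note tf = fnorm_le_mono[OF fnorm_le_fproj_tail[OF f(3) pos(2) s2(2), of ?T K] le(1) order_refl order_refl]
  note ts = fnorm_le_fproj_tail[OF fs(3) s'_bounds(3,1), of ?T K]
  note pf = holo_torus_mono[OF holo_torus_fproj[OF f(1) pos(2) f(3)] le(1) s2(2), of ?T]
  note ps = holo_torus_mono[OF holo_torus_fproj[OF fs(1) s'_bounds(3) fs(3)] le2, of ?T]
  note fj' = holo_torus_mono[OF fj(1) le2] fnorm_le_mono[OF fj(3) le2 order_refl]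
  let ?G = "\<lambda>p. fj p + (fproj ?T f p + fproj ?T fs p)"
  have "fnorm_le D (r / 2) (s / 2) ?G (u (K - 1) * F + (exp (- (k * (s - s / 2))) * F + exp (- (k * (s' - s / 2))) * (2 * u 0 * F)))"
    by (intro fnorm_le_add fj' tf ts pf ps holo_torus_add s2(1)) simp_all
  then have "fnorm_le D (r / 2) (s / 2) ?N (1 * (u (K - 1) * F + (exp (- (k * (s - s / 2))) * F + exp (- (k * (s' - s / 2))) * (2 * u 0 * F))))"
  proof (rule fnorm_le_coeff_mono)
    fix l y assume y: "y \<in> cnbhd D (r / 2)"
    have y': "y \<in> cnbhd D r" using y cnbhd_mono[OF le(1)] by blast
    have G: "fcoeff ?G l y = fcoeff fj l y + ((if l \<in> ?T then fcoeff f l y else 0) + (if l \<in> ?T then fcoeff fs l y else 0))"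
      by (simp only: fcoeff_add[OF fj'(1) holo_torus_add[OF pf ps] y s2(1)] fcoeff_add[OF pf ps y s2(1)]
          fcoeff_fproj[OF s'_bounds(3) fs(3) y] fcoeff_fproj[OF pos(2) f(3) y'])
    have "fcoeff ?N l y = fcoeff ?G l y"
    proof (cases "l \<in> \<Lambda>")
      case True
      then show ?thesis unfolding G c[OF y] by (simp add: coeffs(2)[OF y])
    next
      case nl: False
      show ?thesis
      proof (cases "l \<in> S")
        case True
        then show ?thesis unfolding G c[OF y] coeffs(3)[OF y] by (simp add: coeffs(1)[OF y] gS[OF y])
      next
        case False
        then have "l \<in> ?T" using nl by simp
        then show ?thesis using nl False coeffs(2)[OF y False] unfolding G c[OF y] coeffs(3)[OF y] by simp
      qed
    qed
    then show "norm (fcoeff ?N l y) \<le> 1 * norm (fcoeff ?G l y)" by simp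
  qed simp
  then show "fnorm_le D (r / 2) (s / 2) ?N (2 * ?e * F)"
  proof (rule fnorm_le_mono[OF _ order_refl order_refl])
    have e0: "0 \<le> ?e" by simp
    have "u (K - 1) \<le> (\<theta> / 8) ^ K / 2"
      unfolding u_last using k2 \<theta>0 by (intro divide_left_mono) simp_all
    then have 1: "u (K - 1) * F \<le> 1 / 2 * ?e * F" using tail_bounds(3) f(4) by (intro mult_right_mono) simp_all
    have 2: "exp (- (k * (s - s / 2))) * F \<le> ?e * F" by (intro mult_right_mono tail_bounds f(4))
    have "exp (- (k * (s' - s / 2))) * (2 * u 0 * F) \<le> ?e * (1 / 8 * F)"
      using u0 f(4) by (intro mult_mono tail_bounds mult_right_mono u0_2(2)) simp_all
    then show "1 * (u (K - 1) * F + (exp (- (k * (s - s / 2))) * F + exp (- (k * (s' - s / 2))) * (2 * u 0 * F))) \<le> 2 * ?e * F"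
      using 1 2 mult_nonneg_nonneg[OF e0 f(4)] by (simp add: algebra_simps)
  qed
qed

end

theorem proposition4p1:
  fixes D :: "(real^'n) set"
    and \<Lambda> :: "(int^'n) set"
    and h :: "complex^'n \<Rightarrow> complex"
    and f H :: "'n phase \<Rightarrow> complex"
    and r s \<alpha> \<theta> r' s' :: real
    and K :: nat
  assumes "r > 0" and "s > 0" and "\<alpha> > 0" and "K \<ge> 2"
    and "sublattice \<Lambda>"
    and "real_analytic_act (cnbhd D r) h"
    and "real_analytic_torus D r s f"
    and "H = (\<lambda>(y, x). h y + f (y, x))"
    and "fnorm D r s f < \<infinity>"
    and "nonresonant h \<alpha> K \<Lambda> (cnbhd D r)"
    and "\<theta> = 2 ^ 11 * (real K)\<^sup>2 / (\<alpha> * r * s) * enn2real (fnorm D r s f)"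
    and "\<theta> < 1"
    and "r' = r / 2" and "s' = s * (1 - 1 / real K)"
  shows "\<exists>\<Psi> f' g f''.
     symplectic_change D r' s' \<Psi> \<and>
     \<Psi> ` phase_dom D r' s' \<subseteq> phase_dom D r s \<and>
     (\<forall>(y', x')\<in>phase_dom D r' s'. \<forall>y x. \<Psi> (y', x') = (y, x) \<longrightarrow>
        l1norm (y - y') \<le> \<theta> / (2 ^ 7 * real K) * r \<and>
        (\<forall>i. norm (x $ i - x' $ i) \<le> \<theta> / (16 * (real K)\<^sup>2) * s)) \<and>
     real_analytic_torus D r' s' f' \<and>
     (\<forall>(y, x)\<in>phase_dom D r' s'.
        H (\<Psi> (y, x)) = h y + (fproj \<Lambda> f (y, x) + trunc_perp K (proj_perp \<Lambda> f) (y, x)) + f' (y, x)) \<and>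
     fnorm D r' s' f' \<le> ennreal (1 / real K * \<theta>) * fnorm D r s f \<and>
     fnorm D r' s' (trunc K (proj_perp \<Lambda> f'))
       \<le> ennreal ((\<theta> / 8) ^ K * (8 / (exp 1 * real K))) * fnorm D r s f \<and>
     real_analytic_torus D r' s' g \<and>
     real_analytic_torus D r' s' f'' \<and>
     (\<forall>(y, x)\<in>phase_dom D r' s'. H (\<Psi> (y, x)) = h y + g (y, x) + f'' (y, x)) \<and>
     (\<forall>p\<in>phase_dom D r' s'. fproj \<Lambda> g p = g p) \<and>
     (\<forall>p\<in>phase_dom D r' s'. fproj \<Lambda> f'' p = 0) \<and>
     fnorm D r' s' (\<lambda>p. g p - fproj \<Lambda> f p) \<le> ennreal (1 / real K * \<theta>) * fnorm D r s f \<and>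
     fnorm D r' (s / 2) f'' \<le> ennreal (2 * exp (- (real K - 2) * sbar s \<theta>)) * fnorm D r s f"
proof -
  define F where "F = enn2real (fnorm D r s f)"
  have F: "fnorm D r s f = ennreal F" "0 \<le> F" using assms(9) by (simp_all add: F_def)
  have nbf: "fnorm_le D r s f F" using fnorm_le_iff[OF F(2), of D r s f] F(1) by simp
  interpret A: nf_setup D r \<alpha> K \<Lambda> h s F \<theta> f
    by unfold_locales (use assms nbf F(2) in \<open>simp_all add: real_analytic_torus_iff F_def\<close>)
  note ex = A.normal_form[folded assms(13,14)]
  obtain \<Psi> g fj where \<Psi>: "symplectic_map D r s r' s' \<Psi> (\<theta> / (2 ^ 7 * real K) * r) (\<theta> / (16 * (real K)\<^sup>2) * s)"
    and g: "holo_torus D r' s' g" "real_torus D r' s' g" "fnorm_le D r' s' g ((2 * A.u 0 - A.u (K - 1)) * F)"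
    and fj: "holo_torus D r' s' fj" "real_torus D r' s' fj" "fnorm_le D r' s' fj (A.u (K - 1) * F)" "\<forall>p\<in>phase_dom D r' s'. fproj A.S fj p = fj p"
    and gS: "\<forall>y\<in>cnbhd D r'. \<forall>l\<in>A.S. fcoeff g l y = 0"
    and eq: "\<forall>p\<in>phase_dom D r' s'. A.hh (\<Psi> p) + f (\<Psi> p) = A.hh p + A.b p + g p + fj p"
    using ex by blast
  interpret B: nf_result D r \<alpha> K \<Lambda> h s F \<theta> f g fj
    by unfold_locales (unfold assms(13,14)[symmetric], (rule g fj(1-3) bspec[OF fj(4)] bspec[OF bspec[OF gS]], assumption?)+)
  note resonant = B.resonant_part[folded assms(13,14)] and nonresonant = B.nonresonant_part[folded assms(13,14)]
  note fs = B.fs[folded assms(13,14)] and trunc = B.fnorm_le_trunc_fs[folded assms(13,14)]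
  have sub: "p \<in> phase_dom D r s" if "p \<in> phase_dom D r' s'" for p
    using that phase_dom_mono[OF B.le] unfolding assms(13,14) by blast
  have H: "H (\<Psi> (y, x)) = h y + B.W (y, x)" if "(y, x) \<in> phase_dom D r' s'" for y x
    using bspec[OF eq that] by (simp add: assms(8) case_prod_beta B.W_def B.fs_def A.hh_def add.assoc)
  have norm: "fnorm D a b G \<le> ennreal c * fnorm D r s f" if "fnorm_le D a b G M" "M \<le> c * F" "0 \<le> c" for a b G c M
  proof -
    have "ennreal c * fnorm D r s f = ennreal (c * F)" unfolding F(1) by (rule ennreal_mult[symmetric, OF that(3) F(2)])
    moreover have "fnorm_le D a b G (c * F)" by (rule fnorm_le_mono[OF that(1) order_refl order_refl that(2)])
    ultimately show ?thesis using fnorm_le_iff[of "c * F" D a b G] that(3) F(2) by simp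
  qed
  have c: "0 \<le> 1 / real K * \<theta>" "0 \<le> (\<theta> / 8) ^ K * (8 / (exp 1 * real K))" "0 \<le> 2 * exp (- (real K - 2) * sbar s \<theta>)"
    using A.\<theta>0 by simp_all
  note M = mult_right_mono[OF _ F(2)]
  show ?thesis
  proof (rule exI[of _ \<Psi>], rule exI[of _ B.fs], rule exI[of _ "fproj \<Lambda> B.W"],
      rule exI[of _ "\<lambda>p. B.W p - fproj \<Lambda> B.W p"], intro conjI)
    show "symplectic_change D r' s' \<Psi>" using \<Psi> by (simp add: symplectic_map_def)
    show "\<Psi> ` phase_dom D r' s' \<subseteq> phase_dom D r s" by (rule symplectic_change_image[OF \<Psi>])
    show "\<forall>(y', x')\<in>phase_dom D r' s'. \<forall>y x. \<Psi> (y', x') = (y, x) \<longrightarrow>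
        l1norm (y - y') \<le> \<theta> / (2 ^ 7 * real K) * r \<and> (\<forall>i. norm (x $ i - x' $ i) \<le> \<theta> / (16 * (real K)\<^sup>2) * s)"
    proof (rule ballI, rule case_prodI2, intro allI impI)
      fix p y' x' y x assume "p \<in> phase_dom D r' s'" "p = (y', x')" "\<Psi> (y', x') = (y, x)"
      moreover have "\<forall>p\<in>phase_dom D r' s'. l1norm (fst (\<Psi> p) - fst p) \<le> \<theta> / (2 ^ 7 * real K) * r \<and>
          (\<forall>i. norm (snd (\<Psi> p) $ i - snd p $ i) \<le> \<theta> / (16 * (real K)\<^sup>2) * s)"
        using \<Psi> unfolding symplectic_map_def by (elim conjE)
      ultimately show "l1norm (y - y') \<le> \<theta> / (2 ^ 7 * real K) * r \<and> (\<forall>i. norm (x $ i - x' $ i) \<le> \<theta> / (16 * (real K)\<^sup>2) * s)"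
        by (metis fst_conv snd_conv)
    qed
    show "real_analytic_torus D r' s' B.fs" "real_analytic_torus D r' s' (fproj \<Lambda> B.W)"
      "real_analytic_torus D r' s' (\<lambda>p. B.W p - fproj \<Lambda> B.W p)"
      unfolding real_analytic_torus_iff by (intro conjI fs resonant nonresonant)+
    show "\<forall>(y, x)\<in>phase_dom D r' s'. H (\<Psi> (y, x)) = h y + (fproj \<Lambda> f (y, x) + trunc_perp K (proj_perp \<Lambda> f) (y, x)) + B.fs (y, x)"
    proof (rule ballI, rule case_prodI2)
      fix p y x assume "p \<in> phase_dom D r' s'" "p = (y, x)"
      then have p: "(y, x) \<in> phase_dom D r' s'" by simp
      show "H (\<Psi> (y, x)) = h y + (fproj \<Lambda> f (y, x) + trunc_perp K (proj_perp \<Lambda> f) (y, x)) + B.fs (y, x)"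
        unfolding H[OF p] B.W_def A.b_eq[OF sub[OF p]] by (simp add: add.assoc)
    qed
    show "\<forall>(y, x)\<in>phase_dom D r' s'. H (\<Psi> (y, x)) = h y + fproj \<Lambda> B.W (y, x) + (B.W (y, x) - fproj \<Lambda> B.W (y, x))"
    proof (rule ballI, rule case_prodI2)
      fix p y x assume "p \<in> phase_dom D r' s'" "p = (y, x)"
      then have p: "(y, x) \<in> phase_dom D r' s'" by simp
      show "H (\<Psi> (y, x)) = h y + fproj \<Lambda> B.W (y, x) + (B.W (y, x) - fproj \<Lambda> B.W (y, x))"
        unfolding H[OF p] by simp
    qed
    show "fnorm D r' s' B.fs \<le> ennreal (1 / real K * \<theta>) * fnorm D r s f"
      by (rule norm[OF fs(3) M[OF A.u0_2(1)] c(1)])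
    show "fnorm D r' s' (trunc K (proj_perp \<Lambda> B.fs)) \<le> ennreal ((\<theta> / 8) ^ K * (8 / (exp 1 * real K))) * fnorm D r s f"
      by (rule norm[OF trunc M[OF A.u_last_le] c(2)])
    show "\<forall>p\<in>phase_dom D r' s'. fproj \<Lambda> (fproj \<Lambda> B.W) p = fproj \<Lambda> B.W p"
      by (rule ballI, rule resonant(3))
    show "\<forall>p\<in>phase_dom D r' s'. fproj \<Lambda> (\<lambda>p. B.W p - fproj \<Lambda> B.W p) p = 0"
      by (rule ballI, rule nonresonant(3))
    show "fnorm D r' s' (\<lambda>p. fproj \<Lambda> B.W p - fproj \<Lambda> f p) \<le> ennreal (1 / real K * \<theta>) * fnorm D r s f"
      by (rule norm[OF resonant(4) M[OF A.u0_2(1)] c(1)])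
    show "fnorm D r' (s / 2) (\<lambda>p. B.W p - fproj \<Lambda> B.W p) \<le> ennreal (2 * exp (- (real K - 2) * sbar s \<theta>)) * fnorm D r s f"
      by (rule norm[OF nonresonant(4) order_refl c(3)])
  qed
qed

end
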